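(* Let $f$ be a non-zero multiplicative function (complex-valued, on the positive integers) and let $L(s,f)=\sum_{n=1}^\infty f(n)n^{-s}$ be the associated $L$-function. Suppose that for some $0<\theta<1/2$ and for all integers $r\ge 1$, $f$ satisfies the estimates $$f_{1/r}(n)\ll_{f,r} n^\theta\quad\text{and}\quad \sum_p\sum_{m=2}^\infty\frac{|f_{1/r}(p^m)|^2}{p^m}<\infty,$$ where $f_{1/r}(n)$ is formally defined by $L(s,f)^{1/r}=\sum_{n=1}^\infty f_{1/r}(n)n^{-s}$. Assume furthermore that for some $N_f>0$, as $x\to\infty$, $$\sum_{p\le x}\frac{|f(p)|^2}{p}=N_f\log\log x+O(1).$$ Suppose that $L(s,f)$ admits a meromorphic continuation to the half-plane $\sigma\ge 1/2$ with its only possible pole at $s=1$, and that $L(s,f)=O(|t|^A)$ as $|t|\to\infty$ for some $A>0$, uniformly for all $\sigma\ge 1/2$. Then, for all real $k\ge 0$ and all sufficiently large $T>0$, $$\int_T^{2T}|L(1/2+it,f)|^{2k}\,dt\gg_{f,k}T(\log T)^{N_fk^2}.$$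
   Context: Here $s=\sigma+it$ with $\sigma,t$ real, and $p$ always denotes a prime. A non-zero multiplicative function satisfies $f(1)=1$; $f_{1/r}$ denotes the coefficients of the formal Dirichlet series $r$-th root of $L(s,f)$ with $f_{1/r}(1)=1$. The notation $\gg_{f,k}$ means that the implied constant is positive and depends only on $f$ and $k$. *)

theory Defs
  imports
    "HOL-Complex_Analysis.Complex_Analysis"
    "HOL-Computational_Algebra.Primes"
    "HOL-Library.Landau_Symbols"
begin

text \<open>
  Arithmetic functions are functions on \<^typ>\<open>nat\<close> of which only the values at positive arguments
  matter.
\<close>

definition multiplicative :: "(nat \<Rightarrow> complex) \<Rightarrow> bool" where
  "multiplicative f \<longleftrightarrow> (\<forall>m n. m > 0 \<longrightarrow> n > 0 \<longrightarrow> coprime m n \<longrightarrow> f (m * n) = f m * f n)"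

definition dirichlet_conv :: "(nat \<Rightarrow> complex) \<Rightarrow> (nat \<Rightarrow> complex) \<Rightarrow> nat \<Rightarrow> complex" where
  "dirichlet_conv f g n = (\<Sum>d | d dvd n. f d * g (n div d))"

primrec dirichlet_power :: "(nat \<Rightarrow> complex) \<Rightarrow> nat \<Rightarrow> nat \<Rightarrow> complex" where
  "dirichlet_power g 0 = (\<lambda>n. if n = 1 then 1 else 0)"
| "dirichlet_power g (Suc r) = dirichlet_conv g (dirichlet_power g r)"

text \<open>
  The coefficients of the formal \<open>r\<close>-th root, normalised to have leading coefficient 1, of the
  formal Dirichlet series with coefficients \<open>f\<close>.  The value at 0 is a dummy that makes the root
  unique as a function on \<^typ>\<open>nat\<close>; lemma \<open>ex1_dirichlet_root\<close> below shows that the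
  description is proper whenever \<open>f 1 = 1\<close> and \<open>r \<ge> 1\<close>.
\<close>

definition is_dirichlet_root :: "nat \<Rightarrow> (nat \<Rightarrow> complex) \<Rightarrow> (nat \<Rightarrow> complex) \<Rightarrow> bool" where
  "is_dirichlet_root r f g \<longleftrightarrow> g 0 = 0 \<and> g 1 = 1 \<and> (\<forall>n>0. dirichlet_power g r n = f n)"

definition dirichlet_root :: "nat \<Rightarrow> (nat \<Rightarrow> complex) \<Rightarrow> nat \<Rightarrow> complex" where
  "dirichlet_root r f = (THE g. is_dirichlet_root r f g)"

text \<open>
  \<open>L\<close> is a meromorphic continuation of the \<open>L\<close>-series of \<open>f\<close> to the closed half-plane
  \<open>Re s \<ge> 1/2\<close> (that is, it is meromorphic in a neighbourhood of each point of it) whose only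
  possible pole there is at 1.
\<close>

definition L_continuation :: "(nat \<Rightarrow> complex) \<Rightarrow> (complex \<Rightarrow> complex) \<Rightarrow> bool" where
  "L_continuation f L \<longleftrightarrow>
     (\<exists>\<sigma>. \<forall>s. Re s > \<sigma> \<longrightarrow> ((\<lambda>n. f n / of_nat n powr s) has_sum L s) {1..}) \<and>
     L meromorphic_on {s. Re s \<ge> 1/2} \<and>
     L analytic_on {s. Re s \<ge> 1/2} - {1}"


lemma dirichlet_power_at_1: "dirichlet_power g r 1 = g 1 ^ r"
proof (induction r)
  case (Suc r)
  have "{d::nat. d dvd 1} = {1}" by auto
  then show ?case using Suc by (simp add: dirichlet_conv_def)
qed simp

lemma dirichlet_conv_cong:
  assumes "\<And>d. d dvd n \<Longrightarrow> f d = f' d" "\<And>d. d dvd n \<Longrightarrow> g d = g' d"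
  shows "dirichlet_conv f g n = dirichlet_conv f' g' n"
  unfolding dirichlet_conv_def
proof (rule sum.cong)
  fix d assume "d \<in> {d. d dvd n}"
  then have d: "d dvd n" by simp
  then have "n div d dvd n" by (metis dvd_div_mult_self dvd_triv_left)
  with d show "f d * g (n div d) = f' d * g' (n div d)" using assms by simp
qed simp

lemma dirichlet_power_cong:
  assumes "\<And>d. d dvd n \<Longrightarrow> g d = h d"
  shows "dirichlet_power g r n = dirichlet_power h r n"
  using assms
proof (induction r arbitrary: n)
  case (Suc r)
  have "dirichlet_power g r d = dirichlet_power h r d" if "d dvd n" for d
    using Suc that dvd_trans by blast
  then show ?case by (auto intro!: dirichlet_conv_cong Suc.prems)
qed simp

lemma dirichlet_conv_split:
  assumes "n > (1::nat)"
  shows "dirichlet_conv f g n =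
    f 1 * g n + f n * g 1 + (\<Sum>d | d dvd n \<and> d \<noteq> 1 \<and> d \<noteq> n. f d * g (n div d))"
proof -
  have fin: "finite {d. d dvd n}" using assms by simp
  have "{d. d dvd n} = insert 1 (insert n {d. d dvd n \<and> d \<noteq> 1 \<and> d \<noteq> n})" by auto
  then have "dirichlet_conv f g n =
      (\<Sum>d \<in> insert 1 (insert n {d. d dvd n \<and> d \<noteq> 1 \<and> d \<noteq> n}). f d * g (n div d))"
    unfolding dirichlet_conv_def by simp
  also have "\<dots> = f 1 * g n + f n * g 1 + (\<Sum>d | d dvd n \<and> d \<noteq> 1 \<and> d \<noteq> n. f d * g (n div d))"
    using assms fin by (subst sum.insert; simp)+
  finally show ?thesis .
qed

lemma dirichlet_power_diff:
  assumes "n > (1::nat)" "g 1 = 1" "h 1 = 1" "\<And>m. m > 0 \<Longrightarrow> m < n \<Longrightarrow> g m = h m"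
  shows "dirichlet_power g r n - dirichlet_power h r n = of_nat r * (g n - h n)"
proof (induction r)
  case (Suc r)
  have *: "0 < d \<and> d < n \<and> 0 < n div d \<and> n div d < n" if "d dvd n" "d \<noteq> 1" "d \<noteq> n" for d
    using that assms(1)
    by (metis div_less_dividend dvd_div_eq_0_iff dvd_pos_nat gr0I linorder_neqE_nat
        nat_dvd_not_less not_less_iff_gr_or_eq less_one less_trans zero_less_one)
  have pw: "dirichlet_power g r m = dirichlet_power h r m" if "0 < m" "m < n" for m
    using that assms(4)
    by (intro dirichlet_power_cong) (meson dvd_imp_le dvd_pos_nat le_less_trans)
  have "(\<Sum>d | d dvd n \<and> d \<noteq> 1 \<and> d \<noteq> n. g d * dirichlet_power g r (n div d)) =
        (\<Sum>d | d dvd n \<and> d \<noteq> 1 \<and> d \<noteq> n. h d * dirichlet_power h r (n div d))"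
    by (intro sum.cong refl) (use * pw assms(4) in auto)
  then show ?case
    using Suc assms dirichlet_power_at_1[of g r] dirichlet_power_at_1[of h r]
    by (simp add: dirichlet_conv_split algebra_simps)
qed simp

function dirichlet_root_rec :: "nat \<Rightarrow> (nat \<Rightarrow> complex) \<Rightarrow> nat \<Rightarrow> complex" where
  "dirichlet_root_rec r f n =
     (if n = 0 then 0 else if n = 1 then 1 else
       (f n - dirichlet_power (\<lambda>m. if m < n then dirichlet_root_rec r f m else 0) r n) / of_nat r)"
  by auto
termination by (relation "Wellfounded.measure (\<lambda>(r, f, n). n)") auto

declare dirichlet_root_rec.simps [simp del]

lemma is_dirichlet_root_rec:
  assumes "f 1 = 1" "r \<ge> 1"
  shows "is_dirichlet_root r f (dirichlet_root_rec r f)"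
proof -
  let ?g = "dirichlet_root_rec r f"
  have 1: "?g 1 = 1" by (subst dirichlet_root_rec.simps) simp
  have "dirichlet_power ?g r n = f n" if n: "n > 1" for n
  proof -
    let ?h = "\<lambda>m. if m < n then ?g m else 0"
    have "dirichlet_power ?g r n - dirichlet_power ?h r n = of_nat r * (?g n - ?h n)"
      using n 1 by (intro dirichlet_power_diff) auto
    moreover have "?g n = (f n - dirichlet_power ?h r n) / of_nat r"
      using n by (subst dirichlet_root_rec.simps) simp
    ultimately show ?thesis using assms by (simp add: field_simps)
  qed
  moreover have "dirichlet_power ?g r 1 = f 1"
    using assms 1 by (simp only: dirichlet_power_at_1) simp
  moreover have "?g 0 = 0" by (subst dirichlet_root_rec.simps) simp
  ultimately show ?thesis
    unfolding is_dirichlet_root_def using 1 by (metis One_nat_def Suc_lessI)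
qed

lemma is_dirichlet_root_unique:
  assumes "r \<ge> 1" "is_dirichlet_root r f g" "is_dirichlet_root r f h"
  shows "g = h"
proof
  fix n show "g n = h n"
  proof (induction n rule: less_induct)
    case (less n)
    consider "n = 0" | "n = 1" | "n > 1" by linarith
    then show ?case
    proof cases
      case 3
      then have "dirichlet_power g r n - dirichlet_power h r n = of_nat r * (g n - h n)"
        using assms less by (intro dirichlet_power_diff) (auto simp: is_dirichlet_root_def)
      then show ?thesis using assms 3 by (auto simp: is_dirichlet_root_def)
    qed (use assms in \<open>auto simp: is_dirichlet_root_def\<close>)
  qed
qed

lemma ex1_dirichlet_root:
  assumes "f 1 = 1" "r \<ge> 1"
  shows "\<exists>!g. is_dirichlet_root r f g"
  using is_dirichlet_root_rec[of f r] is_dirichlet_root_unique[of r f] assms by blast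

lemma is_dirichlet_root_dirichlet_root:
  assumes "f 1 = 1" "r \<ge> 1"
  shows "is_dirichlet_root r f (dirichlet_root r f)"
  unfolding dirichlet_root_def by (rule theI'[OF ex1_dirichlet_root[of f r, OF assms]])

end

(*
  Fix 0 < \<kappa> < 1. The primes below a small power of T are split into ranges on which ln p lies in
  a dyadic interval. Truncating the exponential of \<kappa> - 1 times the prime sum over each range and
  multiplying gives a Dirichlet polynomial Q of length at most T^(1/8) that imitates
  L^(\<kappa> - 1); on the exceptional set where a prime sum is too large for the truncation, a high
  even power of that prime sum takes over. A smoothly truncated series S of L replaces L, so that
  every mean value reduces to its diagonal terms, which are Euler products. This yields
    E |S|^(2 \<kappa>) << (log T)^(N \<kappa>^2)   on Re s = 1/2, and
    E |S|^(2 \<kappa>) >> A^(-B) (log T)^(N \<kappa>^2)   on Re s = 1/2 + A / log T,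
  where E is the mean over a Gaussian of width sqrt T centred at any \<tau> of size T. The functions
  |L|^(2 \<kappa>) and |L - S|^(2 \<kappa>) are subharmonic, hence their means over vertical lines are
  log-convex up to constants; as S is extremely close to L far to the right, the mean of
  |L - S|^(2 \<kappa>) at 1/2 + A / log T gains a factor exp (- \<delta> A) over the one at 1/2. For A large this
  beats A^(-B), so E |L|^(2 \<kappa>) at 1/2 cannot be small. Averaging over \<tau> gives the integral.
  For general k > 0 the argument is applied to a power L^r with \<kappa> = k / r, whose coefficients
  satisfy the same hypotheses with N r^2 in place of N.
*)

theory Submission
  imports Defs "HOL-Probability.Probability"
begin

subsection \<open>Multiplicative functions and Dirichlet convolution\<close>

text \<open>The growth hypothesis gives no short approximation to L on the critical line, so S is
  compared with L only far to the right and convexity brings the comparison back. A sharp truncation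
  would destroy multiplicativity. The cutoff in S is therefore a function of the additive, integer
  valued \<open>hh\<close>; its finite Fourier expansion writes S as a combination of twists of the
  coefficients by unimodular multiplicative functions, each with an Euler product. The k-th twist
  costs a power of |k|, and m-fold averaging of the cutoff gives coefficients of size |k|^(-m) that
  pay for it. \<kappa> < 1 enters through interpolation: with U close to |exp ((\<kappa> - 1) P)|^2
  and W close to |exp (\<kappa> P)|^2, P the prime sum, U^\<kappa> W^(1 - \<kappa>) is about 1,
  hence |S|^(2 \<kappa>) is at most about |S|^2 U + W. The lower bound comes from the inner product
  of S Q_(\<kappa> - 1) with Q_\<kappa>. A Gaussian of width sqrt T makes off-diagonal terms of
  polynomials of length T^(1/8) negligible, and has almost no mass outside [T, 2 T] when centred
  near the middle.\<close>

definition nums_over :: "nat set \<Rightarrow> nat set" where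
  "nums_over A = {n. n > 0 \<and> prime_factors n \<subseteq> A}"

lemma one_in_nums_over [simp]: "1 \<in> nums_over A" "Suc 0 \<in> nums_over A"
  by (auto simp: nums_over_def)

lemma nums_over_pos: "n \<in> nums_over A \<Longrightarrow> n > 0"
  by (simp add: nums_over_def)

lemma nums_over_mono: "A \<subseteq> B \<Longrightarrow> nums_over A \<subseteq> nums_over B"
  by (auto simp: nums_over_def)

lemma nums_over_mult_iff: "m * n \<in> nums_over A \<longleftrightarrow> m \<in> nums_over A \<and> n \<in> nums_over A"
  by (auto simp: nums_over_def prime_factors_product)

lemma nums_over_dvd: "n \<in> nums_over A \<Longrightarrow> d dvd n \<Longrightarrow> d \<in> nums_over A"
  by (metis dvd_def nums_over_mult_iff)

lemma nums_over_empty: "nums_over {} = {1}"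
  by (auto simp: nums_over_def prime_factorization_empty_iff)

lemma nums_over_coprime:
  assumes "A \<inter> B = {}" "m \<in> nums_over A" "n \<in> nums_over B"
  shows "coprime m n"
proof (rule ccontr)
  assume "\<not> coprime m n"
  then obtain p where "prime p" "p dvd m" "p dvd n"
    by (metis coprime_iff_gcd_eq_1 gcd_dvd1 gcd_dvd2 dvd_trans prime_factor_nat)
  then have "p \<in> A" "p \<in> B" using assms by (auto simp: nums_over_def prime_factors_dvd)
  with assms show False by blast
qed

text \<open>Together with \<open>nums_over_unique\<close> this identifies the monoid over a disjoint
  union of prime sets with the product of the two monoids; all factorisations of sums into Euler
  products rest on it.\<close>

lemma nums_over_decomp:
  assumes "A \<inter> B = {}" "n \<in> nums_over (A \<union> B)"
  obtains a b where "a \<in> nums_over A" "b \<in> nums_over B" "n = a * b"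
proof -
  let ?P = "prime_factorization n"
  define a where "a = prod_mset (filter_mset (\<lambda>p. p \<in> A) ?P)"
  define b where "b = prod_mset (filter_mset (\<lambda>p. p \<notin> A) ?P)"
  have n: "n > 0" "prime_factors n \<subseteq> A \<union> B" using assms by (auto simp: nums_over_def)
  have pa: "prime_factorization a = filter_mset (\<lambda>p. p \<in> A) ?P"
    unfolding a_def by (rule prime_factorization_prod_mset_primes) auto
  have pb: "prime_factorization b = filter_mset (\<lambda>p. p \<notin> A) ?P"
    unfolding b_def by (rule prime_factorization_prod_mset_primes) auto
  have "?P = filter_mset (\<lambda>p. p \<in> A) ?P + filter_mset (\<lambda>p. p \<notin> A) ?P" by (rule multiset_partition)
  then have "prod_mset ?P = a * b" unfolding a_def b_def by (metis prod_mset_Un)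
  then have ab: "a * b = n" using n by (simp add: prod_mset_prime_factorization_nat)
  then have "a > 0" "b > 0" using n by (auto intro: gr0I)
  then have "a \<in> nums_over A" "b \<in> nums_over B"
    using n pa pb by (auto simp: nums_over_def)
  then show ?thesis using ab that by blast
qed

lemma nums_over_unique:
  assumes AB: "A \<inter> B = {}" and m: "a \<in> nums_over A" "b \<in> nums_over B" "a' \<in> nums_over A" "b' \<in> nums_over B"
    and eq: "a * b = a' * b'"
  shows "a = a' \<and> b = b'"
proof -
  have "coprime a b'" "coprime a' b" using nums_over_coprime[OF AB] m by auto
  then have "a dvd a'" "a' dvd a"
    using eq by (metis coprime_dvd_mult_left_iff dvd_triv_left)+
  then have "a = a'" by (rule dvd_antisym)
  then show ?thesis using eq nums_over_pos[OF m(3)] by simp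
qed

lemma nums_over_singleton:
  assumes "prime p"
  shows "nums_over {p} = range (\<lambda>a. p ^ a)"
proof (intro equalityI subsetI)
  fix n assume n: "n \<in> nums_over {p}"
  then have "n > 0" "prime_factors n \<subseteq> {p}" by (auto simp: nums_over_def)
  have "n = (\<Prod>q\<in>prime_factors n. q ^ multiplicity q n)"
    using \<open>n > 0\<close> by (intro prime_factorization_nat) auto
  also have "\<dots> = p ^ multiplicity p n"
  proof (cases "prime_factors n = {}")
    case True
    then have "multiplicity p n = 0" using assms
      by (metis \<open>n > 0\<close> empty_iff not_dvd_imp_multiplicity_0 not_less0 prime_factorsI)
    with True show ?thesis by simp
  next
    case False
    then have "prime_factors n = {p}" using \<open>prime_factors n \<subseteq> {p}\<close> by blast
    then show ?thesis by simp
  qed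
  finally show "n \<in> range (\<lambda>a. p ^ a)" by blast
next
  fix n assume "n \<in> range (\<lambda>a. p ^ a)"
  then show "n \<in> nums_over {p}"
    using assms prime_gt_0_nat[OF assms] by (auto simp: nums_over_def prime_factorization_prime_power split: if_splits)
qed

text \<open>Meant for nonnegative terms over an infinite index set: the bound is put on finite
  partial sums, so that no summability has to be carried along, and it is evaluated on finite
  supports.\<close>

definition bsum :: "('a \<Rightarrow> real) \<Rightarrow> 'a set \<Rightarrow> real \<Rightarrow> bool" where
  "bsum g A K \<longleftrightarrow> (\<forall>F. finite F \<longrightarrow> F \<subseteq> A \<longrightarrow> sum g F \<le> K)"

lemma bsumI: "(\<And>F. finite F \<Longrightarrow> F \<subseteq> A \<Longrightarrow> sum g F \<le> K) \<Longrightarrow> bsum g A K"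
  by (simp add: bsum_def)

lemma bsumD: "bsum g A K \<Longrightarrow> finite F \<Longrightarrow> F \<subseteq> A \<Longrightarrow> sum g F \<le> K"
  by (simp add: bsum_def)

lemma bsum_nonneg: "bsum g A K \<Longrightarrow> K \<ge> 0"
  using bsumD[of g A K "{}"] by simp

lemma bsum_mono: "bsum g A K \<Longrightarrow> (\<And>x. x \<in> B \<Longrightarrow> h x \<le> g x) \<Longrightarrow> B \<subseteq> A \<Longrightarrow> K \<le> K' \<Longrightarrow> bsum h B K'"
proof (rule bsumI)
  fix F assume *: "bsum g A K" "\<And>x. x \<in> B \<Longrightarrow> h x \<le> g x" "B \<subseteq> A" "K \<le> K'" "finite F" "F \<subseteq> B"
  then have "sum h F \<le> sum g F" by (intro sum_mono) blast
  also have "\<dots> \<le> K" using * by (intro bsumD[of g A K]) auto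
  finally show "sum h F \<le> K'" using * by simp
qed

lemma bsum_add: "bsum g A K \<Longrightarrow> bsum h A K' \<Longrightarrow> bsum (\<lambda>x. g x + h x) A (K + K')"
  unfolding bsum_def by (simp add: sum.distrib add_mono)

lemma bsum_cmult: "bsum g A K \<Longrightarrow> c \<ge> 0 \<Longrightarrow> bsum (\<lambda>x. c * g x) A (c * K)"
  unfolding bsum_def by (simp add: sum_distrib_left[symmetric] mult_left_mono)

text \<open>Splitting each n as a * b embeds a finite set injectively into the rectangle spanned by
  its two projections, and over a rectangle the sum of products factors.\<close>

lemma bsum_nums_over_Un:
  assumes AB: "A \<inter> B = {}"
    and g: "\<And>a b. a \<in> nums_over A \<Longrightarrow> b \<in> nums_over B \<Longrightarrow> g (a * b) \<le> g1 a * g2 b"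
    and nn: "\<And>a. g1 a \<ge> 0" "\<And>b. g2 b \<ge> 0"
    and K1: "bsum g1 (nums_over A) K1" and K2: "bsum g2 (nums_over B) K2"
  shows "bsum g (nums_over (A \<union> B)) (K1 * K2)"
proof (rule bsumI)
  fix F assume F: "finite F" "F \<subseteq> nums_over (A \<union> B)"
  have "\<forall>n\<in>F. \<exists>ab. fst ab \<in> nums_over A \<and> snd ab \<in> nums_over B \<and> n = fst ab * snd ab"
  proof
    fix n assume "n \<in> F"
    then obtain a b where "a \<in> nums_over A" "b \<in> nums_over B" "n = a * b"
      using nums_over_decomp[OF AB, of n] F(2) by blast
    then show "\<exists>ab. fst ab \<in> nums_over A \<and> snd ab \<in> nums_over B \<and> n = fst ab * snd ab"
      by (intro exI[of _ "(a, b)"]) simp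
  qed
  then obtain d where d: "\<And>n. n \<in> F \<Longrightarrow> fst (d n) \<in> nums_over A \<and> snd (d n) \<in> nums_over B \<and> n = fst (d n) * snd (d n)"
    by metis
  have inj: "inj_on d F" using d by (metis inj_onI)
  let ?FA = "fst ` d ` F" and ?FB = "snd ` d ` F"
  have fin: "finite ?FA" "finite ?FB" using F by auto
  have sub: "?FA \<subseteq> nums_over A" "?FB \<subseteq> nums_over B" using d by auto
  have "sum g F \<le> (\<Sum>n\<in>F. g1 (fst (d n)) * g2 (snd (d n)))"
    using d g by (intro sum_mono) metis
  also have "\<dots> = (\<Sum>x\<in>d ` F. g1 (fst x) * g2 (snd x))" using inj by (simp add: sum.reindex)
  also have "\<dots> \<le> (\<Sum>x\<in>?FA \<times> ?FB. g1 (fst x) * g2 (snd x))"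
  proof (rule sum_mono2)
    show "finite (?FA \<times> ?FB)" using fin by (rule finite_cartesian_product)
    show "d ` F \<subseteq> ?FA \<times> ?FB" by (metis image_eqI mem_Times_iff subsetI)
  qed (use nn in auto)
  also have "\<dots> = sum g1 ?FA * sum g2 ?FB"
    by (simp add: sum_product sum.cartesian_product case_prod_beta)
  also have "\<dots> \<le> K1 * K2"
    using bsumD[OF K1 fin(1) sub(1)] bsumD[OF K2 fin(2) sub(2)] bsum_nonneg[OF K1] nn
    by (intro mult_mono) (auto intro: sum_nonneg)
  finally show "sum g F \<le> K1 * K2" .
qed

text \<open>Induction over the primes of \<open>A\<close>. For an upper bound by the Euler product
  submultiplicativity is enough; \<open>E p\<close> majorises the partial sums of the local factor
  at p.\<close>

lemma bsum_nums_over_prod: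
  assumes fin: "finite A" and pr: "\<And>p. p \<in> A \<Longrightarrow> prime p"
    and mult: "\<And>a b. a > 0 \<Longrightarrow> b > 0 \<Longrightarrow> coprime a b \<Longrightarrow> g (a * b) \<le> g a * g b"
    and nn: "\<And>n. g n \<ge> 0" and g1: "g 1 \<le> 1"
    and E: "\<And>p K. p \<in> A \<Longrightarrow> (\<Sum>a\<le>K. g (p ^ a)) \<le> E p"
  shows "bsum g (nums_over A) (\<Prod>p\<in>A. E p)"
  using fin pr E
proof (induction A rule: finite_induct)
  case empty
  have "sum g F \<le> 1" if "F \<subseteq> {1}" for F
    using subset_singletonD[OF that] g1 by (elim disjE) simp_all
  then show ?case by (simp only: bsum_def nums_over_empty prod.empty) blast
next
  case (insert p A)
  have p: "prime p" using insert by blast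
  have "bsum g (nums_over {p}) (E p)"
  proof (rule bsumI)
    fix F assume F: "finite F" "F \<subseteq> nums_over {p}"
    then obtain X where X: "finite X" "F = (\<lambda>a. p ^ a) ` X"
      unfolding nums_over_singleton[OF p] by (metis finite_subset_image)
    have "inj_on (\<lambda>a. p ^ a) X" using p by (meson inj_onI prime_gt_1_nat power_inject_exp)
    then have "sum g F = (\<Sum>a\<in>X. g (p ^ a))" using X by (simp add: sum.reindex)
    also have "\<dots> \<le> (\<Sum>a\<le>Max (insert 0 X). g (p ^ a))"
      using X nn by (intro sum_mono2) auto
    also have "\<dots> \<le> E p" using insert by blast
    finally show "sum g F \<le> E p" .
  qed
  moreover have "bsum g (nums_over A) (\<Prod>p\<in>A. E p)" using insert by blast
  ultimately have "bsum g (nums_over ({p} \<union> A)) (E p * (\<Prod>p\<in>A. E p))"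
    using insert(2) nums_over_coprime[of "{p}" A] nums_over_pos
    by (intro bsum_nums_over_Un[where ?g1.0 = g and ?g2.0 = g] nn mult) blast+
  then show ?case using insert by simp
qed

section \<open>Dirichlet convolution of functions supported on disjoint sets of primes\<close>

lemma sum_divisors_coprime:
  fixes G :: "nat \<Rightarrow> 'a::comm_monoid_add"
  assumes "coprime m n"
  shows "(\<Sum>d | d dvd m * n. G d) = (\<Sum>(d, e)\<in>{d. d dvd m} \<times> {e. e dvd n}. G (d * e))"
proof -
  let ?S = "{d. d dvd m} \<times> {e. e dvd n}"
  have inj: "inj_on (\<lambda>(d, e). d * e) ?S"
  proof (rule inj_onI, clarsimp)
    fix d e d' e' assume *: "d dvd m" "e dvd n" "d' dvd m" "e' dvd n" "d * e = d' * e'"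
    have c: "coprime x y" if "x dvd m" "y dvd n" for x y
      using assms that by (meson coprime_divisors)
    have "d dvd d'" "d' dvd d" "e dvd e'" "e' dvd e"
      using * c[of d e'] c[of d' e] 
      by (metis coprime_dvd_mult_left_iff dvd_triv_left, metis coprime_dvd_mult_left_iff dvd_triv_left,
          metis coprime_commute coprime_dvd_mult_right_iff dvd_triv_right, metis coprime_commute coprime_dvd_mult_right_iff dvd_triv_right)
    then show "d = d' \<and> e = e'" by (simp add: dvd_antisym)
  qed
  have "(\<lambda>(d, e). d * e) ` ?S = {d. d dvd m * n}"
  proof (intro equalityI subsetI)
    fix d assume "d \<in> {d. d dvd m * n}"
    then obtain b c where "d = b * c" "b dvd m" "c dvd n" using division_decomp[of d m n] by blast
    then show "d \<in> (\<lambda>(d, e). d * e) ` ?S" by force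
  qed (auto intro: mult_dvd_mono)
  then have "(\<Sum>d | d dvd m * n. G d) = sum G ((\<lambda>(d, e). d * e) ` ?S)" by simp
  also have "\<dots> = (\<Sum>(d, e)\<in>?S. G (d * e))"
    by (subst sum.reindex[OF inj]) (simp add: case_prod_beta')
  finally show ?thesis .
qed

text \<open>By uniqueness of the splitting, d = m is the only divisor of m * n that can
  contribute.\<close>

lemma dirichlet_conv_supported_mult:
  assumes AB: "A \<inter> B = {}"
    and x: "\<And>k. x k \<noteq> 0 \<Longrightarrow> k \<in> nums_over A" and y: "\<And>k. y k \<noteq> 0 \<Longrightarrow> k \<in> nums_over B"
    and m: "m \<in> nums_over A" and n: "n \<in> nums_over B"
  shows "dirichlet_conv x y (m * n) = x m * y n"
proof -
  have pos: "m > 0" "n > 0" using m n by (auto dest: nums_over_pos)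
  have "x d * y (m * n div d) = 0" if "d dvd m * n" "d \<noteq> m" for d
  proof (rule ccontr)
    assume "x d * y (m * n div d) \<noteq> 0"
    then have "d \<in> nums_over A" "m * n div d \<in> nums_over B" using x y by auto
    moreover have "d * (m * n div d) = m * n" using that by simp
    ultimately have "d = m" using nums_over_unique[OF AB _ _ m n] by blast
    with that show False by simp
  qed
  then have "dirichlet_conv x y (m * n) = (\<Sum>d\<in>{m}. x d * y (m * n div d))"
    unfolding dirichlet_conv_def using pos by (intro sum.mono_neutral_right) auto
  then show ?thesis using pos by simp
qed

text \<open>Three functions \<open>x\<close>, \<open>y\<close>, \<open>z\<close> instead of one, so
  that it covers both the multiplicativity of a convolution and the case where the second factor is
  a product of polynomials over different primes.\<close>

lemma dirichlet_conv_coprime: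
  fixes F z x y :: "nat \<Rightarrow> complex"
  assumes mn: "coprime m n" "m > 0" "n > 0"
    and F: "\<And>d e. d dvd m \<Longrightarrow> e dvd n \<Longrightarrow> F (d * e) = F d * F e"
    and z: "\<And>d e. d dvd m \<Longrightarrow> e dvd n \<Longrightarrow> z (d * e) = x d * y e"
  shows "dirichlet_conv F z (m * n) = dirichlet_conv F x m * dirichlet_conv F y n"
proof -
  have "dirichlet_conv F z (m * n) = (\<Sum>(d, e)\<in>{d. d dvd m} \<times> {e. e dvd n}. F (d * e) * z (m * n div (d * e)))"
    unfolding dirichlet_conv_def by (rule sum_divisors_coprime[OF mn(1)])
  also have "\<dots> = (\<Sum>(d, e)\<in>{d. d dvd m} \<times> {e. e dvd n}. (F d * x (m div d)) * (F e * y (n div e)))"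
  proof (intro sum.cong refl, clarsimp)
    fix d e assume d: "d dvd m" and e: "e dvd n"
    have "m * n div (d * e) = (m div d) * (n div e)" using d e by (simp add: div_mult_div_if_dvd)
    moreover have "m div d dvd m" "n div e dvd n" using d e by (metis dvd_div_mult_self dvd_triv_left)+
    ultimately show "F (d * e) * z (m * n div (d * e)) = F d * x (m div d) * (F e * y (n div e))"
      using F[OF d e] z by simp
  qed
  also have "\<dots> = dirichlet_conv F x m * dirichlet_conv F y n"
    by (simp add: dirichlet_conv_def sum_product sum.cartesian_product)
  finally show ?thesis .
qed

lemma multiplicative_dirichlet_conv:
  assumes F: "multiplicative F" and G: "multiplicative G"
  shows "multiplicative (dirichlet_conv F G)"
  unfolding multiplicative_def
proof (intro allI impI)
  fix m n :: nat assume mn: "m > 0" "n > 0" "coprime m n"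
  show "dirichlet_conv F G (m * n) = dirichlet_conv F G m * dirichlet_conv F G n"
  proof (rule dirichlet_conv_coprime[OF mn(3,1,2)])
    fix d e assume "d dvd m" "e dvd n"
    then have "d > 0" "e > 0" "coprime d e" using mn by (auto intro!: gr0I intro: coprime_divisors)
    then show "F (d * e) = F d * F e" "G (d * e) = G d * G e"
      using F G by (auto simp: multiplicative_def)
  qed
qed

lemma dirichlet_conv_mult_supported:
  assumes F: "multiplicative F" and AB: "A \<inter> B = {}"
    and x: "\<And>k. x k \<noteq> 0 \<Longrightarrow> k \<in> nums_over A" and y: "\<And>k. y k \<noteq> 0 \<Longrightarrow> k \<in> nums_over B"
    and m: "m \<in> nums_over A" and n: "n \<in> nums_over B"
  shows "dirichlet_conv F (dirichlet_conv x y) (m * n) = dirichlet_conv F x m * dirichlet_conv F y n"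
proof (rule dirichlet_conv_coprime[OF nums_over_coprime[OF AB m n] nums_over_pos[OF m] nums_over_pos[OF n]])
  fix d e assume de: "d dvd m" "e dvd n"
  then have d: "d \<in> nums_over A" and e: "e \<in> nums_over B" using m n nums_over_dvd by blast+
  then show "F (d * e) = F d * F e"
    using F nums_over_coprime[OF AB d e] nums_over_pos by (auto simp: multiplicative_def)
  show "dirichlet_conv x y (d * e) = x d * y e"
    by (rule dirichlet_conv_supported_mult[OF AB x y d e])
qed

definition conv_one :: "nat \<Rightarrow> complex" where
  "conv_one n = (if n = 1 then 1 else 0)"

lemma dirichlet_conv_one_right: "n > 0 \<Longrightarrow> dirichlet_conv x conv_one n = x n"
proof -
  assume n: "n > 0"
  have "dirichlet_conv x conv_one n = (\<Sum>d\<in>{n}. x d * conv_one (n div d))"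
    unfolding dirichlet_conv_def
  proof (rule sum.mono_neutral_right)
    show "\<forall>d\<in>{d. d dvd n} - {n}. x d * conv_one (n div d) = 0"
      using n by (auto simp: conv_one_def)
  qed (use n in auto)
  then show ?thesis using n by (simp add: conv_one_def)
qed

lemma dirichlet_conv_one_left: "n > 0 \<Longrightarrow> dirichlet_conv conv_one x n = x n"
proof -
  assume n: "n > 0"
  have "dirichlet_conv conv_one x n = (\<Sum>d\<in>{1}. conv_one d * x (n div d))"
    unfolding dirichlet_conv_def by (rule sum.mono_neutral_right) (use n in \<open>auto simp: conv_one_def\<close>)
  then show ?thesis by (simp add: conv_one_def)
qed

lemma multiplicative_conv_one: "multiplicative conv_one"
  by (auto simp: multiplicative_def conv_one_def)

subsection \<open>Dirichlet polynomials\<close>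

definition dpoly :: "(nat \<Rightarrow> complex) \<Rightarrow> complex \<Rightarrow> complex" where
  "dpoly a s = (\<Sum>n | a n \<noteq> 0. a n * of_nat n powr (- s))"

text \<open>Over an infinite support \<open>dpoly\<close> is 0 by convention, so it is meaningful
  under this predicate. The index 0 is a dummy and is excluded: every number divides 0, so a
  convolution carries no information there.\<close>

definition fin_supp :: "(nat \<Rightarrow> complex) \<Rightarrow> bool" where
  "fin_supp a \<longleftrightarrow> finite {n. a n \<noteq> 0} \<and> a 0 = 0"

lemma dpoly_superset:
  "finite F \<Longrightarrow> (\<And>n. a n \<noteq> 0 \<Longrightarrow> n \<in> F) \<Longrightarrow> dpoly a s = (\<Sum>n\<in>F. a n * of_nat n powr (- s))"
  unfolding dpoly_def by (intro sum.mono_neutral_left) auto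

lemma dirichlet_conv_eq_sum:
  assumes a: "finite X" "\<And>n. a n \<noteq> 0 \<Longrightarrow> n \<in> X" "0 \<notin> X"
    and b: "finite Y" "\<And>n. b n \<noteq> 0 \<Longrightarrow> n \<in> Y" "0 \<notin> Y"
    and n: "n > 0"
  shows "dirichlet_conv a b n = (\<Sum>(d, e)\<in>{(d, e) \<in> X \<times> Y. d * e = n}. a d * b e)"
proof -
  have "dirichlet_conv a b n = (\<Sum>d\<in>{d. d dvd n \<and> d \<in> X \<and> n div d \<in> Y}. a d * b (n div d))"
    unfolding dirichlet_conv_def using n a(2) b(2) by (intro sum.mono_neutral_right) auto
  also have "\<dots> = (\<Sum>(d, e)\<in>{(d, e) \<in> X \<times> Y. d * e = n}. a d * b e)"
    by (rule sum.reindex_bij_witness[where i = fst and j = "\<lambda>d. (d, n div d)"]) (use a(3) n in \<open>auto intro!: gr0I\<close>)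
  finally show ?thesis .
qed

lemma fin_supp_conv:
  assumes "fin_supp a" "fin_supp b"
  shows "fin_supp (dirichlet_conv a b)"
    and "dirichlet_conv a b n \<noteq> 0 \<Longrightarrow> \<exists>d e. a d \<noteq> 0 \<and> b e \<noteq> 0 \<and> n = d * e"
proof -
  have 0: "dirichlet_conv a b 0 = 0"
    using infinite_UNIV_nat by (simp add: dirichlet_conv_def)
  show *: "\<exists>d e. a d \<noteq> 0 \<and> b e \<noteq> 0 \<and> n = d * e" if "dirichlet_conv a b n \<noteq> 0" for n
  proof -
    have "\<exists>d\<in>{d. d dvd n}. a d * b (n div d) \<noteq> 0"
      using that unfolding dirichlet_conv_def by (meson sum.neutral)
    then show ?thesis by (metis dvd_mult_div_cancel mem_Collect_eq mult_eq_0_iff)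
  qed
  have "{n. dirichlet_conv a b n \<noteq> 0} \<subseteq> (\<lambda>(d, e). d * e) ` ({d. a d \<noteq> 0} \<times> {e. b e \<noteq> 0})"
    using * by force
  then show "fin_supp (dirichlet_conv a b)"
    using assms 0 unfolding fin_supp_def by (meson finite_SigmaI finite_imageI finite_subset)
qed

lemma dpoly_conv:
  assumes a: "fin_supp a" and b: "fin_supp b"
  shows "dpoly (dirichlet_conv a b) s = dpoly a s * dpoly b s"
proof -
  let ?X = "{n. a n \<noteq> 0}" and ?Y = "{n. b n \<noteq> 0}"
  have X: "finite ?X" "0 \<notin> ?X" and Y: "finite ?Y" "0 \<notin> ?Y" using a b by (auto simp: fin_supp_def)
  let ?Z = "(\<lambda>(d, e). d * e) ` (?X \<times> ?Y)"
  have Z: "finite ?Z" using X Y by auto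
  have "dpoly (dirichlet_conv a b) s = (\<Sum>n\<in>?Z. dirichlet_conv a b n * of_nat n powr (- s))"
    by (rule dpoly_superset[OF Z]) (use fin_supp_conv(2)[OF a b] in force)
  also have "\<dots> = (\<Sum>n\<in>?Z. \<Sum>x\<in>{x \<in> ?X \<times> ?Y. (\<lambda>(d, e). d * e) x = n}. (a (fst x) * b (snd x)) * of_nat n powr (- s))"
  proof (intro sum.cong refl)
    fix n assume "n \<in> ?Z"
    then have "n > 0" using X Y by (auto intro!: gr0I)
    have *: "{x \<in> ?X \<times> ?Y. (\<lambda>(d, e). d * e) x = n} = {(d, e) \<in> ?X \<times> ?Y. d * e = n}" by auto
    show "dirichlet_conv a b n * of_nat n powr (- s) =
      (\<Sum>x\<in>{x \<in> ?X \<times> ?Y. (\<lambda>(d, e). d * e) x = n}. (a (fst x) * b (snd x)) * of_nat n powr (- s))"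
      unfolding * by (subst dirichlet_conv_eq_sum[of ?X a ?Y b]) (use X Y \<open>n > 0\<close> in \<open>auto simp: sum_distrib_right case_prod_beta\<close>)
  qed
  also have "\<dots> = (\<Sum>n\<in>?Z. \<Sum>x\<in>{x \<in> ?X \<times> ?Y. (\<lambda>(d, e). d * e) x = n}. (a (fst x) * of_nat (fst x) powr (- s)) * (b (snd x) * of_nat (snd x) powr (- s)))"
    by (intro sum.cong refl) (auto simp: powr_times_real)
  also have "\<dots> = (\<Sum>x\<in>?X \<times> ?Y. (a (fst x) * of_nat (fst x) powr (- s)) * (b (snd x) * of_nat (snd x) powr (- s)))"
    by (rule sum.group) (use X Y Z in auto)
  also have "\<dots> = dpoly a s * dpoly b s"
    by (simp add: dpoly_def sum_product sum.cartesian_product case_prod_beta)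
  finally show ?thesis .
qed

subsection \<open>Gaussian means of Dirichlet polynomials\<close>

text \<open>A normal law as averaging weight: its characteristic function is again Gaussian, so the
  mean of each oscillating term is known exactly and decays very fast in the frequency.\<close>

definition gmean :: "real \<Rightarrow> real \<Rightarrow> (real \<Rightarrow> 'b::{banach, second_countable_topology}) \<Rightarrow> 'b" where
  "gmean \<tau> s h = (\<integral>t. normal_density \<tau> s t *\<^sub>R h t \<partial>lborel)"

definition gint :: "real \<Rightarrow> real \<Rightarrow> (real \<Rightarrow> 'b::{banach, second_countable_topology}) \<Rightarrow> bool" where
  "gint \<tau> s h = integrable lborel (\<lambda>t. normal_density \<tau> s t *\<^sub>R h t)"

lemma gint_bounded:
  assumes "s > 0" "h \<in> borel_measurable borel" "\<And>t. norm (h t) \<le> C"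
  shows "gint \<tau> s h"
  unfolding gint_def
proof (rule Bochner_Integration.integrable_bound)
  show "integrable lborel (\<lambda>t. normal_density \<tau> s t * C)"
    using integrable_normal_density[OF assms(1), of \<tau>] by simp
  show "(\<lambda>t. normal_density \<tau> s t *\<^sub>R h t) \<in> borel_measurable lborel"
    using assms(2) by measurable
  have "0 \<le> C" using norm_ge_zero assms(3) order_trans by blast
  then show "AE t in lborel. norm (normal_density \<tau> s t *\<^sub>R h t) \<le> norm (normal_density \<tau> s t * C)"
    using assms(3) by (intro AE_I2) (simp add: mult_left_mono abs_mult)
qed

lemma gint_cont_bounded:
  assumes "s > 0" "continuous_on UNIV h" "\<And>t. norm (h t) \<le> C"
  shows "gint \<tau> s h"
  using assms gint_bounded borel_measurable_continuous_onI by blast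

lemma gmean_mono:
  fixes g h :: "real \<Rightarrow> real"
  assumes "gint \<tau> s g" "gint \<tau> s h" "\<And>t. g t \<le> h t"
  shows "gmean \<tau> s g \<le> gmean \<tau> s h"
  using assms unfolding gmean_def gint_def by (intro integral_mono) (auto intro: mult_left_mono)

lemma gmean_nonneg: "(\<And>t. 0 \<le> (h t :: real)) \<Longrightarrow> 0 \<le> gmean \<tau> s h"
  unfolding gmean_def by (intro integral_nonneg_AE AE_I2) simp

lemma gmean_add: "gint \<tau> s g \<Longrightarrow> gint \<tau> s h \<Longrightarrow> gmean \<tau> s (\<lambda>t. g t + h t) = gmean \<tau> s g + gmean \<tau> s h"
  unfolding gmean_def gint_def by (simp add: scaleR_add_right)

lemma gint_add: "gint \<tau> s g \<Longrightarrow> gint \<tau> s h \<Longrightarrow> gint \<tau> s (\<lambda>t. g t + h t)"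
  unfolding gint_def by (simp add: scaleR_add_right)

lemma gmean_sum: "(\<And>i. i \<in> I \<Longrightarrow> gint \<tau> s (g i)) \<Longrightarrow> gmean \<tau> s (\<lambda>t. \<Sum>i\<in>I. g i t) = (\<Sum>i\<in>I. gmean \<tau> s (g i))"
  unfolding gmean_def gint_def by (simp add: scaleR_sum_right)

lemma gint_sum: "(\<And>i. i \<in> I \<Longrightarrow> gint \<tau> s (g i)) \<Longrightarrow> gint \<tau> s (\<lambda>t. \<Sum>i\<in>I. g i t)"
  unfolding gint_def by (simp add: scaleR_sum_right)

lemma gmean_cmult: 
  fixes c :: "'a::{real_normed_field, banach, second_countable_topology}"
  shows "gmean \<tau> s (\<lambda>t. c * h t) = c * gmean \<tau> s h"
  unfolding gmean_def by (simp flip: mult_scaleR_right)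

lemma gint_cmult: 
  fixes c :: "'a::{real_normed_field, banach, second_countable_topology}"
  shows "gint \<tau> s h \<Longrightarrow> gint \<tau> s (\<lambda>t. c * h t)"
  unfolding gint_def by (simp flip: mult_scaleR_right)

lemma gmean_const: "s > 0 \<Longrightarrow> gmean \<tau> s (\<lambda>t. c :: real) = c"
  unfolding gmean_def using integral_normal_density[of s \<tau>] by simp

lemma norm_gmean_le: "norm (gmean \<tau> s h) \<le> gmean \<tau> s (\<lambda>t. norm (h t))"
  unfolding gmean_def using integral_norm_bound[of lborel "\<lambda>t. normal_density \<tau> s t *\<^sub>R h t"] by simp

text \<open>The substitution t = \<tau> + s x reduces this to the characteristic function of the
  standard normal law.\<close>

lemma gmean_iexp:
  assumes s: "s > 0"
  shows "gmean \<tau> s (\<lambda>t. iexp (\<theta> * t)) = iexp (\<theta> * \<tau>) * of_real (exp (- (s * \<theta>)\<^sup>2 / 2))"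
proof -
  have "gmean \<tau> s (\<lambda>t. iexp (\<theta> * t)) =
      s *\<^sub>R (\<integral>x. normal_density \<tau> s (\<tau> + s * x) *\<^sub>R iexp (\<theta> * (\<tau> + s * x)) \<partial>lborel)"
    unfolding gmean_def using s by (subst lborel_integral_real_affine[of s _ \<tau>]) auto
  also have "\<dots> = s *\<^sub>R (\<integral>x. (iexp (\<theta> * \<tau>) / s) * (std_normal_density x *\<^sub>R iexp ((s * \<theta>) * x)) \<partial>lborel)"
  proof -
    have "normal_density \<tau> s (\<tau> + s * x) = std_normal_density x / s" for x
      using s by (simp add: normal_density_def power_mult_distrib real_sqrt_mult field_simps)
    moreover have "iexp (\<theta> * (\<tau> + s * x)) = iexp (\<theta> * \<tau>) * iexp ((s * \<theta>) * x)" for x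
      by (simp add: exp_add[symmetric] algebra_simps)
    ultimately show ?thesis
      by (intro arg_cong[where f = "\<lambda>x. s *\<^sub>R x"] Bochner_Integration.integral_cong) (auto simp: scaleR_conv_of_real)
  qed
  also have "\<dots> = iexp (\<theta> * \<tau>) * (\<integral>x. std_normal_density x *\<^sub>R iexp ((s * \<theta>) * x) \<partial>lborel)"
    using s by (simp add: scaleR_conv_of_real)
  also have "(\<integral>x. std_normal_density x *\<^sub>R iexp ((s * \<theta>) * x) \<partial>lborel) = char std_normal_distribution (s * \<theta>)"
    unfolding char_def by (subst integral_density) (auto simp: normal_density_nonneg)
  also have "\<dots> = of_real (exp (- (s * \<theta>)\<^sup>2 / 2))" by (simp add: char_std_normal_distribution)
  finally show ?thesis .
qed

lemma dpoly_cont: "continuous_on UNIV (\<lambda>t. dpoly a (Complex \<sigma> t))"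
  unfolding dpoly_def
proof (rule continuous_on_sum)
  fix n :: nat assume "n \<in> {n. a n \<noteq> 0}"
  show "continuous_on UNIV (\<lambda>t. a n * of_nat n powr - Complex \<sigma> t)"
  proof (cases "n = 0")
    case False
    then have eq: "(\<lambda>t. a n * of_nat n powr - Complex \<sigma> t) =
      (\<lambda>t. a n * exp (- (complex_of_real \<sigma> + \<i> * complex_of_real t) * ln (of_nat n)))"
      by (simp add: powr_def Complex_eq)
    show ?thesis unfolding eq by (intro continuous_intros)
  qed simp
qed

lemma norm_nat_powr_Complex: "norm (of_nat n powr - Complex \<sigma> t) = real n powr - \<sigma>"
  by (cases "n = 0") (auto simp: norm_powr_real_powr)

lemma dpoly_bound: "norm (dpoly a (Complex \<sigma> t)) \<le> (\<Sum>n | a n \<noteq> 0. norm (a n) * real n powr - \<sigma>)"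
  unfolding dpoly_def by (rule order_trans[OF norm_sum]) (simp add: norm_mult norm_nat_powr_Complex)

text \<open>For a < b one has ln (b / a) >= 1 - a / b >= 1 / b; so the frequencies of a polynomial
  of length Z are separated by 1 / Z.\<close>

lemma ln_nat_diff_ge:
  assumes "m \<noteq> n" "0 < m" "0 < n" "real m \<le> Z" "real n \<le> Z"
  shows "\<bar>ln (real m) - ln (real n)\<bar> \<ge> 1 / Z"
proof -
  have *: "ln (real b) - ln (real a) \<ge> 1 / Z" if "a < b" "0 < a" "real b \<le> Z" for a b
  proof -
    have "ln (real a / real b) \<le> real a / real b - 1" using that by (intro ln_le_minus_one) auto
    moreover have "ln (real a / real b) = ln (real a) - ln (real b)" using that by (simp add: ln_div)
    moreover have "1 - real a / real b \<ge> 1 / real b" using that by (simp add: field_simps)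
    moreover have "1 / real b \<ge> 1 / Z" using that by (intro divide_left_mono) auto
    ultimately show ?thesis by linarith
  qed
  show ?thesis using *[of m n] *[of n m] assms by (cases "m < n") auto
qed

lemma sum_le_sqrt_card:
  fixes f :: "nat \<Rightarrow> real"
  assumes "finite F" "\<And>n. n \<in> F \<Longrightarrow> 0 < n" "\<And>n. n \<in> F \<Longrightarrow> real n \<le> Z" "Z \<ge> 0"
  shows "sum f F \<le> sqrt Z * sqrt (\<Sum>n\<in>F. (f n)\<^sup>2)"
proof -
  have "F \<subseteq> {1..nat \<lfloor>Z\<rfloor>}" using assms by (auto simp: le_nat_floor Suc_le_eq)
  then have "card F \<le> nat \<lfloor>Z\<rfloor>" using card_mono[of "{1..nat \<lfloor>Z\<rfloor>}" F] by simp
  then have c: "real (card F) \<le> Z" using assms(4) by linarith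
  have "(sum f F)\<^sup>2 \<le> (\<Sum>n\<in>F. (f n)\<^sup>2) * card F"
    using Cauchy_Schwarz_ineq_sum[of f "\<lambda>_. 1" F] by simp
  also have "\<dots> \<le> (\<Sum>n\<in>F. (f n)\<^sup>2) * Z" using c by (intro mult_left_mono) (auto intro: sum_nonneg)
  finally have "sqrt ((sum f F)\<^sup>2) \<le> sqrt ((\<Sum>n\<in>F. (f n)\<^sup>2) * Z)" by (rule real_sqrt_le_mono)
  then show ?thesis by (simp add: real_sqrt_mult mult.commute)
qed

text \<open>The diagonal part of the mean square of \<open>dpoly a\<close> on the line Re s =
  \<sigma>.\<close>

definition dnorm2 :: "(nat \<Rightarrow> complex) \<Rightarrow> real \<Rightarrow> real" where
  "dnorm2 a \<sigma> = (\<Sum>n | a n \<noteq> 0. (norm (a n))\<^sup>2 * real n powr (- 2 * \<sigma>))"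

lemma dnorm2_nonneg: "dnorm2 a \<sigma> \<ge> 0"
  unfolding dnorm2_def by (intro sum_nonneg) auto

text \<open>Expand into a double sum. The terms m = n give the diagonal; for m \<noteq> n the
  frequencies differ by at least 1 / Z, so each mean is at most exp (- (s / Z)^2 / 2) in modulus.
  The sum of the absolute coefficients is bounded by Cauchy-Schwarz, which costs sqrt Z for each
  polynomial.\<close>

lemma gmean_dpoly_inner:
  assumes s: "s > 0" and a: "fin_supp a" and b: "fin_supp b"
    and Z: "\<And>n. a n \<noteq> 0 \<Longrightarrow> real n \<le> Z" "\<And>n. b n \<noteq> 0 \<Longrightarrow> real n \<le> Z" "Z > 0"
  shows "norm (gmean \<tau> s (\<lambda>t. dpoly a (Complex \<sigma> t) * cnj (dpoly b (Complex \<sigma> t)))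
      - (\<Sum>n | a n \<noteq> 0. a n * cnj (b n) * of_real (real n powr (- 2 * \<sigma>))))
    \<le> Z * exp (- (s / Z)\<^sup>2 / 2) * sqrt (dnorm2 a \<sigma>) * sqrt (dnorm2 b \<sigma>)"
proof -
  let ?A = "{n. a n \<noteq> 0}" and ?B = "{n. b n \<noteq> 0}"
  have fin: "finite ?A" "finite ?B" and nz: "a 0 = 0" "b 0 = 0" using a b by (auto simp: fin_supp_def)
  have pos: "n > 0" if "a n \<noteq> 0 \<or> b n \<noteq> 0" for n using that nz by (auto intro!: gr0I)
  define w where "w m n = a m * cnj (b n) * of_real (real m powr - \<sigma> * real n powr - \<sigma>)" for m n
  have eq: "dpoly a (Complex \<sigma> t) * cnj (dpoly b (Complex \<sigma> t)) =
      (\<Sum>m\<in>?A. \<Sum>n\<in>?B. w m n * iexp ((ln (real n) - ln (real m)) * t))" for t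
  proof -
    have p: "of_nat n powr - Complex \<sigma> t = of_real (real n powr - \<sigma>) * iexp (- ln (real n) * t)" if "n > 0" for n :: nat
    proof -
      have "of_nat n powr - Complex \<sigma> t = exp (- Complex \<sigma> t * of_real (ln (real n)))"
        using that by (simp add: powr_def Ln_of_nat)
      also have "- Complex \<sigma> t * of_real (ln (real n)) = of_real (- \<sigma> * ln (real n)) + \<i> * of_real (- ln (real n) * t)"
        by (simp add: complex_eq_iff)
      also have "exp \<dots> = exp (of_real (- \<sigma> * ln (real n))) * iexp (- ln (real n) * t)" by (rule exp_add)
      also have "exp (of_real (- \<sigma> * ln (real n))) = complex_of_real (real n powr - \<sigma>)"
        using that unfolding exp_of_real by (simp add: powr_def)
      finally show ?thesis .
    qed
    have "dpoly a (Complex \<sigma> t) * cnj (dpoly b (Complex \<sigma> t)) =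
      (\<Sum>m\<in>?A. \<Sum>n\<in>?B. (a m * of_nat m powr - Complex \<sigma> t) * cnj (b n * of_nat n powr - Complex \<sigma> t))"
      unfolding dpoly_def by (simp add: sum_product)
    also have "\<dots> = (\<Sum>m\<in>?A. \<Sum>n\<in>?B. w m n * iexp ((ln (real n) - ln (real m)) * t))"
    proof (intro sum.cong refl)
      fix m n assume "m \<in> ?A" "n \<in> ?B"
      then have mn: "m > 0" "n > 0" using pos by auto
      have "cnj (iexp (- ln (real n) * t)) = iexp (ln (real n) * t)" by (simp add: exp_cnj)
      then have "iexp ((ln (real n) - ln (real m)) * t) = iexp (- ln (real m) * t) * cnj (iexp (- ln (real n) * t))"
        by (simp only: exp_add[symmetric]) (simp add: algebra_simps)
      then show "(a m * of_nat m powr - Complex \<sigma> t) * cnj (b n * of_nat n powr - Complex \<sigma> t) =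
          w m n * iexp ((ln (real n) - ln (real m)) * t)"
        unfolding p[OF mn(1)] p[OF mn(2)] by (simp add: w_def)
    qed
    finally show ?thesis .
  qed
  have gi: "gint \<tau> s (\<lambda>t. w m n * iexp ((ln (real n) - ln (real m)) * t))" for m n
    by (rule gint_cont_bounded[where C = "norm (w m n)"]) (use s in \<open>auto intro!: continuous_intros simp: norm_mult\<close>)
  have "gmean \<tau> s (\<lambda>t. dpoly a (Complex \<sigma> t) * cnj (dpoly b (Complex \<sigma> t))) =
      (\<Sum>m\<in>?A. \<Sum>n\<in>?B. w m n * (iexp ((ln (real n) - ln (real m)) * \<tau>) * of_real (exp (- (s * (ln (real n) - ln (real m)))\<^sup>2 / 2))))"
    unfolding eq using gi by (simp only: gmean_sum gint_sum gmean_cmult gmean_iexp[OF s])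
  also have "\<dots> = (\<Sum>m\<in>?A. \<Sum>n\<in>?B. if m = n then w m n else 0) + (\<Sum>m\<in>?A. \<Sum>n\<in>?B. if m = n then 0 else w m n * (iexp ((ln (real n) - ln (real m)) * \<tau>) * of_real (exp (- (s * (ln (real n) - ln (real m)))\<^sup>2 / 2))))"
    by (simp only: sum.distrib[symmetric]) (intro sum.cong refl, auto)
  also have "(\<Sum>m\<in>?A. \<Sum>n\<in>?B. if m = n then w m n else 0) = (\<Sum>m\<in>?A. a m * cnj (b m) * of_real (real m powr (- 2 * \<sigma>)))"
  proof (intro sum.cong refl)
    fix m assume "m \<in> ?A"
    then have m: "m > 0" using pos by auto
    have "(\<Sum>n\<in>?B. if m = n then w m n else 0) = (if m \<in> ?B then w m m else 0)"
      using fin by (simp add: sum.delta')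
    also have "\<dots> = w m m" by (simp add: w_def)
    also have "\<dots> = a m * cnj (b m) * of_real (real m powr (- 2 * \<sigma>))"
      by (simp add: w_def powr_add[symmetric])
    finally show "(\<Sum>n\<in>?B. if m = n then w m n else 0) = a m * cnj (b m) * of_real (real m powr (- 2 * \<sigma>))" .
  qed
  finally have "norm (gmean \<tau> s (\<lambda>t. dpoly a (Complex \<sigma> t) * cnj (dpoly b (Complex \<sigma> t)))
      - (\<Sum>n | a n \<noteq> 0. a n * cnj (b n) * of_real (real n powr (- 2 * \<sigma>)))) =
    norm (\<Sum>m\<in>?A. \<Sum>n\<in>?B. if m = n then 0 else w m n * (iexp ((ln (real n) - ln (real m)) * \<tau>) * of_real (exp (- (s * (ln (real n) - ln (real m)))\<^sup>2 / 2))))"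
    by simp
  also have "\<dots> \<le> (\<Sum>m\<in>?A. \<Sum>n\<in>?B. (norm (a m) * real m powr - \<sigma>) * (norm (b n) * real n powr - \<sigma>) * exp (- (s / Z)\<^sup>2 / 2))"
  proof (rule order_trans[OF norm_sum], intro sum_mono order_trans[OF norm_sum])
    fix m n assume mn: "m \<in> ?A" "n \<in> ?B"
    show "norm (if m = n then 0 else w m n * (iexp ((ln (real n) - ln (real m)) * \<tau>) * of_real (exp (- (s * (ln (real n) - ln (real m)))\<^sup>2 / 2))))
      \<le> (norm (a m) * real m powr - \<sigma>) * (norm (b n) * real n powr - \<sigma>) * exp (- (s / Z)\<^sup>2 / 2)"
    proof (cases "m = n")
      case False
      have "1 / Z \<le> \<bar>ln (real n) - ln (real m)\<bar>"
        using False mn pos Z by (intro ln_nat_diff_ge) auto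
      then have "s * (1 / Z) \<le> s * \<bar>ln (real n) - ln (real m)\<bar>" using s by (intro mult_left_mono) auto
      then have "(s / Z)\<^sup>2 \<le> (s * \<bar>ln (real n) - ln (real m)\<bar>)\<^sup>2" using s Z by (intro power_mono) auto
      then have "exp (- (s * (ln (real n) - ln (real m)))\<^sup>2 / 2) \<le> exp (- (s / Z)\<^sup>2 / 2)"
        by (simp add: power_mult_distrib)
      moreover have "norm (w m n) = (norm (a m) * real m powr - \<sigma>) * (norm (b n) * real n powr - \<sigma>)"
        by (simp add: w_def norm_mult)
      ultimately show ?thesis using False by (simp add: norm_mult mult_left_mono)
    qed (auto)
  qed
  also have "\<dots> = exp (- (s / Z)\<^sup>2 / 2) * ((\<Sum>m\<in>?A. norm (a m) * real m powr - \<sigma>) * (\<Sum>n\<in>?B. norm (b n) * real n powr - \<sigma>))"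
    unfolding sum_product sum_distrib_right[symmetric] by (rule mult.commute)
  also have "\<dots> \<le> exp (- (s / Z)\<^sup>2 / 2) * ((sqrt Z * sqrt (dnorm2 a \<sigma>)) * (sqrt Z * sqrt (dnorm2 b \<sigma>)))"
  proof -
    have "(\<Sum>m | c m \<noteq> 0. norm (c m) * real m powr - \<sigma>) \<le> sqrt Z * sqrt (dnorm2 c \<sigma>)"
      if "fin_supp c" "\<And>n. c n \<noteq> 0 \<Longrightarrow> real n \<le> Z" for c
    proof -
      have "(\<Sum>m | c m \<noteq> 0. norm (c m) * real m powr - \<sigma>) \<le> sqrt Z * sqrt (\<Sum>m | c m \<noteq> 0. (norm (c m) * real m powr - \<sigma>)\<^sup>2)"
        by (rule sum_le_sqrt_card) (use that Z in \<open>auto simp: fin_supp_def intro!: gr0I\<close>)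
      also have "(\<Sum>m | c m \<noteq> 0. (norm (c m) * real m powr - \<sigma>)\<^sup>2) = dnorm2 c \<sigma>"
        unfolding dnorm2_def by (intro sum.cong refl) (simp add: power_mult_distrib powr_add[symmetric] power2_eq_square)
      finally show ?thesis .
    qed
    from this[OF a Z(1)] this[OF b Z(2)] show ?thesis
      by (intro mult_left_mono mult_mono) (auto intro!: sum_nonneg simp: Z(3) less_imp_le dnorm2_nonneg)
  qed
  also have "\<dots> = Z * exp (- (s / Z)\<^sup>2 / 2) * sqrt (dnorm2 a \<sigma>) * sqrt (dnorm2 b \<sigma>)"
    using Z(3) by (simp add: real_sqrt_mult_self mult_ac)
  finally show ?thesis .
qed

lemma gmean_of_real: "gmean \<tau> s (\<lambda>t. complex_of_real (h t)) = of_real (gmean \<tau> s h)"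
proof -
  have "(\<lambda>t. normal_density \<tau> s t *\<^sub>R complex_of_real (h t)) = (\<lambda>t. of_real (normal_density \<tau> s t *\<^sub>R h t))"
    by (simp add: scaleR_conv_of_real)
  then show ?thesis unfolding gmean_def by (simp only: integral_complex_of_real)
qed

text \<open>The factor 2 is the diagonal plus an off-diagonal part which, by the condition on s and
  Z, is at most another copy of the diagonal.\<close>

lemma gmean_dpoly_le:
  assumes s: "s > 0" and a: "fin_supp a"
    and Z: "\<And>n. a n \<noteq> 0 \<Longrightarrow> real n \<le> Z" "Z > 0" and sZ: "Z * exp (- (s / Z)\<^sup>2 / 2) \<le> 1"
  shows "gmean \<tau> s (\<lambda>t. (norm (dpoly a (Complex \<sigma> t)))\<^sup>2) \<le> 2 * dnorm2 a \<sigma>"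
proof -
  have 1: "gmean \<tau> s (\<lambda>t. dpoly a (Complex \<sigma> t) * cnj (dpoly a (Complex \<sigma> t))) =
     of_real (gmean \<tau> s (\<lambda>t. (norm (dpoly a (Complex \<sigma> t)))\<^sup>2))"
    unfolding gmean_of_real[symmetric] by (simp add: complex_norm_square del: of_real_power)
  have 2: "(\<Sum>n | a n \<noteq> 0. a n * cnj (a n) * of_real (real n powr (- 2 * \<sigma>))) = of_real (dnorm2 a \<sigma>)"
    unfolding dnorm2_def by (simp add: complex_norm_square del: of_real_power)
  have "norm (gmean \<tau> s (\<lambda>t. (norm (dpoly a (Complex \<sigma> t)))\<^sup>2) - dnorm2 a \<sigma>)
      \<le> Z * exp (- (s / Z)\<^sup>2 / 2) * sqrt (dnorm2 a \<sigma>) * sqrt (dnorm2 a \<sigma>)"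
    using gmean_dpoly_inner[OF s a a Z(1) Z(1) Z(2), of \<tau> \<sigma>]
    unfolding 1 2 of_real_diff[symmetric] norm_of_real by simp
  also have "\<dots> = Z * exp (- (s / Z)\<^sup>2 / 2) * dnorm2 a \<sigma>" using dnorm2_nonneg by simp
  also have "\<dots> \<le> 1 * dnorm2 a \<sigma>" by (rule mult_right_mono[OF sZ dnorm2_nonneg])
  finally show ?thesis by (simp add: abs_le_iff)
qed

subsection \<open>Convexity of moments in a vertical strip\<close>

text \<open>Subharmonicity of (|G|^2 + e)^k made explicit. Near zeros of G there is no holomorphic
  branch of G^(2 k); adding e and multiplying by cnj (G z) keeps the base in the right half-plane on
  a small disc, where the principal branch \<phi> of (G w cnj (G z) + e)^(2 k) is holomorphic.
  Cauchy's formula gives the mean value of \<phi>, with |\<phi> z| = n^(2 k), and on the circle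
  |\<phi> w| is at most (|G w|^2 + e)^k n^k. Dividing by n^k gives the claim.\<close>

lemma submean_circle:
  fixes G :: "complex \<Rightarrow> complex" and e k r :: real
  assumes e: "e > 0" and k: "k > 0" and r: "r > 0"
    and hol: "G holomorphic_on ball z r" and cont: "continuous_on (cball z r) G"
    and pos: "\<And>w. w \<in> cball z r \<Longrightarrow> Re (G w * cnj (G z)) + e > 0"
  shows "((norm (G z))\<^sup>2 + e) powr k
    \<le> integral {0..1} (\<lambda>x. ((norm (G (z + of_real r * exp (2 * of_real pi * \<i> * of_real x))))\<^sup>2 + e) powr k)"
proof -
  define n where "n = (norm (G z))\<^sup>2 + e"
  have n: "n > 0" using e by (simp add: n_def add_nonneg_pos)
  define \<phi> where "\<phi> w = (G w * cnj (G z) + of_real e) powr (of_real (2 * k))" for w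
  have nonneg: "G w * cnj (G z) + of_real e \<notin> \<real>\<^sub>\<le>\<^sub>0" if "w \<in> cball z r" for w
    using pos[OF that] by (auto simp: complex_nonpos_Reals_iff simp del: mem_cball)
  have contp: "continuous_on (cball z r) \<phi>"
    unfolding \<phi>_def
  proof (intro continuous_on_powr_complex continuous_intros cont subsetI)
    fix w assume "w \<in> cball z r"
    then show "w \<in> {w. 0 \<le> Re (G w * cnj (G z) + of_real e) \<or> Im (G w * cnj (G z) + of_real e) \<noteq> 0}"
      using pos[of w] by simp
  qed (use k in auto)
  have holp: "\<phi> holomorphic_on ball z r"
    unfolding \<phi>_def using nonneg by (intro holomorphic_intros hol) auto
  let ?c = "\<lambda>x::real. z + of_real r * exp (2 * of_real pi * \<i> * of_real x)"
  have inb: "?c x \<in> cball z r" for x using r by (simp add: dist_norm norm_mult)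
  have "((\<lambda>u. \<phi> u / (u - z)) has_contour_integral (2 * of_real pi * \<i> * \<phi> z)) (circlepath z r)"
    by (rule Cauchy_integral_circlepath[OF contp holp]) (use r in simp)
  then have hc: "((\<lambda>x. \<phi> (circlepath z r x) / (circlepath z r x - z) * vector_derivative (circlepath z r) (at x within {0..1}))
      has_integral (2 * of_real pi * \<i> * \<phi> z)) {0..1}"
    by (simp add: has_contour_integral_def)
  have "\<phi> (circlepath z r x) / (circlepath z r x - z) * vector_derivative (circlepath z r) (at x within {0..1})
      = (2 * of_real pi * \<i>) * \<phi> (?c x)" if "x \<in> {0..1}" for x
  proof -
    have 1: "vector_derivative (circlepath z r) (at x within {0..1}) =
        2 * of_real pi * \<i> * of_real r * exp (2 * of_real pi * \<i> * of_real x)"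
      using that by (simp add: vector_derivative_circlepath01)
    show ?thesis unfolding 1 using r by (simp add: circlepath)
  qed
  note has_integral_eq[OF this hc]
  from has_integral_mult_right[OF this, of "1 / (2 * of_real pi * \<i>)"]
  have hi: "((\<lambda>x. \<phi> (?c x)) has_integral \<phi> z) {0..1}" by simp
  have nz: "G z * cnj (G z) + of_real e = of_real n"
    unfolding n_def by (simp add: complex_norm_square del: of_real_power)
  have phiz: "norm (\<phi> z) = n powr (2 * k)"
    using n unfolding \<phi>_def nz by (simp add: norm_powr_real_powr)
  have bnd: "norm (\<phi> w) \<le> ((norm (G w))\<^sup>2 + e) powr k * n powr k" if "w \<in> cball z r" for w
  proof -
    let ?q = "G w * cnj (G z) + of_real e"
    have "norm ?q \<le> norm (G w) * norm (G z) + e"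
      using norm_triangle_ineq[of "G w * cnj (G z)" "of_real e"] e by (simp add: norm_mult)
    then have "(norm ?q)\<^sup>2 \<le> (norm (G w) * norm (G z) + e)\<^sup>2" by (intro power_mono) auto
    \<comment> \<open>Cauchy-Schwarz for the vectors (|G w|, sqrt e) and (|G z|, sqrt e); the
      difference of the two sides is e (|G w| - |G z|)^2.\<close>
    also have "\<dots> \<le> ((norm (G w))\<^sup>2 + e) * n"
    proof -
      have "0 \<le> e * (norm (G w) - norm (G z))\<^sup>2" using e by simp
      then show ?thesis unfolding n_def by (simp add: power2_eq_square algebra_simps)
    qed
    finally have 1: "(norm ?q)\<^sup>2 \<le> ((norm (G w))\<^sup>2 + e) * n" .
    have "norm (\<phi> w) = norm ?q powr (2 * k)"
      unfolding \<phi>_def using nonneg[OF that]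
      by (subst norm_powr_real_powr') auto
    also have "\<dots> = ((norm ?q)\<^sup>2) powr k"
      using powr_powr[of "norm ?q" 2 k] by (simp add: powr_numeral)
    also have "\<dots> \<le> (((norm (G w))\<^sup>2 + e) * n) powr k"
      using 1 k by (intro powr_mono2) auto
    also have "\<dots> = ((norm (G w))\<^sup>2 + e) powr k * n powr k"
      using e n by (simp add: powr_mult)
    finally show ?thesis .
  qed
  have cc: "continuous_on {0..1} (\<lambda>x. G (?c x))"
    by (rule continuous_on_compose2[OF cont]) (use inb in \<open>auto intro!: continuous_intros\<close>)
  have ge: "(norm (G (?c x)))\<^sup>2 + e \<noteq> 0" for x
    using e by (smt (verit) zero_le_power2)
  have int2: "(\<lambda>x. ((norm (G (?c x)))\<^sup>2 + e) powr k * n powr k) integrable_on {0..1}"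
    using cc ge by (intro integrable_continuous_interval continuous_intros) auto
  have "n powr (2 * k) = norm (integral {0..1} (\<lambda>x. \<phi> (?c x)))"
    using hi phiz by (simp add: integral_unique)
  also have "\<dots> \<le> integral {0..1} (\<lambda>x. ((norm (G (?c x)))\<^sup>2 + e) powr k * n powr k)"
    by (rule integral_norm_bound_integral) (use hi int2 bnd[OF inb] in auto)
  also have "\<dots> = integral {0..1} (\<lambda>x. ((norm (G (?c x)))\<^sup>2 + e) powr k) * n powr k"
    by simp
  also have "n powr (2 * k) = n powr k * n powr k" by (simp only: mult_2 powr_add)
  finally have "n powr k * n powr k \<le> integral {0..1} (\<lambda>x. ((norm (G (?c x)))\<^sup>2 + e) powr k) * n powr k" .
  then have "n powr k \<le> integral {0..1} (\<lambda>x. ((norm (G (?c x)))\<^sup>2 + e) powr k)"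
    by (rule mult_right_le_imp_le) (use n in auto)
  then show ?thesis by (simp add: n_def)
qed

text \<open>The averages over x + r cos (2 pi t) are what a circle mean becomes after integrating
  along vertical lines. At the leftmost maximum point the sub-mean inequality forces M to equal its
  maximum on the whole projected circle, in particular further left.\<close>

lemma submean_max_principle:
  fixes M :: "real \<Rightarrow> real"
  assumes ab: "a \<le> b" and cont: "continuous_on {a..b} M"
    and sub: "\<And>x. a < x \<Longrightarrow> x < b \<Longrightarrow> \<exists>r>0. r \<le> x - a \<and> r \<le> b - x \<and>
        M x \<le> integral {0..1} (\<lambda>t. M (x + r * cos (2 * pi * t)))"
    and x: "x \<in> {a..b}"
  shows "M x \<le> max (M a) (M b)"
proof (rule ccontr)
  assume neg: "\<not> M x \<le> max (M a) (M b)"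
  obtain m where m: "m \<in> {a..b}" "\<And>y. y \<in> {a..b} \<Longrightarrow> M y \<le> M m"
    using continuous_attains_sup[of "{a..b}" M] ab cont by auto
  define A where "A = {y \<in> {a..b}. M y = M m}"
  have "closed A" unfolding A_def
    by (rule continuous_closed_preimage_constant[OF cont]) auto
  moreover have "A \<noteq> {}" "bdd_below A" using m by (auto simp: A_def bdd_below_def)
  ultimately have iA: "Inf A \<in> A" by (intro closed_contains_Inf)
  define y where "y = Inf A"
  have y: "y \<in> {a..b}" "M y = M m" using iA by (auto simp: A_def y_def)
  have "M m > max (M a) (M b)" using neg m(2)[OF x] by linarith
  then have ya: "a < y" "y < b" using y by (auto simp: less_le)
  from sub[OF ya] obtain r where r: "r > 0" "r \<le> y - a" "r \<le> b - y"
    and le: "M y \<le> integral {0..1} (\<lambda>t. M (y + r * cos (2 * pi * t)))" by blast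
  have rng: "y + r * cos (2 * pi * t) \<in> {a..b}" for t
  proof -
    have "\<bar>r * cos (2 * pi * t)\<bar> \<le> r" using r by (simp add: abs_mult mult_left_le)
    then have "r * cos (2 * pi * t) \<le> r" "- r \<le> r * cos (2 * pi * t)" by linarith+
    then show ?thesis using r(2,3) unfolding atLeastAtMost_iff by linarith
  qed
  let ?h = "\<lambda>t. M m - M (y + r * cos (2 * pi * t))"
  have conth': "continuous_on {0..1} (\<lambda>t. M (y + r * cos (2 * pi * t)))"
  proof (rule continuous_on_compose2[OF cont])
    show "continuous_on {0..1} (\<lambda>t. y + r * cos (2 * pi * t))" by (intro continuous_intros)
    show "(\<lambda>t. y + r * cos (2 * pi * t)) ` {0..1} \<subseteq> {a..b}" using rng by blast
  qed
  then have conth: "continuous_on {0..1} ?h" by (intro continuous_intros)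
  have "integral {0..1} ?h = M m - integral {0..1} (\<lambda>t. M (y + r * cos (2 * pi * t)))"
    by (subst integral_diff) (use conth' in \<open>auto intro: integrable_continuous_interval\<close>)
  then have "integral {0..1} ?h \<le> 0" using le y by simp
  moreover have "integral {0..1} ?h \<ge> 0"
    by (rule integral_nonneg) (use conth m(2)[OF rng] in \<open>auto intro: integrable_continuous_interval\<close>)
  ultimately have "integral {0..1} ?h = 0" by simp
  then have hi: "(?h has_integral 0) (cbox 0 1)"
    using integrable_integral[OF integrable_continuous_interval[OF conth]] by simp
  have "continuous_on (cbox 0 1) ?h" using conth by simp
  moreover have "box 0 1 \<noteq> ({}::real set)" "1/2 \<in> cbox 0 (1::real)" by simp_all
  \<comment> \<open>At t = 1/2 the cosine is - 1, so this is the left end y - r.\<close>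
  ultimately have "?h (1/2) = 0"
    using hi m(2)[OF rng] has_integral_0_cbox_imp_0[of 0 1 ?h "1/2"] by (metis (mono_tags, lifting) diff_ge_0_iff_ge)
  then have "M (y - r) = M m" by simp
  then have "y - r \<in> A" using r y by (simp add: A_def)
  then have "y \<le> y - r" unfolding y_def by (intro cInf_lower \<open>bdd_below A\<close>) 
  then show False using r by simp
qed


lemma powr_add_le_add_powr:
  fixes x y k :: real
  assumes "0 \<le> x" "0 \<le> y" "0 < k" "k \<le> 1"
  shows "(x + y) powr k \<le> x powr k + y powr k"
proof (cases "x + y = 0")
  case True
  then show ?thesis using assms by simp
next
  case False
  then have pos: "x + y > 0" using assms by simp
  have *: "u / (x + y) \<le> (u / (x + y)) powr k" if "0 \<le> u" "u \<le> x + y" for u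
  proof (cases "u = 0")
    case False
    have "(u / (x + y)) powr 1 \<le> (u / (x + y)) powr k"
      using that pos False assms by (intro powr_mono') (auto simp: field_simps)
    then show ?thesis using that pos False by simp
  qed simp
  have "1 = x / (x + y) + y / (x + y)" using pos by (simp add: add_divide_distrib[symmetric])
  also have "\<dots> \<le> (x / (x + y)) powr k + (y / (x + y)) powr k"
    using *[of x] *[of y] assms by simp
  also have "\<dots> = (x powr k + y powr k) / (x + y) powr k"
    using assms pos by (simp add: powr_divide add_divide_distrib)
  finally have "1 * (x + y) powr k \<le> (x powr k + y powr k) / (x + y) powr k * (x + y) powr k"
    by (intro mult_right_mono) auto
  then show ?thesis using pos by simp
qed

text \<open>Integrate \<open>submean_circle\<close> along a vertical line: the vertical component of
  the circle is a translation and disappears, leaving a one-dimensional sub-mean inequality for the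
  moment as a function of the abscissa. The regularisation e tends to 0 at the end by dominated
  convergence.\<close>

lemma strip_moment_max:
  fixes G :: "complex \<Rightarrow> complex" and a b k x :: real and w :: "real \<Rightarrow> real"
  assumes ab: "a < b" and k: "0 < k" "k \<le> 1"
    and cont: "continuous_on {s. a \<le> Re s \<and> Re s \<le> b} G"
    and hol: "G holomorphic_on {s. a < Re s \<and> Re s < b}"
    and w: "integrable lborel w"
    and bd: "\<And>s. a \<le> Re s \<Longrightarrow> Re s \<le> b \<Longrightarrow> norm (G s) powr (2 * k) \<le> w (Im s)"
    and lim: "\<And>e. e > 0 \<Longrightarrow> \<exists>R. \<forall>s. a \<le> Re s \<longrightarrow> Re s \<le> b \<longrightarrow> R \<le> \<bar>Im s\<bar> \<longrightarrow> norm (G s) < e"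
    and x: "x \<in> {a..b}"
  shows "(\<integral>t. norm (G (Complex x t)) powr (2 * k) \<partial>lborel) \<le>
    max (\<integral>t. norm (G (Complex a t)) powr (2 * k) \<partial>lborel) (\<integral>t. norm (G (Complex b t)) powr (2 * k) \<partial>lborel)"
proof -
  \<comment> \<open>Clamping the abscissa extends everything continuously beyond the strip, so
    continuity and measurability can be stated on the whole plane.\<close>
  define cl where "cl y = max a (min b y)" for y
  have cl: "a \<le> cl y" "cl y \<le> b" for y using ab by (auto simp: cl_def)
  have cl_id: "cl y = y" if "a \<le> y" "y \<le> b" for y using that by (auto simp: cl_def)
  define N where "N y t = norm (G (Complex (cl y) t))" for y t
  have N0: "N y t \<ge> 0" for y t by (simp add: N_def)
  have contN: "continuous_on UNIV (\<lambda>p. N (fst p) (snd p))"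
    unfolding N_def cl_def Complex_eq
    by (intro continuous_on_norm continuous_on_compose2[OF cont] continuous_intros) (use cl in \<open>auto simp: cl_def\<close>)
  have Nw: "N y t powr (2 * k) \<le> w t" for y t
    using bd[of "Complex (cl y) t"] cl by (simp add: N_def)
  \<comment> \<open>Subtracting the constant e^k makes the regularised moment integrable over the
    whole line; subadditivity of the k-th power, k <= 1, keeps it below |G|^(2 k).\<close>
  define v where "v e y t = ((N y t)\<^sup>2 + e) powr k - e powr k" for e y t
  have v0: "0 \<le> v e y t" if "e > 0" for e y t
    unfolding v_def using that k by (simp add: powr_mono2)
  have vN: "v e y t \<le> N y t powr (2 * k)" if "e > 0" for e y t
  proof -
    have "((N y t)\<^sup>2 + e) powr k \<le> ((N y t)\<^sup>2) powr k + e powr k"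
      using that k by (intro powr_add_le_add_powr) auto
    also have "((N y t)\<^sup>2) powr k = N y t powr (2 * k)"
      using powr_powr[of "N y t" 2 k] N0[of y t] by (simp add: powr_numeral)
    finally show ?thesis by (simp add: v_def)
  qed
  have vw: "v e y t \<le> w t" if "e > 0" for e y t
    using vN[OF that, of y t] Nw[of y t] by simp
  have contv: "continuous_on UNIV (\<lambda>p. v e (fst p) (snd p))" if "e > 0" for e
  proof -
    have "(N y t)\<^sup>2 + e \<noteq> 0" for y t using that by (smt (verit) zero_le_power2)
    then show ?thesis unfolding v_def by (intro continuous_intros contN) auto
  qed
  have contv2: "continuous_on S (\<lambda>p. v e (p1 p) (p2 p))"
    if "e > 0" "continuous_on S p1" "continuous_on S p2" for e S and p1 p2 :: "'z::topological_space \<Rightarrow> real"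
    by (rule continuous_on_compose2[OF contv[OF that(1)] continuous_on_Pair[OF that(2,3)], simplified])
  have contN2: "continuous_on UNIV (\<lambda>t. N y t)" for y
    using continuous_on_compose2[OF contN continuous_on_Pair[OF continuous_on_const[of _ y] continuous_on_id]] by simp
  have measN: "(\<lambda>t. N y t powr (2 * k)) \<in> borel_measurable lborel" for y
    using borel_measurable_continuous_onI[OF contN2[of y]] by simp
  have measv: "v e y \<in> borel_measurable lborel" if "e > 0" for e y
    using borel_measurable_continuous_onI[OF contv2[OF that continuous_on_const[of _ y] continuous_on_id]] by simp
  have intN: "integrable lborel (\<lambda>t. N y t powr (2 * k))" for y
    by (rule Bochner_Integration.integrable_bound[OF w measN]) (use Nw in \<open>auto intro!: AE_I2 intro: order_trans[OF _ abs_ge_self]\<close>)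
  have intv: "integrable lborel (v e y)" if "e > 0" for e y
    by (rule Bochner_Integration.integrable_bound[OF w measv[OF that]])
      (use v0[OF that] vw[OF that] in \<open>auto intro!: AE_I2 intro: order_trans[OF _ abs_ge_self]\<close>)
  define M where "M e y = (\<integral>t. v e y t \<partial>lborel)" for e y
  define M0 where "M0 y = (\<integral>t. N y t powr (2 * k) \<partial>lborel)" for y
  have contM: "continuous_on UNIV (M e)" if e: "e > 0" for e
  proof (unfold continuous_on_sequentially, intro ballI allI impI, elim conjE)
    fix X :: "nat \<Rightarrow> real" and y assume X: "X \<longlonglongrightarrow> y"
    show "(M e \<circ> X) \<longlonglongrightarrow> M e y"
      unfolding M_def comp_def
    proof (rule integral_dominated_convergence[where w = w])
      show "AE t in lborel. (\<lambda>i. v e (X i) t) \<longlonglongrightarrow> v e y t"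
      proof (rule AE_I2)
        fix t
        have "continuous_on UNIV (\<lambda>y. v e y t)"
          by (rule contv2[OF e continuous_on_id continuous_on_const])
        then have "isCont (\<lambda>y. v e y t) y" by (simp add: continuous_on_eq_continuous_at)
        then show "(\<lambda>i. v e (X i) t) \<longlonglongrightarrow> v e y t" using X by (rule isCont_tendsto_compose)
      qed
    qed (use w measv[OF e] v0[OF e] vw[OF e] in auto)
  qed
  have contM2: "continuous_on S (\<lambda>p. M e (p1 p))" if "e > 0" "continuous_on S p1" for e S and p1 :: "real \<Rightarrow> real"
    by (rule continuous_on_compose2[OF contM[OF that(1)] that(2)]) simp
  have sub: "\<exists>r>0. r \<le> y - a \<and> r \<le> b - y \<and> M e y \<le> integral {0..1} (\<lambda>t. M e (y + r * cos (2 * pi * t)))"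
    if e: "e > 0" and y: "a < y" "y < b" for e y
  proof -
    \<comment> \<open>A radius that works for all points of the line at once: below height R + 1 by
      uniform continuity on a compact rectangle, and above height R because |G|^2 < e there.\<close>
    obtain R where R: "\<And>s. a \<le> Re s \<Longrightarrow> Re s \<le> b \<Longrightarrow> R \<le> \<bar>Im s\<bar> \<Longrightarrow> norm (G s) < sqrt e"
      using lim[of "sqrt e"] e by auto
    define K where "K = cbox (Complex a (- R - 1)) (Complex b (R + 1))"
    have memK: "s \<in> K \<longleftrightarrow> a \<le> Re s \<and> Re s \<le> b \<and> \<bar>Im s\<bar> \<le> R + 1" for s
      by (auto simp: K_def in_cbox_complex_iff)
    have "uniformly_continuous_on K G"
      by (rule compact_uniformly_continuous[OF continuous_on_subset[OF cont]]) (auto simp: memK, auto simp: K_def)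
    then obtain d where d: "d > 0" "\<And>s s'. s \<in> K \<Longrightarrow> s' \<in> K \<Longrightarrow> dist s' s < d \<Longrightarrow> dist (G s') (G s) < sqrt e"
      using uniformly_continuous_onE[of K G "sqrt e"] e by (auto simp: dist_commute)
    define r where "r = min (min (d / 2) 1) (min (y - a) (b - y) / 2)"
    have r: "r > 0" "r < d" "r \<le> 1" "r < y - a" "r < b - y" using d y by (auto simp: r_def min_def)
    have pos: "Re (G s * cnj (G z)) + e > 0" if z: "Re z = y" and s: "s \<in> cball z r" for s z
    proof -
      have ds: "dist s z \<le> r" using s by (simp add: dist_commute)
      have "\<bar>Re s - y\<bar> \<le> r" using abs_Re_le_cmod[of "s - z"] ds z by (simp add: dist_norm)
      then have Res: "a \<le> Re s" "Re s \<le> b" using r by auto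
      have Ims: "\<bar>Im s - Im z\<bar> \<le> 1" using abs_Im_le_cmod[of "s - z"] ds r by (simp add: dist_norm)
      have *: "- (norm A * norm B) \<le> Re (A * cnj B)" for A B
        using abs_Re_le_cmod[of "A * cnj B"] by (simp add: norm_mult)
      \<comment> \<open>Both heights differ by at most 1, so if one point leaves \<open>K\<close>
        then both lie above R.\<close>
      consider "s \<in> K" "z \<in> K" | "R \<le> \<bar>Im s\<bar>" "R \<le> \<bar>Im z\<bar>"
        using Ims Res z y unfolding memK by linarith
      then show ?thesis
      proof cases
        case 1
        then have lt: "norm (G s - G z) < sqrt e" using d(2)[of z s] ds r by (simp add: dist_norm)
        have "G s * cnj (G z) = (G s - G z) * cnj (G z) + of_real ((norm (G z))\<^sup>2)"
          by (simp add: complex_norm_square algebra_simps del: of_real_power)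
        then have "Re (G s * cnj (G z)) = Re ((G s - G z) * cnj (G z)) + (norm (G z))\<^sup>2"
          by (metis Re_complex_of_real plus_complex.sel(1))
        moreover have "- (norm (G s - G z) * norm (G z)) \<le> Re ((G s - G z) * cnj (G z))" by (rule *)
        moreover have "norm (G s - G z) * norm (G z) \<le> sqrt e * norm (G z)"
          using lt by (intro mult_right_mono) auto
        moreover have "sqrt e * norm (G z) < (norm (G z))\<^sup>2 + e"
        proof -
          have "0 \<le> (norm (G z) - sqrt e / 2)\<^sup>2" by simp
          then have "sqrt e * norm (G z) \<le> (norm (G z))\<^sup>2 + e / 4"
            using e by (simp add: power2_eq_square algebra_simps)
          then show ?thesis using e by simp
        qed
        ultimately show ?thesis by linarith
      next
        case 2
        have "norm (G s) * norm (G z) < sqrt e * sqrt e"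
          using R[of s] R[of z] 2 Res z y by (intro mult_strict_mono') auto
        then show ?thesis using *[of "G s" "G z"] e by simp
      qed
    qed
    let ?f = "\<lambda>q t. indicator {0..1::real} q * v e (y + r * cos (2 * pi * q)) (t + r * sin (2 * pi * q))"
    have pt: "v e y t \<le> (\<integral>q. ?f q t \<partial>lborel)" for t
    proof -
      let ?z = "Complex y t"
      have Rb: "\<bar>Re s - y\<bar> \<le> r" if "dist s ?z \<le> r" for s
      proof -
        have "\<bar>Re (s - ?z)\<bar> \<le> norm (s - ?z)" by (rule abs_Re_le_cmod)
        then show ?thesis using that unfolding dist_norm by simp
      qed
      have inb: "a < Re s" "Re s < b" if "dist s ?z \<le> r" for s
        using Rb[OF that] r(4,5) by linarith+
      have zz: "?z + of_real r * exp (2 * of_real pi * \<i> * of_real q) =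
          Complex (y + r * cos (2 * pi * q)) (t + r * sin (2 * pi * q))" for q
        by (rule complex_eqI) (auto simp: Re_exp Im_exp)
      have rng: "cl (y + r * cos (2 * pi * q)) = y + r * cos (2 * pi * q)" for q
      proof -
        have "\<bar>r * cos (2 * pi * q)\<bar> \<le> r" using r by (simp add: abs_mult mult_left_le)
        then have "r * cos (2 * pi * q) \<le> r" "- r \<le> r * cos (2 * pi * q)" by linarith+
        then show ?thesis using r by (intro cl_id) linarith+
      qed
      have "G holomorphic_on ball ?z r"
        by (rule holomorphic_on_subset[OF hol]) (use inb in \<open>auto simp: dist_commute less_imp_le\<close>)
      moreover have "continuous_on (cball ?z r) G"
        by (rule continuous_on_subset[OF cont]) (use inb in \<open>auto simp: dist_commute less_imp_le\<close>)
      ultimately have "((norm (G ?z))\<^sup>2 + e) powr k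
        \<le> integral {0..1} (\<lambda>q. ((norm (G (?z + of_real r * exp (2 * of_real pi * \<i> * of_real q))))\<^sup>2 + e) powr k)"
        by (intro submean_circle[OF e k(1) r(1)] pos) auto
      also have "\<dots> = integral {0..1} (\<lambda>q. v e (y + r * cos (2 * pi * q)) (t + r * sin (2 * pi * q)) + e powr k)"
        by (simp only: zz v_def N_def rng diff_add_cancel)
      also have "\<dots> = integral {0..1} (\<lambda>q. v e (y + r * cos (2 * pi * q)) (t + r * sin (2 * pi * q))) + e powr k"
      proof (subst integral_add)
        show "(\<lambda>q. v e (y + r * cos (2 * pi * q)) (t + r * sin (2 * pi * q))) integrable_on {0..1}"
          by (intro integrable_continuous_interval contv2[OF e] continuous_intros)
      qed (auto intro: integrable_continuous_interval)
      finally have "v e y t \<le> integral {0..1} (\<lambda>q. v e (y + r * cos (2 * pi * q)) (t + r * sin (2 * pi * q)))"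
        using y unfolding v_def N_def by (simp add: cl_id)
      also have "\<dots> = (LINT q:{0..1}|lborel. v e (y + r * cos (2 * pi * q)) (t + r * sin (2 * pi * q)))"
        by (rule set_borel_integral_eq_integral(2)[symmetric], rule borel_integrable_atLeastAtMost')
          (intro contv2[OF e] continuous_intros)
      also have "\<dots> = (\<integral>q. ?f q t \<partial>lborel)" by (simp add: set_lebesgue_integral_def)
      finally show ?thesis .
    qed
    have meas: "case_prod ?f \<in> borel_measurable (lborel \<Otimes>\<^sub>M lborel)"
    proof -
      have "continuous_on UNIV (\<lambda>p. v e (y + r * cos (2 * pi * fst p)) (snd p + r * sin (2 * pi * fst p)))"
        by (intro contv2[OF e] continuous_intros)
      then have [measurable]: "(\<lambda>p. v e (y + r * cos (2 * pi * fst p)) (snd p + r * sin (2 * pi * fst p))) \<in> borel_measurable (borel \<Otimes>\<^sub>M borel)"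
        by (simp add: borel_measurable_continuous_onI borel_prod)
      show ?thesis by (simp add: case_prod_beta' cong: measurable_cong_sets)
    qed
    have transl: "(\<integral>t. v e u (t + c) \<partial>lborel) = M e u" for u c
      unfolding M_def using lborel_integral_real_affine[of 1 "v e u" c] by (simp add: add.commute)
    have transi: "integrable lborel (\<lambda>t. v e u (t + c))" for u c
      using lborel_integrable_real_affine[OF intv[OF e], of 1 u c] by (simp add: add.commute)
    have intM: "integrable lborel (\<lambda>q. indicator {0..1} q * M e (y + r * cos (2 * pi * q)))"
    proof -
      have "set_integrable lborel {0..1} (\<lambda>q. M e (y + r * cos (2 * pi * q)))"
        by (rule borel_integrable_atLeastAtMost') (intro contM2[OF e] continuous_intros)
      then show ?thesis by (simp add: set_integrable_def)
    qed
    have inp: "integrable (lborel \<Otimes>\<^sub>M lborel) (case_prod ?f)"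
    proof (rule lborel_pair.Fubini_integrable[OF meas])
      have "(\<integral>t. norm (case_prod ?f (q, t)) \<partial>lborel) = indicator {0..1} q * M e (y + r * cos (2 * pi * q))" for q
        using v0[OF e] transl by (simp add: abs_mult indicator_def)
      then show "integrable lborel (\<lambda>q. \<integral>t. norm (case_prod ?f (q, t)) \<partial>lborel)" using intM by simp
    qed (use transi in auto)
    have "M e y \<le> (\<integral>t. \<integral>q. ?f q t \<partial>lborel \<partial>lborel)"
      unfolding M_def by (rule integral_mono[OF intv[OF e] lborel_pair.integrable_snd[OF inp] pt])
    also have "\<dots> = (\<integral>q. \<integral>t. ?f q t \<partial>lborel \<partial>lborel)"
      by (rule lborel_pair.Fubini_integral[OF inp])
    also have "\<dots> = (\<integral>q. indicator {0..1} q * M e (y + r * cos (2 * pi * q)) \<partial>lborel)"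
      by (simp add: transl)
    also have "\<dots> = (LINT q:{0..1}|lborel. M e (y + r * cos (2 * pi * q)))"
      by (simp add: set_lebesgue_integral_def)
    also have "\<dots> = integral {0..1} (\<lambda>q. M e (y + r * cos (2 * pi * q)))"
      by (rule set_borel_integral_eq_integral(2), rule borel_integrable_atLeastAtMost')
        (intro contM2[OF e] continuous_intros)
    finally show ?thesis using r by (intro exI[of _ r]) auto
  qed
  have le: "M e x \<le> max (M0 a) (M0 b)" if e: "e > 0" for e
  proof -
    have "M e x \<le> max (M e a) (M e b)"
      by (rule submean_max_principle[OF _ continuous_on_subset[OF contM[OF e]] sub[OF e] x]) (use ab in auto)
    also have "\<dots> \<le> max (M0 a) (M0 b)"
      unfolding M_def M0_def by (intro max.mono integral_mono intv intN vN e)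
    finally show ?thesis .
  qed
  have "(\<lambda>n. M (1 / real (Suc n)) x) \<longlonglongrightarrow> M0 x"
    unfolding M_def M0_def
  proof (rule integral_dominated_convergence[where w = w])
    show "AE t in lborel. (\<lambda>i. v (1 / real (Suc i)) x t) \<longlonglongrightarrow> N x t powr (2 * k)"
    proof (rule AE_I2)
      fix t
      have l: "(\<lambda>i. 1 / real (Suc i)) \<longlonglongrightarrow> 0" by (rule LIMSEQ_Suc[OF lim_1_over_n])
      have "(\<lambda>i. v (1 / real (Suc i)) x t) \<longlonglongrightarrow> ((N x t)\<^sup>2 + 0) powr k - 0 powr k"
        unfolding v_def
        by (intro tendsto_intros tendsto_powr2 l eventuallyI) (use k in auto)
      then show "(\<lambda>i. v (1 / real (Suc i)) x t) \<longlonglongrightarrow> N x t powr (2 * k)"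
        using powr_powr[of "N x t" 2 k] N0[of x t] k by (simp add: powr_numeral)
    qed
  qed (use w measN measv v0 vw in auto)
  then have "M0 x \<le> max (M0 a) (M0 b)"
    by (rule LIMSEQ_le_const2) (use le in auto)
  then show ?thesis using x ab unfolding M0_def N_def by (simp add: cl_id)
qed

subsection \<open>A smooth cutoff in terms of additive characters\<close>

lemma sin_ge_third:
  assumes "0 \<le> x" "x \<le> pi / 2"
  shows "x / 3 \<le> sin x"
proof -
  have x2: "x \<le> 2" using assms pi_half_less_two by linarith
  have "\<bar>sin x - (\<Sum>m<3. sin_coeff m * x ^ m)\<bar> \<le> inverse (fact 3) * \<bar>x\<bar> ^ 3" by (rule Maclaurin_sin_bound)
  moreover have "(\<Sum>m<3. sin_coeff m * x ^ m) = x" by (simp add: sin_coeff_def numeral_3_eq_3)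
  moreover have "inverse (fact 3) * \<bar>x\<bar> ^ 3 = x * x\<^sup>2 / 6"
    using assms by (simp add: fact_numeral power3_eq_cube power2_eq_square)
  ultimately have "\<bar>sin x - x\<bar> \<le> x * x\<^sup>2 / 6" by simp
  then have "x - x * x\<^sup>2 / 6 \<le> sin x" by linarith
  moreover have "x * x\<^sup>2 \<le> x * 4" using assms x2 power_mono[of x 2 2] by (intro mult_left_mono) auto
  ultimately show ?thesis by simp
qed

lemma norm_cis_minus_one: "norm (cis \<phi> - 1) = 2 * \<bar>sin (\<phi> / 2)\<bar>"
proof -
  have "(norm (cis \<phi> - 1))\<^sup>2 = (cos \<phi> - 1)\<^sup>2 + (sin \<phi>)\<^sup>2" by (simp add: cmod_power2)
  also have "\<dots> = 2 - 2 * cos \<phi>" using sin_cos_squared_add[of \<phi>] by (simp add: power2_eq_square algebra_simps)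
  also have "cos \<phi> = 1 - 2 * (sin (\<phi> / 2))\<^sup>2" using cos_double_sin[of "\<phi> / 2"] by simp
  finally have "(norm (cis \<phi> - 1))\<^sup>2 = (2 * \<bar>sin (\<phi> / 2)\<bar>)\<^sup>2" by (simp add: power_mult_distrib)
  then show ?thesis by (rule power2_eq_imp_eq) auto
qed

lemma norm_cis_minus_one_le: "norm (cis \<phi> - 1) \<le> \<bar>\<phi>\<bar>"
  unfolding norm_cis_minus_one using abs_sin_x_le_abs_x[of "\<phi> / 2"] by simp

lemma norm_cis_minus_one_ge: 
  assumes "\<bar>\<phi>\<bar> \<le> pi" shows "norm (cis \<phi> - 1) \<ge> \<bar>\<phi>\<bar> / 3"
proof -
  have "\<bar>\<phi>\<bar> / 2 / 3 \<le> sin (\<bar>\<phi>\<bar> / 2)" by (rule sin_ge_third) (use assms in auto)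
  also have "\<dots> \<le> \<bar>sin (\<phi> / 2)\<bar>" by (cases "\<phi> \<ge> 0") (auto simp: abs_if)
  finally show ?thesis unfolding norm_cis_minus_one by simp
qed

text \<open>Multiplicative in the argument z; composed with an additive function such as
  \<open>hh\<close> it becomes a unimodular completely multiplicative function.\<close>

definition addchar :: "nat \<Rightarrow> int \<Rightarrow> nat \<Rightarrow> complex" where
  "addchar Q k z = cis (2 * pi * of_int k * real z / real Q)"

lemma addchar_add: "addchar Q k (y + z) = addchar Q k y * addchar Q k z"
  by (simp add: addchar_def cis_mult ring_distribs add_divide_distrib)

lemma norm_addchar [simp]: "norm (addchar Q k z) = 1"
  by (simp add: addchar_def)

lemma addchar_power: "addchar Q k z = (cis (2 * pi * of_int k / real Q)) ^ z"
  by (simp add: addchar_def Complex.DeMoivre mult_ac)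

lemma norm_addchar_minus_one: "norm (addchar Q k z - 1) \<le> 2 * pi * \<bar>of_int k\<bar> * real z / real Q"
  unfolding addchar_def by (rule order_trans[OF norm_cis_minus_one_le]) (simp add: abs_mult)

text \<open>Orthogonality of characters. The symmetric residue system - Y..Y is used so that decay
  of coefficients can be measured in |k|.\<close>

lemma sum_cis_symmetric:
  fixes Y :: nat and x :: int
  defines "Q \<equiv> 2 * Y + 1"
  shows "(\<Sum>k\<in>{- int Y..int Y}. cis (2 * pi * of_int k * of_int x / real Q)) =
    (if int Q dvd x then of_nat Q else 0)"
proof -
  define \<zeta> where "\<zeta> = cis (2 * pi * of_int x / real Q)"
  have Q: "Q > 0" by (simp add: Q_def)
  have "(\<Sum>k\<in>{- int Y..int Y}. cis (2 * pi * of_int k * of_int x / real Q)) =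
      (\<Sum>j<Q. cis (2 * pi * (real j - real Y) * of_int x / real Q))"
    by (rule sum.reindex_bij_witness[where i = "\<lambda>j. int j - int Y" and j = "\<lambda>k. nat (k + int Y)"]) (auto simp: Q_def)
  also have "\<dots> = (\<Sum>j<Q. cis (- 2 * pi * real Y * of_int x / real Q) * \<zeta> ^ j)"
    unfolding \<zeta>_def Complex.DeMoivre cis_mult
    by (intro sum.cong refl arg_cong[where f = cis]) (use Q in \<open>simp add: field_simps\<close>)
  also have "\<dots> = cis (- 2 * pi * real Y * of_int x / real Q) * (\<Sum>j<Q. \<zeta> ^ j)"
    by (simp add: sum_distrib_left)
  finally have eq: "(\<Sum>k\<in>{- int Y..int Y}. cis (2 * pi * of_int k * of_int x / real Q)) =
     cis (- 2 * pi * real Y * of_int x / real Q) * (\<Sum>j<Q. \<zeta> ^ j)" .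
  show ?thesis
  proof (cases "int Q dvd x")
    case True
    then obtain c where c: "x = int Q * c" by (elim dvdE)
    have "\<zeta> = cis (2 * pi * of_int c)" using Q by (simp add: \<zeta>_def c mult_ac)
    then have z: "\<zeta> = 1" by (simp add: complex_eq_iff)
    have "cis (- 2 * pi * real Y * of_int x / real Q) = cis (2 * pi * of_int (- int Y * c))"
      using Q by (simp add: c mult_ac)
    also have "\<dots> = 1" by (simp only: complex_eq_iff cis.sel cos_int_2pin sin_int_2pin) simp
    finally show ?thesis using eq True z by simp
  next
    case False
    have "\<zeta> \<noteq> 1"
    proof
      assume "\<zeta> = 1"
      then have "cos (2 * pi * of_int x / real Q) = 1" by (simp add: \<zeta>_def complex_eq_iff)
      then obtain c :: int where "2 * pi * of_int x / real Q = c * 2 * pi" by (auto simp: cos_one_2pi_int)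
      then have "of_int x = (of_int (int Q * c) :: real)" using Q by (simp add: field_simps)
      then have "x = int Q * c" by (simp only: of_int_eq_iff)
      then show False using False by simp
    qed
    moreover have "\<zeta> ^ Q = 1"
    proof -
      have "\<zeta> ^ Q = cis (2 * pi * of_int x)" using Q by (simp add: \<zeta>_def Complex.DeMoivre)
      then show ?thesis by (simp add: complex_eq_iff)
    qed
    ultimately have "(\<Sum>j<Q. \<zeta> ^ j) = 0" by (simp add: geometric_sum)
    then show ?thesis using eq False by simp
  qed
qed

text \<open>The indicator of z < 2 m K is averaged m times over windows of K consecutive integers.
  Each averaging multiplies the k-th Fourier coefficient by a factor of size m / |k|, whence the
  m-fold decay. The windows move a point by at most m (K - 1), so the values 1 on [0, m K] and 0 on
  [2 m K, 3 m K] survive, and the modulus 4 m K + 1 is large enough to exclude wrap-around.\<close>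

lemma smooth_cutoff_coefficients:
  fixes m K :: nat
  assumes m: "m \<ge> 1" and K: "K \<ge> 1"
  defines "Y \<equiv> 2 * m * K" and "Q \<equiv> 4 * m * K + 1"
  obtains c :: "int \<Rightarrow> complex" where
    "\<And>z. z \<le> m * K \<Longrightarrow> (\<Sum>k\<in>{- int Y..int Y}. c k * addchar Q k z) = 1"
    "\<And>z. 2 * m * K \<le> z \<Longrightarrow> z \<le> 3 * m * K \<Longrightarrow> (\<Sum>k\<in>{- int Y..int Y}. c k * addchar Q k z) = 0"
    "\<And>k. norm (c k) \<le> 1"
    "\<And>k. k \<noteq> 0 \<Longrightarrow> \<bar>k\<bar> \<le> int Y \<Longrightarrow> norm (c k) \<le> (5 * real m / of_int \<bar>k\<bar>) ^ m"
proof -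
  have Q: "Q > 0" "Q = 2 * Y + 1" by (auto simp: Q_def Y_def)
  have sc: "(\<Sum>k\<in>{- int Y..int Y}. cis (2 * pi * of_int k * of_int x / real Q)) = (if int Q dvd x then of_nat Q else 0)" for x
    using sum_cis_symmetric[of x Y] unfolding Q(2)[symmetric] .
  \<comment> \<open>Fourier coefficients of the indicator, followed by the multiplier of one
    averaging step and the function after j steps.\<close>
  define c0 where "c0 k = (1 / of_nat Q) * (\<Sum>y<2*m*K. cnj (addchar Q k y))" for k
  define av where "av k = (1 / of_nat K) * (\<Sum>u<K. addchar Q k u)" for k
  define W where "W j z = (\<Sum>k\<in>{- int Y..int Y}. (c0 k * av k ^ j) * addchar Q k z)" for j z
  have W0: "W 0 z = (if z < 2 * m * K then 1 else 0)" if "z \<le> 4 * m * K" for z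
  proof -
    have "W 0 z = (\<Sum>k\<in>{- int Y..int Y}. \<Sum>y<2*m*K. (1 / of_nat Q) * (cnj (addchar Q k y) * addchar Q k z))"
      unfolding W_def c0_def by (simp add: sum_distrib_left sum_distrib_right mult_ac)
    also have "\<dots> = (\<Sum>y<2*m*K. \<Sum>k\<in>{- int Y..int Y}. (1 / of_nat Q) * (cnj (addchar Q k y) * addchar Q k z))"
      by (rule sum.swap)
    also have "\<dots> = (\<Sum>y<2*m*K. if z = y then 1 else 0)"
    proof (intro sum.cong refl)
      fix y assume y: "y \<in> {..<2*m*K}"
      have "cnj (addchar Q k y) * addchar Q k z = cis (2 * pi * of_int k * of_int (int z - int y) / real Q)" for k
        unfolding addchar_def cis_cnj cis_mult by (rule arg_cong[where f = cis]) (use Q(1) in \<open>simp add: field_simps\<close>)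
      then have "(\<Sum>k\<in>{- int Y..int Y}. (1 / of_nat Q) * (cnj (addchar Q k y) * addchar Q k z)) =
          (1 / of_nat Q) * (\<Sum>k\<in>{- int Y..int Y}. cis (2 * pi * of_int k * of_int (int z - int y) / real Q))"
        by (simp only: sum_distrib_left)
      also have "\<dots> = (1 / of_nat Q) * (if int Q dvd int z - int y then of_nat Q else 0)"
        unfolding sc ..
      also have "int Q dvd int z - int y \<longleftrightarrow> z = y"
      proof
        assume "int Q dvd int z - int y"
        moreover have "z < Q" "y < Q" using that y by (auto simp: Q_def)
        then have "\<bar>int z - int y\<bar> < int Q" by linarith
        ultimately have "int z - int y = 0" using dvd_imp_le_int[of "int z - int y" "int Q"] by linarith
        then show "z = y" by simp
      qed simp
      finally show "(\<Sum>k\<in>{- int Y..int Y}. (1 / of_nat Q) * (cnj (addchar Q k y) * addchar Q k z)) = (if z = y then 1 else 0)"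
        using Q(1) by simp
    qed
    also have "\<dots> = (if z < 2 * m * K then 1 else 0)" by (simp add: sum.delta)
    finally show ?thesis .
  qed
  have Wstep: "W (Suc j) z = (1 / of_nat K) * (\<Sum>u<K. W j (z + u))" for j z
  proof -
    have "(1 / of_nat K) * (\<Sum>u<K. W j (z + u)) =
        (\<Sum>u<K. \<Sum>k\<in>{- int Y..int Y}. (c0 k * av k ^ j) * addchar Q k z * ((1 / of_nat K) * addchar Q k u))"
      unfolding W_def addchar_add by (simp add: sum_distrib_left mult_ac)
    also have "\<dots> = (\<Sum>k\<in>{- int Y..int Y}. \<Sum>u<K. (c0 k * av k ^ j) * addchar Q k z * ((1 / of_nat K) * addchar Q k u))"
      by (rule sum.swap)
    also have "\<dots> = (\<Sum>k\<in>{- int Y..int Y}. (c0 k * av k ^ j) * addchar Q k z * av k)"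
      unfolding av_def by (simp only: sum_distrib_left)
    also have "\<dots> = W (Suc j) z" unfolding W_def by (simp add: mult_ac)
    finally show ?thesis ..
  qed
  have W1: "W j z = 1" if "z + j * (K - 1) < 2 * m * K" for j z
    using that
  proof (induction j arbitrary: z)
    case 0
    then show ?case by (subst W0) auto
  next
    case (Suc j)
    have "W j (z + u) = 1" if "u < K" for u using Suc.prems that by (intro Suc.IH) auto
    then have "(\<Sum>u<K. W j (z + u)) = (\<Sum>u<K. 1)" by (intro sum.cong) auto
    then show ?case using K by (simp add: Wstep)
  qed
  have W2: "W j z = 0" if "2 * m * K \<le> z" "z + j * (K - 1) \<le> 4 * m * K" for j z
    using that
  proof (induction j arbitrary: z)
    case 0
    then show ?case by (subst W0) auto
  next
    case (Suc j)
    have "W j (z + u) = 0" if "u < K" for u using Suc.prems that by (intro Suc.IH) auto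
    then have "(\<Sum>u<K. W j (z + u)) = (\<Sum>u<K. 0)" by (intro sum.cong) auto
    then show ?case by (simp add: Wstep)
  qed
  have c0_le: "norm (c0 k) \<le> 1" for k
  proof -
    have "norm (\<Sum>y<2*m*K. cnj (addchar Q k y)) \<le> (\<Sum>y<2*m*K. 1)"
      by (rule order_trans[OF norm_sum]) simp
    also have "\<dots> \<le> real Q" by (simp add: Q_def)
    finally show ?thesis using Q(1) by (simp add: c0_def norm_mult norm_divide field_simps)
  qed
  have av_le: "norm (av k) \<le> 1" for k
  proof -
    have "norm (\<Sum>u<K. addchar Q k u) \<le> (\<Sum>u<K. 1)"
      by (rule order_trans[OF norm_sum]) simp
    then show ?thesis using K by (simp add: av_def norm_mult norm_divide field_simps)
  qed
  \<comment> \<open>A geometric sum: the numerator is at most 2 and |cis \<phi> - 1| >= 2 |k| / Q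
    since |k| <= Q / 2 keeps \<phi> in [- pi, pi]. Finally Q <= 5 m K.\<close>
  have av_le': "norm (av k) \<le> 5 * real m / of_int \<bar>k\<bar>" if k: "k \<noteq> 0" "\<bar>k\<bar> \<le> int Y" for k
  proof -
    define \<phi> where "\<phi> = 2 * pi * of_int k / real Q"
    have kY: "\<bar>real_of_int k\<bar> \<le> real Y" using k(2) by linarith
    have absphi: "\<bar>\<phi>\<bar> = 2 * pi * \<bar>of_int k\<bar> / real Q" by (simp add: \<phi>_def abs_mult)
    have "2 * \<bar>of_int k\<bar> \<le> real Q" using kY Q(2) by linarith
    then have "pi * (2 * \<bar>of_int k\<bar>) \<le> pi * real Q" by (intro mult_left_mono) auto
    then have "2 * pi * \<bar>of_int k\<bar> \<le> pi * real Q" by (simp only: mult_ac)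
    then have "\<bar>\<phi>\<bar> \<le> pi" unfolding absphi using Q by (simp add: field_simps)
    then have "norm (cis \<phi> - 1) \<ge> \<bar>\<phi>\<bar> / 3" by (rule norm_cis_minus_one_ge)
    moreover have "\<bar>\<phi>\<bar> / 3 \<ge> 2 * \<bar>of_int k\<bar> / real Q"
    proof -
      have "3 * \<bar>of_int k\<bar> \<le> pi * \<bar>of_int k\<bar>" using pi_gt3 by (intro mult_right_mono) auto
      then have "2 * (3 * \<bar>of_int k\<bar>) / real Q / 3 \<le> 2 * (pi * \<bar>of_int k\<bar>) / real Q / 3"
        by (intro divide_right_mono mult_left_mono) auto
      then show ?thesis unfolding absphi by (simp add: mult_ac)
    qed
    ultimately have lb: "norm (cis \<phi> - 1) \<ge> 2 * \<bar>of_int k\<bar> / real Q" by linarith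
    have pos: "2 * \<bar>of_int k\<bar> / real Q > 0" using k Q by simp
    then have ne: "cis \<phi> \<noteq> 1" using lb by auto
    have "(\<Sum>u<K. addchar Q k u) = (cis \<phi> ^ K - 1) / (cis \<phi> - 1)"
      unfolding addchar_power \<phi>_def[symmetric] by (rule geometric_sum[OF ne])
    then have "norm (\<Sum>u<K. addchar Q k u) = norm (cis \<phi> ^ K - 1) / norm (cis \<phi> - 1)" by (simp add: norm_divide)
    also have "\<dots> \<le> 2 / (2 * \<bar>of_int k\<bar> / real Q)"
    proof (rule frac_le)
      show "norm (cis \<phi> ^ K - 1) \<le> 2"
        by (rule order_trans[OF norm_triangle_ineq4]) (simp add: norm_power)
    qed (use pos lb in auto)
    also have "\<dots> = real Q / \<bar>of_int k\<bar>" using k by simp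
    also have "\<dots> \<le> 5 * real m * real K / \<bar>of_int k\<bar>"
    proof (rule divide_right_mono)
      have "1 \<le> m * K" using m K by simp
      then have "Q \<le> 5 * m * K" unfolding Q_def by linarith
      then show "real Q \<le> 5 * real m * real K" by (metis of_nat_le_iff of_nat_mult of_nat_numeral)
    qed simp
    finally have "norm (\<Sum>u<K. addchar Q k u) / real K \<le> 5 * real m * real K / \<bar>of_int k\<bar> / real K"
      by (rule divide_right_mono) simp
    then show ?thesis using K by (simp add: av_def norm_mult norm_divide)
  qed
  show ?thesis
  proof (rule that[of "\<lambda>k. c0 k * av k ^ m"])
    have mK: "m * (K - 1) + m = m * K" using K by (metis Suc_diff_1 less_le_trans mult_Suc_right zero_less_one add.commute)
    show "(\<Sum>k\<in>{- int Y..int Y}. c0 k * av k ^ m * addchar Q k z) = 1" if "z \<le> m * K" for z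
      using W1[of z m] that m mK unfolding W_def by (simp add: mult_ac)
    show "(\<Sum>k\<in>{- int Y..int Y}. c0 k * av k ^ m * addchar Q k z) = 0" if "2 * m * K \<le> z" "z \<le> 3 * m * K" for z
      using W2[of z m] that mK unfolding W_def by simp
    show "norm (c0 k * av k ^ m) \<le> 1" for k
      using mult_mono[OF c0_le[of k] power_le_one[OF norm_ge_zero av_le[of k], of m]] by (simp add: norm_mult norm_power)
    show "norm (c0 k * av k ^ m) \<le> (5 * real m / of_int \<bar>k\<bar>) ^ m" if "k \<noteq> 0" "\<bar>k\<bar> \<le> int Y" for k
      using mult_mono[OF c0_le[of k] power_mono[OF av_le'[OF that] norm_ge_zero, of m]] by (simp add: norm_mult norm_power)
  qed
qed

subsection \<open>Truncated exponentials\<close>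

definition texp :: "nat \<Rightarrow> complex \<Rightarrow> complex" where
  "texp l z = (\<Sum>j\<le>l. z ^ j / fact j)"

lemma power_self_div_fact_le: "real n ^ n / fact n \<le> exp (real n)"
proof -
  have "(\<Sum>j\<in>{n}. real n ^ j / fact j) \<le> (\<Sum>j. real n ^ j / fact j)"
    using summable_exp[of "real n"] by (intro sum_le_suminf) (auto simp: field_simps)
  then show ?thesis by (simp add: exp_def field_simps)
qed

lemma exp_real_le_3_power: "exp (real n) \<le> 3 ^ n"
proof -
  have "exp (real n) = exp 1 ^ n" by (simp add: exp_of_nat_mult[symmetric])
  also have "\<dots> \<le> 3 ^ n" using exp_le by (intro power_mono) auto
  finally show ?thesis .
qed

text \<open>A relative error is obtained since |exp w| >= exp (- l / 60). With n^n / n! <= e^n, e <=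
  3 and l <= 2^l, Taylor's remainder leads to (3 * 2 * 3 * 3 / 60)^l = (54 / 60)^l, which is where
  the constant 60 comes from.\<close>

lemma texp_approx:
  assumes l: "l > 0" and z: "norm z \<le> real l / 60" and a: "\<bar>\<alpha>\<bar> \<le> 1"
  shows "norm (texp l (of_real \<alpha> * z) - exp (of_real \<alpha> * z)) \<le> exp (- real l) / 4 * norm (exp (of_real \<alpha> * z))"
proof -
  let ?w = "of_real \<alpha> * z"
  have "\<bar>\<alpha>\<bar> * norm z \<le> 1 * norm z" using a by (intro mult_right_mono) auto
  then have w: "norm ?w \<le> real l / 60" using z by (simp add: norm_mult)
  have Re: "\<bar>Re ?w\<bar> \<le> real l / 60" using abs_Re_le_cmod[of ?w] w by linarith
  have "norm (exp ?w - texp l ?w) \<le> exp \<bar>Re ?w\<bar> * (norm ?w ^ Suc l) / fact l"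
    unfolding texp_def by (rule Taylor_exp)
  also have "\<dots> \<le> exp (real l / 60) * (real l / 60) ^ Suc l / fact l"
    using w Re by (intro divide_right_mono mult_mono power_mono) auto
  also have "\<dots> = exp (real l / 60) * (real l / 60) * (real l ^ l / fact l / 60 ^ l)"
    by (simp add: power_divide mult_ac)
  also have "\<dots> \<le> exp (real l / 60) * (real l / 60) * (exp (real l) / 60 ^ l)"
    by (intro mult_left_mono divide_right_mono power_self_div_fact_le) auto
  finally have 1: "norm (exp ?w - texp l ?w) \<le> exp (real l / 60) * (real l / 60) * (exp (real l) / 60 ^ l)" .
  have "exp (- (real l / 60)) \<le> exp (Re ?w)" using Re by (simp add: abs_le_iff)
  then have 2: "exp (- (real l / 60)) \<le> norm (exp ?w)" by simp
  have "real l \<le> 2 ^ l" using of_nat_less_two_power[of l] by (simp add: less_imp_le)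
  then have 4: "exp (real l / 60) * (real l / 60) * (exp (real l) / 60 ^ l) \<le> exp (real l) * (2 ^ l / 60) * (exp (real l) / 60 ^ l)"
    by (intro mult_mono divide_right_mono) auto
  have "exp (real l / 60) * exp (real l / 60) * ((real l / 60) * (exp (real l) * exp (real l) / 60 ^ l)) \<le> exp (real l) * ((2 ^ l / 60) * (exp (real l) * exp (real l) / 60 ^ l))"
    using \<open>real l \<le> 2 ^ l\<close> unfolding exp_add[symmetric] by (intro mult_mono divide_right_mono) auto
  also have "\<dots> \<le> 3 ^ l * ((2 ^ l / 60) * (3 ^ l * 3 ^ l / 60 ^ l))"
    by (intro mult_mono divide_right_mono exp_real_le_3_power) auto
  also have "\<dots> = (3 * 2 * 3 * 3 / 60) ^ l / 60" by (simp only: power_mult_distrib power_divide) simp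
  also have "\<dots> \<le> 1 / 4"
  proof -
    have "(54 / 60 :: real) ^ l \<le> 1" by (rule power_le_one) auto
    then show ?thesis by simp
  qed
  finally have 3: "exp (real l / 60) * exp (real l / 60) * ((real l / 60) * (exp (real l) * exp (real l) / 60 ^ l)) \<le> 1 / 4" .
  have "exp (real l / 60) * (real l / 60) * (exp (real l) / 60 ^ l) =
     (exp (real l / 60) * exp (real l / 60) * ((real l / 60) * (exp (real l) * exp (real l) / 60 ^ l))) * (exp (- real l) * exp (- (real l / 60)))"
    by (simp add: exp_minus field_simps)
  also have "\<dots> \<le> 1 / 4 * (exp (- real l) * exp (- (real l / 60)))"
    by (rule mult_right_mono[OF 3]) simp
  also have "\<dots> \<le> 1 / 4 * (exp (- real l) * norm (exp ?w))"
    using 2 by (intro mult_left_mono) auto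
  finally have "exp (real l / 60) * (real l / 60) * (exp (real l) / 60 ^ l) \<le> exp (- real l) / 4 * norm (exp ?w)"
    by (simp only: mult_ac times_divide_eq_left times_divide_eq_right mult_1_left mult_1_right)
  with 1 have "norm (exp ?w - texp l ?w) \<le> exp (- real l) / 4 * norm (exp ?w)" by (rule order_trans)
  then show ?thesis by (simp only: norm_minus_commute)
qed

text \<open>With y = 60 |z| / l >= 1 every power |z|^j, j <= l, is at most y^l (l / 60)^j, and the
  remaining sum is at most e^l <= 3^l; so 180 = 3 * 60.\<close>

lemma norm_texp_large_le:
  assumes l: "l > 0" and z: "norm z \<ge> real l / 60" and a: "\<bar>\<alpha>\<bar> \<le> 1"
  shows "norm (texp l (of_real \<alpha> * z)) \<le> (180 * norm z / real l) ^ l"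
proof -
  define y where "y = 60 * norm z / real l"
  have y: "y \<ge> 1" using z l by (simp add: y_def field_simps)
  have nz: "norm z = y * (real l / 60)" using l by (simp add: y_def)
  have "norm (texp l (of_real \<alpha> * z)) \<le> (\<Sum>j\<le>l. norm z ^ j / fact j)"
    unfolding texp_def
  proof (rule order_trans[OF norm_sum], rule sum_mono)
    fix j
    have "\<bar>\<alpha>\<bar> * norm z \<le> 1 * norm z" using a by (intro mult_right_mono) auto
    then have "(\<bar>\<alpha>\<bar> * norm z) ^ j \<le> norm z ^ j" by (intro power_mono) auto
    then show "norm ((of_real \<alpha> * z) ^ j / fact j) \<le> norm z ^ j / fact j"
      by (simp add: norm_divide norm_power norm_mult divide_right_mono)
  qed
  also have "\<dots> \<le> (\<Sum>j\<le>l. y ^ l * ((real l / 60) ^ j / fact j))"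
  proof (rule sum_mono)
    fix j assume "j \<in> {..l}"
    then have "y ^ j \<le> y ^ l" using y by (intro power_increasing) auto
    then have "y ^ j * ((real l / 60) ^ j / fact j) \<le> y ^ l * ((real l / 60) ^ j / fact j)"
      by (intro mult_right_mono) auto
    then show "norm z ^ j / fact j \<le> y ^ l * ((real l / 60) ^ j / fact j)"
      unfolding nz power_mult_distrib by simp
  qed
  also have "\<dots> = y ^ l * (\<Sum>j\<le>l. (real l / 60) ^ j / fact j)" by (simp add: sum_distrib_left)
  also have "\<dots> \<le> y ^ l * exp (real l)"
  proof -
    have "(\<Sum>j\<le>l. (real l / 60) ^ j / fact j) \<le> (\<Sum>j. (real l / 60) ^ j / fact j)"
      using summable_exp[of "real l / 60"] by (intro sum_le_suminf) (auto simp: field_simps)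
    also have "\<dots> = exp (real l / 60)" by (simp add: exp_def field_simps)
    also have "\<dots> \<le> exp (real l)" by simp
    finally show ?thesis using y by (intro mult_left_mono) auto
  qed
  also have "\<dots> \<le> y ^ l * 3 ^ l" using y by (intro mult_left_mono exp_real_le_3_power) auto
  also have "\<dots> = (180 * norm z / real l) ^ l" by (simp add: y_def power_mult_distrib[symmetric])
  finally show ?thesis .
qed

text \<open>Where \<open>norm z\<close> exceeds \<open>l / 60\<close>, the truncated exponential no longer approximates \<open>exp\<close>, but
  there \<open>Bpart\<close> is large; so powers of \<open>Upart\<close> dominate the exponential everywhere.\<close>

definition Bpart :: "nat \<Rightarrow> nat \<Rightarrow> complex \<Rightarrow> real" where
  "Bpart l M z = (180 * norm z / real l) ^ (2 * M)"

definition Upart :: "real \<Rightarrow> nat \<Rightarrow> nat \<Rightarrow> complex \<Rightarrow> real" where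
  "Upart \<alpha> l M z = (norm (texp l (of_real \<alpha> * z)))\<^sup>2 + Bpart l M z"

lemma Bpart_nonneg: "Bpart l M z \<ge> 0"
  by (simp add: Bpart_def)

lemma Upart_nonneg: "Upart \<alpha> l M z \<ge> 0"
  by (simp add: Upart_def Bpart_nonneg)

lemma norm_texp_bounds:
  assumes l: "l > 0" and z: "norm z \<le> real l / 60" and a: "\<bar>\<alpha>\<bar> \<le> 1"
  defines "h \<equiv> exp (- real l) / 4"
  shows "(1 - h) * exp (\<alpha> * Re z) \<le> norm (texp l (of_real \<alpha> * z))"
    "norm (texp l (of_real \<alpha> * z)) \<le> (1 + h) * exp (\<alpha> * Re z)"
proof -
  have n: "norm (exp (of_real \<alpha> * z)) = exp (\<alpha> * Re z)" by simp
  have "\<bar>norm (texp l (of_real \<alpha> * z)) - norm (exp (of_real \<alpha> * z))\<bar> \<le> h * exp (\<alpha> * Re z)"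
    using order_trans[OF norm_triangle_ineq3 texp_approx[OF l z a]] unfolding n h_def .
  then show "(1 - h) * exp (\<alpha> * Re z) \<le> norm (texp l (of_real \<alpha> * z))"
    "norm (texp l (of_real \<alpha> * z)) \<le> (1 + h) * exp (\<alpha> * Re z)"
    unfolding n left_diff_distrib distrib_right abs_le_iff by auto
qed

lemma one_minus_ge_exp: "0 \<le> x \<Longrightarrow> x \<le> 1 / 2 \<Longrightarrow> exp (- 2 * x) \<le> 1 - (x::real)"
proof -
  assume x: "0 \<le> x" "x \<le> 1 / 2"
  have "(1 - x) * exp (2 * x) \<ge> (1 - x) * (1 + 2 * x)"
    using x exp_ge_add_one_self[of "2 * x"] by (intro mult_left_mono) auto
  moreover have "(1 - x) * (1 + 2 * x) \<ge> 1"
    using x mult_left_mono[of "2 * x" 1 x] by (simp add: algebra_simps)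
  ultimately have "1 \<le> (1 - x) * exp (2 * x)" by linarith
  then show ?thesis by (simp add: exp_minus field_simps)
qed

text \<open>For small z the two parts are about exp (2 (k - 1) Re z) and exp (2 k Re z), and the
  weights cancel the exponents: k (k - 1) + (1 - k) k = 0. For large z both parts are at least 1
  because \<open>Bpart\<close> is. The leading factor repays (1 - h)^2 with h = exp (- l) /
  4.\<close>

lemma one_le_Upart:
  assumes l: "l > 0" and k: "0 < k" "k < 1"
  shows "1 \<le> exp (exp (- real l)) * Upart (k - 1) l M z powr k * Upart k l M z powr (1 - k)"
proof (cases "norm z \<le> real l / 60")
  case False
  then have "1 \<le> 180 * norm z / real l" using l by (simp add: field_simps)
  then have "1 \<le> Bpart l M z" unfolding Bpart_def by (rule one_le_power)
  then have "1 \<le> Upart \<alpha> l M z" for \<alpha> by (simp add: Upart_def add_increasing)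
  then have "1 \<le> Upart (k - 1) l M z powr k" "1 \<le> Upart k l M z powr (1 - k)"
    using k by (auto intro: ge_one_powr_ge_zero)
  moreover have "1 \<le> exp (exp (- real l))" by simp
  ultimately show ?thesis by (metis mult_mono' mult_1 zero_le_one)
next
  case True
  define h where "h = exp (- real l) / 4"
  have "exp (- real l) \<le> 1" by simp
  then have h: "0 < h" "h \<le> 1 / 2" by (auto simp: h_def simp del: exp_le_one_iff)
  have le: "((1 - h) * exp (\<alpha> * Re z))\<^sup>2 \<le> Upart \<alpha> l M z" if "\<bar>\<alpha>\<bar> \<le> 1" for \<alpha>
  proof -
    have "((1 - h) * exp (\<alpha> * Re z))\<^sup>2 \<le> (norm (texp l (of_real \<alpha> * z)))\<^sup>2"
      using norm_texp_bounds(1)[OF l True that] h unfolding h_def[symmetric] by (intro power_mono) auto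
    then show ?thesis using Bpart_nonneg[of l M z] by (simp add: Upart_def)
  qed
  have sq: "((1 - h) * exp (\<alpha> * Re z))\<^sup>2 = exp (2 * (ln (1 - h) + \<alpha> * Re z))" for \<alpha>
  proof -
    have "exp (2 * (ln (1 - h) + \<alpha> * Re z)) = (exp (ln (1 - h)) * exp (\<alpha> * Re z))\<^sup>2"
      by (simp only: exp_double exp_add)
    then show ?thesis using h by simp
  qed
  have "exp (2 * ln (1 - h)) = exp (2 * (ln (1 - h) + (k - 1) * Re z)) powr k * exp (2 * (ln (1 - h) + k * Re z)) powr (1 - k)"
    by (simp add: powr_def exp_add[symmetric] algebra_simps)
  also have "\<dots> \<le> Upart (k - 1) l M z powr k * Upart k l M z powr (1 - k)"
    using le[of "k - 1"] le[of k] k unfolding sq by (intro mult_mono powr_mono2) auto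
  finally have 1: "(1 - h)\<^sup>2 \<le> Upart (k - 1) l M z powr k * Upart k l M z powr (1 - k)"
    using h by (simp add: exp_double)
  have "exp (- 2 * h) * exp (- 2 * h) \<le> (1 - h) * (1 - h)"
    using h by (intro mult_mono one_minus_ge_exp) auto
  also have "exp (- 2 * h) * exp (- 2 * h) = exp (- exp (- real l))" by (simp add: exp_add[symmetric] h_def)
  finally have "exp (exp (- real l)) * exp (- exp (- real l)) \<le> exp (exp (- real l)) * (Upart (k - 1) l M z powr k * Upart k l M z powr (1 - k))"
    using 1 by (intro mult_left_mono) (auto simp: power2_eq_square)
  then show ?thesis by (simp add: exp_minus mult_ac)
qed

text \<open>For small z the exponents add up as 2 (k - 1) + (2 / k) k = 2 k, the exponent of the
  squared truncation with \<alpha> = k. For large z the left side has degree 2 l (1 + 1 / k) in 180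
  |z| / l, which is the reason for the lower bound on M.\<close>

lemma texp_prod_le_Upart:
  assumes l: "l > 0" and k: "0 < k" "k < 1" and M: "real l * (1 + 1 / k) \<le> real M"
  shows "(norm (texp l (of_real (k - 1) * z)))\<^sup>2 * (norm (texp l (of_real k * z))) powr (2 / k)
    \<le> exp ((2 + 1 / k) * exp (- real l)) * Upart k l M z"
proof (cases "norm z \<le> real l / 60")
  case False
  define Y where "Y = 180 * norm z / real l"
  have Y: "1 \<le> Y" using False l by (simp add: Y_def field_simps)
  have b: "norm (texp l (of_real \<alpha> * z)) \<le> Y ^ l" if "\<bar>\<alpha>\<bar> \<le> 1" for \<alpha>
    unfolding Y_def by (rule norm_texp_large_le) (use False l that in auto)
  have "(norm (texp l (of_real (k - 1) * z)))\<^sup>2 * (norm (texp l (of_real k * z))) powr (2 / k) \<le> (Y ^ l)\<^sup>2 * (Y ^ l) powr (2 / k)"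
    using b[of "k - 1"] b[of k] k Y by (intro mult_mono power_mono powr_mono2) auto
  also have "\<dots> = Y powr (2 * (real l * (1 + 1 / k)))"
    using Y k by (simp add: powr_realpow[symmetric] powr_powr powr_add[symmetric] algebra_simps power2_eq_square)
  also have "\<dots> \<le> Y powr (2 * real M)" using M Y by (intro powr_mono) auto
  also have "\<dots> = Bpart l M z" using Y by (simp add: Bpart_def Y_def[symmetric] powr_realpow[symmetric])
  also have "\<dots> \<le> 1 * Upart k l M z" by (simp add: Upart_def)
  also have "\<dots> \<le> exp ((2 + 1 / k) * exp (- real l)) * Upart k l M z"
    using k by (intro mult_right_mono Upart_nonneg) auto
  finally show ?thesis .
next
  case True
  define h where "h = exp (- real l) / 4"
  have "exp (- real l) \<le> 1" by simp
  then have h: "0 < h" "h \<le> 1 / 2" by (auto simp: h_def simp del: exp_le_one_iff)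
  let ?x = "Re z"
  have e1: "1 + h \<le> exp h" by (rule exp_ge_add_one_self)
  have "(norm (texp l (of_real (k - 1) * z)))\<^sup>2 * (norm (texp l (of_real k * z))) powr (2 / k)
    \<le> (exp h * exp ((k - 1) * ?x))\<^sup>2 * (exp h * exp (k * ?x)) powr (2 / k)"
  proof (intro mult_mono power_mono powr_mono2)
    show "norm (texp l (of_real (k - 1) * z)) \<le> exp h * exp ((k - 1) * ?x)"
      using norm_texp_bounds(2)[OF l True, of "k - 1"] k e1 unfolding h_def[symmetric]
      by (smt (verit) exp_ge_zero mult_right_mono)
    show "norm (texp l (of_real k * z)) \<le> exp h * exp (k * ?x)"
      using norm_texp_bounds(2)[OF l True, of k] k e1 unfolding h_def[symmetric]
      by (smt (verit) exp_ge_zero mult_right_mono)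
  qed (use k in auto)
  also have "\<dots> = exp (h * (2 + 2 / k) + 2 * k * ?x)"
    using k by (simp add: powr_def exp_add[symmetric] power2_eq_square field_simps)
  also have "\<dots> = exp (h * (6 + 2 / k)) * (exp (- 2 * h) * exp (k * ?x))\<^sup>2"
    by (simp add: exp_add[symmetric] power2_eq_square algebra_simps)
  also have "\<dots> \<le> exp ((2 + 1 / k) * exp (- real l)) * Upart k l M z"
  proof (intro mult_mono)
    have "h * (6 + 2 / k) = (6 / 4 + 1 / (2 * k)) * exp (- real l)" using k by (simp add: h_def field_simps)
    also have "\<dots> \<le> (2 + 1 / k) * exp (- real l)" using k by (intro mult_right_mono add_mono divide_left_mono) auto
    finally show "exp (h * (6 + 2 / k)) \<le> exp ((2 + 1 / k) * exp (- real l))" by simp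
    have "exp (- 2 * h) * exp (k * ?x) \<le> (1 - h) * exp (k * ?x)"
      using h by (intro mult_right_mono one_minus_ge_exp) auto
    also have "\<dots> \<le> norm (texp l (of_real k * z))"
      using norm_texp_bounds(1)[OF l True, of k] k unfolding h_def[symmetric] by simp
    finally have "(exp (- 2 * h) * exp (k * ?x))\<^sup>2 \<le> (norm (texp l (of_real k * z)))\<^sup>2"
      by (intro power_mono) auto
    then show "(exp (- 2 * h) * exp (k * ?x))\<^sup>2 \<le> Upart k l M z"
      using Bpart_nonneg[of l M z] unfolding Upart_def by linarith
  qed auto
  finally show ?thesis .
qed

subsection \<open>Euler product bounds for mean squares\<close>

text \<open>The arithmetic function Omega: prime factors counted with multiplicity.\<close>

definition Om :: "nat \<Rightarrow> nat" where "Om n = size (prime_factorization n)"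

lemma Om_mult: "m > 0 \<Longrightarrow> n > 0 \<Longrightarrow> Om (m * n) = Om m + Om n"
  by (simp add: Om_def prime_factorization_mult)

lemma Om_one [simp]: "Om (Suc 0) = 0" "Om 1 = 0"
  by (simp_all add: Om_def)

lemma Om_prime_power: "prime p \<Longrightarrow> Om (p ^ a) = a"
  by (simp add: Om_def prime_factorization_prime_power)

text \<open>The coefficients of the exponential of the Dirichlet series of \<open>f\<close> over primes.\<close>

definition ftil :: "(nat \<Rightarrow> complex) \<Rightarrow> nat \<Rightarrow> complex" where
  "ftil f n = (\<Prod>p\<in>prime_factors n. f p ^ multiplicity p n / fact (multiplicity p n))"

lemma ftil_one [simp]: "ftil f (Suc 0) = 1" "ftil f 1 = 1"
  by (simp_all add: ftil_def)

lemma ftil_prime_power: "prime p \<Longrightarrow> ftil f (p ^ a) = f p ^ a / fact a"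
  by (cases "a = 0") (simp_all add: ftil_def prime_factorization_prime_power)

lemma ftil_mult:
  assumes mn: "m > 0" "n > 0" "coprime m n"
  shows "ftil f (m * n) = ftil f m * ftil f n"
proof -
  have disj: "prime_factors m \<inter> prime_factors n = {}"
  proof (rule ccontr)
    assume "prime_factors m \<inter> prime_factors n \<noteq> {}"
    then obtain p where "prime p" "p dvd m" "p dvd n" by (auto simp: prime_factors_dvd)
    then show False using mn(3) by (meson coprime_common_divisor_nat not_prime_1 coprime_common_divisor not_prime_unit)
  qed
  have mm: "multiplicity p (m * n) = multiplicity p m" if "p \<in> prime_factors m" for p
  proof -
    have "prime p" "\<not> p dvd n" using that disj mn by (auto simp: prime_factors_dvd)
    then show ?thesis using mn by (simp add: prime_elem_multiplicity_mult_distrib not_dvd_imp_multiplicity_0)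
  qed
  have mn': "multiplicity p (m * n) = multiplicity p n" if "p \<in> prime_factors n" for p
  proof -
    have "prime p" "\<not> p dvd m" using that disj mn by (auto simp: prime_factors_dvd)
    then show ?thesis using mn by (simp add: prime_elem_multiplicity_mult_distrib not_dvd_imp_multiplicity_0)
  qed
  have "prime_factors (m * n) = prime_factors m \<union> prime_factors n"
    using mn by (simp add: prime_factors_product)
  then show ?thesis unfolding ftil_def
    by (simp add: prod.union_disjoint[OF _ _ disj] mm mn')
qed

lemma ftil_norm: "ftil (\<lambda>p. of_real (norm (f p))) n = of_real (norm (ftil f n))"
  unfolding ftil_def prod_norm[symmetric] norm_divide norm_power of_real_prod by simp

text \<open>Coefficients of the power series with terms \<psi> j P^j / j! in the prime sum P over
  \<open>A\<close>; see \<open>dpoly_wt\<close>.\<close>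

definition wt :: "(nat \<Rightarrow> complex) \<Rightarrow> (nat \<Rightarrow> complex) \<Rightarrow> nat set \<Rightarrow> nat \<Rightarrow> complex" where
  "wt f \<psi> A n = (if n \<in> nums_over A then \<psi> (Om n) * ftil f n else 0)"

lemma wt_supp: "wt f \<psi> A n \<noteq> 0 \<Longrightarrow> n \<in> nums_over A \<and> \<psi> (Om n) \<noteq> 0"
  by (auto simp: wt_def split: if_splits)

lemma nums_over_Om_insert:
  assumes p: "prime p" "p \<notin> A"
  shows "bij_betw (\<lambda>(a, n). p ^ a * n) (SIGMA a:{..j}. {n \<in> nums_over A. Om n = j - a}) {n \<in> nums_over (insert p A). Om n = j}"
proof -
  have disj: "{p} \<inter> A = {}" using p by auto
  have pp: "p ^ a \<in> nums_over {p}" for a unfolding nums_over_singleton[OF p(1)] by blast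
  have p0: "p ^ a > 0" for a using p prime_gt_0_nat by simp
  show ?thesis
  proof (rule bij_betw_imageI)
    show "inj_on (\<lambda>(a, n). p ^ a * n) (SIGMA a:{..j}. {n \<in> nums_over A. Om n = j - a})"
    proof (rule inj_onI, clarify)
      fix a n a' n' assume n: "n \<in> nums_over A" "n' \<in> nums_over A" and eq: "p ^ a * n = p ^ a' * n'"
      have "p ^ a = p ^ a' \<and> n = n'" by (rule nums_over_unique[OF disj pp n(1) pp n(2) eq])
      then show "a = a' \<and> n = n'" using p prime_gt_1_nat power_inject_exp by blast
    qed
    show "(\<lambda>(a, n). p ^ a * n) ` (SIGMA a:{..j}. {n \<in> nums_over A. Om n = j - a}) = {n \<in> nums_over (insert p A). Om n = j}"
    proof (intro equalityI subsetI)
      fix x assume "x \<in> (\<lambda>(a, n). p ^ a * n) ` (SIGMA a:{..j}. {n \<in> nums_over A. Om n = j - a})"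
      then obtain a n where an: "a \<le> j" "n \<in> nums_over A" "Om n = j - a" "x = p ^ a * n" by auto
      have "p ^ a \<in> nums_over (insert p A)" "n \<in> nums_over (insert p A)"
        using pp[of a] an(2) nums_over_mono[of "{p}" "insert p A"] nums_over_mono[of A "insert p A"] by auto
      then have "x \<in> nums_over (insert p A)" using an by (simp add: nums_over_mult_iff)
      moreover have "Om x = j" using an Om_mult[OF p0 nums_over_pos[OF an(2)]] Om_prime_power[OF p(1)] by simp
      ultimately show "x \<in> {n \<in> nums_over (insert p A). Om n = j}" by simp
    next
      fix x assume "x \<in> {n \<in> nums_over (insert p A). Om n = j}"
      then have x: "x \<in> nums_over ({p} \<union> A)" "Om x = j" by auto
      from nums_over_decomp[OF disj x(1)] obtain b n where b: "b \<in> nums_over {p}" "n \<in> nums_over A" "x = b * n" .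
      then obtain a where a: "b = p ^ a" unfolding nums_over_singleton[OF p(1)] by blast
      have "Om x = a + Om n" using b a Om_mult[OF p0 nums_over_pos[OF b(2)]] Om_prime_power[OF p(1)] by simp
      then show "x \<in> (\<lambda>(a, n). p ^ a * n) ` (SIGMA a:{..j}. {n \<in> nums_over A. Om n = j - a})"
        using x(2) b a by (intro image_eqI[of _ _ "(a, n)"]) auto
    qed
  qed
qed

text \<open>The multinomial theorem for the j-th power of the prime sum, by induction over the
  primes with the binomial theorem.\<close>

lemma sum_ftil_powr:
  assumes "finite A" "\<And>p. p \<in> A \<Longrightarrow> prime p"
  shows "finite {n \<in> nums_over A. Om n = j} \<and>
    (\<Sum>n | n \<in> nums_over A \<and> Om n = j. ftil f n * of_nat n powr (- s)) = (\<Sum>p\<in>A. f p * of_nat p powr (- s)) ^ j / fact j"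
  using assms
proof (induction A arbitrary: j rule: finite_induct)
  case empty
  have "{n \<in> nums_over {}. Om n = j} = (if j = 0 then {1} else {})" by (auto simp: nums_over_empty)
  then show ?case by auto
next
  case (insert p A)
  have p: "prime p" "p \<notin> A" using insert by auto
  note bij = nums_over_Om_insert[OF p, of j]
  have IH: "finite {n \<in> nums_over A. Om n = i}"
    "(\<Sum>n | n \<in> nums_over A \<and> Om n = i. ftil f n * of_nat n powr (- s)) = (\<Sum>p\<in>A. f p * of_nat p powr (- s)) ^ i / fact i" for i
    using insert by auto
  have fin: "finite (SIGMA a:{..j}. {n \<in> nums_over A. Om n = j - a})" using IH(1) by auto
  have finj: "finite {n \<in> nums_over (insert p A). Om n = j}"
    using bij_betw_finite[OF bij] fin by simp
  let ?x = "f p * of_nat p powr (- s)" and ?y = "(\<Sum>p\<in>A. f p * of_nat p powr (- s))"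
  have p0: "p ^ a > 0" for a using p prime_gt_0_nat by simp
  have "(\<Sum>n | n \<in> nums_over (insert p A) \<and> Om n = j. ftil f n * of_nat n powr (- s))
      = (\<Sum>(a, n)\<in>(SIGMA a:{..j}. {n \<in> nums_over A. Om n = j - a}). ftil f (p ^ a * n) * of_nat (p ^ a * n) powr (- s))"
    using sum.reindex_bij_betw[OF bij, of "\<lambda>n. ftil f n * of_nat n powr (- s)"] by (simp add: case_prod_beta')
  also have "\<dots> = (\<Sum>a\<le>j. \<Sum>n | n \<in> nums_over A \<and> Om n = j - a. ftil f (p ^ a * n) * of_nat (p ^ a * n) powr (- s))"
    using IH(1) by (subst sum.Sigma) auto
  also have "\<dots> = (\<Sum>a\<le>j. \<Sum>n | n \<in> nums_over A \<and> Om n = j - a. (?x ^ a / fact a) * (ftil f n * of_nat n powr (- s)))"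
  proof (intro sum.cong refl)
    fix a n assume n: "n \<in> {n. n \<in> nums_over A \<and> Om n = j - a}"
    have "coprime (p ^ a) n"
      by (rule nums_over_coprime[of "{p}" A]) (use p n nums_over_singleton[OF p(1)] in auto)
    then have "ftil f (p ^ a * n) = f p ^ a / fact a * ftil f n"
      using n by (subst ftil_mult[OF p0]) (auto dest: nums_over_pos simp: ftil_prime_power[OF p(1)])
    moreover have "of_nat (p ^ a * n) powr (- s) = (of_nat p powr (- s)) ^ a * of_nat n powr (- s)"
    proof -
      have "of_nat (p ^ a * n) powr (- s) = of_nat (p ^ a) powr (- s) * of_nat n powr (- s)"
        by (simp only: of_nat_mult, rule powr_times_real) auto
      also have "of_nat (p ^ a) powr (- s) = (of_nat p powr (- s)) ^ a"
      proof (induction a)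
        case (Suc a)
        have "of_nat (p ^ Suc a) powr (- s) = of_nat p powr (- s) * of_nat (p ^ a) powr (- s)"
          by (simp only: power_Suc of_nat_mult, rule powr_times_real) auto
        then show ?case using Suc by simp
      qed simp
      finally show ?thesis .
    qed
    ultimately show "ftil f (p ^ a * n) * of_nat (p ^ a * n) powr (- s) = (?x ^ a / fact a) * (ftil f n * of_nat n powr (- s))"
      by (simp add: power_mult_distrib)
  qed
  also have "\<dots> = (\<Sum>a\<le>j. (?x ^ a / fact a) * (?y ^ (j - a) / fact (j - a)))"
    by (simp only: sum_distrib_left[symmetric] IH(2))
  also have "\<dots> = (\<Sum>a\<le>j. of_nat (j choose a) * ?x ^ a * ?y ^ (j - a) / fact j)"
    by (intro sum.cong refl) (simp add: binomial_fact)
  also have "\<dots> = (?x + ?y) ^ j / fact j" by (simp add: binomial_ring sum_divide_distrib)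
  also have "?x + ?y = (\<Sum>p\<in>insert p A. f p * of_nat p powr (- s))" using insert by simp
  finally show ?case using finj by simp
qed

lemma finite_nums_over_Om:
  assumes "finite A" "\<And>p. p \<in> A \<Longrightarrow> prime p"
  shows "finite {n \<in> nums_over A. Om n \<le> j}"
proof -
  have "{n \<in> nums_over A. Om n \<le> j} = (\<Union>i\<in>{..j}. {n \<in> nums_over A. Om n = i})" by auto
  then show ?thesis using sum_ftil_powr[OF assms] by auto
qed

lemma fin_supp_wt:
  assumes "finite A" "\<And>p. p \<in> A \<Longrightarrow> prime p" "\<And>j. j > M \<Longrightarrow> \<psi> j = 0"
  shows "fin_supp (wt f \<psi> A)"
proof -
  have sub: "{n. wt f \<psi> A n \<noteq> 0} \<subseteq> {n \<in> nums_over A. Om n \<le> M}"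
  proof
    fix n assume "n \<in> {n. wt f \<psi> A n \<noteq> 0}"
    then have "n \<in> nums_over A" "\<psi> (Om n) \<noteq> 0" using wt_supp by blast+
    then show "n \<in> {n \<in> nums_over A. Om n \<le> M}" using assms(3)[of "Om n"] by (auto simp: not_le[symmetric])
  qed
  have "wt f \<psi> A 0 = 0" by (simp add: wt_def nums_over_def)
  then show ?thesis unfolding fin_supp_def using finite_subset[OF sub finite_nums_over_Om[OF assms(1,2)]] by blast
qed

lemma dpoly_wt:
  assumes A: "finite A" "\<And>p. p \<in> A \<Longrightarrow> prime p" and M: "\<And>j. j > M \<Longrightarrow> \<psi> j = 0"
  shows "dpoly (wt f \<psi> A) s = (\<Sum>j\<le>M. \<psi> j * (\<Sum>p\<in>A. f p * of_nat p powr (- s)) ^ j / fact j)"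
proof -
  have "dpoly (wt f \<psi> A) s = (\<Sum>n\<in>{n \<in> nums_over A. Om n \<le> M}. wt f \<psi> A n * of_nat n powr (- s))"
  proof (rule dpoly_superset[OF finite_nums_over_Om[OF A]])
    fix n assume "wt f \<psi> A n \<noteq> 0"
    then have "n \<in> nums_over A" "\<psi> (Om n) \<noteq> 0" using wt_supp by blast+
    then show "n \<in> {n \<in> nums_over A. Om n \<le> M}" using M[of "Om n"] by (auto simp: not_le[symmetric])
  qed
  also have "\<dots> = (\<Sum>j\<le>M. \<Sum>n\<in>{n \<in> {n \<in> nums_over A. Om n \<le> M}. Om n = j}. wt f \<psi> A n * of_nat n powr (- s))"
    by (rule sum.group[symmetric]) (use finite_nums_over_Om[OF A] in auto)
  also have "\<dots> = (\<Sum>j\<le>M. \<psi> j * (\<Sum>p\<in>A. f p * of_nat p powr (- s)) ^ j / fact j)"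
  proof (intro sum.cong refl)
    fix j assume "j \<in> {..M}"
    then have "{n \<in> {n \<in> nums_over A. Om n \<le> M}. Om n = j} = {n. n \<in> nums_over A \<and> Om n = j}" by auto
    then have "(\<Sum>n\<in>{n \<in> {n \<in> nums_over A. Om n \<le> M}. Om n = j}. wt f \<psi> A n * of_nat n powr (- s))
      = (\<Sum>n | n \<in> nums_over A \<and> Om n = j. \<psi> j * (ftil f n * of_nat n powr (- s)))"
      by (intro sum.cong) (auto simp: wt_def)
    also have "\<dots> = \<psi> j * ((\<Sum>p\<in>A. f p * of_nat p powr (- s)) ^ j / fact j)"
      using sum_ftil_powr[OF A, of j f s] by (simp only: sum_distrib_left[symmetric])
    finally show "(\<Sum>n\<in>{n \<in> {n \<in> nums_over A. Om n \<le> M}. Om n = j}. wt f \<psi> A n * of_nat n powr (- s))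
      = \<psi> j * (\<Sum>p\<in>A. f p * of_nat p powr (- s)) ^ j / fact j" by simp
  qed
  finally show ?thesis .
qed

text \<open>The index b = 0 leaves the tail of y from 2, b = 1 the tail from 1, and b >= 2 all of y.
  If Y1 and Y2 have sizes t and t^2, everything from degree 2 on is thus of size \<xi> + t^2, with
  no term linear in t.\<close>

lemma conv_tail_bound:
  fixes x y :: "nat \<Rightarrow> real"
  assumes x: "\<And>b. x b \<ge> 0" "x 0 \<le> 1" "x 1 \<le> t" "(\<Sum>b=2..K. x b) \<le> \<xi>"
    and y: "\<And>b. y b \<ge> 0" "(\<Sum>b\<le>K. y b) \<le> Y0" "(\<Sum>b=1..K. y b) \<le> Y1" "(\<Sum>b=2..K. y b) \<le> Y2"
  shows "(\<Sum>a=2..K. \<Sum>b\<le>a. x b * y (a - b)) \<le> \<xi> * Y0 + t * Y1 + Y2"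
proof -
  have "(\<Sum>a=2..K. \<Sum>b\<le>a. x b * y (a - b)) = (\<Sum>a=2..K. x 0 * y a + x 1 * y (a - 1) + (\<Sum>b=2..a. x b * y (a - b)))"
  proof (intro sum.cong refl)
    fix a assume "a \<in> {2..K}"
    then have "{..a} = insert 0 (insert 1 {2..a})" by auto
    then show "(\<Sum>b\<le>a. x b * y (a - b)) = x 0 * y a + x 1 * y (a - 1) + (\<Sum>b=2..a. x b * y (a - b))" by simp
  qed
  also have "\<dots> = x 0 * (\<Sum>a=2..K. y a) + x 1 * (\<Sum>a=2..K. y (a - 1)) + (\<Sum>a=2..K. \<Sum>b=2..a. x b * y (a - b))"
    by (simp add: sum.distrib sum_distrib_left)
  also have "\<dots> \<le> 1 * Y2 + t * Y1 + \<xi> * Y0"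
  proof (intro add_mono)
    show "x 0 * (\<Sum>a=2..K. y a) \<le> 1 * Y2" using x y by (intro mult_mono) (auto intro: sum_nonneg)
    have "(\<Sum>a=2..K. y (a - 1)) = (\<Sum>a\<in>(\<lambda>a. a - 1) ` {2..K}. y a)"
      by (subst sum.reindex) (auto simp: inj_on_def)
    also have "\<dots> \<le> (\<Sum>b=1..K. y b)" using y by (intro sum_mono2) auto
    also have "\<dots> \<le> Y1" by fact
    finally have "(\<Sum>a=2..K. y (a - 1)) \<le> Y1" .
    moreover have "0 \<le> (\<Sum>a=2..K. y (a - 1))" using y by (intro sum_nonneg)
    moreover have "t \<ge> 0" using x(1)[of 1] x(3) by linarith
    ultimately show "x 1 * (\<Sum>a=2..K. y (a - 1)) \<le> t * Y1" using x by (intro mult_mono) auto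
    have "(\<Sum>a=2..K. \<Sum>b=2..a. x b * y (a - b)) = (\<Sum>(a, b)\<in>(SIGMA a:{2..K}. {2..a}). x b * y (a - b))"
      by (rule sum.Sigma) auto
    also have "\<dots> = (\<Sum>(b, c)\<in>(\<lambda>(a, b). (b, a - b)) ` (SIGMA a:{2..K}. {2..a}). x b * y c)"
      by (subst sum.reindex) (auto simp: inj_on_def case_prod_beta')
    also have "\<dots> \<le> (\<Sum>(b, c)\<in>{2..K} \<times> {..K}. x b * y c)"
      using x y by (intro sum_mono2) auto
    also have "\<dots> = (\<Sum>b=2..K. x b) * (\<Sum>c\<le>K. y c)" by (simp add: sum_product sum.cartesian_product)
    also have "\<dots> \<le> \<xi> * Y0"
      using x y by (intro mult_mono) (auto intro: sum_nonneg order_trans[OF sum_nonneg x(4)])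
    finally show "(\<Sum>a=2..K. \<Sum>b=2..a. x b * y (a - b)) \<le> \<xi> * Y0" .
  qed
  finally show ?thesis by simp
qed

lemma sum_squares_le_square_sum:
  fixes u :: "'a \<Rightarrow> real"
  assumes "finite F" "\<And>i. i \<in> F \<Longrightarrow> u i \<ge> 0"
  shows "(\<Sum>i\<in>F. (u i)\<^sup>2) \<le> (\<Sum>i\<in>F. u i)\<^sup>2"
proof -
  have "(\<Sum>i\<in>F. (u i)\<^sup>2) \<le> (\<Sum>i\<in>F. u i * (\<Sum>i\<in>F. u i))"
    unfolding power2_eq_square using assms by (intro sum_mono mult_left_mono member_le_sum) auto
  also have "\<dots> = (\<Sum>i\<in>F. u i)\<^sup>2" by (simp add: sum_distrib_right power2_eq_square)
  finally show ?thesis .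
qed

lemma exp_tail_sums:
  fixes z :: real
  assumes "z \<ge> 0"
  shows "(\<Sum>b\<le>K. z ^ b / fact b) \<le> exp z" "(\<Sum>b=1..K. z ^ b / fact b) \<le> z * exp z" "(\<Sum>b=2..K. z ^ b / fact b) \<le> z\<^sup>2 * exp z"
proof -
  have *: "(\<Sum>b\<in>F. z ^ b / fact b) \<le> exp z" if "finite F" for F
  proof -
    have "(\<Sum>b\<in>F. z ^ b / fact b) \<le> (\<Sum>b. z ^ b / fact b)"
      using summable_exp[of z] assms that by (intro sum_le_suminf) (auto simp: field_simps)
    then show ?thesis by (simp add: exp_def field_simps)
  qed
  show "(\<Sum>b\<le>K. z ^ b / fact b) \<le> exp z" by (rule *) simp
  have **: "(\<Sum>b=r..K. z ^ b / fact b) \<le> z ^ r * exp z" for r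
  proof -
    have "(\<Sum>b=r..K. z ^ b / fact b) \<le> (\<Sum>b=r..K. z ^ r * (z ^ (b - r) / fact (b - r)))"
    proof (rule sum_mono)
      fix b assume b: "b \<in> {r..K}"
      have "z ^ b / fact b \<le> z ^ b / fact (b - r)"
        using assms by (intro divide_left_mono fact_mono) auto
      moreover have "z ^ b = z ^ r * z ^ (b - r)" using b by (simp add: power_add[symmetric])
      ultimately show "z ^ b / fact b \<le> z ^ r * (z ^ (b - r) / fact (b - r))"
        by (metis times_divide_eq_right)
    qed
    also have "\<dots> = z ^ r * (\<Sum>b\<in>(\<lambda>b. b - r) ` {r..K}. z ^ b / fact b)"
      by (subst sum.reindex) (auto simp: inj_on_def sum_distrib_left)
    also have "\<dots> \<le> z ^ r * exp z" using assms by (intro mult_left_mono *) auto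
    finally show ?thesis .
  qed
  show "(\<Sum>b=1..K. z ^ b / fact b) \<le> z * exp z" using **[of 1] by simp
  show "(\<Sum>b=2..K. z ^ b / fact b) \<le> z\<^sup>2 * exp z" using **[of 2] by simp
qed

lemma dirichlet_conv_prime_power:
  assumes p: "prime p"
  shows "dirichlet_conv F G (p ^ a) = (\<Sum>b\<le>a. F (p ^ b) * G (p ^ (a - b)))"
proof -
  have "{d. d dvd p ^ a} = (\<lambda>b. p ^ b) ` {..a}" using p by (auto simp: divides_primepow_nat)
  moreover have "inj_on (\<lambda>b. p ^ b) {..a}" using p prime_gt_1_nat by (auto simp: inj_on_def)
  ultimately have "dirichlet_conv F G (p ^ a) = (\<Sum>b\<le>a. F (p ^ b) * G (p ^ a div p ^ b))"
    unfolding dirichlet_conv_def by (simp add: sum.reindex)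
  also have "\<dots> = (\<Sum>b\<le>a. F (p ^ b) * G (p ^ (a - b)))"
    using p prime_gt_0_nat by (intro sum.cong refl) (simp add: power_diff)
  finally show ?thesis .
qed

text \<open>Coefficients of exp (\<alpha> P) with P the sum over all primes; unlike the truncations
  in \<open>wt\<close> they are multiplicative.\<close>

definition omwt :: "(nat \<Rightarrow> complex) \<Rightarrow> complex \<Rightarrow> nat \<Rightarrow> complex" where
  "omwt f \<alpha> n = \<alpha> ^ Om n * ftil f n"

lemma multiplicative_omwt: "multiplicative (omwt f \<alpha>)"
  by (simp add: multiplicative_def omwt_def Om_mult ftil_mult power_add)

lemma omwt_one [simp]: "omwt f \<alpha> (Suc 0) = 1" "omwt f \<alpha> 1 = 1"
  by (simp_all add: omwt_def)

lemma omwt_prime_power: "prime p \<Longrightarrow> omwt f \<alpha> (p ^ a) = (\<alpha> * f p) ^ a / fact a"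
  by (simp add: omwt_def Om_prime_power ftil_prime_power power_mult_distrib)

lemma dirichlet_conv_at_one: "dirichlet_conv F G 1 = F 1 * G 1"
  by (simp add: dirichlet_conv_def)

text \<open>The size of the term p^b of the Dirichlet series on the critical line.\<close>

definition half_norm :: "(nat \<Rightarrow> complex) \<Rightarrow> nat \<Rightarrow> nat \<Rightarrow> real" where
  "half_norm f p b = norm (f (p ^ b)) * real p powr (- real b / 2)"

lemma half_norm_sq: "p > 0 \<Longrightarrow> (half_norm f p b)\<^sup>2 = (norm (f (p ^ b)))\<^sup>2 / real (p ^ b)"
proof -
  assume p: "p > 0"
  have "(real p powr (- real b / 2))\<^sup>2 = real p powr (- real b)"
    by (simp add: power2_eq_square powr_add[symmetric])
  also have "\<dots> = 1 / real (p ^ b)"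
    using p by (simp add: powr_minus powr_realpow divide_inverse)
  finally show ?thesis unfolding half_norm_def power_mult_distrib by simp
qed

lemma half_norm_nonneg: "half_norm f p b \<ge> 0"
  by (simp add: half_norm_def)

text \<open>\<open>xi p\<close> bounds the terms p^2, p^3, ... on the critical line in the l^1 norm,
  because that norm behaves well under convolution with the coefficients of an exponential.\<close>

locale prime_data =
  fixes f :: "nat \<Rightarrow> complex" and xi :: "nat \<Rightarrow> real"
  assumes f_mult: "multiplicative f" and f_one: "f 1 = 1"
    and xi: "\<And>p K. prime p \<Longrightarrow> (\<Sum>b=2..K. half_norm f p b) \<le> xi p"
begin

definition tt :: "nat \<Rightarrow> real" where "tt p = norm (f p) * real p powr (- 1 / 2)"

text \<open>All that a local factor contains beyond its first-order term has size xi p + (tt p)^2;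
  mean squares involve the square of this. It is the error term attached to the prime p.\<close>

definition RR :: "nat \<Rightarrow> real" where "RR p = (xi p + (tt p)\<^sup>2)\<^sup>2"

lemma tt_nonneg: "tt p \<ge> 0" by (simp add: tt_def)

lemma tt_sq: "p > 0 \<Longrightarrow> (tt p)\<^sup>2 = (norm (f p))\<^sup>2 / real p"
  using half_norm_sq[of p f 1] by (simp add: half_norm_def tt_def)

lemma xi_nonneg: "prime p \<Longrightarrow> xi p \<ge> 0"
  using xi[of p 0] by simp

lemma RR_nonneg: "RR p \<ge> 0" by (simp add: RR_def)

text \<open>The square of the constant exp \<rho> * 2 \<rho>^2 that arises in
  \<open>euler_tail\<close>.\<close>

definition CR :: "real \<Rightarrow> real" where "CR \<rho> = 4 * \<rho> ^ 4 * exp (2 * \<rho>)"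

lemma CR_nonneg: "CR \<rho> \<ge> 0" by (simp add: CR_def)

text \<open>The hypothesis says that C is majorised at prime powers by f convolved with the
  coefficients of exp (\<rho> P). Then \<open>conv_tail_bound\<close> applies with y b = (\<rho> tt
  p)^b / b!.\<close>

lemma euler_tail:
  assumes p: "prime p" and tp: "tt p \<le> 1" and r: "\<rho> \<ge> 1"
    and C: "\<And>a. a \<ge> 2 \<Longrightarrow> norm (C (p ^ a)) \<le> (\<Sum>b\<le>a. norm (f (p ^ b)) * ((\<rho> * norm (f p)) ^ (a - b) / fact (a - b)))"
  shows "(\<Sum>a=2..K. (half_norm C p a)\<^sup>2) \<le> CR \<rho> * RR p"
proof -
  define x where "x = half_norm f p"
  define y where "y b = (\<rho> * tt p) ^ b / fact b" for b :: nat
  have p0: "real p > 0" using p prime_gt_0_nat by simp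
  have z0: "\<rho> * tt p \<ge> 0" using r tt_nonneg[of p] by simp
  have x: "x b \<ge> 0" "x 0 \<le> 1" "x 1 \<le> tt p" for b
    using f_one p0 by (auto simp: x_def half_norm_def tt_def)
  have "(\<Sum>a=2..K. half_norm C p a) \<le> (\<Sum>a=2..K. \<Sum>b\<le>a. x b * y (a - b))"
  proof (rule sum_mono)
    fix a assume a: "a \<in> {2..K}"
    have "half_norm C p a \<le> (\<Sum>b\<le>a. norm (f (p ^ b)) * ((\<rho> * norm (f p)) ^ (a - b) / fact (a - b))) * real p powr (- real a / 2)"
      unfolding half_norm_def using a by (intro mult_right_mono C) auto
    also have "\<dots> = (\<Sum>b\<le>a. x b * y (a - b))"
      unfolding sum_distrib_right
    proof (intro sum.cong refl)
      fix b assume b: "b \<in> {..a}"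
      have "(real p powr (- 1 / 2)) ^ (a - b) = real p powr (- real (a - b) / 2)"
        using p0 by (simp add: powr_realpow[symmetric] powr_powr)
      moreover have "real p powr (- real a / 2) = real p powr (- real b / 2) * real p powr (- real (a - b) / 2)"
        using b by (simp add: powr_add[symmetric] of_nat_diff field_simps)
      ultimately show "norm (f (p ^ b)) * ((\<rho> * norm (f p)) ^ (a - b) / fact (a - b)) * real p powr (- real a / 2) = x b * y (a - b)"
        unfolding x_def y_def half_norm_def tt_def by (simp add: power_mult_distrib)
    qed
    finally show "half_norm C p a \<le> (\<Sum>b\<le>a. x b * y (a - b))" .
  qed
  also have "\<dots> \<le> xi p * exp (\<rho> * tt p) + tt p * ((\<rho> * tt p) * exp (\<rho> * tt p)) + (\<rho> * tt p)\<^sup>2 * exp (\<rho> * tt p)"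
    unfolding y_def
    by (rule conv_tail_bound[OF x(1,2,3)]) (use xi[OF p] z0 exp_tail_sums[OF z0] in \<open>auto simp: x_def\<close>)
  also have "\<dots> = exp (\<rho> * tt p) * (xi p + \<rho> * (tt p)\<^sup>2 + \<rho>\<^sup>2 * (tt p)\<^sup>2)"
    by (simp add: power2_eq_square algebra_simps)
  also have "\<dots> \<le> exp \<rho> * (2 * \<rho>\<^sup>2 * (xi p + (tt p)\<^sup>2))"
  proof (intro mult_mono)
    show "exp (\<rho> * tt p) \<le> exp \<rho>" using r tp by (simp add: mult_left_le)
    have r2: "\<rho> \<le> \<rho>\<^sup>2" "1 \<le> \<rho>\<^sup>2" using r by (auto simp: power2_eq_square) (metis mult_mono' mult_1 zero_le_one)
    have "xi p * 1 \<le> xi p * (2 * \<rho>\<^sup>2)" using r2 xi_nonneg[OF p] by (intro mult_left_mono) auto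
    moreover have "\<rho> * (tt p)\<^sup>2 \<le> \<rho>\<^sup>2 * (tt p)\<^sup>2" using r2 by (intro mult_right_mono) auto
    ultimately show "xi p + \<rho> * (tt p)\<^sup>2 + \<rho>\<^sup>2 * (tt p)\<^sup>2 \<le> 2 * \<rho>\<^sup>2 * (xi p + (tt p)\<^sup>2)"
      by (simp add: algebra_simps)
  qed (use r xi_nonneg[OF p] in auto)
  finally have le: "(\<Sum>a=2..K. half_norm C p a) \<le> exp \<rho> * (2 * \<rho>\<^sup>2 * (xi p + (tt p)\<^sup>2))" .
  have "(\<Sum>a=2..K. (half_norm C p a)\<^sup>2) \<le> (\<Sum>a=2..K. half_norm C p a)\<^sup>2"
    by (rule sum_squares_le_square_sum) (auto simp: half_norm_nonneg)
  also have "\<dots> \<le> (exp \<rho> * (2 * \<rho>\<^sup>2 * (xi p + (tt p)\<^sup>2)))\<^sup>2"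
    by (rule power_mono[OF le]) (intro sum_nonneg half_norm_nonneg)
  also have "\<dots> = CR \<rho> * RR p"
    by (simp add: CR_def RR_def power_mult_distrib exp_double power2_eq_square power4_eq_xxxx)
  finally show ?thesis .
qed

lemma bsum_multiplicative:
  assumes A: "finite A" "\<And>p. p \<in> A \<Longrightarrow> prime p" "\<And>p. p \<in> A \<Longrightarrow> tt p \<le> 1" and r: "\<rho> \<ge> 1"
    and C: "multiplicative C" "C 1 = 1"
    and Cp: "\<And>p. p \<in> A \<Longrightarrow> (norm (C p))\<^sup>2 \<le> \<mu> p * (norm (f p))\<^sup>2"
    and Ca: "\<And>p a. p \<in> A \<Longrightarrow> a \<ge> 2 \<Longrightarrow> norm (C (p ^ a)) \<le> (\<Sum>b\<le>a. norm (f (p ^ b)) * ((\<rho> * norm (f p)) ^ (a - b) / fact (a - b)))"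
  shows "bsum (\<lambda>n. (norm (C n))\<^sup>2 / real n) (nums_over A) (exp (\<Sum>p\<in>A. \<mu> p * (tt p)\<^sup>2 + CR \<rho> * RR p))"
proof -
  have "bsum (\<lambda>n. (norm (C n))\<^sup>2 / real n) (nums_over A) (\<Prod>p\<in>A. exp (\<mu> p * (tt p)\<^sup>2 + CR \<rho> * RR p))"
  proof (rule bsum_nums_over_prod[OF A(1,2)])
    fix a b :: nat assume "a > 0" "b > 0" "coprime a b"
    then show "(norm (C (a * b)))\<^sup>2 / real (a * b) \<le> (norm (C a))\<^sup>2 / real a * ((norm (C b))\<^sup>2 / real b)"
      using C by (simp add: multiplicative_def norm_mult power_mult_distrib)
  next
    fix p K assume p: "p \<in> A"
    have p0: "p > 0" using A(2)[OF p] prime_gt_0_nat by simp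
    have "(\<Sum>a\<le>K. (norm (C (p ^ a)))\<^sup>2 / real (p ^ a)) = (\<Sum>a\<le>K. (half_norm C p a)\<^sup>2)"
      by (simp only: half_norm_sq[OF p0])
    also have "\<dots> \<le> (\<Sum>a\<in>insert 0 (insert 1 {2..K}). (half_norm C p a)\<^sup>2)"
      by (rule sum_mono2) (auto simp: not_le)
    also have "\<dots> = 1 + (norm (C p))\<^sup>2 / real p + (\<Sum>a=2..K. (half_norm C p a)\<^sup>2)"
      using half_norm_sq[OF p0, of C 1] C p0 by (simp add: half_norm_def)
    also have "\<dots> \<le> 1 + \<mu> p * (tt p)\<^sup>2 + CR \<rho> * RR p"
    proof -
      have "(norm (C p))\<^sup>2 / real p \<le> \<mu> p * (norm (f p))\<^sup>2 / real p" by (intro divide_right_mono Cp[OF p]) simp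
      also have "\<dots> = \<mu> p * (tt p)\<^sup>2" using p0 by (simp add: tt_sq)
      finally show ?thesis using euler_tail[OF A(2)[OF p] A(3)[OF p] r Ca[OF p], of K] by linarith
    qed
    also have "\<dots> \<le> exp (\<mu> p * (tt p)\<^sup>2 + CR \<rho> * RR p)"
      using exp_ge_add_one_self[of "\<mu> p * (tt p)\<^sup>2 + CR \<rho> * RR p"] by linarith
    finally show "(\<Sum>a\<le>K. (norm (C (p ^ a)))\<^sup>2 / real (p ^ a)) \<le> exp (\<mu> p * (tt p)\<^sup>2 + CR \<rho> * RR p)" .
  qed (use C in auto)
  then show ?thesis using A(1) by (simp add: exp_sum)
qed

text \<open>Rankin's trick: a weight bounded by \<delta> \<rho>^j is replaced by \<delta>
  \<rho>^Omega, which is multiplicative. Absolute values lose all cancellation at primes, whence (1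
  + \<rho>)^2; this is affordable only next to an exponentially small factor.\<close>

lemma bsum_conv_rankin:
  assumes A: "finite A" "\<And>p. p \<in> A \<Longrightarrow> prime p" "\<And>p. p \<in> A \<Longrightarrow> tt p \<le> 1" and r: "\<rho> \<ge> 1"
    and F: "\<And>n. n > 0 \<Longrightarrow> norm (F n) \<le> norm (f n)" and psi: "\<And>j. norm (\<psi> j) \<le> \<delta> * \<rho> ^ j" 
  shows "bsum (\<lambda>n. (norm (dirichlet_conv F (wt f \<psi> A) n))\<^sup>2 / real n) (nums_over A)
     (\<delta>\<^sup>2 * exp (\<Sum>p\<in>A. (1 + \<rho>)\<^sup>2 * (tt p)\<^sup>2 + CR \<rho> * RR p))"
proof -
  define fa where "fa n = complex_of_real (norm (f n))" for n
  define H where "H = dirichlet_conv fa (omwt fa (of_real \<rho>))"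
  have d0: "\<delta> \<ge> 0" using psi[of 0] order_trans[OF norm_ge_zero] by simp
  have fam: "multiplicative fa" using f_mult by (simp add: multiplicative_def fa_def norm_mult)
  have om: "omwt fa (of_real \<rho>) n = of_real (\<rho> ^ Om n * norm (ftil f n))" for n
    unfolding omwt_def fa_def ftil_norm by simp
  have Hn: "H n = of_real (\<Sum>d | d dvd n. norm (f d) * (\<rho> ^ Om (n div d) * norm (ftil f (n div d))))" for n
    unfolding H_def dirichlet_conv_def om fa_def by simp
  have normH: "norm (H n) = (\<Sum>d | d dvd n. norm (f d) * (\<rho> ^ Om (n div d) * norm (ftil f (n div d))))" for n
    unfolding Hn norm_of_real using r by (intro abs_of_nonneg sum_nonneg) auto
  have "bsum (\<lambda>n. (norm (H n))\<^sup>2 / real n) (nums_over A) (exp (\<Sum>p\<in>A. (1 + \<rho>)\<^sup>2 * (tt p)\<^sup>2 + CR \<rho> * RR p))"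
  proof (rule bsum_multiplicative[OF A r])
    show "multiplicative H" unfolding H_def by (rule multiplicative_dirichlet_conv[OF fam multiplicative_omwt])
    show "H 1 = 1" unfolding H_def dirichlet_conv_at_one using f_one by (simp add: fa_def)
  next
    fix p assume "p \<in> A"
    then have p: "prime p" using A by blast
    have "H (p ^ 1) = fa p + of_real \<rho> * fa p"
      unfolding H_def dirichlet_conv_prime_power[OF p] omwt_prime_power[OF p]
      using f_one by (simp add: fa_def)
    then have "norm (H p) = (1 + \<rho>) * norm (f p)"
      using r by (simp add: fa_def norm_mult[symmetric] distrib_right[symmetric] flip: of_real_add of_real_mult)
        (simp add: algebra_simps)?
    then show "(norm (H p))\<^sup>2 \<le> (1 + \<rho>)\<^sup>2 * (norm (f p))\<^sup>2" by (simp add: power_mult_distrib)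
    fix a :: nat
    show "norm (H (p ^ a)) \<le> (\<Sum>b\<le>a. norm (f (p ^ b)) * ((\<rho> * norm (f p)) ^ (a - b) / fact (a - b)))"
      unfolding H_def dirichlet_conv_prime_power[OF p] omwt_prime_power[OF p]
      by (rule order_trans[OF norm_sum]) (use r in \<open>simp add: fa_def norm_mult norm_divide norm_power\<close>)
  qed
  then have "bsum (\<lambda>n. \<delta>\<^sup>2 * ((norm (H n))\<^sup>2 / real n)) (nums_over A) (\<delta>\<^sup>2 * exp (\<Sum>p\<in>A. (1 + \<rho>)\<^sup>2 * (tt p)\<^sup>2 + CR \<rho> * RR p))"
    by (rule bsum_cmult) simp
  then show ?thesis
  proof (rule bsum_mono)
    fix n assume n: "n \<in> nums_over A"
    have n0: "n > 0" using n by (rule nums_over_pos)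
    have "norm (dirichlet_conv F (wt f \<psi> A) n) \<le> (\<Sum>d | d dvd n. \<delta> * (norm (f d) * (\<rho> ^ Om (n div d) * norm (ftil f (n div d)))))"
      unfolding dirichlet_conv_def
    proof (rule order_trans[OF norm_sum], rule sum_mono)
      fix d assume "d \<in> {d. d dvd n}"
      then have d: "d > 0" using n0 by (auto intro!: gr0I)
      have "norm (wt f \<psi> A (n div d)) \<le> \<delta> * \<rho> ^ Om (n div d) * norm (ftil f (n div d))"
        unfolding wt_def using psi r d0 by (auto simp: norm_mult intro: mult_right_mono)
      then have "norm (F d * wt f \<psi> A (n div d)) \<le> norm (f d) * (\<delta> * \<rho> ^ Om (n div d) * norm (ftil f (n div d)))"
        unfolding norm_mult using F[OF d] by (intro mult_mono) auto
      then show "norm (F d * wt f \<psi> A (n div d)) \<le> \<delta> * (norm (f d) * (\<rho> ^ Om (n div d) * norm (ftil f (n div d))))"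
        by (simp add: mult_ac)
    qed
    also have "\<dots> = \<delta> * norm (H n)" unfolding normH by (simp only: sum_distrib_left)
    finally have "(norm (dirichlet_conv F (wt f \<psi> A) n))\<^sup>2 \<le> (\<delta> * norm (H n))\<^sup>2" by (rule power_mono) simp
    then show "(norm (dirichlet_conv F (wt f \<psi> A) n))\<^sup>2 / real n \<le> \<delta>\<^sup>2 * ((norm (H n))\<^sup>2 / real n)"
      by (simp add: power_mult_distrib divide_right_mono)
  qed auto
qed

lemma wt_power: "n \<in> nums_over A \<Longrightarrow> wt f (\<lambda>j. \<alpha> ^ j) A n = omwt f \<alpha> n"
  by (simp add: wt_def omwt_def)

lemma conv_wt_power:
  "n \<in> nums_over A \<Longrightarrow> dirichlet_conv F (wt f (\<lambda>j. \<alpha> ^ j) A) n = dirichlet_conv F (omwt f \<alpha>) n"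
  unfolding dirichlet_conv_def
  by (intro sum.cong refl) (metis nums_over_dvd wt_power dvd_div_mult_self dvd_triv_left mem_Collect_eq)

text \<open>Without truncation the coefficient F p + \<alpha> f p keeps its cancellation, recorded
  by \<mu>. For F = f and \<alpha> = \<kappa> - 1 it is \<kappa> f p, the origin of the exponent
  \<kappa>^2.\<close>

lemma bsum_conv_full:
  assumes A: "finite A" "\<And>p. p \<in> A \<Longrightarrow> prime p" "\<And>p. p \<in> A \<Longrightarrow> tt p \<le> 1"
    and F: "multiplicative F" "F 1 = 1" "\<And>n. n > 0 \<Longrightarrow> norm (F n) \<le> norm (f n)" and al: "norm \<alpha> \<le> 1"
    and mu: "\<And>p. p \<in> A \<Longrightarrow> (norm (F p + \<alpha> * f p))\<^sup>2 \<le> \<mu> p * (norm (f p))\<^sup>2"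
  shows "bsum (\<lambda>n. (norm (dirichlet_conv F (wt f (\<lambda>j. \<alpha> ^ j) A) n))\<^sup>2 / real n) (nums_over A)
     (exp (\<Sum>p\<in>A. \<mu> p * (tt p)\<^sup>2 + CR 1 * RR p))"
proof -
  let ?C = "dirichlet_conv F (omwt f \<alpha>)"
  have "bsum (\<lambda>n. (norm (?C n))\<^sup>2 / real n) (nums_over A) (exp (\<Sum>p\<in>A. \<mu> p * (tt p)\<^sup>2 + CR 1 * RR p))"
  proof (rule bsum_multiplicative[OF A order_refl])
    show "multiplicative ?C" by (rule multiplicative_dirichlet_conv[OF F(1) multiplicative_omwt])
    show "?C 1 = 1" unfolding dirichlet_conv_at_one using F by simp
  next
    fix p assume pA: "p \<in> A"
    then have p: "prime p" using A by blast
    have "?C (p ^ 1) = F p + \<alpha> * f p"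
      unfolding dirichlet_conv_prime_power[OF p] omwt_prime_power[OF p] using F by simp
    then show "(norm (?C p))\<^sup>2 \<le> \<mu> p * (norm (f p))\<^sup>2" using mu[OF pA] by simp
    fix a :: nat
    have "norm (?C (p ^ a)) \<le> (\<Sum>b\<le>a. norm (F (p ^ b) * ((\<alpha> * f p) ^ (a - b) / fact (a - b))))"
      unfolding dirichlet_conv_prime_power[OF p] omwt_prime_power[OF p] by (rule norm_sum)
    also have "\<dots> \<le> (\<Sum>b\<le>a. norm (f (p ^ b)) * ((1 * norm (f p)) ^ (a - b) / fact (a - b)))"
    proof (rule sum_mono)
      fix b
      have "norm (\<alpha> * f p) \<le> 1 * norm (f p)" unfolding norm_mult using al by (intro mult_right_mono) auto
      then have "norm ((\<alpha> * f p) ^ (a - b) / fact (a - b)) \<le> (1 * norm (f p)) ^ (a - b) / fact (a - b)"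
        unfolding norm_divide norm_power by (simp add: divide_right_mono power_mono)
      then show "norm (F (p ^ b) * ((\<alpha> * f p) ^ (a - b) / fact (a - b))) \<le> norm (f (p ^ b)) * ((1 * norm (f p)) ^ (a - b) / fact (a - b))"
        unfolding norm_mult[of "F (p ^ b)"] using F(3)[of "p ^ b"] p prime_gt_0_nat by (intro mult_mono) auto
    qed
    finally show "norm (?C (p ^ a)) \<le> (\<Sum>b\<le>a. norm (f (p ^ b)) * ((1 * norm (f p)) ^ (a - b) / fact (a - b)))" .
  qed simp
  then show ?thesis by (rule bsum_mono) (simp_all add: conv_wt_power)
qed

end

text \<open>An additive integer valued substitute for the logarithm, so that a cutoff on it is a finite
  Fourier sum of functions that twist the coefficients multiplicatively.\<close>

definition hh :: "nat \<Rightarrow> nat" where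
  "hh n = sum_mset (image_mset (\<lambda>p. nat \<lceil>ln (real p)\<rceil>) (prime_factorization n))"

lemma hh_mult: "m > 0 \<Longrightarrow> n > 0 \<Longrightarrow> hh (m * n) = hh m + hh n"
  by (simp add: hh_def prime_factorization_mult)

lemma hh_one [simp]: "hh (Suc 0) = 0" "hh 1 = 0" by (simp_all add: hh_def)

lemma hh_prime: "prime p \<Longrightarrow> hh p = nat \<lceil>ln (real p)\<rceil>"
  by (simp add: hh_def prime_factorization_prime)

lemma hh_dvd_le: "n > 0 \<Longrightarrow> d dvd n \<Longrightarrow> hh d \<le> hh n"
  by (elim dvdE) (auto simp: hh_mult)

text \<open>Rounding up at most doubles ln p because already ln 2 exceeds 1 / 2.\<close>

lemma ceil_ln_prime_bounds:
  assumes p: "prime (p::nat)"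
  shows "ln (real p) \<le> real (nat \<lceil>ln (real p)\<rceil>)" "real (nat \<lceil>ln (real p)\<rceil>) \<le> 2 * ln (real p)"
proof -
  have p2: "real p \<ge> 2" using prime_ge_2_nat[OF p] by simp
  have "ln 2 \<le> ln (real p)" using p2 by simp
  then have l: "ln (real p) \<ge> 1 / 2" using ln2_ge_two_thirds by linarith
  show "ln (real p) \<le> real (nat \<lceil>ln (real p)\<rceil>)" by (rule real_nat_ceiling_ge)
  show "real (nat \<lceil>ln (real p)\<rceil>) \<le> 2 * ln (real p)"
  proof (cases "ln (real p) \<le> 1")
    case True
    then have "\<lceil>ln (real p)\<rceil> \<le> 1" by simp
    then have "real (nat \<lceil>ln (real p)\<rceil>) \<le> 1" by linarith
    then show ?thesis using l by linarith
  next
    case False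
    have "real (nat \<lceil>ln (real p)\<rceil>) \<le> ln (real p) + 1" using l by linarith
    then show ?thesis using False by linarith
  qed
qed

lemma ln_prime_factorization:
  assumes "n > 0"
  shows "ln (real n) = sum_mset (image_mset (\<lambda>p. ln (real p)) (prime_factorization n))"
proof -
  have *: "(\<And>p. p \<in># A \<Longrightarrow> prime p) \<Longrightarrow> ln (real (prod_mset A)) = sum_mset (image_mset (\<lambda>p. ln (real p)) A)" for A :: "nat multiset"
  proof (induction A)
    case (add p A)
    have "prime p" "\<And>q. q \<in># A \<Longrightarrow> prime q" using add.prems by auto
    then have p0: "p > 0" and "0 \<notin># A" using prime_gt_0_nat by auto
    then have "prod_mset A > 0" by (auto intro!: gr0I)
    then have "ln (real (p * prod_mset A)) = ln (real p) + ln (real (prod_mset A))"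
      using p0 by (simp only: of_nat_mult, intro ln_mult_pos) (simp_all only: of_nat_0_less_iff)
    also have "ln (real (prod_mset A)) = sum_mset (image_mset (\<lambda>p. ln (real p)) A)"
      using add by auto
    finally show ?case by simp
  qed simp
  have "ln (real n) = ln (real (prod_mset (prime_factorization n)))"
    using assms by (simp add: prod_mset_prime_factorization_nat)
  also have "\<dots> = sum_mset (image_mset (\<lambda>p. ln (real p)) (prime_factorization n))" by (rule *) auto
  finally show ?thesis .
qed

lemma hh_bounds:
  assumes "n > 0"
  shows "ln (real n) \<le> real (hh n)" "real (hh n) \<le> 2 * ln (real n)"
proof -
  have h: "real (hh n) = sum_mset (image_mset (\<lambda>p. real (nat \<lceil>ln (real p)\<rceil>)) (prime_factorization n))"
  proof -
    have "real (sum_mset (image_mset g A)) = sum_mset (image_mset (\<lambda>x. real (g x)) A)" for g and A :: "nat multiset"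
      by (induction A) auto
    then show ?thesis unfolding hh_def by blast
  qed
  show "ln (real n) \<le> real (hh n)"
    unfolding h ln_prime_factorization[OF assms]
    by (rule sum_mset_mono) (use ceil_ln_prime_bounds in auto)
  have "real (hh n) \<le> sum_mset (image_mset (\<lambda>p. 2 * ln (real p)) (prime_factorization n))"
    unfolding h by (rule sum_mset_mono) (use ceil_ln_prime_bounds in auto)
  also have "\<dots> = 2 * ln (real n)" unfolding ln_prime_factorization[OF assms] by (simp add: sum_mset_distrib_left)
  finally show "real (hh n) \<le> 2 * ln (real n)" .
qed

lemma hh_le_Om:
  assumes "n \<in> nums_over A" "\<And>p. p \<in> A \<Longrightarrow> prime p \<Longrightarrow> ln (real p) \<le> real B"
  shows "hh n \<le> B * Om n"
proof -
  have "hh n \<le> sum_mset (image_mset (\<lambda>p. B) (prime_factorization n))"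
    unfolding hh_def
  proof (rule sum_mset_mono)
    fix p assume "p \<in># prime_factorization n"
    then have "p \<in> A" "prime p" using assms(1) by (auto simp: nums_over_def)
    then show "nat \<lceil>ln (real p)\<rceil> \<le> B" using assms(2) by (simp add: nat_le_iff ceiling_le_iff)
  qed
  then show ?thesis by (simp add: Om_def mult.commute)
qed

section \<open>Products of Dirichlet polynomials over disjoint sets of primes\<close>

primrec dprod :: "(nat \<Rightarrow> nat \<Rightarrow> complex) \<Rightarrow> nat \<Rightarrow> nat \<Rightarrow> complex" where
  "dprod x 0 = conv_one"
| "dprod x (Suc r) = dirichlet_conv (dprod x r) (x r)"

lemma fin_supp_conv_one: "fin_supp conv_one"
  by (simp add: fin_supp_def conv_one_def)

lemma dpoly_conv_one: "dpoly conv_one s = 1"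
proof -
  have "dpoly conv_one s = (\<Sum>n\<in>{1}. conv_one n * of_nat n powr (- s))"
    by (rule dpoly_superset) (auto simp: conv_one_def split: if_splits)
  then show ?thesis by (simp add: conv_one_def)
qed

lemma fin_supp_dprod: "(\<And>r. r < n \<Longrightarrow> fin_supp (x r)) \<Longrightarrow> fin_supp (dprod x n)"
  by (induction n) (auto intro: fin_supp_conv(1) fin_supp_conv_one)

lemma dpoly_dprod: "(\<And>r. r < n \<Longrightarrow> fin_supp (x r)) \<Longrightarrow> dpoly (dprod x n) s = (\<Prod>r<n. dpoly (x r) s)"
  by (induction n) (simp_all add: dpoly_conv_one dpoly_conv fin_supp_dprod)

lemma dprod_supp:
  assumes "\<And>r. r < n \<Longrightarrow> fin_supp (x r)" "\<And>r e. r < n \<Longrightarrow> x r e \<noteq> 0 \<Longrightarrow> e \<in> nums_over (I r) \<and> hh e \<le> B r"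
    and "dprod x n e \<noteq> 0"
  shows "e \<in> nums_over (\<Union>r<n. I r) \<and> hh e \<le> (\<Sum>r<n. B r)"
  using assms
proof (induction n arbitrary: e)
  case 0
  then show ?case by (auto simp: conv_one_def split: if_splits)
next
  case (Suc n)
  have fs: "fin_supp (dprod x n)" "fin_supp (x n)" using Suc.prems fin_supp_dprod[of n x] by auto
  obtain d e' where de: "dprod x n d \<noteq> 0" "x n e' \<noteq> 0" "e = d * e'"
    using fin_supp_conv(2)[OF fs, of e] Suc.prems(3) unfolding dprod.simps by blast
  have d: "d \<in> nums_over (\<Union>r<n. I r)" "hh d \<le> (\<Sum>r<n. B r)" using Suc.IH[of d] Suc.prems de by auto
  have e': "e' \<in> nums_over (I n)" "hh e' \<le> B n" using Suc.prems(2)[of n e'] de by auto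
  have "d \<in> nums_over (\<Union>r<Suc n. I r)" by (rule subsetD[OF nums_over_mono d(1)], rule UN_mono) auto
  moreover have "e' \<in> nums_over (\<Union>r<Suc n. I r)" by (rule subsetD[OF nums_over_mono e'(1)]) auto
  moreover have "hh e = hh d + hh e'" using de d(1) e'(1) by (simp add: hh_mult nums_over_pos)
  ultimately show ?case using de d(2) e'(2) by (simp add: nums_over_mult_iff)
qed

text \<open>The convolution of a multiplicative F with a product over disjoint prime sets factors
  along these sets, so the bounds multiply.\<close>

lemma bsum_conv_dprod:
  assumes F: "multiplicative F" "F 1 = 1"
    and x: "\<And>r e. r < n \<Longrightarrow> x r e \<noteq> 0 \<Longrightarrow> e \<in> nums_over (I r)" "\<And>r. r < n \<Longrightarrow> fin_supp (x r)"
    and disj: "\<And>r s. r < n \<Longrightarrow> s < n \<Longrightarrow> r \<noteq> s \<Longrightarrow> I r \<inter> I s = {}"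
    and K: "\<And>r. r < n \<Longrightarrow> bsum (\<lambda>k. (norm (dirichlet_conv F (x r) k))\<^sup>2 / real k) (nums_over (I r)) (K r)"
  shows "bsum (\<lambda>k. (norm (dirichlet_conv F (dprod x n) k))\<^sup>2 / real k) (nums_over (\<Union>r<n. I r)) (\<Prod>r<n. K r)"
  using assms
proof (induction n)
  case 0
  show ?case
  proof (rule bsumI)
    fix G :: "nat set" assume "finite G" "G \<subseteq> nums_over (\<Union>r<0. I r)"
    then have "G \<subseteq> {1}" by (simp add: nums_over_empty)
    then have "G = {} \<or> G = {1}" by (rule subset_singletonD)
    then show "(\<Sum>k\<in>G. (norm (dirichlet_conv F (dprod x 0) k))\<^sup>2 / real k) \<le> (\<Prod>r<0. K r)"
      by (elim disjE) (simp_all add: dirichlet_conv_one_right F(2)[simplified])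
  qed
next
  case (Suc n)
  have "I r \<inter> I n = {}" if "r < n" for r using Suc.prems(5)[of r n] that by simp
  then have D: "(\<Union>r<n. I r) \<inter> I n = {}" by blast
  have fs: "fin_supp (x r)" if "r < n" for r using Suc.prems(4) that by simp
  have dp: "dprod x n k \<noteq> 0 \<Longrightarrow> k \<in> nums_over (\<Union>r<n. I r)" for k
    using dprod_supp[of n x I "\<lambda>r. Max (hh ` {e. x r e \<noteq> 0})" k] fs Suc.prems(3)
    by (auto simp: fin_supp_def intro!: Max_ge)
  have "bsum (\<lambda>k. (norm (dirichlet_conv F (dprod x (Suc n)) k))\<^sup>2 / real k) (nums_over ((\<Union>r<n. I r) \<union> I n)) ((\<Prod>r<n. K r) * K n)"
  proof (rule bsum_nums_over_Un[OF D])
    show "bsum (\<lambda>k. (norm (dirichlet_conv F (dprod x n) k))\<^sup>2 / real k) (nums_over (\<Union>r<n. I r)) (\<Prod>r<n. K r)"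
      using Suc by simp
    show "bsum (\<lambda>k. (norm (dirichlet_conv F (x n) k))\<^sup>2 / real k) (nums_over (I n)) (K n)"
      using Suc.prems by simp
    fix a b assume ab: "a \<in> nums_over (\<Union>r<n. I r)" "b \<in> nums_over (I n)"
    have "dirichlet_conv F (dprod x (Suc n)) (a * b) = dirichlet_conv F (dprod x n) a * dirichlet_conv F (x n) b"
      unfolding dprod.simps
      by (rule dirichlet_conv_mult_supported[OF F(1) D dp _ ab]) (use Suc.prems(3)[of n] in auto)
    then show "(norm (dirichlet_conv F (dprod x (Suc n)) (a * b)))\<^sup>2 / real (a * b) \<le>
        (norm (dirichlet_conv F (dprod x n) a))\<^sup>2 / real a * ((norm (dirichlet_conv F (x n) b))\<^sup>2 / real b)"
      by (simp add: norm_mult power_mult_distrib)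
  qed auto
  then show ?case by (simp add: lessThan_Suc Un_commute mult.commute)
qed

section \<open>Coefficients of the truncated exponential and of the high power\<close>

definition trunc_pow :: "real \<Rightarrow> nat \<Rightarrow> nat \<Rightarrow> complex" where
  "trunc_pow \<alpha> l j = (if j \<le> l then of_real (\<alpha> ^ j) else 0)"

text \<open>M! cancels the denominator in \<open>wt\<close>, so the polynomial is (180 P / l)^M and
  its squared modulus is \<open>Bpart\<close>.\<close>

definition top_pow :: "nat \<Rightarrow> nat \<Rightarrow> nat \<Rightarrow> complex" where
  "top_pow l M j = (if j = M then of_real ((180 / real l) ^ M * fact M) else 0)"

lemma dpoly_trunc_pow:
  assumes A: "finite A" "\<And>p. p \<in> A \<Longrightarrow> prime p"
  shows "dpoly (wt f (trunc_pow \<alpha> l) A) s = texp l (of_real \<alpha> * (\<Sum>p\<in>A. f p * of_nat p powr (- s)))"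
proof -
  have "dpoly (wt f (trunc_pow \<alpha> l) A) s = (\<Sum>j\<le>l. trunc_pow \<alpha> l j * (\<Sum>p\<in>A. f p * of_nat p powr (- s)) ^ j / fact j)"
    by (rule dpoly_wt[OF A]) (auto simp: trunc_pow_def)
  also have "\<dots> = texp l (of_real \<alpha> * (\<Sum>p\<in>A. f p * of_nat p powr (- s)))"
    unfolding texp_def by (intro sum.cong refl) (simp add: trunc_pow_def power_mult_distrib)
  finally show ?thesis .
qed

lemma dpoly_top_pow:
  assumes A: "finite A" "\<And>p. p \<in> A \<Longrightarrow> prime p"
  shows "(norm (dpoly (wt f (top_pow l M) A) s))\<^sup>2 = Bpart l M (\<Sum>p\<in>A. f p * of_nat p powr (- s))"
proof -
  let ?P = "\<Sum>p\<in>A. f p * of_nat p powr (- s)"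
  have "dpoly (wt f (top_pow l M) A) s = (\<Sum>j\<le>M. top_pow l M j * ?P ^ j / fact j)"
    by (rule dpoly_wt[OF A]) (auto simp: top_pow_def)
  also have "\<dots> = (\<Sum>j\<in>{M}. top_pow l M j * ?P ^ j / fact j)"
    by (rule sum.mono_neutral_right) (auto simp: top_pow_def)
  also have "\<dots> = (of_real (180 / real l) * ?P) ^ M" by (simp add: top_pow_def power_mult_distrib power_divide)
  finally have "norm (dpoly (wt f (top_pow l M) A) s) = (180 * norm ?P / real l) ^ M"
    by (simp add: norm_power norm_mult norm_divide)
  then show ?thesis unfolding Bpart_def by (simp add: power_mult[symmetric] mult.commute)
qed

lemma norm_add_sq_le:
  fixes x y :: complex
  assumes e: "e > 0"
  shows "(norm (x + y))\<^sup>2 \<le> (1 + e) * (norm x)\<^sup>2 + (1 + 1 / e) * (norm y)\<^sup>2"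
proof -
  have "(norm (x + y))\<^sup>2 \<le> (norm x + norm y)\<^sup>2" by (intro power_mono norm_triangle_ineq) auto
  also have "\<dots> = (norm x)\<^sup>2 + 2 * norm x * norm y + (norm y)\<^sup>2" by (simp add: power2_sum)
  also have "2 * norm x * norm y \<le> e * (norm x)\<^sup>2 + (1 / e) * (norm y)\<^sup>2"
  proof -
    have "0 \<le> (e * norm x - norm y)\<^sup>2 / e" using e by simp
    also have "\<dots> = e * (norm x)\<^sup>2 - 2 * norm x * norm y + (1 / e) * (norm y)\<^sup>2"
      using e by (simp add: power2_eq_square field_simps)
    finally show ?thesis by simp
  qed
  finally show ?thesis by (simp add: algebra_simps)
qed

context prime_data
begin

lemma bsum_conv_rankin_bound:
  assumes A: "finite A" "\<And>p. p \<in> A \<Longrightarrow> prime p" "\<And>p. p \<in> A \<Longrightarrow> tt p \<le> 1" and r: "\<rho> \<ge> 1"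
    and F: "\<And>n. n > 0 \<Longrightarrow> norm (F n) \<le> norm (f n)" and psi: "\<And>j. norm (\<psi> j) \<le> \<delta> * \<rho> ^ j"
    and V: "(\<Sum>p\<in>A. (tt p)\<^sup>2) \<le> V" and R0: "(\<Sum>p\<in>A. RR p) \<le> R0"
  shows "bsum (\<lambda>n. (norm (dirichlet_conv F (wt f \<psi> A) n))\<^sup>2 / real n) (nums_over A)
     (\<delta>\<^sup>2 * exp ((1 + \<rho>)\<^sup>2 * V + CR \<rho> * R0))"
proof -
  have "(\<Sum>p\<in>A. (1 + \<rho>)\<^sup>2 * (tt p)\<^sup>2 + CR \<rho> * RR p) = (1 + \<rho>)\<^sup>2 * (\<Sum>p\<in>A. (tt p)\<^sup>2) + CR \<rho> * (\<Sum>p\<in>A. RR p)"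
    by (simp add: sum.distrib sum_distrib_left)
  also have "\<dots> \<le> (1 + \<rho>)\<^sup>2 * V + CR \<rho> * R0" using V R0 CR_nonneg by (intro add_mono mult_left_mono) auto
  finally show ?thesis
    by (intro bsum_mono[OF bsum_conv_rankin[OF A r F psi]] mult_left_mono) auto
qed

text \<open>Write the truncation as the full exponential minus its terms j > l. On those 1 <= exp (-
  l) 3^j, so Rankin's bound applies with \<rho> = 3 and \<delta> = e = exp (- l); (1 + 3)^2 = 16.
  The square of the sum is split with weights 1 + e and 1 + 1 / e, and since the tail has size e^2
  both losses are of order e.\<close>

lemma bsum_trunc:
  assumes A: "finite A" "\<And>p. p \<in> A \<Longrightarrow> prime p" "\<And>p. p \<in> A \<Longrightarrow> tt p \<le> 1"
    and F: "multiplicative F" "F 1 = 1" "\<And>n. n > 0 \<Longrightarrow> norm (F n) \<le> norm (f n)" and al: "\<bar>\<alpha>\<bar> \<le> 1"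
    and mu: "\<And>p. p \<in> A \<Longrightarrow> (norm (F p + of_real \<alpha> * f p))\<^sup>2 \<le> \<mu> p * (norm (f p))\<^sup>2" "\<And>p. p \<in> A \<Longrightarrow> \<mu> p \<ge> 0"
    and V: "(\<Sum>p\<in>A. (tt p)\<^sup>2) \<le> V" and R0: "(\<Sum>p\<in>A. RR p) \<le> R0"
  shows "bsum (\<lambda>n. (norm (dirichlet_conv F (wt f (trunc_pow \<alpha> l) A) n))\<^sup>2 / real n) (nums_over A)
     (exp ((\<Sum>p\<in>A. \<mu> p * (tt p)\<^sup>2 + CR 1 * RR p) + (1 + 2 * exp (16 * V + CR 3 * R0)) * exp (- real l)))"
proof -
  define K1 where "K1 = exp (\<Sum>p\<in>A. \<mu> p * (tt p)\<^sup>2 + CR 1 * RR p)"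
  define C where "C = exp (16 * V + CR 3 * R0)"
  define e where "e = exp (- real l)"
  have e: "e > 0" "e \<le> 1" by (auto simp: e_def)
  define \<psi> where "\<psi> j = (if j \<le> l then 0 else - (of_real (\<alpha> ^ j)) :: complex)" for j
  have b1: "bsum (\<lambda>n. (norm (dirichlet_conv F (wt f (\<lambda>j. of_real \<alpha> ^ j) A) n))\<^sup>2 / real n) (nums_over A) K1"
    unfolding K1_def by (rule bsum_conv_full[OF A F]) (use al mu in auto)
  have psi: "norm (\<psi> j) \<le> e * 3 ^ j" for j
  proof (cases "j \<le> l")
    case False
    have "1 \<le> exp (real j - real l)" using False by simp
    also have "\<dots> = e * exp (real j)" by (simp add: e_def exp_add[symmetric])
    also have "\<dots> \<le> e * 3 ^ j" using e by (intro mult_left_mono exp_real_le_3_power) auto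
    finally have "1 \<le> e * 3 ^ j" .
    moreover have "\<bar>\<alpha>\<bar> ^ j \<le> 1" using al by (intro power_le_one) auto
    ultimately show ?thesis using False by (simp add: \<psi>_def norm_power)
  qed (use e in \<open>simp add: \<psi>_def\<close>)
  have b2: "bsum (\<lambda>n. (norm (dirichlet_conv F (wt f \<psi> A) n))\<^sup>2 / real n) (nums_over A) (e\<^sup>2 * C)"
    using bsum_conv_rankin_bound[OF A _ F(3) psi V R0] by (simp add: C_def)
  have eq: "dirichlet_conv F (wt f (trunc_pow \<alpha> l) A) n =
      dirichlet_conv F (wt f (\<lambda>j. of_real \<alpha> ^ j) A) n + dirichlet_conv F (wt f \<psi> A) n" for n
    unfolding dirichlet_conv_def sum.distrib[symmetric] wt_def trunc_pow_def \<psi>_def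
    by (intro sum.cong refl) (auto simp: algebra_simps)
  have "bsum (\<lambda>n. (norm (dirichlet_conv F (wt f (trunc_pow \<alpha> l) A) n))\<^sup>2 / real n) (nums_over A) ((1 + e) * K1 + (1 + 1 / e) * (e\<^sup>2 * C))"
  proof (rule bsum_mono[OF bsum_add[OF bsum_cmult[OF b1, of "1 + e"] bsum_cmult[OF b2, of "1 + 1 / e"]]])
    fix n assume "n \<in> nums_over A"
    have "(norm (dirichlet_conv F (wt f (trunc_pow \<alpha> l) A) n))\<^sup>2 / real n \<le> ((1 + e) * (norm (dirichlet_conv F (wt f (\<lambda>j. of_real \<alpha> ^ j) A) n))\<^sup>2 + (1 + 1 / e) * (norm (dirichlet_conv F (wt f \<psi> A) n))\<^sup>2) / real n"
      unfolding eq by (intro divide_right_mono norm_add_sq_le e) auto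
    then show "(norm (dirichlet_conv F (wt f (trunc_pow \<alpha> l) A) n))\<^sup>2 / real n
      \<le> (1 + e) * ((norm (dirichlet_conv F (wt f (\<lambda>j. of_real \<alpha> ^ j) A) n))\<^sup>2 / real n) + (1 + 1 / e) * ((norm (dirichlet_conv F (wt f \<psi> A) n))\<^sup>2 / real n)"
      by (simp add: add_divide_distrib)
  qed (use e in auto)
  then show ?thesis
  proof (rule bsum_mono)
    have K1: "K1 \<ge> 1" unfolding K1_def using mu CR_nonneg RR_nonneg by (auto intro!: sum_nonneg)
    have "(1 + 1 / e) * (e\<^sup>2 * C) = (e + e\<^sup>2) * C" using e by (simp add: power2_eq_square field_simps)
    also have "\<dots> \<le> (e + e) * C" using e by (intro mult_right_mono add_left_mono) (auto simp: power2_eq_square mult_left_le C_def)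
    also have "\<dots> \<le> K1 * (2 * C * e)" using K1 e mult_right_mono[of 1 K1 "2 * C * e"] by (simp add: C_def mult_ac)
    finally have "(1 + e) * K1 + (1 + 1 / e) * (e\<^sup>2 * C) \<le> K1 * (1 + (1 + 2 * C) * e)"
      by (simp add: algebra_simps)
    also have "\<dots> \<le> K1 * exp ((1 + 2 * C) * e)" using K1 by (intro mult_left_mono exp_ge_add_one_self) auto
    finally show "(1 + e) * K1 + (1 + 1 / e) * (e\<^sup>2 * C) \<le>
        exp ((\<Sum>p\<in>A. \<mu> p * (tt p)\<^sup>2 + CR 1 * RR p) + (1 + 2 * exp (16 * V + CR 3 * R0)) * exp (- real l))"
      by (simp add: K1_def C_def e_def exp_add)
  qed auto
qed

text \<open>The single nonzero weight is at most (180 b)^M <= exp (- M) (540 b)^M by M! <= M^M and e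
  <= 3, so Rankin's bound applies with \<rho> = 540 b and the factor exp (- 2 M) remains.\<close>

lemma bsum_top:
  assumes A: "finite A" "\<And>p. p \<in> A \<Longrightarrow> prime p" "\<And>p. p \<in> A \<Longrightarrow> tt p \<le> 1"
    and F: "\<And>n. n > 0 \<Longrightarrow> norm (F n) \<le> norm (f n)" and l: "l \<ge> 1" and b: "b \<ge> 1"
    and V: "(\<Sum>p\<in>A. (tt p)\<^sup>2) \<le> V" and R0: "(\<Sum>p\<in>A. RR p) \<le> R0"
  shows "bsum (\<lambda>n. (norm (dirichlet_conv F (wt f (top_pow l (b * l)) A) n))\<^sup>2 / real n) (nums_over A)
     (exp ((1 + 540 * real b)\<^sup>2 * V + CR (540 * real b) * R0) * exp (- real l))"
proof -
  define M where "M = b * l"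
  define \<rho> where "\<rho> = 540 * real b"
  have r: "\<rho> \<ge> 1" using b by (simp add: \<rho>_def)
  have "l \<le> M" using b by (simp add: M_def)
  then have Ml: "real M \<ge> real l" by simp
  have psi: "norm (top_pow l M j) \<le> exp (- real M) * \<rho> ^ j" for j
  proof (cases "j = M")
    case True
    have "norm (top_pow l M j) = (180 / real l) ^ M * fact M" using True by (simp add: top_pow_def norm_mult norm_power norm_divide)
    also have "\<dots> \<le> (180 / real l) ^ M * real M ^ M" using fact_le_power[of M, where 'a = real] by (intro mult_left_mono) auto
    also have "\<dots> = (180 / real l * real M) ^ M" by (simp only: power_mult_distrib)
    also have "\<dots> = (180 * real b) ^ M" using l by (simp add: M_def)
    also have "\<dots> = exp (- real M) * (exp (real M) * (180 * real b) ^ M)" by (simp add: exp_minus)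
    also have "\<dots> \<le> exp (- real M) * (3 ^ M * (180 * real b) ^ M)"
      by (intro mult_left_mono mult_right_mono exp_real_le_3_power) auto
    also have "3 ^ M * (180 * real b) ^ M = \<rho> ^ j" by (simp only: \<rho>_def True power_mult_distrib[symmetric]) simp
    finally show ?thesis .
  qed (use r in \<open>simp add: top_pow_def\<close>)
  have "bsum (\<lambda>n. (norm (dirichlet_conv F (wt f (top_pow l M) A) n))\<^sup>2 / real n) (nums_over A)
     ((exp (- real M))\<^sup>2 * exp ((1 + \<rho>)\<^sup>2 * V + CR \<rho> * R0))"
    by (rule bsum_conv_rankin_bound[OF A r F psi V R0])
  moreover have "(exp (- real M))\<^sup>2 \<le> exp (- real l)"
    using Ml by (simp add: exp_double[symmetric])
  ultimately show ?thesis unfolding M_def[symmetric] \<rho>_def[symmetric]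
    by (elim bsum_mono) (auto simp: mult.commute intro: mult_right_mono)
qed

end

subsection \<open>The ranges of primes and the truncated series\<close>

lemma sum_inverse_squares_le: "(\<Sum>k=1..Y. 1 / (real k)\<^sup>2) \<le> 2"
proof (cases "Y = 0")
  case False
  then have "1 \<le> Y" by simp
  then have "(\<Sum>k=1..Y. 1 / (real k)\<^sup>2) \<le> 2 - 1 / real Y"
  proof (induction Y rule: dec_induct)
    case (step Y)
    have "1 / (real (Suc Y))\<^sup>2 + 1 / real (Suc Y) \<le> 1 / real Y"
    proof -
      have "1 / real Y - 1 / real (Suc Y) = 1 / (real Y * real (Suc Y))" using step(1) by (simp add: field_simps)
      moreover have "1 / (real (Suc Y))\<^sup>2 \<le> 1 / (real Y * real (Suc Y))"
        unfolding power2_eq_square using step(1) by (intro divide_left_mono mult_right_mono) auto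
      ultimately show ?thesis by linarith
    qed
    then show ?case using step by simp
  qed simp
  also have "\<dots> \<le> 2" by simp
  finally show ?thesis .
qed simp

lemma sum_int_symmetric_le:
  fixes g :: "nat \<Rightarrow> real"
  shows "(\<Sum>k\<in>{- int Y..int Y}. g (nat \<bar>k\<bar>)) = g 0 + 2 * (\<Sum>k=1..Y. g k)"
proof -
  have e: "{- int Y..int Y} = {0} \<union> (int ` {1..Y} \<union> (\<lambda>k. - int k) ` {1..Y})"
  proof (intro equalityI subsetI)
    fix k assume "k \<in> {- int Y..int Y}"
    then have k: "- int Y \<le> k" "k \<le> int Y" by auto
    consider "k = 0" | "k > 0" | "k < 0" by linarith
    then show "k \<in> {0} \<union> (int ` {1..Y} \<union> (\<lambda>k. - int k) ` {1..Y})"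
    proof cases
      case 2
      then have "k = int (nat k)" "nat k \<in> {1..Y}" using k by auto
      then show ?thesis by blast
    next
      case 3
      then have "k = - int (nat (- k))" "nat (- k) \<in> {1..Y}" using k by auto
      then show ?thesis by blast
    qed simp
  qed auto
  have "(\<Sum>k\<in>{- int Y..int Y}. g (nat \<bar>k\<bar>)) = g 0 + ((\<Sum>k\<in>int ` {1..Y}. g (nat \<bar>k\<bar>)) + (\<Sum>k\<in>(\<lambda>k. - int k) ` {1..Y}. g (nat \<bar>k\<bar>)))"
    unfolding e by (subst sum.union_disjoint, simp, simp, fastforce, subst sum.union_disjoint, simp, simp, fastforce) simp
  also have "\<dots> = g 0 + 2 * (\<Sum>k=1..Y. g k)"
    by (simp add: sum.reindex inj_on_def)
  finally show ?thesis .
qed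

text \<open>About log_2 (1 + x) of the terms are cut off at 2, the others form a geometric series.
  This lemma is the origin of all exponents of the form V / ln 2.\<close>

lemma sum_min_geometric:
  fixes x :: real
  assumes x: "x \<ge> 0"
  shows "(\<Sum>r<n. min 2 (x / 2 ^ (n - r))) \<le> 2 * (ln (1 + x) / ln 2) + 3"
proof -
  have e: "(\<Sum>r<n. min 2 (x / 2 ^ (n - r))) = (\<Sum>j=1..n. min 2 (x / 2 ^ j))"
    by (rule sum.reindex_bij_witness[where i = "\<lambda>j. n - j" and j = "\<lambda>r. n - r"]) auto
  define J where "J = nat \<lceil>ln (1 + x) / ln 2\<rceil>"
  have J: "real J \<le> ln (1 + x) / ln 2 + 1" "ln (1 + x) / ln 2 \<le> real J"
  proof -
    have "ln (1 + x) / ln 2 \<ge> 0" using x by simp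
    then show "real J \<le> ln (1 + x) / ln 2 + 1" unfolding J_def by linarith
    show "ln (1 + x) / ln 2 \<le> real J" unfolding J_def by (rule real_nat_ceiling_ge)
  qed
  have "ln (1 + x) \<le> real J * ln 2" using J(2) by (simp add: field_simps)
  then have "ln (1 + x) \<le> ln (2 ^ J)" by (simp add: ln_realpow)
  then have xJ: "x \<le> 2 ^ J" using x by (subst (asm) ln_le_cancel_iff) auto
  have "(\<Sum>j=1..n. min 2 (x / 2 ^ j)) \<le> (\<Sum>j=1..n. if j \<le> J then 2 else (1 / 2) ^ (j - J))"
  proof (rule sum_mono)
    fix j
    show "min 2 (x / 2 ^ j) \<le> (if j \<le> J then 2 else (1 / 2) ^ (j - J))"
    proof (cases "j \<le> J")
      case False
      have "x / 2 ^ j \<le> 2 ^ J / 2 ^ j" using xJ by (rule divide_right_mono) simp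
      also have "\<dots> = (1 / 2) ^ (j - J)" using False by (simp add: power_diff power_divide)
      finally show ?thesis using False by simp
    qed simp
  qed
  also have "\<dots> \<le> (if n \<le> J then 2 * real n else 2 * real J + 1 - (1 / 2) ^ (n - J))"
  proof (induction n)
    case (Suc n)
    show ?case
    proof (cases "Suc n \<le> J")
      case True
      then show ?thesis using Suc by simp
    next
      case False
      show ?thesis
      proof (cases "n = J")
        case True
        then show ?thesis using Suc by simp
      next
        case neq: False
        then have d: "Suc n - J = Suc (n - J)" "\<not> n \<le> J" using False by auto
        then show ?thesis using Suc by simp
      qed
    qed
  qed simp
  also have "\<dots> \<le> 2 * real J + 1" by (auto simp: not_le)
  also have "\<dots> \<le> 2 * (ln (1 + x) / ln 2) + 3" using J(1) by simp
  finally show ?thesis unfolding e .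
qed

text \<open>Range r has primes with logarithm of order 2^r and degree proportional to n - r; the
  total logarithmic length is then no more than a constant times that of the last range.\<close>

lemma sum_rev_powers: "(\<Sum>r<n. (n - r) * 2 ^ r) \<le> 2 * 2 ^ (n::nat)"
proof (induction n)
  case (Suc n)
  have "(\<Sum>r<Suc n. (Suc n - r) * 2 ^ r) = (\<Sum>r<n. (n - r) * 2 ^ r + 2 ^ r) + 2 ^ n"
  proof -
    have "(\<Sum>r<n. (Suc n - r) * 2 ^ r) = (\<Sum>r<n. (n - r) * 2 ^ r + 2 ^ r)"
      by (intro sum.cong refl) (simp add: Suc_diff_le)
    then show ?thesis by simp
  qed
  also have "\<dots> = (\<Sum>r<n. (n - r) * 2 ^ r) + (\<Sum>r<n. 2 ^ r) + 2 ^ n" by (simp add: sum.distrib)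
  also have "(\<Sum>r<n. 2 ^ r) \<le> (2::nat) ^ n"
    by (induction n) auto
  finally show ?case using Suc by simp
qed simp

text \<open>The truncation lengths decrease towards the largest primes, but their errors still have
  a sum bounded independently of the number of ranges.\<close>

lemma sum_exp_rev_le:
  assumes a: "a \<ge> (1::nat)"
  shows "(\<Sum>r<n. exp (- real (a * (n - r)))) \<le> 1"
proof -
  have "(\<Sum>r<n. exp (- real (a * (n - r)))) \<le> 1 - (1 / 2) ^ n"
  proof -
    have "(\<Sum>r<n. exp (- real (a * (n - r)))) \<le> (\<Sum>r<n. (1 / 2) ^ (n - r))"
    proof (rule sum_mono)
      fix r
      have "n - r \<le> a * (n - r)" using a by simp
      then have ar: "real (n - r) \<le> real (a * (n - r))" by (simp only: of_nat_le_iff)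
      have "2 \<le> exp (1::real)" using exp_ge_add_one_self[of 1] by simp
      then have "exp (- 1) \<le> 1 / (2::real)" by (simp add: exp_minus field_simps)
      then have "exp (- 1) ^ (n - r) \<le> (1 / 2 :: real) ^ (n - r)" by (intro power_mono) auto
      moreover have "exp (- real (a * (n - r))) \<le> exp (- real (n - r))" using ar by (simp only: exp_le_cancel_iff neg_le_iff_le)
      moreover have "exp (- real (n - r)) = exp (- 1) ^ (n - r)" by (simp add: exp_of_nat_mult[symmetric])
      ultimately show "exp (- real (a * (n - r))) \<le> (1 / 2) ^ (n - r)" by linarith
    qed
    also have "\<dots> = (\<Sum>j=1..n. (1 / 2) ^ j)"
      by (rule sum.reindex_bij_witness[where i = "\<lambda>j. n - j" and j = "\<lambda>r. n - r"]) auto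
    also have "\<dots> = 1 - (1 / 2) ^ n" by (induction n) auto
    finally show ?thesis .
  qed
  also have "\<dots> \<le> 1" by simp
  finally show ?thesis .
qed

lemma dirichlet_conv_one_right_fun:
  assumes "fin_supp x" shows "dirichlet_conv x conv_one = x"
proof
  fix n show "dirichlet_conv x conv_one n = x n"
    using assms infinite_UNIV_nat by (cases "n = 0") (simp_all add: dirichlet_conv_one_right, simp add: dirichlet_conv_def fin_supp_def)
qed

lemma dirichlet_conv_one_left_fun:
  assumes "fin_supp x" shows "dirichlet_conv conv_one x = x"
proof
  fix n show "dirichlet_conv conv_one x n = x n"
    using assms infinite_UNIV_nat by (cases "n = 0") (simp_all add: dirichlet_conv_one_left, simp add: dirichlet_conv_def fin_supp_def)
qed

text \<open>Cauchy-Schwarz with the weights |c k|: only the l^1 norm of c enters, not the number of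
  frequencies.\<close>

lemma norm_weighted_sum_sq_le:
  fixes c g :: "'a \<Rightarrow> complex"
  shows "(norm (\<Sum>k\<in>K. c k * g k))\<^sup>2 \<le> (\<Sum>k\<in>K. norm (c k)) * (\<Sum>k\<in>K. norm (c k) * (norm (g k))\<^sup>2)"
proof -
  have "norm (\<Sum>k\<in>K. c k * g k) \<le> (\<Sum>k\<in>K. sqrt (norm (c k)) * (sqrt (norm (c k)) * norm (g k)))"
    by (rule order_trans[OF norm_sum]) (simp add: norm_mult mult.assoc[symmetric])
  then have "(norm (\<Sum>k\<in>K. c k * g k))\<^sup>2 \<le> (\<Sum>k\<in>K. sqrt (norm (c k)) * (sqrt (norm (c k)) * norm (g k)))\<^sup>2"
    by (intro power_mono) auto
  also have "\<dots> \<le> (\<Sum>k\<in>K. (sqrt (norm (c k)))\<^sup>2) * (\<Sum>k\<in>K. (sqrt (norm (c k)) * norm (g k))\<^sup>2)"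
    by (rule Cauchy_Schwarz_ineq_sum)
  finally show ?thesis by (simp add: power_mult_distrib)
qed

lemma finite_ln_le: "finite {p. prime (p::nat) \<and> ln (real p) \<le> x}"
proof (rule finite_subset)
  show "{p. prime (p::nat) \<and> ln (real p) \<le> x} \<subseteq> {..nat \<lfloor>exp x\<rfloor>}"
  proof
    fix p assume "p \<in> {p. prime (p::nat) \<and> ln (real p) \<le> x}"
    then have "prime p" "ln (real p) \<le> x" by auto
    then have "real p \<le> exp x" using prime_gt_0_nat[of p] by (metis exp_le_cancel_iff exp_ln of_nat_0_less_iff)
    then show "p \<in> {..nat \<lfloor>exp x\<rfloor>}" by (simp add: le_nat_floor)
  qed
qed auto

text \<open>The ranges start at ln p > 2^i0. \<open>V\<close> bounds the prime sum over one range,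
  \<open>R0\<close> the total error of the local factors. \<open>V1\<close> treats the primes in no
  range: the small ones, and those between the last range and the height 3 * m * KK n of the
  truncated series. \<open>a\<close> scales the truncation lengths, \<open>b\<close> is the ratio of
  the high power to the length as required by \<open>texp_prod_le_Upart\<close>, and
  \<open>m\<close> is the smoothness of the cutoff, large enough for
  \<open>sum_cc_weighted\<close>.\<close>

locale range_data = prime_data +
  fixes i0 :: nat and V R0 V1 \<kappa> :: real and a b m :: nat
  assumes tt_small: "\<And>p. prime p \<Longrightarrow> 2 ^ i0 < ln (real p) \<Longrightarrow> tt p \<le> 1"
    and V_bound: "\<And>r. (\<Sum>p | prime p \<and> 2 ^ (i0 + r) < ln (real p) \<and> ln (real p) \<le> 2 ^ (i0 + r + 1). (tt p)\<^sup>2) \<le> V"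
    and R0_bound: "\<And>A. finite A \<Longrightarrow> (\<And>p. p \<in> A \<Longrightarrow> prime p \<and> 2 ^ i0 < ln (real p)) \<Longrightarrow> (\<Sum>p\<in>A. RR p) \<le> R0"
    and V1_bound: "\<And>n. (\<Sum>p | prime p \<and> ln (real p) \<le> real (24 * m * b * a * 2 ^ (i0 + n)) \<and> (ln (real p) \<le> 2 ^ i0 \<or> 2 ^ (i0 + n) < ln (real p)). (tt p)\<^sup>2 + (xi p)\<^sup>2) \<le> V1"
    and kappa: "0 < \<kappa>" "\<kappa> < 1"
    and a1: "a \<ge> 1" and b1: "b \<ge> 1" and b2: "1 + 1 / \<kappa> \<le> real b"
    and m1: "m \<ge> 2" and m2: "8 * V / ln 2 + 2 \<le> real m"
begin

definition I :: "nat \<Rightarrow> nat set" where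
  "I r = {p. prime p \<and> 2 ^ (i0 + r) < ln (real p) \<and> ln (real p) \<le> 2 ^ (i0 + r + 1)}"

text \<open>Small primes can afford long expansions. The linear growth in n - r makes the errors exp
  (- lr n r) summable while the total length stays bounded by \<open>sum_rev_powers\<close>.\<close>

definition lr :: "nat \<Rightarrow> nat \<Rightarrow> nat" where "lr n r = a * (n - r)"
definition Mr :: "nat \<Rightarrow> nat \<Rightarrow> nat" where "Mr n r = b * lr n r"
text \<open>Both the unit of height of the cutoff and a bound for the height of the product of
  polynomials (\<open>sum_Mr\<close>). The factor 8 leaves a modulus of at least 32 * 2 ^ (i0 + n),
  as \<open>addchar_close\<close> wants.\<close>

definition KK :: "nat \<Rightarrow> nat" where "KK n = 8 * b * a * 2 ^ (i0 + n)"
definition QQ :: "nat \<Rightarrow> nat" where "QQ n = 4 * m * KK n + 1"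
definition YY :: "nat \<Rightarrow> nat" where "YY n = 2 * m * KK n"

lemma KK_pos: "KK n \<ge> 1" using a1 b1 by (simp add: KK_def Suc_le_eq)

lemma finite_I: "finite (I r)"
  by (rule finite_subset[OF _ finite_ln_le[of "2 ^ (i0 + r + 1)"]]) (auto simp: I_def)

lemma prime_I: "p \<in> I r \<Longrightarrow> prime p" by (simp add: I_def)

lemma ln_gt_I: "p \<in> I r \<Longrightarrow> 2 ^ i0 < ln (real p)"
proof -
  assume "p \<in> I r"
  then have "2 ^ (i0 + r) < ln (real p)" by (simp add: I_def)
  moreover have "(2::real) ^ i0 \<le> 2 ^ (i0 + r)" by (intro power_increasing) auto
  ultimately show ?thesis by linarith
qed

lemma tt_I: "p \<in> I r \<Longrightarrow> tt p \<le> 1" using tt_small prime_I ln_gt_I by blast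

lemma I_disjoint: "r \<noteq> s \<Longrightarrow> I r \<inter> I s = {}"
proof -
  have *: "I r \<inter> I s = {}" if "r < s" for r s
  proof -
    have "(2::real) ^ (i0 + r + 1) \<le> 2 ^ (i0 + s)" using that by (intro power_increasing) auto
    then show ?thesis unfolding I_def by fastforce
  qed
  assume "r \<noteq> s"
  then show ?thesis using *[of r s] *[of s r] by (cases "r < s") auto
qed

lemma V_I: "(\<Sum>p\<in>I r. (tt p)\<^sup>2) \<le> V" using V_bound[of r] by (simp add: I_def)

lemma V_nonneg: "V \<ge> 0" using V_I[of 0] by (meson order_trans sum_nonneg zero_le_power2)

lemma R0_I: "(\<Sum>p\<in>I r. RR p) \<le> R0" by (rule R0_bound[OF finite_I]) (auto intro: prime_I ln_gt_I)

lemma R0_Un: "(\<Sum>r<n. \<Sum>p\<in>I r. RR p) \<le> R0"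
proof -
  have "(\<Sum>r<n. \<Sum>p\<in>I r. RR p) = (\<Sum>p\<in>(\<Union>r<n. I r). RR p)"
    by (rule sum.UNION_disjoint[symmetric]) (auto simp: finite_I dest: I_disjoint)
  also have "\<dots> \<le> R0" by (rule R0_bound) (auto simp: finite_I intro: prime_I ln_gt_I)
  finally show ?thesis .
qed

definition vr :: "nat \<Rightarrow> real" where "vr r = (\<Sum>p\<in>I r. (tt p)\<^sup>2)"

definition Pr :: "nat \<Rightarrow> complex \<Rightarrow> complex" where
  "Pr r s = (\<Sum>p\<in>I r. f p * of_nat p powr (- s))"

definition Csum :: real where "Csum = 1 + 4 * (10 * real m) ^ m"

definition cc :: "nat \<Rightarrow> int \<Rightarrow> complex" where
  "cc n = (SOME c. (\<forall>z. z \<le> m * KK n \<longrightarrow> (\<Sum>k\<in>{- int (YY n)..int (YY n)}. c k * addchar (QQ n) k z) = 1) \<and>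
    (\<forall>z. 2 * m * KK n \<le> z \<longrightarrow> z \<le> 3 * m * KK n \<longrightarrow> (\<Sum>k\<in>{- int (YY n)..int (YY n)}. c k * addchar (QQ n) k z) = 0) \<and>
    (\<forall>k. norm (c k) \<le> 1) \<and>
    (\<forall>k. k \<noteq> 0 \<longrightarrow> \<bar>k\<bar> \<le> int (YY n) \<longrightarrow> norm (c k) \<le> (5 * real m / of_int \<bar>k\<bar>) ^ m))"

lemma cc:
  shows cc1: "z \<le> m * KK n \<Longrightarrow> (\<Sum>k\<in>{- int (YY n)..int (YY n)}. cc n k * addchar (QQ n) k z) = 1"
    and cc2: "2 * m * KK n \<le> z \<Longrightarrow> z \<le> 3 * m * KK n \<Longrightarrow> (\<Sum>k\<in>{- int (YY n)..int (YY n)}. cc n k * addchar (QQ n) k z) = 0"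
    and cc3: "norm (cc n k) \<le> 1"
    and cc4: "k \<noteq> 0 \<Longrightarrow> \<bar>k\<bar> \<le> int (YY n) \<Longrightarrow> norm (cc n k) \<le> (5 * real m / of_int \<bar>k\<bar>) ^ m"
proof -
  have m': "m \<ge> 1" using m1 by simp
  have "\<exists>c. (\<forall>z. z \<le> m * KK n \<longrightarrow> (\<Sum>k\<in>{- int (YY n)..int (YY n)}. c k * addchar (QQ n) k z) = 1) \<and>
    (\<forall>z. 2 * m * KK n \<le> z \<longrightarrow> z \<le> 3 * m * KK n \<longrightarrow> (\<Sum>k\<in>{- int (YY n)..int (YY n)}. c k * addchar (QQ n) k z) = 0) \<and>
    (\<forall>k. norm (c k) \<le> 1) \<and>
    (\<forall>k. k \<noteq> 0 \<longrightarrow> \<bar>k\<bar> \<le> int (YY n) \<longrightarrow> norm (c k) \<le> (5 * real m / of_int \<bar>k\<bar>) ^ m)"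
    unfolding YY_def QQ_def by (rule smooth_cutoff_coefficients[OF m' KK_pos[of n]]) blast
  from someI_ex[OF this, folded cc_def]
  show "z \<le> m * KK n \<Longrightarrow> (\<Sum>k\<in>{- int (YY n)..int (YY n)}. cc n k * addchar (QQ n) k z) = 1"
    "2 * m * KK n \<le> z \<Longrightarrow> z \<le> 3 * m * KK n \<Longrightarrow> (\<Sum>k\<in>{- int (YY n)..int (YY n)}. cc n k * addchar (QQ n) k z) = 0"
    "norm (cc n k) \<le> 1"
    "k \<noteq> 0 \<Longrightarrow> \<bar>k\<bar> \<le> int (YY n) \<Longrightarrow> norm (cc n k) \<le> (5 * real m / of_int \<bar>k\<bar>) ^ m"
    by blast+
qed

text \<open>The weight is the loss that the k-th twist causes in \<open>sum_mu\<close>. Since its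
  exponent is at most m - 2, the decay of order m leaves (10 m)^m / k^2; the sum of 1 / k^2 is at
  most 2 and occurs for both signs, which gives \<open>Csum\<close>.\<close>

lemma sum_cc_weighted:
  "(\<Sum>k\<in>{- int (YY n)..int (YY n)}. norm (cc n k) * (1 + \<bar>of_int k\<bar>) powr (8 * V / ln 2)) \<le> Csum"
proof -
  define g where "g j = (if j = 0 then 1 else (10 * real m) ^ m * (1 / (real j)\<^sup>2))" for j :: nat
  have B: "8 * V / ln 2 \<ge> 0" "8 * V / ln 2 \<le> real (m - 2)" using V_nonneg m1 m2 by (auto simp: of_nat_diff)
  have "norm (cc n k) * (1 + \<bar>of_int k\<bar>) powr (8 * V / ln 2) \<le> g (nat \<bar>k\<bar>)" if k: "k \<in> {- int (YY n)..int (YY n)}" for k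
  proof (cases "k = 0")
    case True
    then show ?thesis using cc3[of n 0] by (simp add: g_def)
  next
    case False
    define j where "j = real_of_int \<bar>k\<bar>"
    have j: "j \<ge> 1" using False by (simp add: j_def)
    have kk: "\<bar>k\<bar> \<le> int (YY n)" using k by auto
    have "norm (cc n k) * (1 + \<bar>of_int k\<bar>) powr (8 * V / ln 2) \<le> (5 * real m / j) ^ m * (2 * j) powr real (m - 2)"
    proof (rule mult_mono)
      show "norm (cc n k) \<le> (5 * real m / j) ^ m" using cc4[OF False kk] by (simp add: j_def)
      have "(1 + \<bar>real_of_int k\<bar>) powr (8 * V / ln 2) \<le> (2 * j) powr (8 * V / ln 2)"
        using j B by (intro powr_mono2) (auto simp: j_def)
      also have "\<dots> \<le> (2 * j) powr real (m - 2)" using j B by (intro powr_mono) auto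
      finally show "(1 + \<bar>real_of_int k\<bar>) powr (8 * V / ln 2) \<le> (2 * j) powr real (m - 2)" .
    qed (use j in auto)
    also have "(2 * j) powr real (m - 2) = (2 * j) ^ (m - 2)" using j by (simp add: powr_realpow)
    also have "(2 * j) ^ (m - 2) \<le> (2 * j) ^ m / j\<^sup>2"
    proof -
      have "m - 2 + 2 = m" using m1 by simp
      then have "(2 * j) ^ m = (2 * j) ^ (m - 2) * (2 * j)\<^sup>2" by (metis power_add)
      then show ?thesis using j by (simp add: power_mult_distrib field_simps)
    qed
    also have "(5 * real m / j) ^ m * ((2 * j) ^ m / j\<^sup>2) = (5 * real m / j * (2 * j)) ^ m / j\<^sup>2"
      by (simp only: power_mult_distrib times_divide_eq_right)
    also have "5 * real m / j * (2 * j) = 10 * real m" using j by simp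
    finally show ?thesis using False j by (simp add: g_def j_def mult_left_mono)
  qed
  then have "(\<Sum>k\<in>{- int (YY n)..int (YY n)}. norm (cc n k) * (1 + \<bar>of_int k\<bar>) powr (8 * V / ln 2)) \<le> (\<Sum>k\<in>{- int (YY n)..int (YY n)}. g (nat \<bar>k\<bar>))"
    by (rule sum_mono)
  also have "\<dots> = g 0 + 2 * (\<Sum>k=1..YY n. g k)" by (rule sum_int_symmetric_le)
  also have "(\<Sum>k=1..YY n. g k) = (10 * real m) ^ m * (\<Sum>k=1..YY n. 1 / (real k)\<^sup>2)"
    unfolding sum_distrib_left by (intro sum.cong) (auto simp: g_def)
  also have "g 0 + 2 * ((10 * real m) ^ m * (\<Sum>k=1..YY n. 1 / (real k)\<^sup>2)) \<le> 1 + 2 * ((10 * real m) ^ m * 2)"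
    using sum_inverse_squares_le[of "YY n"] by (intro add_mono mult_left_mono) (auto simp: g_def)
  finally show ?thesis by (simp add: Csum_def)
qed

lemma sum_cc: "(\<Sum>k\<in>{- int (YY n)..int (YY n)}. norm (cc n k)) \<le> Csum"
proof -
  have "norm (cc n k) \<le> norm (cc n k) * (1 + \<bar>of_int k\<bar>) powr (8 * V / ln 2)" for k
    using mult_left_mono[OF ge_one_powr_ge_zero[of "1 + \<bar>real_of_int k\<bar>" "8 * V / ln 2"], of "norm (cc n k)"] V_nonneg by simp
  then show ?thesis by (intro order_trans[OF sum_mono sum_cc_weighted]) auto
qed

text \<open>A cutoff that is 1 for \<open>hh d \<le> m * KK n\<close>. The Fourier expansion also vanishes for
  \<open>2 * m * KK n \<le> hh d \<le> 3 * m * KK n\<close>, so it may replace the cutoff in products of total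
  height at most \<open>3 * m * KK n\<close>.\<close>

definition bcut :: "nat \<Rightarrow> nat \<Rightarrow> complex" where
  "bcut n d = (if d > 0 \<and> hh d < 2 * m * KK n then (\<Sum>k\<in>{- int (YY n)..int (YY n)}. cc n k * addchar (QQ n) k (hh d)) else 0)"

definition sf :: "nat \<Rightarrow> nat \<Rightarrow> complex" where "sf n d = f d * bcut n d"

lemma bcut_one: "d > 0 \<Longrightarrow> hh d \<le> m * KK n \<Longrightarrow> bcut n d = 1"
proof -
  assume d: "d > 0" "hh d \<le> m * KK n"
  have "m * KK n < 2 * m * KK n" using KK_pos[of n] m1 by simp
  then have "hh d < 2 * m * KK n" using d(2) by (rule le_less_trans[rotated])
  then show ?thesis unfolding bcut_def using d cc1[OF d(2)] by simp
qed

lemma bcut_eq: "d > 0 \<Longrightarrow> hh d \<le> 3 * m * KK n \<Longrightarrow>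
    bcut n d = (\<Sum>k\<in>{- int (YY n)..int (YY n)}. cc n k * addchar (QQ n) k (hh d))"
  using cc2[of n "hh d"] unfolding bcut_def by auto

lemma norm_bcut: "norm (bcut n d) \<le> Csum"
proof -
  have "norm (\<Sum>k\<in>{- int (YY n)..int (YY n)}. cc n k * addchar (QQ n) k (hh d)) \<le> Csum"
    by (rule order_trans[OF norm_sum]) (simp add: norm_mult sum_cc)
  moreover have "0 \<le> Csum" by (simp add: Csum_def)
  ultimately show ?thesis by (simp add: bcut_def)
qed

lemma sf_supp: "sf n d \<noteq> 0 \<Longrightarrow> d > 0 \<and> hh d \<le> 2 * m * KK n"
  by (auto simp: sf_def bcut_def split: if_splits)

lemma hh_le_imp_le: "d > 0 \<Longrightarrow> hh d \<le> N \<Longrightarrow> real d \<le> exp (real N)"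
proof -
  assume d: "d > 0" "hh d \<le> N"
  then have "ln (real d) \<le> real N" using hh_bounds(1)[OF d(1)] by (simp add: order_trans)
  then show ?thesis using d(1) by (metis exp_le_cancel_iff exp_ln of_nat_0_less_iff)
qed

lemma finite_hh_le: "finite {d. d > 0 \<and> hh d \<le> N}"
  by (rule finite_subset[of _ "{..nat \<lfloor>exp (real N)\<rfloor>}"]) (auto simp: le_nat_floor dest: hh_le_imp_le)

lemma fin_supp_sf: "fin_supp (sf n)"
proof -
  have "{d. sf n d \<noteq> 0} \<subseteq> {d. d > 0 \<and> hh d \<le> 2 * m * KK n}" using sf_supp by auto
  from finite_subset[OF this finite_hh_le] show ?thesis unfolding fin_supp_def by (simp add: sf_def bcut_def)
qed

text \<open>\<open>D\<close> is the set of ranges on which the truncated exponential is used; on the others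
  its place is taken by the high power in \<open>Bpart\<close>.\<close>

definition xch :: "real \<Rightarrow> nat \<Rightarrow> nat set \<Rightarrow> nat \<Rightarrow> nat \<Rightarrow> complex" where
  "xch \<alpha> n D r = wt f (if r \<in> D then trunc_pow \<alpha> (lr n r) else top_pow (lr n r) (Mr n r)) (I r)"

lemma fin_supp_xch: "fin_supp (xch \<alpha> n D r)"
  unfolding xch_def
  by (rule fin_supp_wt[where M = "max (lr n r) (Mr n r)", OF finite_I prime_I]) (auto simp: trunc_pow_def top_pow_def)

lemma xch_supp: "xch \<alpha> n D r e \<noteq> 0 \<Longrightarrow> e \<in> nums_over (I r) \<and> hh e \<le> 2 ^ (i0 + r + 1) * Mr n r"
proof -
  assume "xch \<alpha> n D r e \<noteq> 0"
  then have e: "e \<in> nums_over (I r)" and "(if r \<in> D then trunc_pow \<alpha> (lr n r) else top_pow (lr n r) (Mr n r)) (Om e) \<noteq> 0"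
    unfolding xch_def using wt_supp by blast+
  then have "Om e \<le> max (lr n r) (Mr n r)"
    by (auto simp: trunc_pow_def top_pow_def split: if_splits)
  also have "\<dots> = Mr n r" using b1 by (simp add: Mr_def max_def)
  finally have "2 ^ (i0 + r + 1) * Om e \<le> 2 ^ (i0 + r + 1) * Mr n r" by (rule mult_le_mono2)
  moreover have "hh e \<le> 2 ^ (i0 + r + 1) * Om e"
    by (rule hh_le_Om[OF e]) (simp add: I_def)
  ultimately show ?thesis using e by (meson order_trans)
qed

text \<open>Products of the polynomials therefore stay at heights where the cutoff is 1, and
  together with \<open>sf n\<close> at heights where its Fourier expansion is valid.\<close>

lemma sum_Mr: "(\<Sum>r<n. 2 ^ (i0 + r + 1) * Mr n r) \<le> m * KK n"
proof -
  have "(\<Sum>r<n. 2 ^ (i0 + r + 1) * Mr n r) = 2 ^ (i0 + 1) * (b * a) * (\<Sum>r<n. (n - r) * 2 ^ r)"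
    unfolding Mr_def lr_def sum_distrib_left by (intro sum.cong refl) (simp add: power_add mult_ac)
  also have "\<dots> \<le> 2 ^ (i0 + 1) * (b * a) * (2 * 2 ^ n)" by (intro mult_left_mono sum_rev_powers) auto
  also have "\<dots> \<le> KK n" by (simp add: KK_def power_add)
  also have "\<dots> \<le> m * KK n" using m1 by simp
  finally show ?thesis .
qed

lemma dprod_xch_supp:
  "dprod (xch \<alpha> n D) n e \<noteq> 0 \<Longrightarrow> e \<in> nums_over (\<Union>r<n. I r) \<and> hh e \<le> m * KK n"
  using dprod_supp[of n "xch \<alpha> n D" I "\<lambda>r. 2 ^ (i0 + r + 1) * Mr n r" e] fin_supp_xch xch_supp sum_Mr[of n]
  by (meson order_trans)

text \<open>Each \<open>Upart\<close> is a sum of two squared moduli. Expanding the product over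
  subsets D gives a sum of squared moduli of single Dirichlet polynomials, to which the mean value
  bound applies; afterwards the sum over D recombines into a product.\<close>

lemma gmean_prod_Upart:
  assumes s: "s > 0" and a0: "fin_supp a0" and w: "\<And>k. k \<in> KS \<Longrightarrow> w k \<ge> 0"
    and bd: "\<And>D. D \<subseteq> {..<n} \<Longrightarrow> dnorm2 (dirichlet_conv a0 (dprod (xch \<alpha> n D) n)) \<sigma> \<le>
        (\<Sum>k\<in>KS. w k * (\<Prod>r<n. if r \<in> D then KU k r else KB k r))"
    and Z: "\<And>D e. dirichlet_conv a0 (dprod (xch \<alpha> n D) n) e \<noteq> 0 \<Longrightarrow> real e \<le> Z" "Z > 0"
    and sZ: "Z * exp (- (s / Z)\<^sup>2 / 2) \<le> 1"
  defines "h \<equiv> (\<lambda>t. (norm (dpoly a0 (Complex \<sigma> t)))\<^sup>2 * (\<Prod>r<n. Upart \<alpha> (lr n r) (Mr n r) (Pr r (Complex \<sigma> t))))"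
  shows "gint \<tau> s h" "gmean \<tau> s h \<le> 2 * (\<Sum>k\<in>KS. w k * (\<Prod>r<n. KU k r + KB k r))"
proof -
  let ?d = "\<lambda>D. dirichlet_conv a0 (dprod (xch \<alpha> n D) n)"
  have fs: "fin_supp (dprod (xch \<alpha> n D) n)" for D by (rule fin_supp_dprod) (rule fin_supp_xch)
  have fs2: "fin_supp (?d D)" for D by (rule fin_supp_conv(1)[OF a0 fs])
  have eq: "h = (\<lambda>t. \<Sum>D\<in>Pow {..<n}. (norm (dpoly (?d D) (Complex \<sigma> t)))\<^sup>2)"
  proof
    fix t
    let ?z = "Complex \<sigma> t"
    have sq: "(norm (dpoly (xch \<alpha> n D r) ?z))\<^sup>2 = (if r \<in> D then (norm (texp (lr n r) (of_real \<alpha> * Pr r ?z)))\<^sup>2 else Bpart (lr n r) (Mr n r) (Pr r ?z))" for D r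
      unfolding xch_def Pr_def
      using dpoly_trunc_pow[OF finite_I prime_I, where f = f] dpoly_top_pow[OF finite_I prime_I, where f = f] by simp
    have "(\<Prod>r<n. Upart \<alpha> (lr n r) (Mr n r) (Pr r ?z)) =
      (\<Sum>D\<in>Pow {..<n}. (\<Prod>r\<in>D. (norm (texp (lr n r) (of_real \<alpha> * Pr r ?z)))\<^sup>2) * (\<Prod>r\<in>{..<n} - D. Bpart (lr n r) (Mr n r) (Pr r ?z)))"
      unfolding Upart_def by (rule prod_add) simp
    also have "\<dots> = (\<Sum>D\<in>Pow {..<n}. (norm (dpoly (dprod (xch \<alpha> n D) n) ?z))\<^sup>2)"
    proof (intro sum.cong refl)
      fix D assume D: "D \<in> Pow {..<n}"
      have "(norm (dpoly (dprod (xch \<alpha> n D) n) ?z))\<^sup>2 = (\<Prod>r<n. (norm (dpoly (xch \<alpha> n D r) ?z))\<^sup>2)"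
        by (simp add: dpoly_dprod fin_supp_xch prod_norm[symmetric] prod_power_distrib)
      also have "\<dots> = (\<Prod>r\<in>D. (norm (dpoly (xch \<alpha> n D r) ?z))\<^sup>2) * (\<Prod>r\<in>{..<n} - D. (norm (dpoly (xch \<alpha> n D r) ?z))\<^sup>2)"
        using D by (subst prod.subset_diff[of D]) (auto simp: mult.commute)
      also have "\<dots> = (\<Prod>r\<in>D. (norm (texp (lr n r) (of_real \<alpha> * Pr r ?z)))\<^sup>2) * (\<Prod>r\<in>{..<n} - D. Bpart (lr n r) (Mr n r) (Pr r ?z))"
        by (intro arg_cong2[where f = times] prod.cong refl) (simp_all add: sq)
      finally show "(\<Prod>r\<in>D. (norm (texp (lr n r) (of_real \<alpha> * Pr r ?z)))\<^sup>2) * (\<Prod>r\<in>{..<n} - D. Bpart (lr n r) (Mr n r) (Pr r ?z)) = (norm (dpoly (dprod (xch \<alpha> n D) n) ?z))\<^sup>2" ..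
    qed
    finally show "h t = (\<Sum>D\<in>Pow {..<n}. (norm (dpoly (?d D) ?z))\<^sup>2)"
      unfolding h_def by (simp add: dpoly_conv[OF a0 fs] norm_mult power_mult_distrib sum_distrib_left)
  qed
  have gi: "gint \<tau> s (\<lambda>t. (norm (dpoly (?d D) (Complex \<sigma> t)))\<^sup>2)" for D
    by (rule gint_cont_bounded[OF s, where C = "(\<Sum>n | ?d D n \<noteq> 0. norm (?d D n) * real n powr - \<sigma>)\<^sup>2"])
      (use dpoly_bound in \<open>auto intro!: continuous_intros dpoly_cont power_mono\<close>)
  show "gint \<tau> s h" unfolding eq by (rule gint_sum) (rule gi)
  have "gmean \<tau> s h = (\<Sum>D\<in>Pow {..<n}. gmean \<tau> s (\<lambda>t. (norm (dpoly (?d D) (Complex \<sigma> t)))\<^sup>2))"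
    unfolding eq by (rule gmean_sum) (rule gi)
  also have "\<dots> \<le> (\<Sum>D\<in>Pow {..<n}. 2 * (\<Sum>k\<in>KS. w k * ((\<Prod>r\<in>D. KU k r) * (\<Prod>r\<in>{..<n} - D. KB k r))))"
  proof (rule sum_mono)
    fix D assume D: "D \<in> Pow {..<n}"
    have pe: "(\<Prod>r<n. if r \<in> D then KU k r else KB k r) = (\<Prod>r\<in>D. KU k r) * (\<Prod>r\<in>{..<n} - D. KB k r)" for k
      using D by (subst prod.subset_diff[of D]) (auto simp: mult.commute intro!: arg_cong2[where f = times] prod.cong)
    have "gmean \<tau> s (\<lambda>t. (norm (dpoly (?d D) (Complex \<sigma> t)))\<^sup>2) \<le> 2 * dnorm2 (?d D) \<sigma>"
      by (rule gmean_dpoly_le[OF s fs2 Z sZ])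
    also have "\<dots> \<le> 2 * (\<Sum>k\<in>KS. w k * (\<Prod>r<n. if r \<in> D then KU k r else KB k r))" using bd D by auto
    finally show "gmean \<tau> s (\<lambda>t. (norm (dpoly (?d D) (Complex \<sigma> t)))\<^sup>2) \<le> 2 * (\<Sum>k\<in>KS. w k * ((\<Prod>r\<in>D. KU k r) * (\<Prod>r\<in>{..<n} - D. KB k r)))" unfolding pe .
  qed
  also have "\<dots> = 2 * (\<Sum>k\<in>KS. w k * (\<Sum>D\<in>Pow {..<n}. (\<Prod>r\<in>D. KU k r) * (\<Prod>r\<in>{..<n} - D. KB k r)))"
    unfolding sum_distrib_left by (rule sum.swap)
  also have "\<dots> = 2 * (\<Sum>k\<in>KS. w k * (\<Prod>r<n. KU k r + KB k r))"
    by (simp only: prod_add[OF finite_lessThan])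
  finally show "gmean \<tau> s h \<le> 2 * (\<Sum>k\<in>KS. w k * (\<Prod>r<n. KU k r + KB k r))" .
qed

end

subsection \<open>Mean squares\<close>

lemma fin_supp_conv_eq_image:
  assumes AB: "A \<inter> B = {}"
    and u: "fin_supp u" "\<And>k. u k \<noteq> 0 \<Longrightarrow> k \<in> nums_over A" and v: "fin_supp v" "\<And>k. v k \<noteq> 0 \<Longrightarrow> k \<in> nums_over B"
  shows "bij_betw (\<lambda>(d, e). d * e) ({d. u d \<noteq> 0} \<times> {e. v e \<noteq> 0}) {k. dirichlet_conv u v k \<noteq> 0}"
proof (rule bij_betw_imageI)
  show "inj_on (\<lambda>(d, e). d * e) ({d. u d \<noteq> 0} \<times> {e. v e \<noteq> 0})"
  proof (rule inj_onI, clarify)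
    fix d e d' e' assume "u d \<noteq> 0" "v e \<noteq> 0" "u d' \<noteq> 0" "v e' \<noteq> 0" "d * e = d' * e'"
    then show "d = d' \<and> e = e'" using nums_over_unique[OF AB u(2) v(2) u(2) v(2)] by blast
  qed
  show "(\<lambda>(d, e). d * e) ` ({d. u d \<noteq> 0} \<times> {e. v e \<noteq> 0}) = {k. dirichlet_conv u v k \<noteq> 0}"
  proof (intro equalityI subsetI)
    fix k assume "k \<in> (\<lambda>(d, e). d * e) ` ({d. u d \<noteq> 0} \<times> {e. v e \<noteq> 0})"
    then obtain d e where de: "u d \<noteq> 0" "v e \<noteq> 0" "k = d * e" by auto
    then have "dirichlet_conv u v k = u d * v e"
      using dirichlet_conv_supported_mult[OF AB u(2) v(2) u(2)[OF de(1)] v(2)[OF de(2)]] by simp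
    then show "k \<in> {k. dirichlet_conv u v k \<noteq> 0}" using de by simp
  next
    fix k assume "k \<in> {k. dirichlet_conv u v k \<noteq> 0}"
    then obtain d e where "u d \<noteq> 0" "v e \<noteq> 0" "k = d * e" using fin_supp_conv(2)[OF u(1) v(1), of k] by blast
    then show "k \<in> (\<lambda>(d, e). d * e) ` ({d. u d \<noteq> 0} \<times> {e. v e \<noteq> 0})" by force
  qed
qed

lemma dprod_height_supp:
  assumes "\<And>r. r < n \<Longrightarrow> fin_supp (x r)" "\<And>r e. r < n \<Longrightarrow> x r e \<noteq> 0 \<Longrightarrow> e \<in> nums_over (I r)"
    and "dprod x n e \<noteq> 0"
  shows "e \<in> nums_over (\<Union>r<n. I r)"
  \<comment> \<open>\<open>dprod_supp\<close> also wants heights; the maximum over the finite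
    support serves.\<close>
  using dprod_supp[of n x I "\<lambda>r. Max (hh ` {e. x r e \<noteq> 0})" e] assms
  by (auto simp: fin_supp_def intro!: Max_ge)

text \<open>The diagonal of the mean of F X times cnj Y, with X and Y the products of the
  polynomials \<open>x r\<close> and \<open>y r\<close>, factors along the disjoint prime
  sets.\<close>

lemma inner_dprod:
  assumes F: "multiplicative F" "F 1 = 1"
    and x: "\<And>r. r < n \<Longrightarrow> fin_supp (x r)" "\<And>r e. r < n \<Longrightarrow> x r e \<noteq> 0 \<Longrightarrow> e \<in> nums_over (I r)"
    and y: "\<And>r. r < n \<Longrightarrow> fin_supp (y r)" "\<And>r e. r < n \<Longrightarrow> y r e \<noteq> 0 \<Longrightarrow> e \<in> nums_over (I r)"
    and disj: "\<And>r s. r < n \<Longrightarrow> s < n \<Longrightarrow> r \<noteq> s \<Longrightarrow> I r \<inter> I s = {}"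
  shows "(\<Sum>e | dprod y n e \<noteq> 0. dirichlet_conv F (dprod x n) e * cnj (dprod y n e) * of_real (real e powr w))
    = (\<Prod>r<n. \<Sum>e | y r e \<noteq> 0. dirichlet_conv F (x r) e * cnj (y r e) * of_real (real e powr w))"
  using assms
proof (induction n)
  case 0
  have "{e. conv_one e \<noteq> 0} = {1}" by (auto simp: conv_one_def)
  moreover have "conv_one 1 = 1" by (simp add: conv_one_def)
  ultimately show ?case using 0(2) by (simp add: dirichlet_conv_one_right)
next
  case (Suc n)
  have "I r \<inter> I n = {}" if "r < n" for r using Suc.prems(7)[of r n] that by simp
  then have D: "(\<Union>r<n. I r) \<inter> I n = {}" by blast
  have dx: "dprod x n k \<noteq> 0 \<Longrightarrow> k \<in> nums_over (\<Union>r<n. I r)" for k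
    by (rule dprod_height_supp[of n x]) (use Suc.prems(3,4) in auto)
  have dy: "dprod y n k \<noteq> 0 \<Longrightarrow> k \<in> nums_over (\<Union>r<n. I r)" for k
    by (rule dprod_height_supp[of n y]) (use Suc.prems(5,6) in auto)
  have xn: "x n k \<noteq> 0 \<Longrightarrow> k \<in> nums_over (I n)" and yn: "y n k \<noteq> 0 \<Longrightarrow> k \<in> nums_over (I n)" for k
    using Suc.prems(4)[of n k] Suc.prems(6)[of n k] by auto
  have fy: "fin_supp (dprod y n)" "fin_supp (y n)" using Suc.prems(5) fin_supp_dprod[of n y] by auto
  let ?g = "\<lambda>u v e. u e * cnj (v e) * complex_of_real (real e powr w)"
  have "(\<Sum>e | dprod y (Suc n) e \<noteq> 0. dirichlet_conv F (dprod x (Suc n)) e * cnj (dprod y (Suc n) e) * of_real (real e powr w))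
    = (\<Sum>(d, e)\<in>{d. dprod y n d \<noteq> 0} \<times> {e. y n e \<noteq> 0}. dirichlet_conv F (dprod x (Suc n)) (d * e) * cnj (dprod y (Suc n) (d * e)) * of_real (real (d * e) powr w))"
    using sum.reindex_bij_betw[OF fin_supp_conv_eq_image[OF D fy(1) dy fy(2) yn], of "\<lambda>e. dirichlet_conv F (dprod x (Suc n)) e * cnj (dprod y (Suc n) e) * of_real (real e powr w)"]
    by (simp add: case_prod_beta')
  also have "\<dots> = (\<Sum>(d, e)\<in>{d. dprod y n d \<noteq> 0} \<times> {e. y n e \<noteq> 0}.
      (dirichlet_conv F (dprod x n) d * cnj (dprod y n d) * of_real (real d powr w)) * (dirichlet_conv F (x n) e * cnj (y n e) * of_real (real e powr w)))"
  proof (intro sum.cong refl, clarify)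
    fix d e assume de: "dprod y n d \<noteq> 0" "y n e \<noteq> 0"
    have 1: "dirichlet_conv F (dprod x (Suc n)) (d * e) = dirichlet_conv F (dprod x n) d * dirichlet_conv F (x n) e"
      unfolding dprod.simps by (rule dirichlet_conv_mult_supported[OF Suc.prems(1) D dx xn dy[OF de(1)] yn[OF de(2)]])
    have 2: "dprod y (Suc n) (d * e) = dprod y n d * y n e"
      unfolding dprod.simps by (rule dirichlet_conv_supported_mult[OF D dy yn dy[OF de(1)] yn[OF de(2)]])
    have 3: "real (d * e) powr w = real d powr w * real e powr w" by (simp add: powr_mult)
    show "dirichlet_conv F (dprod x (Suc n)) (d * e) * cnj (dprod y (Suc n) (d * e)) * of_real (real (d * e) powr w) =
      (dirichlet_conv F (dprod x n) d * cnj (dprod y n d) * of_real (real d powr w)) * (dirichlet_conv F (x n) e * cnj (y n e) * of_real (real e powr w))"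
      unfolding 1 2 3 by simp
  qed
  also have "\<dots> = (\<Sum>d | dprod y n d \<noteq> 0. dirichlet_conv F (dprod x n) d * cnj (dprod y n d) * of_real (real d powr w)) *
      (\<Sum>e | y n e \<noteq> 0. dirichlet_conv F (x n) e * cnj (y n e) * of_real (real e powr w))"
    by (simp only: sum_product sum.cartesian_product)
  also have "(\<Sum>d | dprod y n d \<noteq> 0. dirichlet_conv F (dprod x n) d * cnj (dprod y n d) * of_real (real d powr w)) =
      (\<Prod>r<n. \<Sum>e | y r e \<noteq> 0. dirichlet_conv F (x r) e * cnj (y r e) * of_real (real e powr w))"
    by (rule Suc.IH) (use Suc.prems in auto)
  finally show ?case by simp
qed

text \<open>Cutting each local factor at exponent l yields a sum over a set that contains every e
  with Om e <= l. What else the set contains is left open: those e have more than l prime factors,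
  and being in \<open>nums_over A\<close> suffices to bound them.\<close>

lemma truncated_euler_product:
  fixes G :: "nat \<Rightarrow> complex"
  assumes "finite A" "\<And>p. p \<in> A \<Longrightarrow> prime p"
    and G: "\<And>m n. m > 0 \<Longrightarrow> n > 0 \<Longrightarrow> coprime m n \<Longrightarrow> G (m * n) = G m * G n" "G 1 = 1"
  shows "\<exists>Y. finite Y \<and> Y \<subseteq> nums_over A \<and> {e \<in> nums_over A. Om e \<le> l} \<subseteq> Y \<and> sum G Y = (\<Prod>p\<in>A. \<Sum>a\<le>l. G (p ^ a))"
  using assms(1,2)
proof (induction A rule: finite_induct)
  case empty
  show ?case by (rule exI[of _ "{1}"]) (use G(2) in \<open>auto simp: nums_over_empty\<close>)
next
  case (insert p A)
  have p: "prime p" "p \<notin> A" using insert by auto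
  obtain Y where Y: "finite Y" "Y \<subseteq> nums_over A" "{e \<in> nums_over A. Om e \<le> l} \<subseteq> Y" "sum G Y = (\<Prod>p\<in>A. \<Sum>a\<le>l. G (p ^ a))"
    using insert by blast
  have disj: "{p} \<inter> A = {}" using p by auto
  have pp: "p ^ a \<in> nums_over {p}" for a unfolding nums_over_singleton[OF p(1)] by blast
  have p0: "p ^ a > 0" for a using p prime_gt_0_nat by simp
  let ?f = "\<lambda>(a, y). p ^ a * y"
  have inj: "inj_on ?f ({..l} \<times> Y)"
  proof (rule inj_onI, clarify)
    fix a n a' n' assume n: "n \<in> Y" "n' \<in> Y" and eq: "p ^ a * n = p ^ a' * n'"
    have "p ^ a = p ^ a' \<and> n = n'" by (rule nums_over_unique[OF disj pp _ pp _ eq]) (use n Y in auto)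
    then show "a = a' \<and> n = n'" using p prime_gt_1_nat power_inject_exp by blast
  qed
  show ?case
  proof (intro exI[of _ "?f ` ({..l} \<times> Y)"] conjI)
    show "finite (?f ` ({..l} \<times> Y))" using Y by auto
    show "?f ` ({..l} \<times> Y) \<subseteq> nums_over (insert p A)"
    proof clarify
      fix a y assume "y \<in> Y"
      then have "y \<in> nums_over (insert p A)" using Y(2) nums_over_mono[of A "insert p A"] by auto
      moreover have "p ^ a \<in> nums_over (insert p A)" using pp[of a] nums_over_mono[of "{p}" "insert p A"] by auto
      ultimately show "p ^ a * y \<in> nums_over (insert p A)" by (simp add: nums_over_mult_iff)
    qed
    show "{e \<in> nums_over (insert p A). Om e \<le> l} \<subseteq> ?f ` ({..l} \<times> Y)"
    proof clarify
      fix e assume e: "e \<in> nums_over (insert p A)" "Om e \<le> l"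
      then have "e \<in> nums_over ({p} \<union> A)" by simp
      from nums_over_decomp[OF disj this] obtain c y where c: "c \<in> nums_over {p}" "y \<in> nums_over A" "e = c * y" .
      then obtain a where a: "c = p ^ a" unfolding nums_over_singleton[OF p(1)] by blast
      have "Om e = a + Om y" using c a Om_mult[OF p0 nums_over_pos[OF c(2)]] Om_prime_power[OF p(1)] by simp
      then have "a \<le> l" "y \<in> Y" using e(2) c(2) Y(3) by auto
      then show "e \<in> ?f ` ({..l} \<times> Y)" using c(3) a by force
    qed
    have "sum G (?f ` ({..l} \<times> Y)) = (\<Sum>(a, y)\<in>{..l} \<times> Y. G (p ^ a * y))"
      by (subst sum.reindex[OF inj]) (simp add: case_prod_beta')
    also have "\<dots> = (\<Sum>(a, y)\<in>{..l} \<times> Y. G (p ^ a) * G y)"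
    proof (intro sum.cong refl, clarify)
      fix a y assume "y \<in> Y"
      then have "y \<in> nums_over A" using Y by auto
      then show "G (p ^ a * y) = G (p ^ a) * G y"
        by (intro G(1) p0 nums_over_pos[of y A] nums_over_coprime[OF disj pp])
    qed
    also have "\<dots> = (\<Sum>a\<le>l. G (p ^ a)) * sum G Y" by (simp add: sum_product sum.cartesian_product)
    finally show "sum G (?f ` ({..l} \<times> Y)) = (\<Prod>p\<in>insert p A. \<Sum>a\<le>l. G (p ^ a))"
      using insert Y(4) by simp
  qed
qed

section \<open>Mean squares of the twisted and truncated products\<close>

context range_data
begin

definition C2 :: real where "C2 = 1 + 2 * exp (16 * V + CR 3 * R0)"
definition C3 :: real where "C3 = exp ((1 + 540 * real b)\<^sup>2 * V + CR (540 * real b) * R0)"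
text \<open>A factor 2 from \<open>gmean_dpoly_le\<close>, two l^1 norms of the Fourier
  coefficients, \<open>V1\<close> for primes outside the ranges, and 12 V from the bounded part 4 V
  * 3 of \<open>sum_mu\<close>. \<open>C2\<close> and \<open>C3\<close> are the constants of
  \<open>bsum_trunc\<close> and \<open>bsum_top\<close>.\<close>

definition CA :: real where "CA = 2 * Csum\<^sup>2 * exp (V1 + 12 * V + CR 1 * R0 + (C2 + C3))"

text \<open>The mean square bounds on range r for the truncated exponential and, in
  \<open>KB\<close>, for the high power.\<close>

definition KU :: "(nat \<Rightarrow> real) \<Rightarrow> nat \<Rightarrow> nat \<Rightarrow> real" where
  "KU \<mu> n r = exp ((\<Sum>p\<in>I r. \<mu> p * (tt p)\<^sup>2 + CR 1 * RR p) + C2 * exp (- real (lr n r)))"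
definition KB :: "nat \<Rightarrow> nat \<Rightarrow> real" where "KB n r = C3 * exp (- real (lr n r))"

lemma bsum_xch:
  assumes r: "r < n"
    and F: "multiplicative F" "F 1 = 1" "\<And>n. n > 0 \<Longrightarrow> norm (F n) \<le> norm (f n)" and al: "\<bar>\<alpha>\<bar> \<le> 1"
    and mu: "\<And>p. prime p \<Longrightarrow> (norm (F p + of_real \<alpha> * f p))\<^sup>2 \<le> \<mu> p * (norm (f p))\<^sup>2" "\<And>p. \<mu> p \<ge> 0"
  shows "bsum (\<lambda>k. (norm (dirichlet_conv F (xch \<alpha> n D r) k))\<^sup>2 / real k) (nums_over (I r)) (if r \<in> D then KU \<mu> n r else KB n r)"
proof -
  have l: "lr n r \<ge> 1" using r a1 by (simp add: lr_def Suc_le_eq)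
  show ?thesis
  proof (cases "r \<in> D")
    case True
    have "bsum (\<lambda>k. (norm (dirichlet_conv F (wt f (trunc_pow \<alpha> (lr n r)) (I r)) k))\<^sup>2 / real k) (nums_over (I r)) (KU \<mu> n r)"
      unfolding KU_def C2_def
      by (rule bsum_trunc[OF finite_I prime_I tt_I F al mu(1)[OF prime_I] mu(2) V_I R0_I])
    then show ?thesis using True by (simp add: xch_def)
  next
    case False
    have "bsum (\<lambda>k. (norm (dirichlet_conv F (wt f (top_pow (lr n r) (b * lr n r)) (I r)) k))\<^sup>2 / real k) (nums_over (I r)) (KB n r)"
      unfolding KB_def C3_def
      by (rule bsum_top[OF finite_I prime_I tt_I F(3) l b1 V_I R0_I])
    then show ?thesis using False by (simp add: xch_def Mr_def)
  qed
qed

text \<open>\<open>KU\<close> is at least 1, so the high power is absorbed as a factor 1 + C3 exp (-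
  lr n r); these factors multiply to a constant by \<open>sum_exp_rev_le\<close>.\<close>

lemma KU_KB_le:
  assumes mu: "\<And>p. \<mu> p \<ge> 0"
  shows "(\<Prod>r<n. KU \<mu> n r + KB n r) \<le> exp ((\<Sum>r<n. \<Sum>p\<in>I r. \<mu> p * (tt p)\<^sup>2) + CR 1 * R0 + (C2 + C3))"
proof -
  have C: "C2 \<ge> 0" "C3 \<ge> 0" by (auto simp: C2_def C3_def)
  have "KU \<mu> n r + KB n r \<le> exp ((\<Sum>p\<in>I r. \<mu> p * (tt p)\<^sup>2 + CR 1 * RR p) + (C2 + C3) * exp (- real (lr n r)))" for r
  proof -
    let ?e = "exp (- real (lr n r))"
    have 1: "KU \<mu> n r \<ge> 1" unfolding KU_def using mu C RR_nonneg CR_nonneg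
      by (auto intro!: add_nonneg_nonneg sum_nonneg)
    have "KU \<mu> n r + KB n r \<le> KU \<mu> n r * (1 + C3 * ?e)"
      unfolding KB_def using mult_right_mono[OF 1, of "C3 * ?e"] C by (simp add: algebra_simps)
    also have "\<dots> \<le> KU \<mu> n r * exp (C3 * ?e)" using 1 by (intro mult_left_mono exp_ge_add_one_self) auto
    also have "\<dots> = exp ((\<Sum>p\<in>I r. \<mu> p * (tt p)\<^sup>2 + CR 1 * RR p) + (C2 + C3) * ?e)"
      by (simp add: KU_def exp_add[symmetric] algebra_simps)
    finally show ?thesis .
  qed
  then have "(\<Prod>r<n. KU \<mu> n r + KB n r) \<le> (\<Prod>r<n. exp ((\<Sum>p\<in>I r. \<mu> p * (tt p)\<^sup>2 + CR 1 * RR p) + (C2 + C3) * exp (- real (lr n r))))"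
    using C by (intro prod_mono) (auto simp: KU_def KB_def intro!: add_nonneg_nonneg mult_nonneg_nonneg)
  also have "\<dots> = exp ((\<Sum>r<n. \<Sum>p\<in>I r. \<mu> p * (tt p)\<^sup>2) + CR 1 * (\<Sum>r<n. \<Sum>p\<in>I r. RR p) + (C2 + C3) * (\<Sum>r<n. exp (- real (lr n r))))"
    by (simp add: exp_sum[symmetric] sum.distrib sum_distrib_left)
  also have "\<dots> \<le> exp ((\<Sum>r<n. \<Sum>p\<in>I r. \<mu> p * (tt p)\<^sup>2) + CR 1 * R0 + (C2 + C3) * 1)"
    using R0_Un sum_exp_rev_le[OF a1] C CR_nonneg unfolding lr_def exp_le_cancel_iff
    by (intro add_mono mult_left_mono) auto
  finally show ?thesis by simp
qed

text \<open>The primes that can divide an index of the truncated series without belonging to a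
  range.\<close>

definition restp :: "nat \<Rightarrow> nat set" where
  "restp n = {p. prime p \<and> ln (real p) \<le> real (3 * m * KK n) \<and> (ln (real p) \<le> 2 ^ i0 \<or> 2 ^ (i0 + n) < ln (real p))}"

lemma UN_I: "(\<Union>r<n. I r) = {p. prime p \<and> 2 ^ i0 < ln (real p) \<and> ln (real p) \<le> 2 ^ (i0 + n)}"
proof (induction n)
  case (Suc n)
  have "(2::real) ^ i0 \<le> 2 ^ (i0 + n)" "(2::real) ^ (i0 + n) \<le> 2 ^ (i0 + n + 1)" by (auto intro: power_increasing)
  have ch: "(b < x \<and> x \<le> c) \<or> (a < x \<and> x \<le> b) \<longleftrightarrow> a < x \<and> x \<le> c" if "a \<le> b" "b \<le> c" for a b c x :: real
    using that by (cases "x \<le> b") auto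
  note eq = ch[OF \<open>(2::real) ^ i0 \<le> 2 ^ (i0 + n)\<close> \<open>(2::real) ^ (i0 + n) \<le> 2 ^ (i0 + n + 1)\<close>]
  show ?case
  proof (rule set_eqI)
    fix p
    have "p \<in> (\<Union>r<Suc n. I r) \<longleftrightarrow> p \<in> I n \<or> p \<in> (\<Union>r<n. I r)" by (simp add: lessThan_Suc)
    also have "\<dots> \<longleftrightarrow> prime p \<and> ((2 ^ (i0 + n) < ln (real p) \<and> ln (real p) \<le> 2 ^ (i0 + n + 1)) \<or> (2 ^ i0 < ln (real p) \<and> ln (real p) \<le> 2 ^ (i0 + n)))"
      unfolding Suc unfolding I_def mem_Collect_eq by argo
    also have "\<dots> \<longleftrightarrow> prime p \<and> 2 ^ i0 < ln (real p) \<and> ln (real p) \<le> 2 ^ (i0 + n + 1)" by (simp only: eq)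
    finally show "p \<in> (\<Union>r<Suc n. I r) \<longleftrightarrow> p \<in> {p. prime p \<and> 2 ^ i0 < ln (real p) \<and> ln (real p) \<le> 2 ^ (i0 + Suc n)}"
      by (simp only: mem_Collect_eq add_Suc_right Suc_eq_plus1 add.assoc)
  qed
qed auto

lemma restp_bsum:
  assumes F: "multiplicative F" "F 1 = 1" "\<And>n. n > 0 \<Longrightarrow> norm (F n) \<le> norm (f n)"
  shows "bsum (\<lambda>k. (norm (F k))\<^sup>2 / real k) (nums_over (restp n)) (exp V1)"
proof -
  have fin: "finite (restp n)" by (rule finite_subset[OF _ finite_ln_le]) (auto simp: restp_def)
  have pr: "p \<in> restp n \<Longrightarrow> prime p" for p by (simp add: restp_def)
  have "bsum (\<lambda>k. (norm (F k))\<^sup>2 / real k) (nums_over (restp n)) (\<Prod>p\<in>restp n. exp ((tt p)\<^sup>2 + (xi p)\<^sup>2))"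
  proof (rule bsum_nums_over_prod[OF fin pr])
    fix a b :: nat assume "a > 0" "b > 0" "coprime a b"
    then show "(norm (F (a * b)))\<^sup>2 / real (a * b) \<le> (norm (F a))\<^sup>2 / real a * ((norm (F b))\<^sup>2 / real b)"
      using F by (simp add: multiplicative_def norm_mult power_mult_distrib)
  next
    fix p K assume "p \<in> restp n"
    then have p: "prime p" by (rule pr)
    have p0: "p > 0" using p prime_gt_0_nat by simp
    have "(\<Sum>a\<le>K. (norm (F (p ^ a)))\<^sup>2 / real (p ^ a)) \<le> (\<Sum>a\<le>K. (half_norm f p a)\<^sup>2)"
      unfolding half_norm_sq[OF p0] using F(3) p0 by (intro sum_mono divide_right_mono power_mono) auto
    also have "\<dots> \<le> (\<Sum>a\<in>insert 0 (insert 1 {2..K}). (half_norm f p a)\<^sup>2)"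
      by (rule sum_mono2) (auto simp: not_le)
    also have "\<dots> = 1 + (tt p)\<^sup>2 + (\<Sum>a=2..K. (half_norm f p a)\<^sup>2)"
      using f_one p0 by (simp add: half_norm_def tt_def)
    also have "(\<Sum>a=2..K. (half_norm f p a)\<^sup>2) \<le> (\<Sum>a=2..K. half_norm f p a)\<^sup>2"
      by (rule sum_squares_le_square_sum) (auto simp: half_norm_nonneg)
    also have "\<dots> \<le> (xi p)\<^sup>2" using xi[OF p, of K] by (intro power_mono sum_nonneg half_norm_nonneg)
    also have "1 + (tt p)\<^sup>2 + (xi p)\<^sup>2 \<le> exp ((tt p)\<^sup>2 + (xi p)\<^sup>2)"
      using exp_ge_add_one_self[of "(tt p)\<^sup>2 + (xi p)\<^sup>2"] by linarith
    finally show "(\<Sum>a\<le>K. (norm (F (p ^ a)))\<^sup>2 / real (p ^ a)) \<le> exp ((tt p)\<^sup>2 + (xi p)\<^sup>2)" by simp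
  qed (use F in auto)
  moreover have "(\<Prod>p\<in>restp n. exp ((tt p)\<^sup>2 + (xi p)\<^sup>2)) = exp (\<Sum>p\<in>restp n. (tt p)\<^sup>2 + (xi p)\<^sup>2)"
    using fin by (simp add: exp_sum)
  moreover have "(\<Sum>p\<in>restp n. (tt p)\<^sup>2 + (xi p)\<^sup>2) \<le> V1"
    using V1_bound[of n] by (simp add: restp_def KK_def mult_ac)
  ultimately show ?thesis by (auto elim: bsum_mono)
qed

text \<open>Up to height 3 * m * KK n the truncated coefficients \<open>sf n\<close> are the
  combination of these multiplicative functions with weights \<open>cc n k\<close>.\<close>

definition Fk :: "nat \<Rightarrow> int \<Rightarrow> nat \<Rightarrow> complex" where
  "Fk n k d = f d * addchar (QQ n) k (hh d)"

lemma Fk: "multiplicative (Fk n k)" "Fk n k 1 = 1" "norm (Fk n k d) = norm (f d)"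
proof -
  show "multiplicative (Fk n k)"
    using f_mult by (auto simp: multiplicative_def Fk_def hh_mult addchar_add)
  show "Fk n k 1 = 1" using f_one by (simp add: Fk_def addchar_def)
  show "norm (Fk n k d) = norm (f d)" by (simp add: Fk_def norm_mult)
qed

text \<open>The twist by the \<open>k\<close>-th character turns the exponent \<open>\<kappa>\<^sup>2\<close> of a prime into this value.\<close>

definition mu :: "nat \<Rightarrow> int \<Rightarrow> nat \<Rightarrow> real" where
  "mu n k p = \<kappa>\<^sup>2 + 4 * norm (addchar (QQ n) k (hh p) - 1)"

lemma mu_nonneg: "mu n k p \<ge> 0" by (simp add: mu_def)

lemma mu_bound: "(norm (Fk n k p + of_real (\<kappa> - 1) * f p))\<^sup>2 \<le> mu n k p * (norm (f p))\<^sup>2"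
proof -
  let ?\<chi> = "addchar (QQ n) k (hh p)"
  define d where "d = norm (?\<chi> - 1)"
  have d: "0 \<le> d" "d \<le> 2"
    using norm_triangle_ineq4[of ?\<chi> 1] by (auto simp: d_def)
  have "Fk n k p + of_real (\<kappa> - 1) * f p = f p * ((?\<chi> - 1) + of_real \<kappa>)"
    by (simp add: Fk_def algebra_simps)
  then have "norm (Fk n k p + of_real (\<kappa> - 1) * f p) \<le> norm (f p) * (d + \<kappa>)"
    using norm_triangle_ineq[of "?\<chi> - 1" "of_real \<kappa>"] kappa by (simp add: norm_mult d_def mult_left_mono)
  then have "(norm (Fk n k p + of_real (\<kappa> - 1) * f p))\<^sup>2 \<le> (norm (f p) * (d + \<kappa>))\<^sup>2"
    by (intro power_mono) auto
  also have "\<dots> = (d + \<kappa>)\<^sup>2 * (norm (f p))\<^sup>2" by (simp add: power_mult_distrib)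
  also have "\<dots> \<le> mu n k p * (norm (f p))\<^sup>2"
  proof (rule mult_right_mono)
    \<comment> \<open>With d <= 2 and \<kappa> < 1 the square (d + \<kappa>)^2 exceeds \<kappa>^2 by
      at most 4 d.\<close>
    have "d * d \<le> 2 * d" "2 * (d * \<kappa>) \<le> 2 * d" using d kappa by (auto intro: mult_right_mono simp: mult_left_le)
    then show "(d + \<kappa>)\<^sup>2 \<le> mu n k p" unfolding mu_def d_def[symmetric] by (simp add: power2_eq_square algebra_simps)
  qed simp
  finally show ?thesis .
qed

text \<open>The phase at p is proportional to k * hh p / QQ n, and hh p is at most 2^(i0 + r + 1) on
  range r: the twist is close to 1 on all ranges with 2^(n - r) much larger than |k|.\<close>

lemma addchar_close:
  assumes p: "p \<in> I r" and r: "r < n"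
  shows "norm (addchar (QQ n) k (hh p) - 1) \<le> min 2 (\<bar>of_int k\<bar> / 2 ^ (n - r))"
proof -
  have "hh p \<le> 2 ^ (i0 + r + 1)"
  proof -
    have "ln (real p) \<le> real (2 ^ (i0 + r + 1))" using p by (simp add: I_def)
    then show ?thesis unfolding hh_prime[OF prime_I[OF p]] by (simp add: nat_le_iff ceiling_le_iff)
  qed
  then have h: "real (hh p) \<le> 2 ^ (i0 + r + 1)" by (metis of_nat_le_iff of_nat_numeral of_nat_power)
  have "8 * 2 ^ (i0 + n) \<le> KK n" using a1 b1 by (simp add: KK_def Suc_le_eq)
  then have "4 * 8 * 2 ^ (i0 + n) \<le> 4 * 1 * KK n" by simp
  moreover have "4 * 1 * KK n \<le> 4 * m * KK n" using m1 by simp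
  ultimately have "32 * 2 ^ (i0 + n) \<le> QQ n" unfolding QQ_def by linarith
  then have "real (32 * 2 ^ (i0 + n)) \<le> real (QQ n)" by (simp only: of_nat_le_iff)
  then have q: "32 * 2 ^ (i0 + n) \<le> real (QQ n)" by simp
  have "norm (addchar (QQ n) k (hh p) - 1) \<le> 2 * pi * \<bar>of_int k\<bar> * real (hh p) / real (QQ n)"
    by (rule norm_addchar_minus_one)
  also have "\<dots> \<le> 2 * 4 * \<bar>of_int k\<bar> * 2 ^ (i0 + r + 1) / (32 * 2 ^ (i0 + n))"
    using h q pi_less_4 by (intro frac_le mult_mono) auto
  also have "\<dots> \<le> \<bar>of_int k\<bar> / 2 ^ (n - r)"
  proof -
    have "(2::real) ^ (i0 + n) = 2 ^ (i0 + r) * 2 ^ (n - r)" using r by (simp add: power_add[symmetric])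
    then show ?thesis by (simp add: field_simps)
  qed
  finally show ?thesis using norm_triangle_ineq4[of "addchar (QQ n) k (hh p)" 1] by simp
qed

text \<open>Only about log_2 (1 + |k|) ranges feel the twist, and each costs at most 8 V.\<close>

lemma sum_mu:
  "(\<Sum>r<n. \<Sum>p\<in>I r. mu n k p * (tt p)\<^sup>2) \<le> \<kappa>\<^sup>2 * (\<Sum>r<n. vr r) + 4 * V * (2 * (ln (1 + \<bar>of_int k\<bar>) / ln 2) + 3)"
proof -
  have "(\<Sum>r<n. \<Sum>p\<in>I r. mu n k p * (tt p)\<^sup>2) \<le> (\<Sum>r<n. \<kappa>\<^sup>2 * vr r + 4 * V * min 2 (\<bar>of_int k\<bar> / 2 ^ (n - r)))"
  proof (rule sum_mono)
    fix r assume "r \<in> {..<n}"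
    then have r: "r < n" by simp
    have "(\<Sum>p\<in>I r. mu n k p * (tt p)\<^sup>2) \<le> (\<Sum>p\<in>I r. (\<kappa>\<^sup>2 + 4 * min 2 (\<bar>of_int k\<bar> / 2 ^ (n - r))) * (tt p)\<^sup>2)"
      using addchar_close[OF _ r] unfolding mu_def by (intro sum_mono mult_right_mono add_left_mono mult_left_mono) auto
    also have "\<dots> = (\<kappa>\<^sup>2 + 4 * min 2 (\<bar>of_int k\<bar> / 2 ^ (n - r))) * vr r" by (simp add: vr_def sum_distrib_left)
    also have "\<dots> = \<kappa>\<^sup>2 * vr r + 4 * min 2 (\<bar>of_int k\<bar> / 2 ^ (n - r)) * vr r" by (rule distrib_right)
    also have "4 * min 2 (\<bar>of_int k\<bar> / 2 ^ (n - r)) * vr r \<le> 4 * min 2 (\<bar>of_int k\<bar> / 2 ^ (n - r)) * V"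
      using V_I[of r] by (intro mult_left_mono) (auto simp: vr_def)
    finally show "(\<Sum>p\<in>I r. mu n k p * (tt p)\<^sup>2) \<le> \<kappa>\<^sup>2 * vr r + 4 * V * min 2 (\<bar>of_int k\<bar> / 2 ^ (n - r))"
      by (simp add: mult_ac)
  qed
  also have "\<dots> = \<kappa>\<^sup>2 * (\<Sum>r<n. vr r) + 4 * V * (\<Sum>r<n. min 2 (\<bar>of_int k\<bar> / 2 ^ (n - r)))"
    by (simp add: sum.distrib sum_distrib_left)
  also have "\<dots> \<le> \<kappa>\<^sup>2 * (\<Sum>r<n. vr r) + 4 * V * (2 * (ln (1 + \<bar>of_int k\<bar>) / ln 2) + 3)"
    using V_nonneg by (intro add_left_mono mult_left_mono sum_min_geometric) auto
  finally show ?thesis .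
qed

lemma powr_minus_le_inverse:
  assumes "k > (0::nat)" "\<sigma> \<ge> 1 / 2" shows "real k powr (- 2 * \<sigma>) \<le> 1 / real k"
proof -
  have eq: "real k powr (- 1) = 1 / real k" using assms by (simp add: powr_minus_divide)
  have "real k powr (- 2 * \<sigma>) \<le> real k powr (- 1)" using assms by (intro powr_mono) auto
  then show ?thesis unfolding eq .
qed

lemma sf_conv_supp:
  assumes "dirichlet_conv (sf n) (dprod (xch \<alpha> n D) n) e \<noteq> 0"
  shows "e > 0" "hh e \<le> 3 * m * KK n"
proof -
  have fs: "fin_supp (dprod (xch \<alpha> n D) n)" by (rule fin_supp_dprod) (rule fin_supp_xch)
  obtain d e' where de: "sf n d \<noteq> 0" "dprod (xch \<alpha> n D) n e' \<noteq> 0" "e = d * e'"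
    using fin_supp_conv(2)[OF fin_supp_sf fs assms] by blast
  have d: "d > 0" "hh d \<le> 2 * m * KK n" using sf_supp[OF de(1)] by auto
  have e': "e' > 0" "hh e' \<le> m * KK n" using dprod_xch_supp[OF de(2)] nums_over_pos by auto
  show "e > 0" "hh e \<le> 3 * m * KK n" using d e' de(3) hh_mult[OF d(1) e'(1)] by auto
qed

text \<open>On the support of the convolution all divisors have height at most 3 * m * KK n, so the
  cutoff may be replaced by its Fourier expansion. Cauchy-Schwarz over the frequencies leaves one
  Euler product for each k: the ranges contribute \<open>KU\<close> and \<open>KB\<close>, the
  leftover primes exp V1.\<close>

lemma dnorm2_sf_le:
  assumes s: "\<sigma> \<ge> 1 / 2"
  shows "dnorm2 (dirichlet_conv (sf n) (dprod (xch (\<kappa> - 1) n D) n)) \<sigma> \<le>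
    (\<Sum>k\<in>{- int (YY n)..int (YY n)}. (Csum * exp V1 * norm (cc n k)) * (\<Prod>r<n. if r \<in> D then KU (mu n k) n r else KB n r))"
proof -
  let ?A = "dprod (xch (\<kappa> - 1) n D) n"
  let ?X = "{e. dirichlet_conv (sf n) ?A e \<noteq> 0}"
  let ?K = "{- int (YY n)..int (YY n)}"
  have fsA: "fin_supp ?A" by (rule fin_supp_dprod) (rule fin_supp_xch)
  have X: "finite ?X" using fin_supp_conv(1)[OF fin_supp_sf fsA, of n] by (simp add: fin_supp_def)
  note Xe = sf_conv_supp[of n "\<kappa> - 1" D]
  have expand: "dirichlet_conv (sf n) ?A e = (\<Sum>k\<in>?K. cc n k * dirichlet_conv (Fk n k) ?A e)" if e: "e \<in> ?X" for e
  proof -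
    have "dirichlet_conv (sf n) ?A e = (\<Sum>d | d dvd e. \<Sum>k\<in>?K. cc n k * (Fk n k d * ?A (e div d)))"
      unfolding dirichlet_conv_def
    proof (intro sum.cong refl)
      fix d assume "d \<in> {d. d dvd e}"
      then have d: "d dvd e" "d > 0" using Xe(1)[of e] e by (auto intro!: gr0I)
      have "hh d \<le> 3 * m * KK n" using hh_dvd_le[OF _ d(1)] Xe[of e] e by (auto intro: order_trans)
      then have "sf n d = (\<Sum>k\<in>?K. cc n k * Fk n k d)"
        unfolding sf_def bcut_eq[OF d(2) \<open>hh d \<le> 3 * m * KK n\<close>] Fk_def by (simp add: sum_distrib_left mult_ac)
      then show "sf n d * ?A (e div d) = (\<Sum>k\<in>?K. cc n k * (Fk n k d * ?A (e div d)))"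
        by (simp only: sum_distrib_right mult.assoc)
    qed
    also have "\<dots> = (\<Sum>k\<in>?K. cc n k * dirichlet_conv (Fk n k) ?A e)"
      unfolding dirichlet_conv_def sum_distrib_left by (rule sum.swap)
    finally show ?thesis .
  qed
  have bd: "bsum (\<lambda>e. (norm (dirichlet_conv (Fk n k) ?A e))\<^sup>2 / real e) (nums_over ((\<Union>r<n. I r) \<union> restp n))
      ((\<Prod>r<n. if r \<in> D then KU (mu n k) n r else KB n r) * exp V1)" for k
  proof (rule bsum_nums_over_Un)
    show disj: "(\<Union>r<n. I r) \<inter> restp n = {}" unfolding UN_I restp_def by auto
    show "bsum (\<lambda>e. (norm (dirichlet_conv (Fk n k) ?A e))\<^sup>2 / real e) (nums_over (\<Union>r<n. I r)) (\<Prod>r<n. if r \<in> D then KU (mu n k) n r else KB n r)"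
    proof (rule bsum_conv_dprod[OF Fk(1,2)])
      show "bsum (\<lambda>e. (norm (dirichlet_conv (Fk n k) (xch (\<kappa> - 1) n D r) e))\<^sup>2 / real e) (nums_over (I r)) (if r \<in> D then KU (mu n k) n r else KB n r)" if "r < n" for r
        using kappa by (intro bsum_xch[OF that Fk(1,2)] mu_bound mu_nonneg) (auto simp: Fk(3))
    qed (use xch_supp fin_supp_xch I_disjoint in auto)
    show "bsum (\<lambda>k'. (norm (Fk n k k'))\<^sup>2 / real k') (nums_over (restp n)) (exp V1)"
      by (rule restp_bsum[OF Fk(1,2)]) (simp add: Fk(3))
    fix a b assume ab: "a \<in> nums_over (\<Union>r<n. I r)" "b \<in> nums_over (restp n)"
    have b0: "b > 0" using ab nums_over_pos by blast
    \<comment> \<open>On the leftover primes the polynomial is trivial, which is expressed by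
      convolving with the unit \<open>conv_one\<close>.\<close>
    have "dirichlet_conv (Fk n k) (dirichlet_conv ?A conv_one) (a * b) = dirichlet_conv (Fk n k) ?A a * dirichlet_conv (Fk n k) conv_one b"
      by (rule dirichlet_conv_mult_supported[OF Fk(1) disj _ _ ab])
        (use dprod_xch_supp in \<open>auto simp: conv_one_def split: if_splits\<close>)
    then have "dirichlet_conv (Fk n k) ?A (a * b) = dirichlet_conv (Fk n k) ?A a * Fk n k b"
      using dirichlet_conv_one_right_fun[OF fsA] dirichlet_conv_one_right[OF b0] by simp
    then show "(norm (dirichlet_conv (Fk n k) ?A (a * b)))\<^sup>2 / real (a * b) \<le>
        (norm (dirichlet_conv (Fk n k) ?A a))\<^sup>2 / real a * ((norm (Fk n k b))\<^sup>2 / real b)"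
      by (simp add: norm_mult power_mult_distrib)
  qed auto
  have Xsub: "?X \<subseteq> nums_over ((\<Union>r<n. I r) \<union> restp n)"
  proof
    fix e assume "e \<in> ?X"
    then have e: "e > 0" "hh e \<le> 3 * m * KK n" using Xe by auto
    have "p \<in> (\<Union>r<n. I r) \<union> restp n" if "p \<in> prime_factors e" for p
    proof -
      have p: "prime p" "p dvd e" using that by auto
      have "hh p \<le> 3 * m * KK n" using hh_dvd_le[OF e(1) p(2)] e(2) by simp
      then have "real (hh p) \<le> real (3 * m * KK n)" by (simp only: of_nat_le_iff)
      moreover have "ln (real p) \<le> real (hh p)" using hh_bounds(1) p(1) prime_gt_0_nat by blast
      ultimately have "ln (real p) \<le> real (3 * m * KK n)" by linarith
      then show ?thesis unfolding UN_I restp_def using p(1) by auto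
    qed
    then show "e \<in> nums_over ((\<Union>r<n. I r) \<union> restp n)" using e(1) by (auto simp: nums_over_def)
  qed
  have Cs: "Csum \<ge> 0" by (simp add: Csum_def)
  have "dnorm2 (dirichlet_conv (sf n) ?A) \<sigma> \<le> (\<Sum>e\<in>?X. (norm (dirichlet_conv (sf n) ?A e))\<^sup>2 * (1 / real e))"
    unfolding dnorm2_def using Xe(1) s by (intro sum_mono mult_left_mono powr_minus_le_inverse) auto
  also have "\<dots> \<le> (\<Sum>e\<in>?X. Csum * (\<Sum>k\<in>?K. norm (cc n k) * (norm (dirichlet_conv (Fk n k) ?A e))\<^sup>2) * (1 / real e))"
  proof (intro sum_mono mult_right_mono)
    fix e assume e: "e \<in> ?X"
    have "(norm (dirichlet_conv (sf n) ?A e))\<^sup>2 \<le> (\<Sum>k\<in>?K. norm (cc n k)) * (\<Sum>k\<in>?K. norm (cc n k) * (norm (dirichlet_conv (Fk n k) ?A e))\<^sup>2)"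
      unfolding expand[OF e] by (rule norm_weighted_sum_sq_le)
    also have "\<dots> \<le> Csum * (\<Sum>k\<in>?K. norm (cc n k) * (norm (dirichlet_conv (Fk n k) ?A e))\<^sup>2)"
      by (intro mult_right_mono sum_cc sum_nonneg) auto
    finally show "(norm (dirichlet_conv (sf n) ?A e))\<^sup>2 \<le> Csum * (\<Sum>k\<in>?K. norm (cc n k) * (norm (dirichlet_conv (Fk n k) ?A e))\<^sup>2)" .
  qed auto
  also have "\<dots> = Csum * (\<Sum>e\<in>?X. \<Sum>k\<in>?K. norm (cc n k) * ((norm (dirichlet_conv (Fk n k) ?A e))\<^sup>2 / real e))"
    by (simp add: sum_distrib_left sum_distrib_right mult_ac)
  also have "\<dots> = Csum * (\<Sum>k\<in>?K. \<Sum>e\<in>?X. norm (cc n k) * ((norm (dirichlet_conv (Fk n k) ?A e))\<^sup>2 / real e))"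
    by (simp only: sum.swap[of _ ?K ?X])
  also have "\<dots> = Csum * (\<Sum>k\<in>?K. norm (cc n k) * (\<Sum>e\<in>?X. (norm (dirichlet_conv (Fk n k) ?A e))\<^sup>2 / real e))"
    by (simp only: sum_distrib_left)
  also have "\<dots> \<le> Csum * (\<Sum>k\<in>?K. norm (cc n k) * ((\<Prod>r<n. if r \<in> D then KU (mu n k) n r else KB n r) * exp V1))"
    using bsumD[OF bd X Xsub] Cs by (intro mult_left_mono sum_mono) auto
  also have "\<dots> = (\<Sum>k\<in>?K. (Csum * exp V1 * norm (cc n k)) * (\<Prod>r<n. if r \<in> D then KU (mu n k) n r else KB n r))"
    by (simp add: sum_distrib_left mult_ac)
  finally show ?thesis .
qed

text \<open>Every index of the polynomials has height \<open>hh\<close> at most 3 * m * KK n, and an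
  integer is at most the exponential of its height.\<close>

definition ZZ :: "nat \<Rightarrow> real" where "ZZ n = exp (real (3 * m * KK n))"

lemma ZZ_pos: "ZZ n > 0" by (simp add: ZZ_def)

definition good_scale :: "nat \<Rightarrow> real \<Rightarrow> bool" where
  "good_scale n s \<longleftrightarrow> s > 0 \<and> ZZ n * exp (- (s / ZZ n)\<^sup>2 / 2) \<le> 1"

lemma sf_weights_le:
  "(\<Sum>k\<in>{- int (YY n)..int (YY n)}. (Csum * exp V1 * norm (cc n k)) * (\<Prod>r<n. KU (mu n k) n r + KB n r))
    \<le> CA / 2 * exp (\<kappa>\<^sup>2 * (\<Sum>r<n. vr r))"
proof -
  let ?K = "{- int (YY n)..int (YY n)}"
  have Cs: "Csum \<ge> 0" by (simp add: Csum_def)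
  have "(\<Sum>k\<in>?K. (Csum * exp V1 * norm (cc n k)) * (\<Prod>r<n. KU (mu n k) n r + KB n r))
    \<le> (\<Sum>k\<in>?K. (Csum * exp V1 * norm (cc n k)) * (exp (\<kappa>\<^sup>2 * (\<Sum>r<n. vr r) + 12 * V + CR 1 * R0 + (C2 + C3)) * (1 + \<bar>of_int k\<bar>) powr (8 * V / ln 2)))"
  proof (intro mult_left_mono sum_mono)
    fix k
    have "(\<Prod>r<n. KU (mu n k) n r + KB n r) \<le> exp ((\<Sum>r<n. \<Sum>p\<in>I r. mu n k p * (tt p)\<^sup>2) + CR 1 * R0 + (C2 + C3))"
      by (rule KU_KB_le[OF mu_nonneg])
    also have "\<dots> \<le> exp (\<kappa>\<^sup>2 * (\<Sum>r<n. vr r) + 4 * V * (2 * (ln (1 + \<bar>of_int k\<bar>) / ln 2) + 3) + CR 1 * R0 + (C2 + C3))"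
      using sum_mu[of n k] by simp
    also have "\<dots> = exp (\<kappa>\<^sup>2 * (\<Sum>r<n. vr r) + 12 * V + CR 1 * R0 + (C2 + C3)) * (1 + \<bar>of_int k\<bar>) powr (8 * V / ln 2)"
      by (simp add: powr_def exp_add[symmetric] algebra_simps)
    finally show "(\<Prod>r<n. KU (mu n k) n r + KB n r) \<le> exp (\<kappa>\<^sup>2 * (\<Sum>r<n. vr r) + 12 * V + CR 1 * R0 + (C2 + C3)) * (1 + \<bar>of_int k\<bar>) powr (8 * V / ln 2)" .
  qed (use Cs in auto)
  also have "\<dots> = Csum * exp V1 * exp (\<kappa>\<^sup>2 * (\<Sum>r<n. vr r) + 12 * V + CR 1 * R0 + (C2 + C3)) * (\<Sum>k\<in>?K. norm (cc n k) * (1 + \<bar>of_int k\<bar>) powr (8 * V / ln 2))"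
    by (simp add: sum_distrib_left mult_ac)
  also have "\<dots> \<le> Csum * exp V1 * exp (\<kappa>\<^sup>2 * (\<Sum>r<n. vr r) + 12 * V + CR 1 * R0 + (C2 + C3)) * Csum"
    using Cs by (intro mult_left_mono sum_cc_weighted) auto
  also have "\<dots> = CA / 2 * exp (\<kappa>\<^sup>2 * (\<Sum>r<n. vr r))"
    by (simp add: CA_def exp_add power2_eq_square)
  finally show ?thesis .
qed

lemma sq_weights_le:
  "(\<Prod>r<n. KU (\<lambda>_. \<kappa>\<^sup>2) n r + KB n r) \<le> CA / 2 * exp (\<kappa>\<^sup>2 * (\<Sum>r<n. vr r))"
proof -
  have "(\<Prod>r<n. KU (\<lambda>_. \<kappa>\<^sup>2) n r + KB n r) \<le> exp ((\<Sum>r<n. \<Sum>p\<in>I r. \<kappa>\<^sup>2 * (tt p)\<^sup>2) + CR 1 * R0 + (C2 + C3))"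
    by (rule KU_KB_le) auto
  also have "(\<Sum>r<n. \<Sum>p\<in>I r. \<kappa>\<^sup>2 * (tt p)\<^sup>2) = \<kappa>\<^sup>2 * (\<Sum>r<n. vr r)"
    by (simp add: vr_def sum_distrib_left)
  also have "exp (\<kappa>\<^sup>2 * (\<Sum>r<n. vr r) + CR 1 * R0 + (C2 + C3)) \<le> CA / 2 * exp (\<kappa>\<^sup>2 * (\<Sum>r<n. vr r))"
  proof -
    have "V1 \<ge> 0" using order_trans[OF sum_nonneg V1_bound[of 0]] by simp
    have "1 \<le> Csum" by (simp add: Csum_def)
    then have "1 \<le> Csum\<^sup>2" by (rule one_le_power)
    have "exp (CR 1 * R0 + (C2 + C3)) \<le> exp (V1 + 12 * V + CR 1 * R0 + (C2 + C3))"
      using \<open>V1 \<ge> 0\<close> V_nonneg by simp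
    also have "\<dots> \<le> Csum\<^sup>2 * exp (V1 + 12 * V + CR 1 * R0 + (C2 + C3))"
      using mult_right_mono[OF \<open>1 \<le> Csum\<^sup>2\<close>, of "exp (V1 + 12 * V + CR 1 * R0 + (C2 + C3))"] by simp
    finally have "exp (CR 1 * R0 + (C2 + C3)) * exp (\<kappa>\<^sup>2 * (\<Sum>r<n. vr r)) \<le> Csum\<^sup>2 * exp (V1 + 12 * V + CR 1 * R0 + (C2 + C3)) * exp (\<kappa>\<^sup>2 * (\<Sum>r<n. vr r))"
      by (intro mult_right_mono) auto
    then show ?thesis by (simp add: CA_def exp_add mult_ac)
  qed
  finally show ?thesis .
qed

lemma gmean_sq_mult_Upart_le:
  assumes gs: "good_scale n s" and sg: "\<sigma> \<ge> 1 / 2"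
  defines "h \<equiv> (\<lambda>t. (norm (dpoly (sf n) (Complex \<sigma> t)))\<^sup>2 * (\<Prod>r<n. Upart (\<kappa> - 1) (lr n r) (Mr n r) (Pr r (Complex \<sigma> t))))"
  shows "gint \<tau> s h" "gmean \<tau> s h \<le> CA * exp (\<kappa>\<^sup>2 * (\<Sum>r<n. vr r))"
proof -
  let ?K = "{- int (YY n)..int (YY n)}"
  have Cs: "Csum \<ge> 0" by (simp add: Csum_def)
  note * = gmean_prod_Upart[where KS = ?K and w = "\<lambda>k. Csum * exp V1 * norm (cc n k)" and \<alpha> = "\<kappa> - 1" and ?a0.0 = "sf n" and n = n
      and Z = "ZZ n" and KU = "\<lambda>k. KU (mu n k) n" and KB = "\<lambda>k. KB n" and s = s and \<sigma> = \<sigma> and \<tau> = \<tau>]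
  have s: "s > 0" "ZZ n * exp (- (s / ZZ n)\<^sup>2 / 2) \<le> 1" using gs by (auto simp: good_scale_def)
  have Z: "dirichlet_conv (sf n) (dprod (xch (\<kappa> - 1) n D) n) e \<noteq> 0 \<Longrightarrow> real e \<le> ZZ n" for D e
    unfolding ZZ_def using sf_conv_supp hh_le_imp_le by blast
  show "gint \<tau> s h" unfolding h_def
    by (rule *(1)[OF s(1) fin_supp_sf _ dnorm2_sf_le[OF sg] Z ZZ_pos s(2)]) (use Cs in auto)
  have "gmean \<tau> s h \<le> 2 * (\<Sum>k\<in>?K. (Csum * exp V1 * norm (cc n k)) * (\<Prod>r<n. KU (mu n k) n r + KB n r))"
    unfolding h_def by (rule *(2)[OF s(1) fin_supp_sf _ dnorm2_sf_le[OF sg] Z ZZ_pos s(2)]) (use Cs in auto)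
  also have "\<dots> \<le> 2 * (CA / 2 * exp (\<kappa>\<^sup>2 * (\<Sum>r<n. vr r)))"
    by (intro mult_left_mono sf_weights_le) auto
  also have "\<dots> = CA * exp (\<kappa>\<^sup>2 * (\<Sum>r<n. vr r))" by simp
  finally show "gmean \<tau> s h \<le> CA * exp (\<kappa>\<^sup>2 * (\<Sum>r<n. vr r))" .
qed

lemma multiplicative_conv_one_le: "n > 0 \<Longrightarrow> norm (conv_one n) \<le> norm (f n)"
  using f_one by (simp add: conv_one_def)

lemma dnorm2_dprod_le:
  assumes s: "\<sigma> \<ge> 1 / 2"
  shows "dnorm2 (dprod (xch \<kappa> n D) n) \<sigma> \<le> (\<Prod>r<n. if r \<in> D then KU (\<lambda>_. \<kappa>\<^sup>2) n r else KB n r)"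
proof -
  let ?A = "dprod (xch \<kappa> n D) n"
  have fsA: "fin_supp ?A" by (rule fin_supp_dprod) (rule fin_supp_xch)
  have "bsum (\<lambda>e. (norm (dirichlet_conv conv_one ?A e))\<^sup>2 / real e) (nums_over (\<Union>r<n. I r)) (\<Prod>r<n. if r \<in> D then KU (\<lambda>_. \<kappa>\<^sup>2) n r else KB n r)"
  proof (rule bsum_conv_dprod[OF multiplicative_conv_one])
    show "bsum (\<lambda>e. (norm (dirichlet_conv conv_one (xch \<kappa> n D r) e))\<^sup>2 / real e) (nums_over (I r)) (if r \<in> D then KU (\<lambda>_. \<kappa>\<^sup>2) n r else KB n r)" if "r < n" for r
    proof (rule bsum_xch[OF that multiplicative_conv_one _ multiplicative_conv_one_le])
      fix p :: nat assume "prime p"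
      then have "conv_one p = 0" by (auto simp: conv_one_def)
      then show "(norm (conv_one p + of_real \<kappa> * f p))\<^sup>2 \<le> \<kappa>\<^sup>2 * (norm (f p))\<^sup>2"
        using kappa by (simp add: norm_mult power_mult_distrib)
    qed (use kappa in \<open>auto simp: conv_one_def\<close>)
  qed (use xch_supp fin_supp_xch I_disjoint in \<open>auto simp: conv_one_def\<close>)
  then have bd: "bsum (\<lambda>e. (norm (?A e))\<^sup>2 / real e) (nums_over (\<Union>r<n. I r)) (\<Prod>r<n. if r \<in> D then KU (\<lambda>_. \<kappa>\<^sup>2) n r else KB n r)"
    by (simp add: dirichlet_conv_one_left_fun[OF fsA])
  have "dnorm2 ?A \<sigma> \<le> (\<Sum>e | ?A e \<noteq> 0. (norm (?A e))\<^sup>2 * (1 / real e))"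
    unfolding dnorm2_def
  proof (intro sum_mono mult_left_mono powr_minus_le_inverse s)
    fix e assume "e \<in> {e. ?A e \<noteq> 0}"
    then show "e > 0" using dprod_xch_supp nums_over_pos by blast
  qed auto
  also have "\<dots> \<le> (\<Prod>r<n. if r \<in> D then KU (\<lambda>_. \<kappa>\<^sup>2) n r else KB n r)"
    using bsumD[OF bd, of "{e. ?A e \<noteq> 0}"] fsA dprod_xch_supp by (auto simp: fin_supp_def)
  finally show ?thesis .
qed

lemma gmean_prod_Upart_le:
  assumes gs: "good_scale n s" and sg: "\<sigma> \<ge> 1 / 2"
  defines "h \<equiv> (\<lambda>t. (\<Prod>r<n. Upart \<kappa> (lr n r) (Mr n r) (Pr r (Complex \<sigma> t))))"
  shows "gint \<tau> s h" "gmean \<tau> s h \<le> CA * exp (\<kappa>\<^sup>2 * (\<Sum>r<n. vr r))"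
proof -
  have s: "s > 0" "ZZ n * exp (- (s / ZZ n)\<^sup>2 / 2) \<le> 1" using gs by (auto simp: good_scale_def)
  have fsA: "fin_supp (dprod (xch \<kappa> n D) n)" for D by (rule fin_supp_dprod) (rule fin_supp_xch)
  have eq: "dirichlet_conv conv_one (dprod (xch \<kappa> n D) n) = dprod (xch \<kappa> n D) n" for D
    by (rule dirichlet_conv_one_left_fun[OF fsA])
  have bd: "dnorm2 (dirichlet_conv conv_one (dprod (xch \<kappa> n D) n)) \<sigma> \<le>
      (\<Sum>k\<in>{0::int}. 1 * (\<Prod>r<n. if r \<in> D then KU (\<lambda>_. \<kappa>\<^sup>2) n r else KB n r))" for D
    unfolding eq using dnorm2_dprod_le[OF sg, of n D] by simp
  have Z: "dirichlet_conv conv_one (dprod (xch \<kappa> n D) n) e \<noteq> 0 \<Longrightarrow> real e \<le> ZZ n" for D e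
  proof -
    assume "dirichlet_conv conv_one (dprod (xch \<kappa> n D) n) e \<noteq> 0"
    then have "e \<in> nums_over (\<Union>r<n. I r)" "hh e \<le> m * KK n" unfolding eq using dprod_xch_supp by blast+
    then have "e > 0" "hh e \<le> 3 * m * KK n" using nums_over_pos by auto
    then show "real e \<le> ZZ n" unfolding ZZ_def by (rule hh_le_imp_le)
  qed
  have h: "h = (\<lambda>t. (norm (dpoly conv_one (Complex \<sigma> t)))\<^sup>2 * (\<Prod>r<n. Upart \<kappa> (lr n r) (Mr n r) (Pr r (Complex \<sigma> t))))"
    unfolding h_def by (simp add: dpoly_conv_one)
  note * = gmean_prod_Upart[where KS = "{0::int}" and w = "\<lambda>k. 1" and \<alpha> = "\<kappa>" and ?a0.0 = conv_one and n = n
      and Z = "ZZ n" and KU = "\<lambda>k. KU (\<lambda>_. \<kappa>\<^sup>2) n" and KB = "\<lambda>k. KB n" and s = s and \<sigma> = \<sigma> and \<tau> = \<tau>,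
      OF s(1) fin_supp_conv_one _ bd Z ZZ_pos s(2), folded h]
  show "gint \<tau> s h" by (rule *(1)) simp
  have "gmean \<tau> s h \<le> 2 * (\<Prod>r<n. KU (\<lambda>_. \<kappa>\<^sup>2) n r + KB n r)" using *(2) by simp
  also have "\<dots> \<le> 2 * (CA / 2 * exp (\<kappa>\<^sup>2 * (\<Sum>r<n. vr r)))"
    by (intro mult_left_mono sq_weights_le) auto
  also have "\<dots> = CA * exp (\<kappa>\<^sup>2 * (\<Sum>r<n. vr r))" by simp
  finally show "gmean \<tau> s h \<le> CA * exp (\<kappa>\<^sup>2 * (\<Sum>r<n. vr r))" .
qed

end

subsection \<open>Lower bound for the inner product\<close>

lemma one_plus_ge_exp:
  fixes x e :: real
  assumes "0 \<le> x" "x \<le> 1" "0 \<le> e" "e \<le> 1 / 2"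
  shows "1 + x - e \<ge> exp (x - x\<^sup>2 - 2 * e)"
proof -
  have "exp (x - x\<^sup>2) \<le> 1 + x"
    using ln_one_plus_pos_lower_bound[OF assms(1,2)] assms by (subst (asm) ln_ge_iff) auto
  moreover have "exp (- 2 * e) \<le> 1 - e" by (rule one_minus_ge_exp) (use assms in auto)
  ultimately have "exp (x - x\<^sup>2) * exp (- 2 * e) \<le> (1 + x) * (1 - e)"
    using assms by (intro mult_mono) auto
  also have "\<dots> \<le> 1 + x - e" using assms by (simp add: algebra_simps)
  finally show ?thesis by (simp add: exp_add[symmetric])
qed

context range_data
begin

text \<open>Two Rankin bounds, with \<rho> = 1 and \<rho> = 3; the coefficients of V are (1 + 1)^2
  and (1 + 3)^2.\<close>

definition C6 :: real where "C6 = exp (4 * V + CR 1 * R0) + exp (16 * V + CR 3 * R0)"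

text \<open>The polynomial without any high power, that is a product of truncated exponentials
  imitating L^\<alpha>.\<close>

definition qd :: "real \<Rightarrow> nat \<Rightarrow> nat \<Rightarrow> complex" where "qd \<alpha> n = dprod (xch \<alpha> n UNIV) n"

lemma fin_supp_qd: "fin_supp (qd \<alpha> n)"
  unfolding qd_def by (rule fin_supp_dprod) (rule fin_supp_xch)

lemma dpoly_qd: "dpoly (qd \<alpha> n) s = (\<Prod>r<n. texp (lr n r) (of_real \<alpha> * Pr r s))"
  unfolding qd_def dpoly_dprod[OF fin_supp_xch]
  by (simp add: xch_def Pr_def dpoly_trunc_pow[OF finite_I prime_I])

lemma xch_UNIV: "xch \<alpha> n UNIV r e = (if e \<in> nums_over (I r) \<and> Om e \<le> lr n r then omwt f (of_real \<alpha>) e else 0)"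
  by (simp add: xch_def wt_def trunc_pow_def omwt_def)

lemma xch_supp_nums: "xch \<alpha> n D r e \<noteq> 0 \<Longrightarrow> e \<in> nums_over (I r)"
  using xch_supp by blast

text \<open>The truncated sum \<open>sum G N\<close> is compared with a product of local factors
  \<open>sum G Y\<close>. Each local factor is 1 + x p up to CR 1 * RR p, where x p >= 0, so the
  product is at least the exponential of the sum of the x p up to the errors; the difference between
  the two sums is exponentially small in l.\<close>

lemma range_inner_lower:
  assumes r: "r < n" and R: "R0 \<le> 1 / 100" and a: "6 * C6 * exp (- real a) \<le> 1" and sg: "\<sigma> \<ge> 1 / 2"
  shows "exp ((\<Sum>p\<in>I r. \<kappa>\<^sup>2 * (norm (f p))\<^sup>2 * real p powr (- 2 * \<sigma>)) - (1 + 2 * CR 1) * (\<Sum>p\<in>I r. RR p) - 6 * C6 * exp (- real (lr n r)))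
    \<le> norm (\<Sum>e | xch \<kappa> n UNIV r e \<noteq> 0. dirichlet_conv f (xch (\<kappa> - 1) n UNIV r) e * cnj (xch \<kappa> n UNIV r e) * of_real (real e powr (- 2 * \<sigma>)))"
proof -
  define l where "l = lr n r"
  have la: "real a \<le> real l" using r a1 by (simp add: l_def lr_def)
  have l1: "l \<ge> 1" using r a1 by (simp add: l_def lr_def Suc_le_eq)
  define C where "C = dirichlet_conv f (omwt f (of_real (\<kappa> - 1)))"
  define G where "G e = C e * cnj (omwt f (of_real \<kappa>) e) * of_real (real e powr (- 2 * \<sigma>))" for e
  define N where "N = {e \<in> nums_over (I r). Om e \<le> l}"
  have finN: "finite N" unfolding N_def by (rule finite_nums_over_Om[OF finite_I prime_I])
  have CR1: "CR 1 \<le> 36"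
  proof -
    have "exp (2::real) \<le> 3\<^sup>2" using exp_real_le_3_power[of 2] by simp
    then show ?thesis by (simp add: CR_def)
  qed
  have T: "(\<Sum>e | xch \<kappa> n UNIV r e \<noteq> 0. dirichlet_conv f (xch (\<kappa> - 1) n UNIV r) e * cnj (xch \<kappa> n UNIV r e) * of_real (real e powr (- 2 * \<sigma>))) = sum G N"
  proof -
    have "(\<Sum>e | xch \<kappa> n UNIV r e \<noteq> 0. dirichlet_conv f (xch (\<kappa> - 1) n UNIV r) e * cnj (xch \<kappa> n UNIV r e) * of_real (real e powr (- 2 * \<sigma>)))
      = (\<Sum>e\<in>N. dirichlet_conv f (xch (\<kappa> - 1) n UNIV r) e * cnj (xch \<kappa> n UNIV r e) * of_real (real e powr (- 2 * \<sigma>)))"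
      by (rule sum.mono_neutral_left[OF finN]) (auto simp: N_def xch_UNIV l_def)
    also have "\<dots> = sum G N"
    proof (intro sum.cong refl)
      fix e assume e: "e \<in> N"
      have "dirichlet_conv f (xch (\<kappa> - 1) n UNIV r) e = C e"
        unfolding C_def dirichlet_conv_def
      proof (intro sum.cong refl)
        fix d assume "d \<in> {d. d dvd e}"
        then have d: "d dvd e" by simp
        then have eq: "e = d * (e div d)" by simp
        have e': "e \<in> nums_over (I r)" "Om e \<le> l" using e by (auto simp: N_def)
        have m: "d \<in> nums_over (I r)" "e div d \<in> nums_over (I r)" using e'(1) eq nums_over_mult_iff by metis+
        have "Om e = Om d + Om (e div d)" using Om_mult[OF nums_over_pos[OF m(1)] nums_over_pos[OF m(2)]] eq by simp
        then have "Om (e div d) \<le> l" using e'(2) by simp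
        then show "f d * xch (\<kappa> - 1) n UNIV r (e div d) = f d * omwt f (of_real (\<kappa> - 1)) (e div d)"
          using m(2) by (simp add: xch_UNIV l_def)
      qed
      then show "dirichlet_conv f (xch (\<kappa> - 1) n UNIV r) e * cnj (xch \<kappa> n UNIV r e) * of_real (real e powr (- 2 * \<sigma>)) = G e"
        using e by (simp add: G_def xch_UNIV N_def l_def)
    qed
    finally show ?thesis .
  qed
  have Cm: "multiplicative C" unfolding C_def by (rule multiplicative_dirichlet_conv[OF f_mult multiplicative_omwt])
  have C1: "C 1 = 1" unfolding C_def dirichlet_conv_at_one using f_one by simp
  have Gm: "G (m * n) = G m * G n" if "m > 0" "n > 0" "coprime m n" for m n
    using that Cm multiplicative_omwt[of f "of_real \<kappa>"] by (simp add: G_def multiplicative_def powr_mult)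
  have G1: "G 1 = 1" using C1 by (simp add: G_def)
  have "\<exists>Y. finite Y \<and> Y \<subseteq> nums_over (I r) \<and> N \<subseteq> Y \<and> sum G Y = (\<Prod>p\<in>I r. \<Sum>a\<le>l. G (p ^ a))"
    unfolding N_def by (rule truncated_euler_product[OF finite_I prime_I Gm G1])
  then obtain Y where Y: "finite Y" "Y \<subseteq> nums_over (I r)" "N \<subseteq> Y" "sum G Y = (\<Prod>p\<in>I r. \<Sum>a\<le>l. G (p ^ a))"
    by (elim exE conjE)
  define x where "x p = \<kappa>\<^sup>2 * (norm (f p))\<^sup>2 * real p powr (- 2 * \<sigma>)" for p
  have Gle: "norm (G e) \<le> norm (C e) * norm (omwt f (of_real \<kappa>) e) / real e" if "e > 0" for e
  proof -
    have "norm (C e) * norm (omwt f (of_real \<kappa>) e) * (real e powr (- 2 * \<sigma>)) \<le> norm (C e) * norm (omwt f (of_real \<kappa>) e) * (1 / real e)"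
      by (intro mult_left_mono powr_minus_le_inverse that sg) auto
    then show ?thesis by (simp add: G_def norm_mult)
  qed
  have euler: "exp (x p - (1 + 2 * CR 1) * RR p) \<le> norm (\<Sum>a\<le>l. G (p ^ a))" if pI: "p \<in> I r" for p
  proof -
    have p: "prime p" by (rule prime_I[OF pI])
    have p0: "p > 0" using p prime_gt_0_nat by simp
    have tp: "tt p \<le> 1" by (rule tt_I[OF pI])
    have Rp: "RR p \<le> R0" using R0_bound[of "{p}"] p ln_gt_I[OF pI] by simp
    have "{..l} = insert 0 (insert 1 {2..l})" using l1 by auto
    then have split: "(\<Sum>a\<le>l. G (p ^ a)) = G 1 + G p + (\<Sum>a=2..l. G (p ^ a))" by simp
    \<comment> \<open>Convolving f with \<kappa> - 1 leaves \<kappa> f p, and the conjugate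
      polynomial contributes \<kappa> cnj (f p): the first-order term is the nonnegative real x p,
      so the primes cannot cancel each other.\<close>
    have "C (p ^ 1) = of_real \<kappa> * f p"
      unfolding C_def dirichlet_conv_prime_power[OF p] omwt_prime_power[OF p] using f_one by (simp add: algebra_simps)
    then have "G p = of_real \<kappa> * f p * cnj (of_real \<kappa> * f p) * of_real (real p powr (- 2 * \<sigma>))"
      using omwt_prime_power[OF p, of f "of_real \<kappa>" 1] by (simp add: G_def)
    also have "\<dots> = of_real (\<kappa>\<^sup>2) * (f p * cnj (f p)) * of_real (real p powr (- 2 * \<sigma>))"
      by (simp add: power2_eq_square mult_ac)
    also have "f p * cnj (f p) = of_real ((norm (f p))\<^sup>2)" by (rule complex_norm_square[symmetric])
    also have "of_real (\<kappa>\<^sup>2) * of_real ((norm (f p))\<^sup>2) * of_real (real p powr (- 2 * \<sigma>)) = complex_of_real (x p)"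
      by (simp only: x_def of_real_mult)
    finally have Gp: "G p = of_real (x p)" .
    have x0: "0 \<le> x p" by (simp add: x_def)
    have xt: "x p \<le> (tt p)\<^sup>2"
    proof -
      have "\<kappa>\<^sup>2 \<le> 1" using kappa by (simp add: power_le_one)
      then have "x p \<le> 1 * (norm (f p))\<^sup>2 * (1 / real p)"
        unfolding x_def by (intro mult_mono powr_minus_le_inverse p0 sg) auto
      then show ?thesis using tt_sq[OF p0] by simp
    qed
    then have x1: "x p \<le> 1" using tp tt_nonneg[of p] power_le_one[of "tt p" 2] by linarith
    have tail: "norm (\<Sum>a=2..l. G (p ^ a)) \<le> CR 1 * RR p"
    proof -
      have "norm (\<Sum>a=2..l. G (p ^ a)) \<le> (\<Sum>a=2..l. ((half_norm C p a)\<^sup>2 + (half_norm (omwt f (of_real \<kappa>)) p a)\<^sup>2) / 2)"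
      proof (rule order_trans[OF norm_sum], rule sum_mono)
        fix a
        have "norm (G (p ^ a)) \<le> norm (C (p ^ a)) * norm (omwt f (of_real \<kappa>) (p ^ a)) / real (p ^ a)" using p0 by (intro Gle) simp
        also have "\<dots> \<le> ((norm (C (p ^ a)))\<^sup>2 + (norm (omwt f (of_real \<kappa>) (p ^ a)))\<^sup>2) / 2 / real (p ^ a)"
          using sum_squares_bound[of "norm (C (p ^ a))" "norm (omwt f (of_real \<kappa>) (p ^ a))"] by (intro divide_right_mono) auto
        also have "\<dots> = ((half_norm C p a)\<^sup>2 + (half_norm (omwt f (of_real \<kappa>)) p a)\<^sup>2) / 2"
          unfolding half_norm_sq[OF p0] by (simp add: add_divide_distrib)
        finally show "norm (G (p ^ a)) \<le> ((half_norm C p a)\<^sup>2 + (half_norm (omwt f (of_real \<kappa>)) p a)\<^sup>2) / 2" .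
      qed
      also have "\<dots> = ((\<Sum>a=2..l. (half_norm C p a)\<^sup>2) + (\<Sum>a=2..l. (half_norm (omwt f (of_real \<kappa>)) p a)\<^sup>2)) / 2"
        by (simp only: sum_divide_distrib[symmetric] sum.distrib)
      also have "\<dots> \<le> (CR 1 * RR p + CR 1 * RR p) / 2"
      proof (intro divide_right_mono add_mono euler_tail[OF p tp order_refl])
        fix a :: nat
        show "norm (C (p ^ a)) \<le> (\<Sum>b\<le>a. norm (f (p ^ b)) * ((1 * norm (f p)) ^ (a - b) / fact (a - b)))"
          unfolding C_def dirichlet_conv_prime_power[OF p] omwt_prime_power[OF p]
        proof (rule order_trans[OF norm_sum], rule sum_mono)
          fix b
          have "\<bar>\<kappa> - 1\<bar> * norm (f p) \<le> 1 * norm (f p)" using kappa by (intro mult_right_mono) auto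
          then have "norm (of_real (\<kappa> - 1) * f p) \<le> 1 * norm (f p)" unfolding norm_mult norm_of_real .
          then have "norm ((of_real (\<kappa> - 1) * f p) ^ (a - b) / fact (a - b)) \<le> (1 * norm (f p)) ^ (a - b) / fact (a - b)"
            unfolding norm_divide norm_power by (simp add: divide_right_mono power_mono)
          then show "norm (f (p ^ b) * ((of_real (\<kappa> - 1) * f p) ^ (a - b) / fact (a - b))) \<le> norm (f (p ^ b)) * ((1 * norm (f p)) ^ (a - b) / fact (a - b))"
            unfolding norm_mult[of "f (p ^ b)"] by (intro mult_left_mono) auto
        qed
        have "\<bar>\<kappa>\<bar> * norm (f p) \<le> 1 * norm (f p)" using kappa by (intro mult_right_mono) auto
        then have "norm (of_real \<kappa> * f p) \<le> 1 * norm (f p)" unfolding norm_mult norm_of_real .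
        then have "norm (omwt f (of_real \<kappa>) (p ^ a)) \<le> (1 * norm (f p)) ^ a / fact a"
          unfolding omwt_prime_power[OF p] norm_divide norm_power by (simp add: divide_right_mono power_mono)
        also have "\<dots> = (\<Sum>b\<in>{0}. norm (f (p ^ b)) * ((1 * norm (f p)) ^ (a - b) / fact (a - b)))" using f_one by simp
        also have "\<dots> \<le> (\<Sum>b\<le>a. norm (f (p ^ b)) * ((1 * norm (f p)) ^ (a - b) / fact (a - b)))"
          by (rule sum_mono2) auto
        finally show "norm (omwt f (of_real \<kappa>) (p ^ a)) \<le> (\<Sum>b\<le>a. norm (f (p ^ b)) * ((1 * norm (f p)) ^ (a - b) / fact (a - b)))" .
      qed auto
      finally show ?thesis by simp
    qed
    have e2: "CR 1 * RR p \<le> 1 / 2"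
      using mult_mono[OF CR1 order_trans[OF Rp R]] RR_nonneg[of p] by simp
    have "(x p)\<^sup>2 \<le> RR p"
    proof -
      have "x p \<le> xi p + (tt p)\<^sup>2" using xt xi_nonneg[OF p] by simp
      then show ?thesis unfolding RR_def using x0 by (intro power_mono)
    qed
    then have "exp (x p - (1 + 2 * CR 1) * RR p) \<le> exp (x p - (x p)\<^sup>2 - 2 * (CR 1 * RR p))"
      by (simp add: algebra_simps)
    also have "\<dots> \<le> 1 + x p - CR 1 * RR p"
      by (rule one_plus_ge_exp[OF x0 x1 _ e2]) (simp add: CR_nonneg RR_nonneg)
    also have "\<dots> \<le> norm (complex_of_real (1 + x p)) - norm (\<Sum>a=2..l. G (p ^ a))" using tail x0 unfolding norm_of_real by simp
    also have "\<dots> \<le> norm (complex_of_real (1 + x p) + (\<Sum>a=2..l. G (p ^ a)))" by (rule norm_diff_ineq)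
    also have "complex_of_real (1 + x p) + (\<Sum>a=2..l. G (p ^ a)) = (\<Sum>a\<le>l. G (p ^ a))"
      unfolding split G1 Gp by simp
    finally show ?thesis .
  qed
  let ?E = "(\<Sum>p\<in>I r. x p) - (1 + 2 * CR 1) * (\<Sum>p\<in>I r. RR p)"
  have prod: "exp ?E \<le> norm (sum G Y)"
  proof -
    have "exp ?E = (\<Prod>p\<in>I r. exp (x p - (1 + 2 * CR 1) * RR p))"
      by (simp add: exp_sum[OF finite_I, symmetric] sum_subtractf sum_distrib_left)
    also have "\<dots> \<le> (\<Prod>p\<in>I r. norm (\<Sum>a\<le>l. G (p ^ a)))" using euler by (intro prod_mono) auto
    finally show ?thesis unfolding Y(4) by (simp add: prod_norm)
  qed
  \<comment> \<open>A lower bound for the product by an absolute constant, from CR 1 <= 36 and R0 <=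
    1 / 100; it turns the absolute truncation error below into a relative one.\<close>
  have E1: "exp (- 1) \<le> exp ?E"
  proof -
    have "(1 + 2 * CR 1) * (\<Sum>p\<in>I r. RR p) \<le> (1 + 2 * 36) * (1 / 100)"
      using CR1 order_trans[OF R0_I R] CR_nonneg[of 1] by (intro mult_mono) (auto intro: sum_nonneg RR_nonneg)
    moreover have "0 \<le> (\<Sum>p\<in>I r. x p)" by (intro sum_nonneg) (simp add: x_def)
    ultimately show ?thesis by simp
  qed
  \<comment> \<open>Outside \<open>N\<close> there are more than l prime factors, and then
    \<kappa>^Omega <= 1 <= exp (- l) 3^Omega. The sums with 3 in place of \<kappa> are controlled by
    Rankin's bound.\<close>
  have diff: "norm (sum G Y - sum G N) \<le> exp (- real l) * C6"
  proof -
    let ?w = "omwt f 3"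
    have b1: "bsum (\<lambda>e. (norm (C e))\<^sup>2 / real e) (nums_over (I r)) (exp (4 * V + CR 1 * R0))"
    proof -
      have pw: "norm (complex_of_real (\<kappa> - 1) ^ j) \<le> 1 * 1 ^ j" for j
      proof -
        have "\<bar>\<kappa> - 1\<bar> \<le> 1" using kappa by auto
        then show ?thesis unfolding norm_power norm_of_real by (simp add: power_le_one)
      qed
      have "bsum (\<lambda>e. (norm (dirichlet_conv f (wt f (\<lambda>j. of_real (\<kappa> - 1) ^ j) (I r)) e))\<^sup>2 / real e) (nums_over (I r)) (1\<^sup>2 * exp ((1 + 1)\<^sup>2 * V + CR 1 * R0))"
        by (rule bsum_conv_rankin_bound[OF finite_I prime_I tt_I order_refl order_refl pw V_I R0_I])
      then show ?thesis by (rule bsum_mono) (simp_all add: conv_wt_power C_def)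
    qed
    have b2: "bsum (\<lambda>e. (norm (?w e))\<^sup>2 / real e) (nums_over (I r)) (exp (16 * V + CR 3 * R0))"
    proof -
      have "bsum (\<lambda>e. (norm (dirichlet_conv conv_one (wt f (\<lambda>j. 3 ^ j) (I r)) e))\<^sup>2 / real e) (nums_over (I r)) (1\<^sup>2 * exp ((1 + 3)\<^sup>2 * V + CR 3 * R0))"
        by (rule bsum_conv_rankin_bound[OF finite_I prime_I tt_I _ multiplicative_conv_one_le _ V_I R0_I]) (auto simp: norm_power)
      then show ?thesis
        by (rule bsum_mono) (auto simp: dirichlet_conv_one_left[OF nums_over_pos] wt_power)
    qed
    have "sum G Y - sum G N = sum G (Y - N)" using Y(1,3) by (simp add: sum_diff)
    also have "norm \<dots> \<le> (\<Sum>e\<in>Y - N. exp (- real l) * ((norm (C e))\<^sup>2 / real e + (norm (?w e))\<^sup>2 / real e))"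
    proof (rule order_trans[OF norm_sum], rule sum_mono)
      fix e assume e: "e \<in> Y - N"
      then have e1: "e \<in> nums_over (I r)" using Y(2) by auto
      then have e0: "e > 0" by (rule nums_over_pos)
      have "Om e \<ge> l" using e e1 by (auto simp: N_def)
      have "norm (omwt f (of_real \<kappa>) e) \<le> exp (- real l) * norm (?w e)"
      proof -
        have "\<kappa> ^ Om e \<le> 1" using kappa by (intro power_le_one) auto
        also have "1 \<le> exp (- real l) * exp (real (Om e))" using \<open>Om e \<ge> l\<close> by (simp add: exp_add[symmetric])
        also have "\<dots> \<le> exp (- real l) * 3 ^ Om e" by (intro mult_left_mono exp_real_le_3_power) auto
        finally have "\<kappa> ^ Om e * norm (ftil f e) \<le> exp (- real l) * 3 ^ Om e * norm (ftil f e)" by (rule mult_right_mono) simp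
        then show ?thesis using kappa by (simp add: omwt_def norm_mult norm_power)
      qed
      then have "norm (C e) * norm (omwt f (of_real \<kappa>) e) / real e \<le> norm (C e) * (exp (- real l) * norm (?w e)) / real e"
        by (intro divide_right_mono mult_left_mono) auto
      also have "\<dots> = exp (- real l) * (norm (C e) * norm (?w e) / real e)" by simp
      also have "\<dots> \<le> exp (- real l) * (((norm (C e))\<^sup>2 + (norm (?w e))\<^sup>2) / real e)"
      proof (intro mult_left_mono divide_right_mono)
        have "2 * norm (C e) * norm (?w e) \<le> (norm (C e))\<^sup>2 + (norm (?w e))\<^sup>2" by (rule sum_squares_bound)
        moreover have "0 \<le> norm (C e) * norm (?w e)" by simp
        ultimately show "norm (C e) * norm (?w e) \<le> (norm (C e))\<^sup>2 + (norm (?w e))\<^sup>2" by linarith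
      qed auto
      finally show "norm (G e) \<le> exp (- real l) * ((norm (C e))\<^sup>2 / real e + (norm (?w e))\<^sup>2 / real e)"
        using Gle[OF e0] by (simp add: add_divide_distrib)
    qed
    also have "\<dots> = exp (- real l) * ((\<Sum>e\<in>Y - N. (norm (C e))\<^sup>2 / real e) + (\<Sum>e\<in>Y - N. (norm (?w e))\<^sup>2 / real e))"
      by (simp add: sum.distrib sum_distrib_left distrib_left)
    also have "\<dots> \<le> exp (- real l) * C6"
      unfolding C6_def using Y(1,2) by (intro mult_left_mono add_mono bsumD[OF b1] bsumD[OF b2]) auto
    finally show ?thesis .
  qed
  have C60: "C6 \<ge> 0" by (simp add: C6_def)
  have small: "3 * C6 * exp (- real l) \<le> 1 / 2"
  proof -
    have "exp (- real l) \<le> exp (- real a)" using la by simp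
    then have "6 * C6 * exp (- real l) \<le> 6 * C6 * exp (- real a)" using C60 by (intro mult_left_mono) auto
    then show ?thesis using a by linarith
  qed
  have "exp (- real l) * C6 \<le> (3 * exp (- 1)) * (exp (- real l) * C6)"
  proof -
    have "exp (1::real) * exp (- 1) = 1" by (simp add: exp_add[symmetric])
    moreover have "exp (1::real) * exp (- 1) \<le> 3 * exp (- 1)" by (intro mult_right_mono exp_le) auto
    ultimately have "1 \<le> 3 * exp (- 1 :: real)" by linarith
    then show ?thesis using mult_right_mono[of 1 "3 * exp (- 1)" "exp (- real l) * C6"] C60 by simp
  qed
  also have "\<dots> \<le> (3 * exp ?E) * (exp (- real l) * C6)" using E1 C60 by (intro mult_right_mono mult_left_mono) auto
  finally have "norm (sum G Y - sum G N) \<le> exp ?E * (3 * C6 * exp (- real l))" using diff by (simp add: mult_ac)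
  moreover have "norm (sum G Y) - norm (sum G N) \<le> norm (sum G Y - sum G N)" by (rule norm_triangle_ineq2)
  ultimately have "exp ?E * (1 - 3 * C6 * exp (- real l)) \<le> norm (sum G N)" using prod by (simp add: algebra_simps)
  moreover have "exp (- 2 * (3 * C6 * exp (- real l))) \<le> 1 - 3 * C6 * exp (- real l)"
    by (rule one_minus_ge_exp) (use C60 small in auto)
  then have "exp ?E * exp (- 2 * (3 * C6 * exp (- real l))) \<le> exp ?E * (1 - 3 * C6 * exp (- real l))" by (intro mult_left_mono) auto
  moreover have "exp (?E - 6 * C6 * exp (- real l)) = exp ?E * exp (- 2 * (3 * C6 * exp (- real l)))"
    unfolding exp_add[symmetric] by (rule arg_cong[where f = exp]) simp
  ultimately have "exp (?E - 6 * C6 * exp (- real l)) \<le> norm (sum G N)" by linarith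
  then show ?thesis unfolding T x_def l_def by simp
qed

text \<open>On the support of \<open>qd\<close> all heights are at most m * KK n, where the cutoff
  is 1, so \<open>sf n\<close> may be replaced by f and the inner product factors over the ranges.
  Moving off the critical line by A / 2^(i0 + n) costs range r at most min 2 (4 A / 2^(n - r)) of
  its prime sum; \<open>sum_min_geometric\<close> adds this up to a power of 1 + 4 A.\<close>

lemma inner_lower:
  assumes R: "R0 \<le> 1 / 100" and a: "6 * C6 * exp (- real a) \<le> 1" and A: "A \<ge> 0" and sg: "\<sigma> = 1 / 2 + A / 2 ^ (i0 + n)"
  shows "exp (- (1 + 6 * C6 + 3 * V)) * (1 + 4 * A) powr (- (2 * V / ln 2)) * exp (\<kappa>\<^sup>2 * (\<Sum>r<n. vr r))
    \<le> norm (\<Sum>e | qd \<kappa> n e \<noteq> 0. dirichlet_conv (sf n) (qd (\<kappa> - 1) n) e * cnj (qd \<kappa> n e) * of_real (real e powr (- 2 * \<sigma>)))"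
proof -
  have sg2: "\<sigma> \<ge> 1 / 2" using A sg by simp
  have C60: "C6 \<ge> 0" by (simp add: C6_def)
  have "(\<Sum>e | qd \<kappa> n e \<noteq> 0. dirichlet_conv (sf n) (qd (\<kappa> - 1) n) e * cnj (qd \<kappa> n e) * of_real (real e powr (- 2 * \<sigma>)))
    = (\<Sum>e | qd \<kappa> n e \<noteq> 0. dirichlet_conv f (qd (\<kappa> - 1) n) e * cnj (qd \<kappa> n e) * of_real (real e powr (- 2 * \<sigma>)))"
  proof (intro sum.cong refl)
    fix e assume "e \<in> {e. qd \<kappa> n e \<noteq> 0}"
    then have e: "e \<in> nums_over (\<Union>r<n. I r)" "hh e \<le> m * KK n" unfolding qd_def using dprod_xch_supp by blast+
    have "dirichlet_conv (sf n) (qd (\<kappa> - 1) n) e = dirichlet_conv f (qd (\<kappa> - 1) n) e"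
      unfolding dirichlet_conv_def
    proof (intro sum.cong refl)
      fix d assume "d \<in> {d. d dvd e}"
      then have d: "d > 0" "hh d \<le> m * KK n"
        using e nums_over_pos[OF e(1)] hh_dvd_le[of e d] by (auto intro!: gr0I)
      then show "sf n d * qd (\<kappa> - 1) n (e div d) = f d * qd (\<kappa> - 1) n (e div d)"
        by (simp add: sf_def bcut_one)
    qed
    then show "dirichlet_conv (sf n) (qd (\<kappa> - 1) n) e * cnj (qd \<kappa> n e) * of_real (real e powr (- 2 * \<sigma>)) =
       dirichlet_conv f (qd (\<kappa> - 1) n) e * cnj (qd \<kappa> n e) * of_real (real e powr (- 2 * \<sigma>))" by simp
  qed
  also have "\<dots> = (\<Prod>r<n. \<Sum>e | xch \<kappa> n UNIV r e \<noteq> 0. dirichlet_conv f (xch (\<kappa> - 1) n UNIV r) e * cnj (xch \<kappa> n UNIV r e) * of_real (real e powr (- 2 * \<sigma>)))"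
    unfolding qd_def by (rule inner_dprod[where I = I, OF f_mult f_one]) (use fin_supp_xch xch_supp_nums I_disjoint in auto)
  finally have eq: "norm (\<Sum>e | qd \<kappa> n e \<noteq> 0. dirichlet_conv (sf n) (qd (\<kappa> - 1) n) e * cnj (qd \<kappa> n e) * of_real (real e powr (- 2 * \<sigma>)))
    = (\<Prod>r<n. norm (\<Sum>e | xch \<kappa> n UNIV r e \<noteq> 0. dirichlet_conv f (xch (\<kappa> - 1) n UNIV r) e * cnj (xch \<kappa> n UNIV r e) * of_real (real e powr (- 2 * \<sigma>))))"
    by (simp add: prod_norm)
  define X where "X r = (\<Sum>p\<in>I r. \<kappa>\<^sup>2 * (norm (f p))\<^sup>2 * real p powr (- 2 * \<sigma>))" for r
  have X: "X r \<ge> \<kappa>\<^sup>2 * vr r - V * min 2 (4 * A / 2 ^ (n - r))" if r: "r < n" for r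
  proof -
    define d where "d = min 2 (4 * A / 2 ^ (n - r))"
    have d0: "d \<ge> 0" using A by (simp add: d_def)
    have "X r \<ge> (\<Sum>p\<in>I r. \<kappa>\<^sup>2 * (tt p)\<^sup>2 * (1 - d))"
      unfolding X_def
    proof (rule sum_mono)
      fix p assume p: "p \<in> I r"
      have p0: "p > 0" using prime_I[OF p] prime_gt_0_nat by simp
      have "ln (real p) \<le> 2 ^ (i0 + r + 1)" using p by (simp add: I_def)
      then have "2 * A / 2 ^ (i0 + n) * ln (real p) \<le> 2 * A / 2 ^ (i0 + n) * 2 ^ (i0 + r + 1)"
        using A by (intro mult_left_mono) auto
      also have "\<dots> = 4 * A / 2 ^ (n - r)"
      proof -
        have "(2::real) ^ (i0 + n) = 2 ^ (i0 + r) * 2 ^ (n - r)" using r by (simp add: power_add[symmetric])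
        then show ?thesis by (simp add: field_simps)
      qed
      finally have le: "2 * A / 2 ^ (i0 + n) * ln (real p) \<le> 4 * A / 2 ^ (n - r)" .
      have "1 - d \<le> exp (- (2 * A / 2 ^ (i0 + n) * ln (real p)))"
      proof (cases "4 * A / 2 ^ (n - r) \<le> 2")
        case True
        then have "1 - d \<le> 1 + - (2 * A / 2 ^ (i0 + n) * ln (real p))" using le by (simp add: d_def)
        also have "\<dots> \<le> exp (- (2 * A / 2 ^ (i0 + n) * ln (real p)))" by (rule exp_ge_add_one_self)
        finally show ?thesis .
      next
        case False
        then have "1 - d \<le> 0" by (simp add: d_def)
        then show ?thesis by (rule order_trans) simp
      qed
      also have "\<dots> = real p powr (- (2 * A / 2 ^ (i0 + n)))" using p0 by (simp add: powr_def)
      finally have 1: "1 - d \<le> real p powr (- (2 * A / 2 ^ (i0 + n)))" .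
      have "real p powr (- 2 * \<sigma>) = real p powr (- 1) * real p powr (- (2 * A / 2 ^ (i0 + n)))"
      proof -
        have "- 2 * \<sigma> = - 1 + - (2 * A / 2 ^ (i0 + n))" unfolding sg by simp
        then show ?thesis by (simp only: powr_add)
      qed
      also have "real p powr (- 1) = 1 / real p" using p0 by (simp add: powr_minus_divide)
      finally have "\<kappa>\<^sup>2 * (norm (f p))\<^sup>2 * real p powr (- 2 * \<sigma>) = \<kappa>\<^sup>2 * (tt p)\<^sup>2 * real p powr (- (2 * A / 2 ^ (i0 + n)))"
        unfolding tt_sq[OF p0] by simp
      moreover have "\<kappa>\<^sup>2 * (tt p)\<^sup>2 * (1 - d) \<le> \<kappa>\<^sup>2 * (tt p)\<^sup>2 * real p powr (- (2 * A / 2 ^ (i0 + n)))"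
        by (intro mult_left_mono 1) auto
      ultimately show "\<kappa>\<^sup>2 * (tt p)\<^sup>2 * (1 - d) \<le> \<kappa>\<^sup>2 * (norm (f p))\<^sup>2 * real p powr (- 2 * \<sigma>)" by linarith
    qed
    moreover have "(\<Sum>p\<in>I r. \<kappa>\<^sup>2 * (tt p)\<^sup>2 * (1 - d)) = \<kappa>\<^sup>2 * vr r * (1 - d)"
      by (simp add: vr_def sum_distrib_left sum_distrib_right)
    moreover have "\<kappa>\<^sup>2 * vr r * d \<le> V * d"
    proof (rule mult_right_mono[OF _ d0])
      have "\<kappa>\<^sup>2 \<le> 1" using kappa by (simp add: power_le_one)
      moreover have "0 \<le> vr r" "vr r \<le> V" using V_I[of r] by (auto simp: vr_def sum_nonneg)
      ultimately show "\<kappa>\<^sup>2 * vr r \<le> V" using mult_mono[of "\<kappa>\<^sup>2" 1 "vr r" V] by simp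
    qed
    ultimately show ?thesis unfolding d_def[symmetric] by (simp add: right_diff_distrib)
  qed
  have "exp (- (1 + 6 * C6 + 3 * V)) * (1 + 4 * A) powr (- (2 * V / ln 2)) * exp (\<kappa>\<^sup>2 * (\<Sum>r<n. vr r))
    = exp (\<kappa>\<^sup>2 * (\<Sum>r<n. vr r) - V * (2 * (ln (1 + 4 * A) / ln 2) + 3) - 1 - 6 * C6)"
    using A by (simp add: powr_def exp_add[symmetric] algebra_simps)
  also have "\<dots> \<le> exp ((\<Sum>r<n. X r) - (1 + 2 * CR 1) * (\<Sum>r<n. \<Sum>p\<in>I r. RR p) - 6 * C6 * (\<Sum>r<n. exp (- real (lr n r))))"
  proof -
    have "(\<Sum>r<n. \<kappa>\<^sup>2 * vr r - V * min 2 (4 * A / 2 ^ (n - r))) \<le> (\<Sum>r<n. X r)" using X by (intro sum_mono) auto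
    moreover have "(\<Sum>r<n. \<kappa>\<^sup>2 * vr r - V * min 2 (4 * A / 2 ^ (n - r))) = \<kappa>\<^sup>2 * (\<Sum>r<n. vr r) - V * (\<Sum>r<n. min 2 (4 * A / 2 ^ (n - r)))"
      by (simp add: sum_subtractf sum_distrib_left)
    moreover have "V * (\<Sum>r<n. min 2 (4 * A / 2 ^ (n - r))) \<le> V * (2 * (ln (1 + 4 * A) / ln 2) + 3)"
      using A V_nonneg by (intro mult_left_mono sum_min_geometric) auto
    moreover have "(1 + 2 * CR 1) * (\<Sum>r<n. \<Sum>p\<in>I r. RR p) \<le> 1"
    proof -
      have "exp (2::real) \<le> 3\<^sup>2" using exp_real_le_3_power[of 2] by simp
      then have "CR 1 \<le> 36" by (simp add: CR_def)
      then have "(1 + 2 * CR 1) * (\<Sum>r<n. \<Sum>p\<in>I r. RR p) \<le> (1 + 2 * 36) * (1 / 100)"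
        using order_trans[OF R0_Un R] CR_nonneg[of 1] by (intro mult_mono) (auto intro!: sum_nonneg RR_nonneg)
      then show ?thesis by simp
    qed
    moreover have "6 * C6 * (\<Sum>r<n. exp (- real (lr n r))) \<le> 6 * C6 * 1"
      using C60 sum_exp_rev_le[OF a1] unfolding lr_def by (intro mult_left_mono) auto
    ultimately show ?thesis unfolding exp_le_cancel_iff by linarith
  qed
  also have "\<dots> = (\<Prod>r<n. exp (X r - (1 + 2 * CR 1) * (\<Sum>p\<in>I r. RR p) - 6 * C6 * exp (- real (lr n r))))"
    by (simp add: exp_sum[symmetric] sum_subtractf sum_distrib_left)
  also have "\<dots> \<le> (\<Prod>r<n. norm (\<Sum>e | xch \<kappa> n UNIV r e \<noteq> 0. dirichlet_conv f (xch (\<kappa> - 1) n UNIV r) e * cnj (xch \<kappa> n UNIV r e) * of_real (real e powr (- 2 * \<sigma>))))"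
    unfolding X_def using range_inner_lower[OF _ R a sg2] by (intro prod_mono) auto
  finally show ?thesis unfolding eq .
qed

end

subsection \<open>Moments of the truncated series\<close>

lemma powr_geometric_le_add:
  fixes x y k :: real
  assumes "0 \<le> x" "0 \<le> y" "0 < k" "k < 1"
  shows "x powr k * y powr (1 - k) \<le> x + y"
proof -
  have "x powr k * y powr (1 - k) \<le> (x + y) powr k * (x + y) powr (1 - k)"
    using assms by (intro mult_mono powr_mono2) auto
  also have "\<dots> = (x + y) powr 1" by (simp add: powr_add[symmetric])
  also have "\<dots> = x + y" using assms by simp
  finally show ?thesis .
qed

context range_data
begin

text \<open>The main term: the prime sum over all ranges grows like a multiple of n, so this is of
  the order of a power of 2^n, that is of ln T.\<close>

abbreviation LL :: "nat \<Rightarrow> real" where "LL n \<equiv> exp (\<kappa>\<^sup>2 * (\<Sum>r<n. vr r))"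

definition Sd :: "nat \<Rightarrow> complex \<Rightarrow> complex" where "Sd n s = dpoly (sf n) s"

text \<open>The off-diagonal factor of \<open>gmean_dpoly_inner\<close> for polynomials of length ZZ
  n.\<close>

definition eta :: "nat \<Rightarrow> real \<Rightarrow> real" where "eta n s = ZZ n * exp (- (s / ZZ n)\<^sup>2 / 2)"

lemma CA_ge_1: "CA \<ge> 1"
proof -
  show ?thesis using sq_weights_le[of 0] by simp
qed

lemma lr_pos: "r < n \<Longrightarrow> lr n r > 0" using a1 by (simp add: lr_def)

lemma Sd_cont: "continuous_on UNIV (\<lambda>t. Sd n (Complex \<sigma> t))"
  unfolding Sd_def by (rule dpoly_cont)

lemma Sd_bounded: "\<exists>C. \<forall>t. norm (Sd n (Complex \<sigma> t)) \<le> C"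
  unfolding Sd_def using dpoly_bound by blast

lemma gint_Sd:
  assumes s: "s > 0" shows "gint \<tau> s (\<lambda>t. norm (Sd n (Complex \<sigma> t)) powr (2 * \<kappa>))"
proof -
  obtain C where C: "\<And>t. norm (Sd n (Complex \<sigma> t)) \<le> C" using Sd_bounded by blast
  show ?thesis
  proof (rule gint_cont_bounded[OF s])
    show "continuous_on UNIV (\<lambda>t. norm (Sd n (Complex \<sigma> t)) powr (2 * \<kappa>))"
      using kappa by (intro continuous_on_powr' continuous_intros Sd_cont) auto
    show "norm (norm (Sd n (Complex \<sigma> t)) powr (2 * \<kappa>)) \<le> C powr (2 * \<kappa>)" for t
      using C kappa by (simp add: powr_mono2)
  qed
qed

text \<open>Multiply by 1 <= 3 U^\<kappa> W^(1 - \<kappa>), the product of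
  \<open>one_le_Upart\<close> over the ranges, whose errors multiply to at most exp 1 <= 3. The
  result is the geometric mean of S^2 U and W, hence at most their sum.\<close>

lemma S_moment_upper:
  assumes gs: "s > 0" "eta n s \<le> 1" and sg: "\<sigma> \<ge> 1 / 2"
  shows "gmean \<tau> s (\<lambda>t. norm (Sd n (Complex \<sigma> t)) powr (2 * \<kappa>)) \<le> 6 * CA * LL n"
proof -
  have g: "good_scale n s" using gs by (simp add: good_scale_def eta_def)
  define U where "U t = (\<Prod>r<n. Upart (\<kappa> - 1) (lr n r) (Mr n r) (Pr r (Complex \<sigma> t)))" for t
  define W where "W t = (\<Prod>r<n. Upart \<kappa> (lr n r) (Mr n r) (Pr r (Complex \<sigma> t)))" for t
  define S where "S t = norm (Sd n (Complex \<sigma> t))" for t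
  have U0: "U t \<ge> 0" "W t \<ge> 0" for t by (auto simp: U_def W_def intro!: prod_nonneg Upart_nonneg)
  have one: "1 \<le> 3 * (U t powr \<kappa> * W t powr (1 - \<kappa>))" for t
  proof -
    let ?u = "\<lambda>r. Upart (\<kappa> - 1) (lr n r) (Mr n r) (Pr r (Complex \<sigma> t))"
    let ?w = "\<lambda>r. Upart \<kappa> (lr n r) (Mr n r) (Pr r (Complex \<sigma> t))"
    have "(\<Prod>r<n. 1) \<le> (\<Prod>r<n. exp (exp (- real (lr n r))) * ?u r powr \<kappa> * ?w r powr (1 - \<kappa>))"
      by (intro prod_mono) (auto intro: one_le_Upart lr_pos kappa)
    also have "\<dots> = exp (\<Sum>r<n. exp (- real (lr n r))) * (U t powr \<kappa> * W t powr (1 - \<kappa>))"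
      by (simp add: prod.distrib exp_sum U_def W_def prod_powr_distrib Upart_nonneg)
    also have "\<dots> \<le> exp 1 * (U t powr \<kappa> * W t powr (1 - \<kappa>))"
      using sum_exp_rev_le[OF a1, of n] by (intro mult_right_mono) (auto simp: lr_def)
    also have "\<dots> \<le> 3 * (U t powr \<kappa> * W t powr (1 - \<kappa>))" using exp_le by (intro mult_right_mono) auto
    finally show ?thesis by simp
  qed
  have pt: "S t powr (2 * \<kappa>) \<le> 3 * (S t)\<^sup>2 * U t + 3 * W t" for t
  proof -
    have S0: "S t \<ge> 0" by (simp add: S_def)
    have "S t powr (2 * \<kappa>) * 1 \<le> S t powr (2 * \<kappa>) * (3 * (U t powr \<kappa> * W t powr (1 - \<kappa>)))"
      by (intro mult_left_mono one) auto
    also have "\<dots> = ((S t)\<^sup>2) powr \<kappa> * (3 * (U t powr \<kappa> * W t powr (1 - \<kappa>)))"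
      using powr_powr[of "S t" 2 \<kappa>] S0 by (simp add: powr_numeral)
    also have "((S t)\<^sup>2) powr \<kappa> * (3 * (U t powr \<kappa> * W t powr (1 - \<kappa>))) = 3 * (((S t)\<^sup>2 * U t) powr \<kappa> * W t powr (1 - \<kappa>))"
      using U0 by (simp add: powr_mult)
    also have "\<dots> \<le> 3 * ((S t)\<^sup>2 * U t + W t)"
      using U0 kappa by (intro mult_left_mono powr_geometric_le_add) auto
    finally show ?thesis by (simp add: algebra_simps)
  qed
  note A1 = gmean_sq_mult_Upart_le[OF g sg, of \<tau>, folded Sd_def, folded U_def S_def]
  note A2 = gmean_prod_Upart_le[OF g sg, of \<tau>, folded W_def]
  have i1: "gint \<tau> s (\<lambda>t. 3 * ((S t)\<^sup>2 * U t))" by (rule gint_cmult[OF A1(1)])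
  have i2: "gint \<tau> s (\<lambda>t. 3 * W t)" by (rule gint_cmult[OF A2(1)])
  have "gmean \<tau> s (\<lambda>t. S t powr (2 * \<kappa>)) \<le> gmean \<tau> s (\<lambda>t. 3 * ((S t)\<^sup>2 * U t) + 3 * W t)"
    by (rule gmean_mono) (use gint_Sd[OF gs(1)] gint_add[OF i1 i2] pt in \<open>auto simp: S_def mult.assoc\<close>)
  also have "\<dots> = 3 * gmean \<tau> s (\<lambda>t. (S t)\<^sup>2 * U t) + 3 * gmean \<tau> s W"
    by (simp only: gmean_add[OF i1 i2] gmean_cmult)
  also have "\<dots> \<le> 3 * (CA * LL n) + 3 * (CA * LL n)" using A1(2) A2(2) by (intro add_mono mult_left_mono) auto
  finally show ?thesis unfolding S_def by simp
qed

text \<open>The loss \<open>(1 + 4 * A) powr (- (2 * V / ln 2))\<close> comes from the ranges of primes beyond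
  \<open>exp (2 ^ (i0 + n) / A)\<close>, which contribute little at distance \<open>A / 2 ^ (i0 + n)\<close> from the
  critical line.\<close>

definition LB :: "real \<Rightarrow> real" where
  "LB A = exp (- (1 + 6 * C6 + 3 * V)) * (1 + 4 * A) powr (- (2 * V / ln 2))"

text \<open>The inner product of S Q1 with Q2 is large by \<open>inner_lower\<close>. Pointwise S Q1
  Q2 is bounded by a combination of S^(2 \<kappa>), S^2 U and W, and the means of the last two are
  at most CA * LL n; so the mean of S^(2 \<kappa>) must account for the rest.\<close>

lemma S_moment_lower:
  assumes R: "R0 \<le> 1 / 100" and a: "6 * C6 * exp (- real a) \<le> 1" and A: "A \<ge> 0" and sg: "\<sigma> = 1 / 2 + A / 2 ^ (i0 + n)"
    and gs: "s > 0" "eta n s \<le> 1" and es: "eta n s * CA \<le> LB A / 2"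
  shows "(LB A)\<^sup>2 / (4 * (1 + exp (2 + 1 / \<kappa>)) * CA) * LL n \<le> gmean \<tau> s (\<lambda>t. norm (Sd n (Complex \<sigma> t)) powr (2 * \<kappa>))"
proof -
  have g: "good_scale n s" using gs by (simp add: good_scale_def eta_def)
  have sg2: "\<sigma> \<ge> 1 / 2" using A sg by simp
  have LB0: "LB A > 0" using A by (simp add: LB_def)
  define U where "U t = (\<Prod>r<n. Upart (\<kappa> - 1) (lr n r) (Mr n r) (Pr r (Complex \<sigma> t)))" for t
  define W where "W t = (\<Prod>r<n. Upart \<kappa> (lr n r) (Mr n r) (Pr r (Complex \<sigma> t)))" for t
  define S where "S t = norm (Sd n (Complex \<sigma> t))" for t
  define Q1 where "Q1 t = norm (dpoly (qd (\<kappa> - 1) n) (Complex \<sigma> t))" for t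
  define Q2 where "Q2 t = norm (dpoly (qd \<kappa> n) (Complex \<sigma> t))" for t
  have nn: "S t \<ge> 0" "Q1 t \<ge> 0" "Q2 t \<ge> 0" for t by (auto simp: S_def Q1_def Q2_def)
  define aa where "aa = dirichlet_conv (sf n) (qd (\<kappa> - 1) n)"
  have fsa: "fin_supp aa" unfolding aa_def by (rule fin_supp_conv(1)[OF fin_supp_sf fin_supp_qd])
  have Za: "aa e \<noteq> 0 \<Longrightarrow> real e \<le> ZZ n" for e
    unfolding aa_def qd_def ZZ_def using sf_conv_supp hh_le_imp_le by blast
  have Zb: "qd \<kappa> n e \<noteq> 0 \<Longrightarrow> real e \<le> ZZ n" for e
  proof -
    assume "qd \<kappa> n e \<noteq> 0"
    then have "e \<in> nums_over (\<Union>r<n. I r)" "hh e \<le> m * KK n" unfolding qd_def using dprod_xch_supp by blast+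
    then have "e > 0" "hh e \<le> 3 * m * KK n" using nums_over_pos by auto
    then show "real e \<le> ZZ n" unfolding ZZ_def by (rule hh_le_imp_le)
  qed
  have da: "dnorm2 aa \<sigma> \<le> CA * LL n"
  proof -
    have Cs: "Csum \<ge> 0" by (simp add: Csum_def)
    have "dnorm2 aa \<sigma> \<le> (\<Sum>k\<in>{- int (YY n)..int (YY n)}. (Csum * exp V1 * norm (cc n k)) * (\<Prod>r<n. if r \<in> UNIV then KU (mu n k) n r else KB n r))"
      unfolding aa_def qd_def by (rule dnorm2_sf_le[OF sg2])
    also have "\<dots> \<le> (\<Sum>k\<in>{- int (YY n)..int (YY n)}. (Csum * exp V1 * norm (cc n k)) * (\<Prod>r<n. KU (mu n k) n r + KB n r))"
      using Cs by (intro sum_mono mult_left_mono prod_mono) (auto simp: KU_def KB_def C3_def)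
    also have "\<dots> \<le> CA / 2 * LL n" by (rule sf_weights_le)
    also have "\<dots> \<le> CA * LL n" using CA_ge_1 by simp
    finally show ?thesis .
  qed
  have db: "dnorm2 (qd \<kappa> n) \<sigma> \<le> CA * LL n"
  proof -
    have "dnorm2 (qd \<kappa> n) \<sigma> \<le> (\<Prod>r<n. if r \<in> UNIV then KU (\<lambda>_. \<kappa>\<^sup>2) n r else KB n r)"
      unfolding qd_def by (rule dnorm2_dprod_le[OF sg2])
    also have "\<dots> \<le> (\<Prod>r<n. KU (\<lambda>_. \<kappa>\<^sup>2) n r + KB n r)"
      by (intro prod_mono) (auto simp: KU_def KB_def C3_def)
    also have "\<dots> \<le> CA / 2 * LL n" by (rule sq_weights_le)
    also have "\<dots> \<le> CA * LL n" using CA_ge_1 by simp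
    finally show ?thesis .
  qed
  let ?ip = "\<Sum>e | aa e \<noteq> 0. aa e * cnj (qd \<kappa> n e) * of_real (real e powr (- 2 * \<sigma>))"
  have "?ip = (\<Sum>e \<in> {e. aa e \<noteq> 0} \<union> {e. qd \<kappa> n e \<noteq> 0}. aa e * cnj (qd \<kappa> n e) * of_real (real e powr (- 2 * \<sigma>)))"
    using fsa fin_supp_qd by (intro sum.mono_neutral_left) (auto simp: fin_supp_def)
  also have "\<dots> = (\<Sum>e | qd \<kappa> n e \<noteq> 0. aa e * cnj (qd \<kappa> n e) * of_real (real e powr (- 2 * \<sigma>)))"
    using fsa fin_supp_qd by (intro sum.mono_neutral_right) (auto simp: fin_supp_def)
  finally have ip: "LB A * LL n \<le> norm ?ip"
    using inner_lower[OF R a A sg] unfolding LB_def aa_def by simp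
  have "norm (gmean \<tau> s (\<lambda>t. dpoly aa (Complex \<sigma> t) * cnj (dpoly (qd \<kappa> n) (Complex \<sigma> t))) - ?ip)
      \<le> eta n s * sqrt (dnorm2 aa \<sigma>) * sqrt (dnorm2 (qd \<kappa> n) \<sigma>)"
    unfolding eta_def by (rule gmean_dpoly_inner[OF gs(1) fsa fin_supp_qd Za Zb ZZ_pos])
  also have "\<dots> \<le> eta n s * sqrt (CA * LL n) * sqrt (CA * LL n)"
    using da db ZZ_pos[of n] CA_ge_1 by (intro mult_mono real_sqrt_le_mono) (auto simp: eta_def less_imp_le dnorm2_nonneg)
  also have "\<dots> = eta n s * CA * LL n" using CA_ge_1 by simp
  also have "\<dots> \<le> LB A / 2 * LL n" using es by (intro mult_right_mono) auto
  finally have "LB A / 2 * LL n \<le> norm (gmean \<tau> s (\<lambda>t. dpoly aa (Complex \<sigma> t) * cnj (dpoly (qd \<kappa> n) (Complex \<sigma> t))))"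
    using ip norm_triangle_ineq2[of ?ip "gmean \<tau> s (\<lambda>t. dpoly aa (Complex \<sigma> t) * cnj (dpoly (qd \<kappa> n) (Complex \<sigma> t)))"]
    by (simp add: norm_minus_commute)
  also have "\<dots> \<le> gmean \<tau> s (\<lambda>t. norm (dpoly aa (Complex \<sigma> t) * cnj (dpoly (qd \<kappa> n) (Complex \<sigma> t))))" by (rule norm_gmean_le)
  also have "(\<lambda>t. norm (dpoly aa (Complex \<sigma> t) * cnj (dpoly (qd \<kappa> n) (Complex \<sigma> t)))) = (\<lambda>t. S t * Q1 t * Q2 t)"
    unfolding aa_def S_def Q1_def Q2_def Sd_def by (simp add: dpoly_conv[OF fin_supp_sf fin_supp_qd] norm_mult)
  finally have low: "LB A / 2 * LL n \<le> gmean \<tau> s (\<lambda>t. S t * Q1 t * Q2 t)" .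
  define C7 where "C7 = exp (2 + 1 / \<kappa>)"
  have Q1U: "(Q1 t)\<^sup>2 \<le> U t" for t
  proof -
    have "(Q1 t)\<^sup>2 = (\<Prod>r<n. (norm (texp (lr n r) (of_real (\<kappa> - 1) * Pr r (Complex \<sigma> t))))\<^sup>2)"
      unfolding Q1_def dpoly_qd by (simp add: prod_norm[symmetric] prod_power_distrib)
    also have "\<dots> \<le> U t" unfolding U_def Upart_def by (intro prod_mono) (auto simp: Bpart_nonneg)
    finally show ?thesis .
  qed
  have QW: "(Q1 t)\<^sup>2 * Q2 t powr (2 / \<kappa>) \<le> C7 * W t" for t
  proof -
    let ?u = "\<lambda>r. norm (texp (lr n r) (of_real (\<kappa> - 1) * Pr r (Complex \<sigma> t)))"
    let ?w = "\<lambda>r. norm (texp (lr n r) (of_real \<kappa> * Pr r (Complex \<sigma> t)))"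
    have "(Q1 t)\<^sup>2 * Q2 t powr (2 / \<kappa>) = (\<Prod>r<n. (?u r)\<^sup>2 * ?w r powr (2 / \<kappa>))"
      unfolding Q1_def Q2_def dpoly_qd
      by (simp add: prod_norm[symmetric] prod_power_distrib prod.distrib prod_powr_distrib)
    also have "\<dots> \<le> (\<Prod>r<n. exp ((2 + 1 / \<kappa>) * exp (- real (lr n r))) * Upart \<kappa> (lr n r) (Mr n r) (Pr r (Complex \<sigma> t)))"
    proof (intro prod_mono conjI texp_prod_le_Upart lr_pos kappa)
      fix r
      show "real (lr n r) * (1 + 1 / \<kappa>) \<le> real (Mr n r)"
        using mult_left_mono[OF b2, of "real (lr n r)"] by (simp add: Mr_def mult.commute)
    qed auto
    also have "\<dots> = exp ((2 + 1 / \<kappa>) * (\<Sum>r<n. exp (- real (lr n r)))) * W t"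
      by (simp add: prod.distrib exp_sum[symmetric] sum_distrib_left W_def)
    also have "\<dots> \<le> C7 * W t"
      unfolding C7_def
    proof (intro mult_right_mono)
      have "(2 + 1 / \<kappa>) * (\<Sum>r<n. exp (- real (lr n r))) \<le> (2 + 1 / \<kappa>) * 1"
        using sum_exp_rev_le[OF a1, of n] kappa by (intro mult_left_mono) (auto simp: lr_def)
      then show "exp ((2 + 1 / \<kappa>) * (\<Sum>r<n. exp (- real (lr n r)))) \<le> exp (2 + 1 / \<kappa>)" by simp
      show "0 \<le> W t" by (auto simp: W_def intro!: prod_nonneg Upart_nonneg)
    qed
    finally show ?thesis .
  qed
  \<comment> \<open>Weight in the inequality of arithmetic and geometric means, chosen so that the
    means of S^2 U and W use up exactly half of the lower bound LB A / 2 * LL n.\<close>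
  define lm where "lm = 2 * (1 + C7) * CA / LB A"
  have C70: "C7 > 0" by (simp add: C7_def)
  have lam: "lm > 0" using CA_ge_1 LB0 C70 by (simp add: lm_def)
  have pt: "S t * Q1 t * Q2 t \<le> (lm / 2) * S t powr (2 * \<kappa>) + (1 / (2 * lm)) * ((S t)\<^sup>2 * U t) + (C7 / (2 * lm)) * W t" for t
  proof -
    \<comment> \<open>The splitting S Q1 Q2 = x y is made so that x^2 = S^(2 \<kappa>) and y^2 is a
      geometric mean of S^2 Q1^2 and Q1^2 Q2^(2 / \<kappa>); the first is below S^2 U, the second
      below a constant times W by \<open>texp_prod_le_Upart\<close>.\<close>
    define x where "x = S t powr \<kappa>"
    define y where "y = (S t * Q1 t) powr (1 - \<kappa>) * (Q1 t powr \<kappa> * Q2 t)"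
    have xy: "S t * Q1 t * Q2 t = x * y"
    proof -
      have "S t powr \<kappa> * S t powr (1 - \<kappa>) = S t" "Q1 t powr \<kappa> * Q1 t powr (1 - \<kappa>) = Q1 t"
        using nn[of t] by (simp_all add: powr_add[symmetric])
      moreover have "x * y = (S t powr \<kappa> * S t powr (1 - \<kappa>)) * (Q1 t powr \<kappa> * Q1 t powr (1 - \<kappa>)) * Q2 t"
        unfolding x_def y_def using nn[of t] by (simp only: powr_mult mult_ac)
      ultimately show ?thesis by simp
    qed
    have sq: "(z powr c)\<^sup>2 = (z\<^sup>2) powr c" if "z \<ge> 0" for z c :: real
      using that by (simp add: power2_eq_square powr_mult)
    have "y\<^sup>2 = ((S t)\<^sup>2 * (Q1 t)\<^sup>2) powr (1 - \<kappa>) * ((Q1 t)\<^sup>2 * Q2 t powr (2 / \<kappa>)) powr \<kappa>"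
    proof -
      have "(Q2 t powr (2 / \<kappa>)) powr \<kappa> = (Q2 t)\<^sup>2" using kappa nn[of t] by (simp add: powr_powr powr_numeral)
      then show ?thesis unfolding y_def using nn[of t] by (simp add: power_mult_distrib sq powr_mult)
    qed
    also have "\<dots> \<le> (S t)\<^sup>2 * (Q1 t)\<^sup>2 + (Q1 t)\<^sup>2 * Q2 t powr (2 / \<kappa>)"
      using powr_geometric_le_add[of "(S t)\<^sup>2 * (Q1 t)\<^sup>2" "(Q1 t)\<^sup>2 * Q2 t powr (2 / \<kappa>)" "1 - \<kappa>"] kappa by simp
    also have "\<dots> \<le> (S t)\<^sup>2 * U t + C7 * W t" using Q1U QW by (intro add_mono mult_left_mono) auto
    finally have y2: "y\<^sup>2 \<le> (S t)\<^sup>2 * U t + C7 * W t" .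
    have "0 \<le> (lm * x - y)\<^sup>2 / (2 * lm)" using lam by simp
    also have "\<dots> = (lm / 2) * x\<^sup>2 + (1 / (2 * lm)) * y\<^sup>2 - x * y"
      using lam by (simp add: power2_eq_square field_simps)
    finally have "x * y \<le> (lm / 2) * x\<^sup>2 + (1 / (2 * lm)) * y\<^sup>2" by simp
    also have "\<dots> \<le> (lm / 2) * x\<^sup>2 + (1 / (2 * lm)) * ((S t)\<^sup>2 * U t + C7 * W t)"
      using lam y2 by (intro add_left_mono mult_left_mono) auto
    also have "x\<^sup>2 = S t powr (2 * \<kappa>)" by (simp add: x_def power2_eq_square powr_add[symmetric])
    finally show ?thesis unfolding xy by (simp add: algebra_simps)
  qed
  note A1 = gmean_sq_mult_Upart_le[OF g sg2, of \<tau>, folded Sd_def, folded U_def S_def]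
  note A2 = gmean_prod_Upart_le[OF g sg2, of \<tau>, folded W_def]
  have i0: "gint \<tau> s (\<lambda>t. (lm / 2) * S t powr (2 * \<kappa>))" by (rule gint_cmult) (use gint_Sd[OF gs(1)] in \<open>simp add: S_def\<close>)
  have i1: "gint \<tau> s (\<lambda>t. (1 / (2 * lm)) * ((S t)\<^sup>2 * U t))" by (rule gint_cmult[OF A1(1)])
  have i2: "gint \<tau> s (\<lambda>t. (C7 / (2 * lm)) * W t)" by (rule gint_cmult[OF A2(1)])
  have i3: "gint \<tau> s (\<lambda>t. S t * Q1 t * Q2 t)"
  proof (rule gint_cont_bounded[OF gs(1)])
    show "continuous_on UNIV (\<lambda>t. S t * Q1 t * Q2 t)" unfolding S_def Q1_def Q2_def Sd_def
      by (intro continuous_intros dpoly_cont)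
    show "norm (S t * Q1 t * Q2 t) \<le> (\<Sum>k | sf n k \<noteq> 0. norm (sf n k) * real k powr - \<sigma>) * (\<Sum>k | qd (\<kappa> - 1) n k \<noteq> 0. norm (qd (\<kappa> - 1) n k) * real k powr - \<sigma>) * (\<Sum>k | qd \<kappa> n k \<noteq> 0. norm (qd \<kappa> n k) * real k powr - \<sigma>)" for t
      unfolding S_def Q1_def Q2_def Sd_def real_norm_def abs_mult abs_norm_cancel
      by (intro mult_mono dpoly_bound mult_nonneg_nonneg sum_nonneg) auto
  qed
  have "LB A / 2 * LL n \<le> gmean \<tau> s (\<lambda>t. (lm / 2) * S t powr (2 * \<kappa>) + (1 / (2 * lm)) * ((S t)\<^sup>2 * U t) + (C7 / (2 * lm)) * W t)"
    by (rule order_trans[OF low gmean_mono[OF i3 gint_add[OF gint_add[OF i0 i1] i2] pt]])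
  also have "\<dots> = (lm / 2) * gmean \<tau> s (\<lambda>t. S t powr (2 * \<kappa>)) + (1 / (2 * lm)) * gmean \<tau> s (\<lambda>t. (S t)\<^sup>2 * U t) + (C7 / (2 * lm)) * gmean \<tau> s W"
    by (simp only: gmean_add[OF gint_add[OF i0 i1] i2] gmean_add[OF i0 i1] gmean_cmult)
  also have "\<dots> \<le> (lm / 2) * gmean \<tau> s (\<lambda>t. S t powr (2 * \<kappa>)) + (1 / (2 * lm)) * (CA * LL n) + (C7 / (2 * lm)) * (CA * LL n)"
    using A1(2) A2(2) lam C70 by (intro add_mono mult_left_mono) auto
  also have "\<dots> = (lm / 2) * gmean \<tau> s (\<lambda>t. S t powr (2 * \<kappa>)) + (1 + C7) * CA / (2 * lm) * LL n"
    using lam by (simp add: field_simps)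
  also have "(1 + C7) * CA / (2 * lm) = LB A / 4"
  proof -
    have "(1 + C7) * CA > 0" using C70 CA_ge_1 by (intro mult_pos_pos) auto
    moreover have "D / (2 * (2 * D / L)) = L / 4" if "D > 0" "L > 0" for D L :: real
      using that by (simp add: field_simps)
    ultimately show ?thesis unfolding lm_def using LB0 by (simp only: mult.assoc)
  qed
  finally have "LB A / 4 * LL n \<le> (lm / 2) * gmean \<tau> s (\<lambda>t. S t powr (2 * \<kappa>))" by simp
  then have "(2 / lm) * (LB A / 4 * LL n) \<le> (2 / lm) * ((lm / 2) * gmean \<tau> s (\<lambda>t. S t powr (2 * \<kappa>)))"
    using lam by (intro mult_left_mono) auto
  also have "\<dots> = gmean \<tau> s (\<lambda>t. S t powr (2 * \<kappa>))" using lam by simp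
  also have "(2 / lm) * (LB A / 4 * LL n) = (LB A)\<^sup>2 / (4 * (1 + C7) * CA) * LL n"
  proof -
    have "2 / (2 * D / L) * (L / 4 * x) = L\<^sup>2 / (4 * D) * x" if "D > 0" "L > 0" for D L x :: real
      using that by (simp add: field_simps power2_eq_square)
    moreover have "(1 + C7) * CA > 0" using C70 CA_ge_1 by (intro mult_pos_pos) auto
    ultimately show ?thesis unfolding lm_def using LB0 by (simp only: mult.assoc)
  qed
  finally show ?thesis unfolding S_def C7_def .
qed

end

section \<open>Convexity of Gaussian moments for functions of polynomial growth\<close>

lemma integrable_normal_poly:
  assumes s: "s > 0"
  shows "integrable lborel (\<lambda>t. normal_density \<tau> s t * (1 + \<bar>t\<bar>) ^ N)"
proof (rule Bochner_Integration.integrable_bound)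
  let ?g = "\<lambda>t. (1 + \<bar>\<tau>\<bar>) ^ N * (\<Sum>k\<le>N. of_nat (N choose k) * (normal_density \<tau> s t * \<bar>t - \<tau>\<bar> ^ k))"
  show "integrable lborel ?g"
    by (intro integrable_mult_right Bochner_Integration.integrable_sum integrable_normal_moment_abs[OF s])
  show "AE t in lborel. norm (normal_density \<tau> s t * (1 + \<bar>t\<bar>) ^ N) \<le> norm (?g t)"
  proof (rule AE_I2)
    fix t
    have "1 + \<bar>t\<bar> \<le> (1 + \<bar>\<tau>\<bar>) * (1 + \<bar>t - \<tau>\<bar>)"
    proof -
      have "\<bar>t\<bar> \<le> \<bar>\<tau>\<bar> + \<bar>t - \<tau>\<bar>" by linarith
      moreover have "0 \<le> \<bar>\<tau>\<bar> * \<bar>t - \<tau>\<bar>" by simp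
      ultimately show ?thesis unfolding distrib_left distrib_right by linarith
    qed
    then have "(1 + \<bar>t\<bar>) ^ N \<le> ((1 + \<bar>\<tau>\<bar>) * (1 + \<bar>t - \<tau>\<bar>)) ^ N" by (intro power_mono) auto
    also have "\<dots> = (1 + \<bar>\<tau>\<bar>) ^ N * (\<bar>t - \<tau>\<bar> + 1) ^ N" by (simp add: power_mult_distrib add.commute)
    also have "(\<bar>t - \<tau>\<bar> + 1) ^ N = (\<Sum>k\<le>N. of_nat (N choose k) * \<bar>t - \<tau>\<bar> ^ k)"
      by (simp add: binomial_ring)
    finally have "normal_density \<tau> s t * (1 + \<bar>t\<bar>) ^ N \<le> normal_density \<tau> s t * ((1 + \<bar>\<tau>\<bar>) ^ N * (\<Sum>k\<le>N. of_nat (N choose k) * \<bar>t - \<tau>\<bar> ^ k))"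
      by (intro mult_left_mono) auto
    also have "\<dots> = ?g t" by (simp add: sum_distrib_left mult_ac)
    finally show "norm (normal_density \<tau> s t * (1 + \<bar>t\<bar>) ^ N) \<le> norm (?g t)" by simp
  qed
qed measurable

lemma gint_poly:
  assumes s: "s > 0" and c: "continuous_on UNIV h" and b: "\<And>t. norm (h t) \<le> C * (1 + \<bar>t\<bar>) ^ N"
  shows "gint \<tau> s h"
  unfolding gint_def
proof (rule Bochner_Integration.integrable_bound[OF integrable_mult_left[OF integrable_normal_poly[OF s, of \<tau> N], of C]])
  have [measurable]: "h \<in> borel_measurable borel" by (rule borel_measurable_continuous_onI[OF c])
  show "(\<lambda>t. normal_density \<tau> s t *\<^sub>R h t) \<in> borel_measurable lborel" by measurable
  show "AE t in lborel. norm (normal_density \<tau> s t *\<^sub>R h t) \<le> norm (normal_density \<tau> s t * (1 + \<bar>t\<bar>) ^ N * C)"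
  proof (rule AE_I2)
    fix t
    have "normal_density \<tau> s t * norm (h t) \<le> normal_density \<tau> s t * (C * (1 + \<bar>t\<bar>) ^ N)"
      by (intro mult_left_mono b) auto
    also have "\<dots> \<le> \<bar>normal_density \<tau> s t * (1 + \<bar>t\<bar>) ^ N * C\<bar>" by (simp add: mult_ac)
    finally show "norm (normal_density \<tau> s t *\<^sub>R h t) \<le> norm (normal_density \<tau> s t * (1 + \<bar>t\<bar>) ^ N * C)" by simp
  qed
qed

lemma poly_gauss_small:
  fixes \<alpha> \<tau> :: real
  assumes al: "\<alpha> > 0" and e: "e > 0" and C: "C \<ge> 0"
  shows "\<exists>R. \<forall>t. R \<le> \<bar>t\<bar> \<longrightarrow> C * (1 + \<bar>t\<bar>) ^ N * exp (- \<alpha> * (t - \<tau>)\<^sup>2) < e"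
proof -
  define D where "D = C * (1 + \<bar>\<tau>\<bar>) ^ N * (2 / \<alpha>) ^ N"
  have "((\<lambda>x. x ^ N / exp x) \<longlongrightarrow> (0::real)) at_top" by (rule tendsto_power_div_exp_0)
  then have "((\<lambda>x. D * (x ^ N / exp x)) \<longlongrightarrow> D * 0) at_top" by (intro tendsto_intros)
  then have "\<forall>\<^sub>F x in at_top. D * (x ^ N / exp x) < e" using e by (intro order_tendstoD(2)[where a = e]) auto
  then obtain X where X: "\<And>x. x \<ge> X \<Longrightarrow> D * (x ^ N / exp x) < e" unfolding eventually_at_top_linorder by blast
  show ?thesis
  proof (intro exI[of _ "\<bar>\<tau>\<bar> + 1 + \<bar>X\<bar> / \<alpha>"] allI impI)
    fix t assume t: "\<bar>\<tau>\<bar> + 1 + \<bar>X\<bar> / \<alpha> \<le> \<bar>t\<bar>"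
    define u where "u = \<bar>t - \<tau>\<bar>"
    have u: "u \<ge> 1" "u \<ge> \<bar>X\<bar> / \<alpha>"
    proof -
      have "0 \<le> \<bar>X\<bar> / \<alpha>" using al by simp
      moreover have "\<bar>t\<bar> \<le> \<bar>\<tau>\<bar> + u" unfolding u_def by linarith
      ultimately show "u \<ge> 1" "u \<ge> \<bar>X\<bar> / \<alpha>" using t by linarith+
    qed
    have "1 + \<bar>t\<bar> \<le> (1 + \<bar>\<tau>\<bar>) * (1 + u)"
    proof -
      have "\<bar>t\<bar> \<le> \<bar>\<tau>\<bar> + u" unfolding u_def by linarith
      moreover have "0 \<le> \<bar>\<tau>\<bar> * u" using u by simp
      ultimately show ?thesis unfolding distrib_left distrib_right by linarith
    qed
    also have "\<dots> \<le> (1 + \<bar>\<tau>\<bar>) * (2 * u)" using u by (intro mult_left_mono) auto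
    finally have "(1 + \<bar>t\<bar>) ^ N \<le> ((1 + \<bar>\<tau>\<bar>) * (2 * u)) ^ N" by (intro power_mono) auto
    also have "(1 + \<bar>\<tau>\<bar>) * (2 * u) = (1 + \<bar>\<tau>\<bar>) * (2 / \<alpha>) * (\<alpha> * u)" using al by simp
    finally have 1: "(1 + \<bar>t\<bar>) ^ N \<le> (1 + \<bar>\<tau>\<bar>) ^ N * (2 / \<alpha>) ^ N * (\<alpha> * u) ^ N" by (simp only: power_mult_distrib)
    have "\<alpha> * u * 1 \<le> \<alpha> * u * u" using u al by (intro mult_left_mono) auto
    then have "- \<alpha> * (t - \<tau>)\<^sup>2 \<le> - (\<alpha> * u)" by (simp add: u_def power2_eq_square abs_mult[symmetric])
    then have "exp (- \<alpha> * (t - \<tau>)\<^sup>2) \<le> exp (- (\<alpha> * u))" by simp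
    then have "C * (1 + \<bar>t\<bar>) ^ N * exp (- \<alpha> * (t - \<tau>)\<^sup>2) \<le> C * ((1 + \<bar>\<tau>\<bar>) ^ N * (2 / \<alpha>) ^ N * (\<alpha> * u) ^ N) * exp (- (\<alpha> * u))"
      using 1 C al u by (intro mult_mono mult_left_mono) (auto intro!: mult_nonneg_nonneg)
    also have "\<dots> = D * ((\<alpha> * u) ^ N / exp (\<alpha> * u))" by (simp add: D_def exp_minus divide_inverse mult_ac)
    also have "\<dots> < e"
    proof (rule X)
      have "X \<le> \<bar>X\<bar>" by simp
      also have "\<dots> \<le> \<alpha> * u" using u(2) al by (simp add: field_simps)
      finally show "X \<le> \<alpha> * u" .
    qed
    finally show "C * (1 + \<bar>t\<bar>) ^ N * exp (- \<alpha> * (t - \<tau>)\<^sup>2) < e" .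
  qed
qed

text \<open>\<open>strip_moment_max\<close> for H times an exponential of a quadratic polynomial.
  The linear coefficient c is free; choosing it according to the data amounts to log-convexity. The
  factor 2 bounds exp (y^2 / (2 s^2)) for y <= b <= s.\<close>

lemma gmean_convexity:
  fixes H :: "complex \<Rightarrow> complex" and a b k x s c C :: real
  assumes ab: "0 \<le> a" "a < b" and k: "0 < k" "k \<le> 1" and c: "c \<ge> 0" and s: "s > 0" "s \<ge> b"
    and cont: "continuous_on {z. a \<le> Re z \<and> Re z \<le> b} H"
    and hol: "H holomorphic_on {z. a < Re z \<and> Re z < b}"
    and bd: "\<And>z. a \<le> Re z \<Longrightarrow> Re z \<le> b \<Longrightarrow> norm (H z) \<le> C * (1 + \<bar>Im z\<bar>) ^ N"
    and x: "a \<le> x" "x \<le> b"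
  shows "exp (c * (x - a)) * gmean \<tau> s (\<lambda>t. norm (H (Complex x t)) powr (2 * k))
    \<le> 2 * (gmean \<tau> s (\<lambda>t. norm (H (Complex a t)) powr (2 * k)) + exp (c * (b - a)) * gmean \<tau> s (\<lambda>t. norm (H (Complex b t)) powr (2 * k)))"
proof -
  define q where "q = 1 / sqrt (2 * pi * s\<^sup>2)"
  have q: "q > 0" using s by (simp add: q_def)
  have C0: "C \<ge> 0" using order_trans[OF norm_ge_zero bd[of "Complex a 0"]] ab by simp
  \<comment> \<open>The real part of (z - i \<tau>)^2 is (Re z)^2 - (Im z - \<tau>)^2, so |exp (E
    z)|^(2 k) is the normal density in Im z up to a constant and a factor that depends on Re z
    only.\<close>
  define E where "E z = ((z - \<i> * of_real \<tau>)\<^sup>2 / of_real (2 * s\<^sup>2) + of_real c * (z - of_real a)) / of_real (2 * k)" for z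
  define G where "G z = H z * exp (E z)" for z
  have ReE: "2 * k * Re (E z) = ((Re z)\<^sup>2 - (Im z - \<tau>)\<^sup>2) / (2 * s\<^sup>2) + c * (Re z - a)" for z
  proof -
    have "Re (E z) = (((Re z)\<^sup>2 - (Im z - \<tau>)\<^sup>2) / (2 * s\<^sup>2) + c * (Re z - a)) / (2 * k)"
      unfolding E_def Re_divide_of_real by (simp add: power2_eq_square Re_divide_of_real del: of_real_mult of_real_power of_real_numeral)
    then show ?thesis using k by simp
  qed
  have Gn: "norm (G z) powr (2 * k) = norm (H z) powr (2 * k) * exp (((Re z)\<^sup>2 - (Im z - \<tau>)\<^sup>2) / (2 * s\<^sup>2) + c * (Re z - a))" for z
  proof -
    have "norm (G z) powr (2 * k) = norm (H z) powr (2 * k) * exp (Re (E z)) powr (2 * k)"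
      by (simp add: G_def norm_mult powr_mult)
    also have "exp (Re (E z)) powr (2 * k) = exp (2 * k * Re (E z))" by (simp add: powr_def)
    finally show ?thesis unfolding ReE .
  qed
  have nd: "normal_density \<tau> s t = q * exp (- (t - \<tau>)\<^sup>2 / (2 * s\<^sup>2))" for t
    by (simp add: normal_density_def q_def)
  define A where "A y = exp (y\<^sup>2 / (2 * s\<^sup>2) + c * (y - a))" for y
  have Gd: "q * norm (G (Complex y t)) powr (2 * k) = A y * (normal_density \<tau> s t * norm (H (Complex y t)) powr (2 * k))" for y t
  proof -
    have "(y\<^sup>2 - (t - \<tau>)\<^sup>2) / (2 * s\<^sup>2) + c * (y - a) = (y\<^sup>2 / (2 * s\<^sup>2) + c * (y - a)) + - (t - \<tau>)\<^sup>2 / (2 * s\<^sup>2)"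
      by (simp add: diff_divide_distrib)
    then show ?thesis unfolding Gn nd A_def complex.sel by (simp only: exp_add mult_ac)
  qed
  have Gi: "q * (\<integral>t. norm (G (Complex y t)) powr (2 * k) \<partial>lborel) = A y * gmean \<tau> s (\<lambda>t. norm (H (Complex y t)) powr (2 * k))" for y
    unfolding gmean_def real_scaleR_def
    by (simp only: integral_mult_right_zero[symmetric] Gd)
  define w where "w t = (A b / q) * (C powr (2 * k)) * (normal_density \<tau> s t * (1 + \<bar>t\<bar>) ^ (2 * N))" for t
  have Amono: "A y \<le> A b" if "a \<le> y" "y \<le> b" for y
    unfolding A_def using that ab c s by (simp add: add_mono divide_right_mono power_mono mult_left_mono)
  have main: "(\<integral>t. norm (G (Complex x t)) powr (2 * k) \<partial>lborel) \<le> max (\<integral>t. norm (G (Complex a t)) powr (2 * k) \<partial>lborel) (\<integral>t. norm (G (Complex b t)) powr (2 * k) \<partial>lborel)"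
  proof (rule strip_moment_max[OF ab(2) k, where w = w])
    show "continuous_on {s. a \<le> Re s \<and> Re s \<le> b} G"
      unfolding G_def E_def using k s by (intro continuous_intros cont) auto
    show "G holomorphic_on {s. a < Re s \<and> Re s < b}"
      unfolding G_def E_def using k s by (intro holomorphic_intros hol) auto
    show "integrable lborel w"
      unfolding w_def by (intro integrable_mult_right integrable_normal_poly s)
    show "norm (G z) powr (2 * k) \<le> w (Im z)" if z: "a \<le> Re z" "Re z \<le> b" for z
    proof -
      have "norm (H z) powr (2 * k) \<le> (C * (1 + \<bar>Im z\<bar>) ^ N) powr (2 * k)"
        using bd[OF z] k by (intro powr_mono2) auto
      also have "\<dots> = C powr (2 * k) * ((1 + \<bar>Im z\<bar>) ^ N) powr (2 * k)" using C0 by (simp add: powr_mult)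
      also have "((1 + \<bar>Im z\<bar>) ^ N) powr (2 * k) \<le> ((1 + \<bar>Im z\<bar>) ^ N) powr 2" using k by (intro powr_mono) auto
      also have "((1 + \<bar>Im z\<bar>) ^ N) powr 2 = (1 + \<bar>Im z\<bar>) ^ (2 * N)" by (simp add: powr_numeral power_mult[symmetric] mult.commute)
      finally have Hb: "norm (H z) powr (2 * k) \<le> C powr (2 * k) * (1 + \<bar>Im z\<bar>) ^ (2 * N)" by (simp add: mult_left_mono)
      have "q * norm (G z) powr (2 * k) = A (Re z) * (normal_density \<tau> s (Im z) * norm (H z) powr (2 * k))"
        using Gd[of "Re z" "Im z"] by simp
      also have "\<dots> \<le> A b * (normal_density \<tau> s (Im z) * (C powr (2 * k) * (1 + \<bar>Im z\<bar>) ^ (2 * N)))"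
        using Hb Amono[OF z] by (intro mult_mono mult_left_mono) (auto simp: A_def)
      finally show ?thesis using q unfolding w_def by (simp add: field_simps)
    qed
    show "\<exists>R. \<forall>z. a \<le> Re z \<longrightarrow> Re z \<le> b \<longrightarrow> R \<le> \<bar>Im z\<bar> \<longrightarrow> norm (G z) < e" if e: "e > 0" for e
    proof -
      define \<alpha> where "\<alpha> = 1 / (2 * s\<^sup>2) / (2 * k)"
      have al: "\<alpha> > 0" using s k by (simp add: \<alpha>_def)
      define B where "B = exp ((b\<^sup>2 / (2 * s\<^sup>2) + c * (b - a)) / (2 * k))"
      have CB: "C * B \<ge> 0" using C0 by (simp add: B_def)
      obtain R where R: "\<And>t. R \<le> \<bar>t\<bar> \<Longrightarrow> (C * B) * (1 + \<bar>t\<bar>) ^ N * exp (- \<alpha> * (t - \<tau>)\<^sup>2) < e"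
        using poly_gauss_small[OF al e CB, of N \<tau>] by blast
      have "norm (G z) < e" if z: "a \<le> Re z" "Re z \<le> b" "R \<le> \<bar>Im z\<bar>" for z
      proof -
        have "Re (E z) = (2 * k * Re (E z)) / (2 * k)" using k by simp
        also have "\<dots> = ((Re z)\<^sup>2 / (2 * s\<^sup>2) + c * (Re z - a)) / (2 * k) + (- \<alpha> * (Im z - \<tau>)\<^sup>2)"
          unfolding ReE \<alpha>_def using s k by (simp add: field_simps)
        also have "\<dots> \<le> (b\<^sup>2 / (2 * s\<^sup>2) + c * (b - a)) / (2 * k) + (- \<alpha> * (Im z - \<tau>)\<^sup>2)"
          using z ab c s k by (intro add_right_mono divide_right_mono add_mono mult_left_mono power_mono) auto
        finally have "exp (Re (E z)) \<le> B * exp (- \<alpha> * (Im z - \<tau>)\<^sup>2)" by (simp add: B_def exp_add[symmetric])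
        then have "norm (G z) \<le> (C * (1 + \<bar>Im z\<bar>) ^ N) * (B * exp (- \<alpha> * (Im z - \<tau>)\<^sup>2))"
          unfolding G_def norm_mult norm_exp_eq_Re using bd[OF z(1,2)] C0 by (intro mult_mono) auto
        also have "\<dots> = (C * B) * (1 + \<bar>Im z\<bar>) ^ N * exp (- \<alpha> * (Im z - \<tau>)\<^sup>2)" by (simp add: mult_ac)
        also have "\<dots> < e" by (rule R[OF z(3)])
        finally show ?thesis .
      qed
      then show ?thesis by blast
    qed
  qed (use x in auto)
  have gn: "gmean \<tau> s (\<lambda>t. norm (H (Complex y t)) powr (2 * k)) \<ge> 0" for y by (rule gmean_nonneg) simp
  have A2: "A y \<le> 2 * exp (c * (y - a))" if "a \<le> y" "y \<le> b" for y
  proof -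
    have "y\<^sup>2 \<le> s\<^sup>2" using that ab s by (intro power_mono) auto
    then have "y\<^sup>2 / (2 * s\<^sup>2) \<le> 1 / 2" using s by (simp add: field_simps)
    then have "exp (y\<^sup>2 / (2 * s\<^sup>2)) \<le> exp (1 / 2)" by simp
    also have "\<dots> \<le> (2::real)"
    proof -
      have "exp (1 / 2) * exp (1 / 2) \<le> (2::real) * 2" using exp_le by (simp add: exp_add[symmetric])
      then show ?thesis by (metis abs_le_square_iff abs_of_nonneg exp_ge_zero power2_eq_square zero_le_numeral)
    qed
    finally show ?thesis unfolding A_def exp_add by (intro mult_right_mono) auto
  qed
  have "exp (c * (x - a)) * gmean \<tau> s (\<lambda>t. norm (H (Complex x t)) powr (2 * k)) \<le> A x * gmean \<tau> s (\<lambda>t. norm (H (Complex x t)) powr (2 * k))"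
    unfolding A_def by (intro mult_right_mono gn) simp
  also have "\<dots> \<le> max (A a * gmean \<tau> s (\<lambda>t. norm (H (Complex a t)) powr (2 * k))) (A b * gmean \<tau> s (\<lambda>t. norm (H (Complex b t)) powr (2 * k)))"
    using mult_left_mono[OF main, of q] q unfolding Gi[symmetric] by (simp add: max_mult_distrib_left)
  also have "\<dots> \<le> A a * gmean \<tau> s (\<lambda>t. norm (H (Complex a t)) powr (2 * k)) + A b * gmean \<tau> s (\<lambda>t. norm (H (Complex b t)) powr (2 * k))"
    using gn[of a] gn[of b] by (auto simp: A_def intro!: add_increasing add_increasing2)
  also have "\<dots> \<le> (2 * exp (c * (a - a))) * gmean \<tau> s (\<lambda>t. norm (H (Complex a t)) powr (2 * k)) + (2 * exp (c * (b - a))) * gmean \<tau> s (\<lambda>t. norm (H (Complex b t)) powr (2 * k))"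
    using A2[of a] A2[of b] ab gn by (intro add_mono mult_right_mono) auto
  finally show ?thesis by (simp add: algebra_simps)
qed

subsection \<open>Comparison of the series with its truncation\<close>

lemma add_powr_le_4:
  fixes x y k :: real
  assumes "0 \<le> x" "0 \<le> y" "0 < k" "k \<le> 1"
  shows "(x + y) powr (2 * k) \<le> 4 * (x powr (2 * k) + y powr (2 * k))"
proof -
  have "(x + y) powr (2 * k) \<le> (2 * max x y) powr (2 * k)" using assms by (intro powr_mono2) auto
  also have "\<dots> = 2 powr (2 * k) * max x y powr (2 * k)" using assms by (simp add: powr_mult)
  also have "\<dots> \<le> 2 powr 2 * (x powr (2 * k) + y powr (2 * k))"
    using assms by (intro mult_mono powr_mono) (auto simp: max_def)
  finally show ?thesis by simp
qed

lemma gint_powr_poly: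
  fixes g :: "real \<Rightarrow> complex"
  assumes s: "s > 0" and k: "0 < k" "k \<le> 1" and g: "continuous_on UNIV g" "\<And>t. norm (g t) \<le> C * (1 + \<bar>t\<bar>) ^ N"
  shows "gint \<tau> s (\<lambda>t. norm (g t) powr (2 * k))"
proof (rule gint_poly[OF s, where C = "C powr (2 * k)" and N = "2 * N"])
  show "continuous_on UNIV (\<lambda>t. norm (g t) powr (2 * k))"
    using k g by (intro continuous_on_powr' continuous_intros) auto
  have C0: "C \<ge> 0" using order_trans[OF norm_ge_zero g(2)[of 0]] by simp
  fix t
  have "norm (g t) powr (2 * k) \<le> (C * (1 + \<bar>t\<bar>) ^ N) powr (2 * k)"
    using g k by (intro powr_mono2) auto
  also have "\<dots> = C powr (2 * k) * ((1 + \<bar>t\<bar>) ^ N) powr (2 * k)" using C0 by (simp add: powr_mult)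
  also have "\<dots> \<le> C powr (2 * k) * ((1 + \<bar>t\<bar>) ^ N) powr 2" using k by (intro mult_left_mono powr_mono) auto
  also have "((1 + \<bar>t\<bar>) ^ N) powr 2 = (1 + \<bar>t\<bar>) ^ (2 * N)" by (simp add: powr_numeral power_mult[symmetric] mult.commute)
  finally show "norm (norm (g t) powr (2 * k)) \<le> C powr (2 * k) * (1 + \<bar>t\<bar>) ^ (2 * N)" by simp
qed

lemma gmean_le_bound:
  assumes "s > 0" "gint \<tau> s h" "\<And>t. h t \<le> (C :: real)"
  shows "gmean \<tau> s h \<le> C"
  using gmean_mono[OF assms(2) gint_bounded[OF assms(1), of "\<lambda>_. C" "\<bar>C\<bar>"] assms(3)] gmean_const[OF assms(1), of \<tau> C] by simp

lemma norm_nat_powr: "norm (of_nat n powr - z) = real n powr - Re z"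
  using norm_nat_powr_Complex[of n "Re z" "Im z"] by simp

lemma dpoly_holomorphic: "dpoly a holomorphic_on A"
  unfolding dpoly_def by (intro holomorphic_intros)

lemma dpoly_le_sum:
  assumes "a 0 = 0" "Re z \<ge> 0"
  shows "norm (dpoly a z) \<le> (\<Sum>n | a n \<noteq> 0. norm (a n))"
proof -
  have "norm (dpoly a z) \<le> (\<Sum>n | a n \<noteq> 0. norm (a n) * real n powr - Re z)"
    using dpoly_bound[of a "Re z" "Im z"] by simp
  also have "\<dots> \<le> (\<Sum>n | a n \<noteq> 0. norm (a n) * 1)"
  proof (intro sum_mono mult_left_mono)
    fix n assume "n \<in> {n. a n \<noteq> 0}"
    then have "n \<ge> 1" using assms(1) by (cases n) auto
    then have "real n powr - Re z \<le> real n powr 0" using assms(2) by (intro powr_mono) auto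
    then show "real n powr - Re z \<le> 1" using \<open>n \<ge> 1\<close> by simp
  qed auto
  finally show ?thesis by simp
qed

lemma dirichlet_has_sum_sums:
  assumes "((\<lambda>n. f n / of_nat n powr z) has_sum l) {1..}"
  shows "(\<lambda>n. f n * of_nat n powr - z) sums (l::complex)"
proof -
  have "((\<lambda>n. f n * of_nat n powr - z) has_sum l) UNIV"
    using assms by (subst (asm) has_sum_cong_neutral[where T = UNIV and g = "\<lambda>n. f n * of_nat n powr - z"])
      (auto simp: powr_minus divide_inverse not_le)
  then show ?thesis by (rule has_sum_imp_sums)
qed

text \<open>This and the next two lemmas concern the quotient (z - 1) / z, which removes the pole:
  its modulus is at most 1 in the half-plane, at least 1 / 2 up to Re z = 2 / 3, and exactly 1 on
  the critical line.\<close>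

lemma norm_minus_one_le: "Re z \<ge> 1 / 2 \<Longrightarrow> norm (z - 1) \<le> norm z"
proof -
  assume z: "Re z \<ge> 1 / 2"
  have "(norm (z - 1))\<^sup>2 \<le> (norm z)\<^sup>2" unfolding cmod_power2 using z by (simp add: power2_eq_square algebra_simps)
  then show ?thesis using norm_ge_zero power2_le_imp_le by blast
qed

lemma half_norm_le_minus_one: "1 / 2 \<le> Re z \<Longrightarrow> Re z \<le> 2 / 3 \<Longrightarrow> norm z / 2 \<le> norm (z - 1)"
proof -
  assume z: "1 / 2 \<le> Re z" "Re z \<le> 2 / 3"
  have "0 \<le> (2 / 3 - Re z) * (2 - Re z)" using z by (intro mult_nonneg_nonneg) auto
  moreover have "(Re z - 1) * (Re z - 1) + Im z * Im z - (Re z * Re z + Im z * Im z) / 4 =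
      3 / 4 * ((2 / 3 - Re z) * (2 - Re z)) + 3 / 4 * (Im z * Im z)" by (simp add: field_simps)
  moreover have "0 \<le> Im z * Im z" by simp
  ultimately have "(Re z * Re z + Im z * Im z) / 4 \<le> (Re z - 1) * (Re z - 1) + Im z * Im z" by linarith
  then have "(norm z / 2)\<^sup>2 \<le> (norm (z - 1))\<^sup>2" unfolding power_divide cmod_power2
    by (simp add: power2_eq_square)
  then show ?thesis using norm_ge_zero power2_le_imp_le by blast
qed

lemma norm_minus_one_half_line: "norm (Complex (1 / 2) t - 1) = norm (Complex (1 / 2) t)"
proof -
  have "(norm (Complex (1 / 2) t - 1))\<^sup>2 = (norm (Complex (1 / 2) t))\<^sup>2" unfolding cmod_power2 by (simp add: power2_eq_square)
  then show ?thesis by simp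
qed

lemma Complex_ne_1: "\<sigma> \<noteq> 1 \<Longrightarrow> Complex \<sigma> t \<noteq> 1"
  by (simp add: complex_eq_iff)

context range_data
begin

text \<open>A second name for the fact on the natural number b, since below \<open>b1\<close>
  denotes an abscissa.\<close>

lemmas b_ge_1 = b1

text \<open>The series differ only in terms with hh d > m * KK n, where d >= exp (m * KK n / 2)
  since hh d is at most twice ln d. One power of d is traded for this exponential, and the rest
  converges absolutely.\<close>

lemma Sd_close:
  assumes sm: "summable (\<lambda>d. norm (f d) * real d powr (1 - b1))"
    and hs: "((\<lambda>n. f n / of_nat n powr z) has_sum l) {1..}" and z: "Re z = b1"
  shows "norm (l - Sd n z) \<le> (1 + Csum) * exp (- (real (m * KK n) / 2)) * (\<Sum>d. norm (f d) * real d powr (1 - b1))"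
proof -
  let ?K = "(1 + Csum) * exp (- (real (m * KK n) / 2))"
  have "finite {d. sf n d \<noteq> 0}" using fin_supp_sf by (simp add: fin_supp_def)
  then have "(\<lambda>d. sf n d * of_nat d powr - z) sums Sd n z"
    unfolding Sd_def dpoly_def by (intro sums_finite) auto
  from sums_diff[OF dirichlet_has_sum_sums[OF hs] this]
  have sd: "(\<lambda>d. f d * (1 - bcut n d) * of_nat d powr - z) sums (l - Sd n z)"
    by (simp add: sf_def algebra_simps)
  have Cs: "Csum \<ge> 0" by (simp add: Csum_def)
  have tb: "norm (f d * (1 - bcut n d) * of_nat d powr - z) \<le> ?K * (norm (f d) * real d powr (1 - b1))" for d
  proof (cases "d = 0 \<or> hh d \<le> m * KK n")
    case True
    then show ?thesis using Cs bcut_one[of d n] by (cases "d = 0") auto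
  next
    case False
    then have d: "d > 0" "m * KK n \<le> hh d" by auto
    have n1: "norm (1 - bcut n d) \<le> 1 + Csum"
      using norm_triangle_ineq4[of 1 "bcut n d"] norm_bcut[of n d] by simp
    have "real (m * KK n) \<le> 2 * ln (real d)" using hh_bounds(2)[OF d(1)] d(2) by linarith
    then have "exp (- ln (real d)) \<le> exp (- (real (m * KK n) / 2))" by simp
    then have e: "real d powr - 1 \<le> exp (- (real (m * KK n) / 2))" using d by (simp add: powr_def)
    have "norm ((of_nat d :: complex) powr - z) = real d powr - b1"
      using z by (simp add: norm_nat_powr)
    also have "\<dots> = real d powr - 1 * real d powr (1 - b1)" unfolding powr_add[symmetric] by simp
    finally have "norm (f d * (1 - bcut n d) * of_nat d powr - z) = norm (f d) * norm (1 - bcut n d) * (real d powr - 1 * real d powr (1 - b1))"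
      by (simp add: norm_mult)
    also have "\<dots> \<le> norm (f d) * (1 + Csum) * (exp (- (real (m * KK n) / 2)) * real d powr (1 - b1))"
      using n1 e Cs by (intro mult_mono mult_left_mono mult_right_mono) auto
    finally show ?thesis by (simp add: mult_ac)
  qed
  have sK: "summable (\<lambda>d. ?K * (norm (f d) * real d powr (1 - b1)))" by (rule summable_mult[OF sm])
  have "norm (\<Sum>d. f d * (1 - bcut n d) * of_nat d powr - z) \<le> (\<Sum>d. ?K * (norm (f d) * real d powr (1 - b1)))"
    by (rule norm_suminf_le[OF tb sK])
  then show ?thesis using sd sm by (simp add: sums_unique[symmetric] suminf_mult)
qed

text \<open>In A the quantity \<open>LB A\<close> is only a negative power of 1 + 4 A.\<close>

lemma LB_beats:
  assumes "\<delta> > 0" "c > 0"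
  shows "\<exists>A>0. exp (- \<delta> * A) \<le> c * (LB A)\<^sup>2"
proof -
  define g where "g = 4 * V / ln 2"
  define K where "K = c * (exp (- (1 + 6 * C6 + 3 * V)))\<^sup>2"
  have K: "K > 0" using assms by (simp add: K_def)
  have lim: "((\<lambda>A. exp (- \<delta> * A) * (1 + 4 * A) powr g) \<longlongrightarrow> 0) at_top"
    using assms by real_asymp
  have "\<forall>\<^sub>F A in at_top. exp (- \<delta> * A) * (1 + 4 * A) powr g < K"
    by (rule order_tendstoD(2)[OF lim K])
  moreover have "\<forall>\<^sub>F A in at_top. (A::real) > 0" by (rule eventually_gt_at_top)
  ultimately have "\<forall>\<^sub>F A in at_top. A > 0 \<and> exp (- \<delta> * A) * (1 + 4 * A) powr g < K" by eventually_elim simp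
  then obtain A where A: "A > 0" "exp (- \<delta> * A) * (1 + 4 * A) powr g < K"
    using eventually_happens[of _ "at_top :: real filter"] by (metis (no_types, lifting) trivial_limit_at_top_linorder)
  have "c * (LB A)\<^sup>2 = K * (1 + 4 * A) powr - g"
    by (simp add: LB_def K_def power_mult_distrib power2_eq_square powr_add[symmetric] g_def)
  moreover have "exp (- \<delta> * A) = (exp (- \<delta> * A) * (1 + 4 * A) powr g) * (1 + 4 * A) powr - g"
  proof -
    have "(1 + 4 * A) powr g * (1 + 4 * A) powr - g = 1" using A(1) unfolding powr_add[symmetric] by simp
    then show ?thesis by (simp only: mult.assoc mult_1_right)
  qed
  moreover have "(exp (- \<delta> * A) * (1 + 4 * A) powr g) * (1 + 4 * A) powr - g \<le> K * (1 + 4 * A) powr - g"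
    using A(2) by (intro mult_right_mono) auto
  ultimately have "exp (- \<delta> * A) \<le> c * (LB A)\<^sup>2" by linarith
  then show ?thesis using A(1) by blast
qed

text \<open>With H = w (L - S), where w removes the pole, the moment of S at the abscissa x is
  shared between H and w L. Convexity bounds H at x by its size on the critical line, at most the
  moments of L and S, times exp (- \<delta> A), because H is tiny at the abscissa \<open>b1\<close>.
  So the S-part of this bound is smaller than the lower bound for S at x, and the moment J of L on
  the critical line must be large.\<close>

lemma L_moment_lower:
  fixes F0 L :: "complex \<Rightarrow> complex"
  assumes R: "R0 \<le> 1 / 100" and a: "6 * C6 * exp (- real a) \<le> 1" and b1: "b1 \<ge> 2"
    and F0c: "continuous_on {s. Re s \<ge> 1 / 2} F0" and F0h: "F0 holomorphic_on {s. Re s > 1 / 2}"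
    and F0b: "\<And>s. 1 / 2 \<le> Re s \<Longrightarrow> Re s \<le> b1 \<Longrightarrow> norm (F0 s) \<le> C * (1 + \<bar>Im s\<bar>) ^ M"
    and LF: "\<And>s. 1 / 2 \<le> Re s \<Longrightarrow> s \<noteq> 1 \<Longrightarrow> L s = F0 s / (s - 1) ^ q"
    and sm: "summable (\<lambda>d. norm (f d) * real d powr (1 - b1))"
    and hs: "\<And>s. Re s = b1 \<Longrightarrow> ((\<lambda>n. f n / of_nat n powr s) has_sum L s) {1..}"
    and LL: "filterlim LL at_top sequentially"
  shows "\<exists>c>0. \<exists>\<eta>>0. \<exists>n0. \<forall>n\<ge>n0. \<forall>s\<ge>b1. \<forall>\<tau>. eta n s \<le> \<eta> \<longrightarrow>
    c * LL n \<le> gmean \<tau> s (\<lambda>t. norm (L (Complex (1 / 2) t)) powr (2 * \<kappa>))"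
proof -
  define Sf where "Sf = (\<Sum>d. norm (f d) * real d powr (1 - b1))"
  have Sf0: "Sf \<ge> 0" unfolding Sf_def by (intro suminf_nonneg sm) auto
  have Cs: "Csum \<ge> 0" by (simp add: Csum_def)
  \<comment> \<open>At \<open>b1\<close> the moment of H is at most C9 exp (- \<kappa> K) with K >=
    2^(i0 + n). With c = \<delta> 2^(i0 + n) the convexity weight exp (c (b1 - 1/2)) is still paid
    for by this, while at x it amounts to exp (\<delta> A).\<close>
  define \<delta> where "\<delta> = \<kappa> / b1"
  have dl: "\<delta> > 0" using kappa b1 by (simp add: \<delta>_def)
  \<comment> \<open>The constant of \<open>S_moment_lower\<close>, with 1 / 4^q for the loss from w
    at abscissas up to 2 / 3.\<close>
  define c1 where "c1 = 1 / 4 ^ q / (4 * (1 + exp (2 + 1 / \<kappa>)) * CA)"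
  have c1: "c1 > 0" unfolding c1_def using CA_ge_1 by (intro divide_pos_pos mult_pos_pos add_pos_pos) auto
  have "c1 / (384 * CA) > 0" using c1 CA_ge_1 by simp
  \<comment> \<open>384 = 8 * 48: the contribution 48 CA exp (- \<delta> A) LL n of S on the
    critical line becomes at most one eighth of the lower bound c2 * LL n.\<close>
  from LB_beats[OF dl this] obtain A where A: "A > 0" "exp (- \<delta> * A) \<le> c1 / (384 * CA) * (LB A)\<^sup>2" by blast
  have LB0: "LB A > 0" using A by (simp add: LB_def)
  define C9 where "C9 = ((1 + Csum) * Sf) powr (2 * \<kappa>)"
  define C10 where "C10 = Sf powr (2 * \<kappa>)"
  have C910: "C9 \<ge> 0" "C10 \<ge> 0" by (simp_all add: C9_def C10_def)
  define c2 where "c2 = c1 * (LB A)\<^sup>2"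
  have c2: "c2 > 0" using c1 LB0 by (simp add: c2_def)
  define HL where "HL z = F0 z / z ^ q" for z
  define w where "w z = ((z - 1) / z) ^ q" for z :: complex
  have nz: "z \<noteq> 0" if "Re z \<ge> 1 / 2" for z using that by auto
  have HLw: "HL z = w z * L z" if "Re z \<ge> 1 / 2" "z \<noteq> 1" for z
    using LF[OF that] that nz[OF that(1)] by (simp add: HL_def w_def power_divide)
  have w1: "norm (w z) \<le> 1" if "Re z \<ge> 1 / 2" for z
    unfolding w_def norm_power norm_divide using norm_minus_one_le[OF that] nz[OF that]
    by (intro power_le_one) (auto simp: divide_le_eq)
  have w2: "norm (w z) \<ge> (1 / 2) ^ q" if "1 / 2 \<le> Re z" "Re z \<le> 2 / 3" for z
    unfolding w_def norm_power norm_divide using half_norm_le_minus_one[OF that] nz[OF that(1)]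
    by (intro power_mono) (auto simp: field_simps)
  have w3: "norm (w (Complex (1 / 2) t)) = 1" for t
    unfolding w_def norm_power norm_divide norm_minus_one_half_line using nz[of "Complex (1 / 2) t"] by simp
  have Lhalf: "norm (L (Complex (1 / 2) t)) = norm (HL (Complex (1 / 2) t))" for t
    using HLw[OF _ Complex_ne_1, of "1 / 2" t] w3[of t] by (simp add: norm_mult)
  have C0: "C \<ge> 0" using order_trans[OF norm_ge_zero F0b[of "1 / 2"]] b1 by simp
  have HLb: "norm (HL z) \<le> C * 2 ^ q * (1 + \<bar>Im z\<bar>) ^ M" if "1 / 2 \<le> Re z" "Re z \<le> b1" for z
  proof -
    have "1 / 2 \<le> norm z" using that(1) complex_Re_le_cmod[of z] by linarith
    then have "(1 / 2) ^ q \<le> norm z ^ q" by (intro power_mono) auto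
    then have "norm (F0 z) / norm z ^ q \<le> (C * (1 + \<bar>Im z\<bar>) ^ M) / (1 / 2) ^ q"
      using F0b[OF that] C0 by (intro frac_le) auto
    then show ?thesis by (simp add: HL_def norm_divide norm_power power_divide mult_ac)
  qed
  have HLc: "continuous_on {z. 1 / 2 \<le> Re z} HL" unfolding HL_def using nz by (intro continuous_intros F0c) auto
  have HLh: "HL holomorphic_on {z. 1 / 2 < Re z}" unfolding HL_def using nz by (intro holomorphic_intros F0h) auto
  have wc: "continuous_on {z. 1 / 2 \<le> Re z} w" unfolding w_def using nz by (intro continuous_intros) auto
  have wh: "w holomorphic_on {z. 1 / 2 < Re z}" unfolding w_def using nz by (intro holomorphic_intros) auto
  have Sh: "Sd n holomorphic_on B" for n B unfolding Sd_def[abs_def] by (rule dpoly_holomorphic)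
  have Lb: "norm (L z) \<le> Sf" if "Re z = b1" for z
  proof -
    have s: "(\<lambda>n. f n * of_nat n powr - z) sums L z" by (rule dirichlet_has_sum_sums[OF hs[OF that]])
    have tb: "norm (f d * of_nat d powr - z) \<le> norm (f d) * real d powr (1 - b1)" for d
    proof (cases "d = 0")
      case False
      then have "real d powr - b1 \<le> real d powr (1 - b1)" by (intro powr_mono) auto
      then show ?thesis using that by (simp add: norm_nat_powr norm_mult mult_left_mono)
    qed simp
    show ?thesis using norm_suminf_le[OF tb sm] s unfolding Sf_def by (simp add: sums_unique[symmetric])
  qed
  have line: "continuous_on UNIV (\<lambda>t. g (Complex x t))" if "continuous_on {z. 1 / 2 \<le> Re z} g" "x \<ge> 1 / 2" for g :: "complex \<Rightarrow> complex" and x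
    by (rule continuous_on_compose2[OF that(1)]) (use that in \<open>auto intro!: continuous_intros simp: Complex_eq\<close>)
  \<comment> \<open>Since LL n tends to infinity, the bounded contributions from the abscissa
    \<open>b1\<close> are eventually a small part of c2 * LL n.\<close>
  have "\<forall>\<^sub>F n in sequentially. LL n \<ge> 4 * (8 * C9 + 8 * C10 + 1) / c2"
    using LL by (simp add: filterlim_at_top)
  then obtain n1 where n1: "\<And>n. n \<ge> n1 \<Longrightarrow> LL n \<ge> 4 * (8 * C9 + 8 * C10 + 1) / c2"
    unfolding eventually_sequentially by blast
  \<comment> \<open>Ensures that x lies below 2 / 3, where the modulus of w is bounded from
    below.\<close>
  obtain n2 where n2: "6 * A < 2 ^ n2" using real_arch_pow[of 2 "6 * A"] by auto
  define \<eta> where "\<eta> = min 1 (LB A / (2 * CA))"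
  have eta0: "\<eta> > 0" using LB0 CA_ge_1 by (simp add: \<eta>_def)
  have main: "c2 / 160 * LL n \<le> gmean \<tau> s (\<lambda>t. norm (L (Complex (1 / 2) t)) powr (2 * \<kappa>))"
    if n: "n \<ge> n1" "n \<ge> n2" and s: "s \<ge> b1" and es: "eta n s \<le> \<eta>" for n s \<tau>
  proof -
    have s0: "s > 0" using s b1 by simp
    have es1: "eta n s \<le> 1" using es by (simp add: \<eta>_def)
    have es2: "eta n s * CA \<le> LB A / 2"
    proof -
      have "eta n s * CA \<le> LB A / (2 * CA) * CA" using es CA_ge_1 by (intro mult_right_mono) (auto simp: \<eta>_def)
      then show ?thesis using CA_ge_1 by simp
    qed
    define x where "x = 1 / 2 + A / 2 ^ (i0 + n)"
    have "6 * A \<le> 2 ^ (i0 + n)"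
    proof -
      have "(2::real) ^ n2 \<le> 2 ^ (i0 + n)" using n by (intro power_increasing) auto
      then show ?thesis using n2 by linarith
    qed
    then have x: "1 / 2 \<le> x" "x \<le> 2 / 3" using A by (auto simp: x_def field_simps)
    then have xb: "x \<le> b1" using b1 by simp
    define c where "c = \<delta> * 2 ^ (i0 + n)"
    have c0: "c \<ge> 0" using dl by (simp add: c_def)
    have cx: "c * (x - 1 / 2) = \<delta> * A" by (simp add: c_def x_def)
    define E where "E y g = gmean \<tau> s (\<lambda>t. norm (g (Complex y t)) powr (2 * \<kappa>))" for y and g :: "complex \<Rightarrow> complex"
    define H where "H z = HL z - w z * Sd n z" for z
    define SB where "SB = (\<Sum>d | sf n d \<noteq> 0. norm (sf n d))"
    have SB0: "SB \<ge> 0" by (simp add: SB_def sum_nonneg)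
    have SdB: "norm (Sd n z) \<le> SB" if "Re z \<ge> 1 / 2" for z
      unfolding Sd_def SB_def using fin_supp_sf[of n] that by (intro dpoly_le_sum) (auto simp: fin_supp_def)
    have Hc: "continuous_on {z. 1 / 2 \<le> Re z} H" unfolding H_def
      by (intro continuous_intros HLc wc holomorphic_on_imp_continuous_on[OF Sh])
    have Hh: "H holomorphic_on {z. 1 / 2 < Re z}" unfolding H_def by (intro holomorphic_intros HLh wh Sh)
    have Hb: "norm (H z) \<le> (C * 2 ^ q + SB) * (1 + \<bar>Im z\<bar>) ^ M" if z: "1 / 2 \<le> Re z" "Re z \<le> b1" for z
    proof -
      have "norm (H z) \<le> norm (HL z) + norm (w z) * norm (Sd n z)"
        unfolding H_def by (metis norm_mult norm_triangle_ineq4)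
      also have "\<dots> \<le> C * 2 ^ q * (1 + \<bar>Im z\<bar>) ^ M + 1 * SB"
        using HLb[OF z] w1[OF z(1)] SdB[OF z(1)] by (intro add_mono mult_mono) auto
      also have "\<dots> \<le> C * 2 ^ q * (1 + \<bar>Im z\<bar>) ^ M + (1 + \<bar>Im z\<bar>) ^ M * SB"
        using SB0 by (intro add_left_mono mult_right_mono one_le_power) auto
      finally show ?thesis by (simp add: algebra_simps)
    qed
    have gi: "gint \<tau> s (\<lambda>t. norm (g (Complex y t)) powr (2 * \<kappa>))"
      if "continuous_on {z. 1 / 2 \<le> Re z} g" "\<And>z. 1 / 2 \<le> Re z \<Longrightarrow> Re z \<le> b1 \<Longrightarrow> norm (g z) \<le> K * (1 + \<bar>Im z\<bar>) ^ M'" "1 / 2 \<le> y" "y \<le> b1" for g :: "complex \<Rightarrow> complex" and K M' y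
      by (rule gint_powr_poly[OF s0 _ _ line[OF that(1,3)], of _ K M']) (use that(2)[of "Complex y _"] that(3,4) kappa in auto)
    have iHL: "gint \<tau> s (\<lambda>t. norm (HL (Complex y t)) powr (2 * \<kappa>))" if "1 / 2 \<le> y" "y \<le> b1" for y
      by (rule gi[OF HLc HLb that])
    have iH: "gint \<tau> s (\<lambda>t. norm (H (Complex y t)) powr (2 * \<kappa>))" if "1 / 2 \<le> y" "y \<le> b1" for y
      by (rule gi[OF Hc Hb that])
    have iS: "gint \<tau> s (\<lambda>t. norm (Sd n (Complex y t)) powr (2 * \<kappa>))" for y
      by (rule gint_Sd[OF s0])
    have cv: "exp (c' * (x - 1 / 2)) * E x g \<le> 2 * (E (1 / 2) g + exp (c' * (b1 - 1 / 2)) * E b1 g)"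
      if "c' \<ge> 0" "continuous_on {z. 1 / 2 \<le> Re z} g" "g holomorphic_on {z. 1 / 2 < Re z}"
        "\<And>z. 1 / 2 \<le> Re z \<Longrightarrow> Re z \<le> b1 \<Longrightarrow> norm (g z) \<le> K * (1 + \<bar>Im z\<bar>) ^ M" for c' K and g :: "complex \<Rightarrow> complex"
      unfolding E_def
      by (rule gmean_convexity[where C = K and N = M])
        (use that x xb s s0 b1 kappa in \<open>auto intro: continuous_on_subset holomorphic_on_subset\<close>)
    define J where "J = E (1 / 2) HL"
    have J: "J = gmean \<tau> s (\<lambda>t. norm (L (Complex (1 / 2) t)) powr (2 * \<kappa>))" unfolding J_def E_def Lhalf ..
    have J0: "J \<ge> 0" unfolding J_def E_def by (rule gmean_nonneg) simp
    have EbHL: "E b1 HL \<le> C10"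
      unfolding E_def
    proof (rule gmean_le_bound[OF s0 iHL])
      fix t
      have "norm (HL (Complex b1 t)) \<le> 1 * Sf"
        using HLw[OF _ Complex_ne_1, of b1 t] mult_mono[OF w1[of "Complex b1 t"] Lb[of "Complex b1 t"]] b1
        by (simp add: norm_mult)
      then show "norm (HL (Complex b1 t)) powr (2 * \<kappa>) \<le> C10" unfolding C10_def using kappa by (intro powr_mono2) auto
    qed (use b1 in auto)
    have EbH: "exp (c * (b1 - 1 / 2)) * E b1 H \<le> C9"
    proof -
      define K where "K = real (m * KK n)"
      have "E b1 H \<le> exp (- \<kappa> * K) * C9"
        unfolding E_def
      proof (rule gmean_le_bound[OF s0 iH])
        fix t
        let ?z = "Complex b1 t"
        have "H ?z = w ?z * (L ?z - Sd n ?z)" unfolding H_def using HLw[OF _ Complex_ne_1, of b1 t] b1 by (simp add: algebra_simps)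
        then have "norm (H ?z) \<le> 1 * ((1 + Csum) * exp (- (K / 2)) * Sf)"
          unfolding Sf_def K_def using mult_mono[OF w1[of ?z] Sd_close[OF sm hs, of ?z n]] b1
          by (simp add: norm_mult)
        then have "norm (H ?z) powr (2 * \<kappa>) \<le> (exp (- (K / 2)) * ((1 + Csum) * Sf)) powr (2 * \<kappa>)"
          using kappa by (intro powr_mono2) (auto simp: mult_ac)
        also have "\<dots> = exp (- \<kappa> * K) * C9" unfolding C9_def using Cs Sf0 by (simp add: powr_mult) (simp add: powr_def)
        finally show "norm (H ?z) powr (2 * \<kappa>) \<le> exp (- \<kappa> * K) * C9" .
      qed (use b1 in auto)
      then have "exp (c * (b1 - 1 / 2)) * E b1 H \<le> exp (c * (b1 - 1 / 2)) * (exp (- \<kappa> * K) * C9)"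
        by (intro mult_left_mono) auto
      also have "\<dots> = exp (c * (b1 - 1 / 2) + - \<kappa> * K) * C9" by (simp only: exp_add mult.assoc)
      also have "\<dots> \<le> 1 * C9"
      proof (intro mult_right_mono C910)
        have "c * (b1 - 1 / 2) \<le> c * b1" using c0 by (intro mult_left_mono) auto
        also have "\<dots> = \<kappa> * 2 ^ (i0 + n)" using b1 by (simp add: c_def \<delta>_def)
        also have "\<dots> \<le> \<kappa> * K"
        proof (intro mult_left_mono)
          have "(1::nat) * 2 ^ (i0 + n) \<le> m * (8 * b * a) * 2 ^ (i0 + n)"
            using m1 b_ge_1 a1 by (intro mult_right_mono) auto
          then have "real (1 * 2 ^ (i0 + n)) \<le> K" unfolding K_def KK_def of_nat_le_iff by (simp add: mult_ac)
          then show "2 ^ (i0 + n) \<le> K" by simp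
        qed (use kappa in auto)
        finally show "exp (c * (b1 - 1 / 2) + - \<kappa> * K) \<le> 1" by simp
      qed
      finally show ?thesis by simp
    qed
    have EhH: "E (1 / 2) H \<le> 4 * (J + 6 * CA * LL n)"
    proof -
      let ?g = "\<lambda>t. norm (HL (Complex (1 / 2) t)) powr (2 * \<kappa>)" and ?h = "\<lambda>t. norm (Sd n (Complex (1 / 2) t)) powr (2 * \<kappa>)"
      have i1: "gint \<tau> s ?g" using b1 by (intro iHL) auto
      have "E (1 / 2) H \<le> gmean \<tau> s (\<lambda>t. 4 * (?g t + ?h t))"
        unfolding E_def
      proof (rule gmean_mono[OF iH gint_cmult[OF gint_add[OF i1 iS]]])
        fix t
        have "norm (H (Complex (1 / 2) t)) \<le> norm (HL (Complex (1 / 2) t)) + norm (Sd n (Complex (1 / 2) t))"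
          unfolding H_def using norm_triangle_ineq4[of "HL (Complex (1 / 2) t)" "w (Complex (1 / 2) t) * Sd n (Complex (1 / 2) t)"]
          by (simp add: norm_mult w3)
        then have "norm (H (Complex (1 / 2) t)) powr (2 * \<kappa>) \<le> (norm (HL (Complex (1 / 2) t)) + norm (Sd n (Complex (1 / 2) t))) powr (2 * \<kappa>)"
          using kappa by (intro powr_mono2) auto
        also have "\<dots> \<le> 4 * (?g t + ?h t)" using kappa by (intro add_powr_le_4) auto
        finally show "norm (H (Complex (1 / 2) t)) powr (2 * \<kappa>) \<le> 4 * (?g t + ?h t)" .
      qed (use b1 in auto)
      also have "\<dots> = 4 * (gmean \<tau> s ?g + gmean \<tau> s ?h)" by (simp only: gmean_cmult gmean_add[OF i1 iS])
      also have "\<dots> \<le> 4 * (J + 6 * CA * LL n)"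
        using S_moment_upper[OF s0 es1, of "1 / 2" \<tau>] unfolding J_def E_def by simp
      finally show ?thesis .
    qed
    have ExS: "c2 * LL n \<le> 4 * (E x H + E x HL)"
    proof -
      let ?g = "\<lambda>t. norm (H (Complex x t)) powr (2 * \<kappa>)" and ?h = "\<lambda>t. norm (HL (Complex x t)) powr (2 * \<kappa>)"
      have i1: "gint \<tau> s ?g" "gint \<tau> s ?h" using iH iHL x xb by auto
      have "c2 * LL n = (1 / 4) ^ q * ((LB A)\<^sup>2 / (4 * (1 + exp (2 + 1 / \<kappa>)) * CA) * LL n)"
        by (simp add: c2_def c1_def power_divide)
      also have "\<dots> \<le> (1 / 4) ^ q * gmean \<tau> s (\<lambda>t. norm (Sd n (Complex x t)) powr (2 * \<kappa>))"
        by (intro mult_left_mono S_moment_lower[OF R a _ x_def s0 es1 es2]) (use A in auto)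
      also have "\<dots> = gmean \<tau> s (\<lambda>t. (1 / 4) ^ q * norm (Sd n (Complex x t)) powr (2 * \<kappa>))" by (simp only: gmean_cmult)
      also have "\<dots> \<le> gmean \<tau> s (\<lambda>t. 4 * (?g t + ?h t))"
      proof (rule gmean_mono[OF gint_cmult[OF iS] gint_cmult[OF gint_add[OF i1]]])
        fix t
        let ?z = "Complex x t"
        have "(1 / 4 :: real) ^ q = ((1 / 2) ^ q) powr 2"
          by (simp add: powr_numeral power2_eq_square power_mult_distrib[symmetric])
        also have "\<dots> \<le> ((1 / 2) ^ q) powr (2 * \<kappa>)" using kappa by (intro powr_mono') (auto simp: power_le_one)
        also have "\<dots> \<le> norm (w ?z) powr (2 * \<kappa>)" using w2[of ?z] x kappa by (intro powr_mono2) auto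
        finally have "(1 / 4) ^ q * norm (Sd n ?z) powr (2 * \<kappa>) \<le> norm (w ?z) powr (2 * \<kappa>) * norm (Sd n ?z) powr (2 * \<kappa>)"
          by (intro mult_right_mono) auto
        also have "\<dots> = norm (w ?z * Sd n ?z) powr (2 * \<kappa>)" by (simp add: norm_mult powr_mult)
        also have "\<dots> \<le> (norm (H ?z) + norm (HL ?z)) powr (2 * \<kappa>)"
          using norm_triangle_ineq4[of "HL ?z" "H ?z"] kappa by (intro powr_mono2) (auto simp: H_def)
        also have "\<dots> \<le> 4 * (?g t + ?h t)" using kappa by (intro add_powr_le_4) auto
        finally show "(1 / 4) ^ q * norm (Sd n ?z) powr (2 * \<kappa>) \<le> 4 * (?g t + ?h t)" .
      qed
      also have "\<dots> = 4 * (E x H + E x HL)" unfolding E_def by (simp only: gmean_cmult gmean_add[OF i1])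
      finally show ?thesis .
    qed
    \<comment> \<open>Convexity with weight parameter 0: for L itself the moment at x is bounded by
      the two ends.\<close>
    have X1: "E x HL \<le> 2 * (J + C10)"
      using cv[of 0 HL "C * 2 ^ q", OF _ HLc HLh HLb] EbHL by (simp add: J_def)
    have "exp (c * (x - 1 / 2)) * E x H \<le> 2 * (4 * (J + 6 * CA * LL n) + C9)"
    proof -
      have "exp (c * (x - 1 / 2)) * E x H \<le> 2 * (E (1 / 2) H + exp (c * (b1 - 1 / 2)) * E b1 H)"
        by (rule cv[OF c0 Hc Hh]) (rule Hb)
      also have "\<dots> \<le> 2 * (4 * (J + 6 * CA * LL n) + C9)" by (intro mult_left_mono add_mono EhH EbH) auto
      finally show ?thesis .
    qed
    then have "exp (- \<delta> * A) * (exp (\<delta> * A) * E x H) \<le> exp (- \<delta> * A) * (2 * (4 * (J + 6 * CA * LL n) + C9))"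
      unfolding cx by (intro mult_left_mono) auto
    moreover have "exp (- \<delta> * A) * (exp (\<delta> * A) * E x H) = E x H" by (simp add: exp_minus field_simps)
    moreover have "2 * (4 * (J + 6 * CA * LL n) + C9) = 8 * J + 48 * CA * LL n + 2 * C9" by (simp add: algebra_simps)
    ultimately have X2: "E x H \<le> exp (- \<delta> * A) * (8 * J + 48 * CA * LL n + 2 * C9)" by (simp only:)
    have e1: "exp (- \<delta> * A) \<le> 1" using dl A by simp
    have "exp (- \<delta> * A) * (48 * CA * LL n) \<le> c1 / (384 * CA) * (LB A)\<^sup>2 * (48 * CA * LL n)"
      using A(2) CA_ge_1 by (intro mult_right_mono) auto
    also have "\<dots> = c2 * LL n / 8" using CA_ge_1 by (simp add: c2_def)
    finally have X3: "exp (- \<delta> * A) * (48 * CA * LL n) \<le> c2 * LL n / 8" .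
    have "exp (- \<delta> * A) * (8 * J + 2 * C9) \<le> 1 * (8 * J + 2 * C9)"
      using e1 J0 C910 by (intro mult_right_mono) auto
    with X2 X3 have "E x H \<le> 8 * J + 2 * C9 + c2 * LL n / 8" unfolding distrib_left by linarith
    moreover have "4 * (8 * C9 + 8 * C10 + 1) \<le> c2 * LL n" using n1[OF n(1)] c2 by (simp add: pos_divide_le_eq mult.commute)
    \<comment> \<open>Inserting the bounds for u and v returns l / 2 on the right, and the constants
      take another l / 4; what remains is l / 4 <= 40 J.\<close>
    moreover have "l \<le> 160 * J" if "l \<le> 4 * (u + v)" "v \<le> 2 * (J + C10)" "u \<le> 8 * J + 2 * C9 + l / 8" "4 * (8 * C9 + 8 * C10 + 1) \<le> l" for l u v
      using that by (simp add: algebra_simps)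
    ultimately have "c2 * LL n \<le> 160 * J" using ExS X1 by blast
    then show ?thesis unfolding J by linarith
  qed
  show ?thesis
    by (intro exI[of _ "c2 / 160"] conjI exI[of _ \<eta>] eta0 exI[of _ "max n1 n2"] allI impI main) (use c2 in auto)
qed

end

section \<open>Choice of the parameters and of the number of ranges\<close>

lemma summable_on_small_tail:
  fixes g :: "nat \<Rightarrow> real"
  assumes g: "g summable_on P" and nn: "\<And>p. p \<in> P \<Longrightarrow> g p \<ge> 0" and e: "e > 0"
  shows "\<exists>X. \<forall>A. finite A \<longrightarrow> A \<subseteq> P \<longrightarrow> (\<forall>p\<in>A. p > X) \<longrightarrow> sum g A \<le> e"
proof -
  have "(g has_sum infsum g P) P" using g by (rule has_sum_infsum)
  then have "\<forall>\<^sub>F F in finite_subsets_at_top P. dist (sum g F) (infsum g P) < e"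
    unfolding has_sum_def using e by (rule tendstoD)
  then obtain F where F: "finite F" "F \<subseteq> P" "dist (sum g F) (infsum g P) < e"
    unfolding eventually_finite_subsets_at_top by blast
  have "sum g A \<le> e" if A: "finite A" "A \<subseteq> P" "\<forall>p\<in>A. p > Max (insert 0 F)" for A
  proof -
    have "p \<le> Max (insert 0 F)" if "p \<in> F" for p using that F(1) by (intro Max_ge) auto
    then have "A \<inter> F = {}" using A(3) by (fastforce simp: not_less[symmetric] simp del: Max_insert)
    then have "sum g A + sum g F = sum g (A \<union> F)" using A F by (simp add: sum.union_disjoint)
    also have "\<dots> \<le> infsum g P" using A F nn by (intro finite_sum_le_infsum g) auto
    also have "\<dots> \<le> sum g F + e" using F(3) by (auto simp: dist_real_def)
    finally show ?thesis by simp
  qed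
  then show ?thesis by blast
qed

context prime_data
begin

definition SS :: "real \<Rightarrow> real" where "SS u = (\<Sum>p | prime p \<and> ln (real p) \<le> u. (tt p)\<^sup>2)"

lemma SS_diff:
  assumes "u \<le> v"
  shows "(\<Sum>p | prime p \<and> u < ln (real p) \<and> ln (real p) \<le> v. (tt p)\<^sup>2) = SS v - SS u"
proof -
  have "{p. prime p \<and> ln (real p) \<le> v} = {p. prime p \<and> ln (real p) \<le> u} \<union> {p. prime p \<and> u < ln (real p) \<and> ln (real p) \<le> v}"
    using assms by auto
  moreover have "finite {p. prime (p::nat) \<and> u < ln (real p) \<and> ln (real p) \<le> v}"
    by (rule finite_subset[OF _ finite_ln_le[of v]]) auto
  ultimately have "SS v = SS u + (\<Sum>p | prime p \<and> u < ln (real p) \<and> ln (real p) \<le> v. (tt p)\<^sup>2)"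
    unfolding SS_def using finite_ln_le[of u] by (simp, subst sum.union_disjoint) auto
  then show ?thesis by simp
qed

text \<open>The order of choices avoids a circle: \<open>V\<close> comes from the prime sum over u <
  ln p <= 2 u and depends on N' and B only, then a, b and m depend on \<open>V\<close> and \<kappa>,
  then i0 makes the tails of the error series at most 1 / 100, and \<open>V1\<close> comes
  last.\<close>

lemma ex_range_data:
  assumes kp: "0 < \<kappa>" "\<kappa> < 1"
    and mert: "\<And>u. u \<ge> u0 \<Longrightarrow> \<bar>SS u - N' * ln u\<bar> \<le> B"
    and xs: "(\<lambda>p. (xi p)\<^sup>2) summable_on {p. prime p}" and t4: "(\<lambda>p. tt p ^ 4) summable_on {p. prime p}"
  shows "\<exists>i0 V V1 a b m. range_data f xi i0 V (1 / 100) V1 \<kappa> a b m \<and>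
    6 * (exp (4 * V + CR 1 * (1 / 100)) + exp (16 * V + CR 3 * (1 / 100))) * exp (- real a) \<le> 1 \<and> u0 \<le> 2 ^ i0"
proof -
  define V where "V = N' * ln 2 + 2 * B"
  define C where "C = 6 * (exp (4 * V + CR 1 * (1 / 100)) + exp (16 * V + CR 3 * (1 / 100)))"
  define b where "b = nat \<lceil>1 + 1 / \<kappa>\<rceil>"
  define m where "m = max 2 (nat \<lceil>8 * V / ln 2 + 2\<rceil>)"
  define a where "a = max 1 (nat \<lceil>ln C\<rceil>)"
  have C0: "C > 0" unfolding C_def by (intro mult_pos_pos add_pos_pos) auto
  have Ca: "C * exp (- real a) \<le> 1"
  proof -
    have "ln C \<le> real a" unfolding a_def by linarith
    then have "C \<le> exp (real a)" using C0 by (metis exp_le_cancel_iff exp_ln)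
    then show ?thesis by (simp add: exp_minus field_simps)
  qed
  have b: "1 + 1 / \<kappa> \<le> real b" unfolding b_def by linarith
  have b1: "b \<ge> 1"
  proof -
    have "0 < 1 / \<kappa>" using kp by simp
    then show ?thesis using b by linarith
  qed
  have m: "m \<ge> 2" "8 * V / ln 2 + 2 \<le> real m" unfolding m_def by simp linarith
  \<comment> \<open>Since (xi + t^2)^2 <= 2 xi^2 + 2 t^4, this series majorises that of
    \<open>RR\<close>.\<close>
  have "(\<lambda>p. 2 * (xi p)\<^sup>2 + 2 * tt p ^ 4) summable_on {p. prime p}"
    by (intro summable_on_add summable_on_cmult_right xs t4)
  from summable_on_small_tail[OF this, of "1 / 100"] obtain X where
    X: "\<And>A. finite A \<Longrightarrow> A \<subseteq> {p. prime p} \<Longrightarrow> (\<forall>p\<in>A. p > X) \<Longrightarrow> (\<Sum>p\<in>A. 2 * (xi p)\<^sup>2 + 2 * tt p ^ 4) \<le> 1 / 100"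
    by auto
  obtain i0 where i0: "max (max u0 1) (real X) < 2 ^ i0" using real_arch_pow[of 2 "max (max u0 1) (real X)"] by auto
  have pX: "p > X" if "prime p" "2 ^ i0 < ln (real p)" for p
  proof -
    have "ln (real p) \<le> real p - 1" using that(1) prime_gt_0_nat by (intro ln_le_minus_one) auto
    then have "real X < real p" using i0 that(2) by linarith
    then show ?thesis by simp
  qed
  have u0: "u0 \<le> u" if "2 ^ i0 \<le> u" for u using i0 that by linarith
  have SSd: "SS (M * u) - SS u \<le> N' * ln M + 2 * B" if "2 ^ i0 \<le> u" "M \<ge> 1" for M u
  proof -
    have u: "u > 0" using that(1) by (rule less_le_trans[rotated]) simp
    have "u \<le> M * u" using that(2) u by simp
    then have "\<bar>SS (M * u) - N' * ln (M * u)\<bar> \<le> B" "\<bar>SS u - N' * ln u\<bar> \<le> B"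
      using u0 that by (auto intro!: mert)
    moreover have "N' * ln (M * u) = N' * ln M + N' * ln u" using u that(2) by (simp add: ln_mult distrib_left)
    ultimately show ?thesis by linarith
  qed
  define M where "M = real (24 * m * b * a)"
  have M: "M \<ge> 1"
  proof -
    have "1 \<le> 24 * m * b * a" using m b1 by (simp add: a_def Suc_le_eq)
    then show ?thesis unfolding M_def by (metis of_nat_1 of_nat_le_iff)
  qed
  define V1 where "V1 = SS (2 ^ i0) + (N' * ln M + 2 * B) + (\<Sum>\<^sub>\<infinity>p\<in>{p. prime p}. (xi p)\<^sup>2)"
  have "range_data f xi i0 V (1 / 100) V1 \<kappa> a b m"
  proof
    show "tt p \<le> 1" if p: "prime p" "2 ^ i0 < ln (real p)" for p
    proof -
      have "2 * (xi p)\<^sup>2 + 2 * tt p ^ 4 \<le> 1 / 100" using X[of "{p}"] pX[OF p] p by simp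
      then have "tt p ^ 4 \<le> 1" using zero_le_power2[of "xi p"] by linarith
      then show ?thesis using power_le_imp_le_base[of "tt p" 3 1] by (simp add: numeral_eq_Suc)
    qed
    show "(\<Sum>p | prime p \<and> 2 ^ (i0 + r) < ln (real p) \<and> ln (real p) \<le> 2 ^ (i0 + r + 1). (tt p)\<^sup>2) \<le> V" for r
    proof -
      have "(2::real) ^ i0 \<le> 2 ^ (i0 + r)" by (intro power_increasing) auto
      from SSd[OF this, of 2] show ?thesis unfolding V_def by (subst SS_diff) auto
    qed
    show "(\<Sum>p\<in>A. RR p) \<le> 1 / 100" if A: "finite A" "\<And>p. p \<in> A \<Longrightarrow> prime p \<and> 2 ^ i0 < ln (real p)" for A
    proof -
      have "(\<Sum>p\<in>A. RR p) \<le> (\<Sum>p\<in>A. 2 * (xi p)\<^sup>2 + 2 * tt p ^ 4)"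
      proof (rule sum_mono)
        fix p
        have "0 \<le> (xi p - (tt p)\<^sup>2)\<^sup>2" by simp
        then show "RR p \<le> 2 * (xi p)\<^sup>2 + 2 * tt p ^ 4" unfolding RR_def by (simp add: power2_eq_square algebra_simps numeral_eq_Suc)
      qed
      also have "\<dots> \<le> 1 / 100" using A pX by (intro X) auto
      finally show ?thesis .
    qed
    show "(\<Sum>p | prime p \<and> ln (real p) \<le> real (24 * m * b * a * 2 ^ (i0 + n)) \<and> (ln (real p) \<le> 2 ^ i0 \<or> 2 ^ (i0 + n) < ln (real p)). (tt p)\<^sup>2 + (xi p)\<^sup>2) \<le> V1" (is "sum _ ?D \<le> _") for n
    proof -
      let ?u = "(2::real) ^ (i0 + n)"
      have u: "2 ^ i0 \<le> ?u" by (intro power_increasing) auto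
      have Mu: "real (24 * m * b * a * 2 ^ (i0 + n)) = M * ?u" by (simp add: M_def)
      let ?D1 = "{p. prime p \<and> ln (real p) \<le> 2 ^ i0}" and ?D2 = "{p. prime p \<and> ?u < ln (real p) \<and> ln (real p) \<le> M * ?u}"
      have f2: "finite ?D2" by (rule finite_subset[OF _ finite_ln_le[of "M * ?u"]]) auto
      have D: "?D \<subseteq> ?D1 \<union> ?D2" unfolding Mu by auto
      have fD: "finite ?D" by (rule finite_subset[OF D]) (use f2 finite_ln_le in auto)
      have "(\<Sum>p\<in>?D. (tt p)\<^sup>2) \<le> (\<Sum>p\<in>?D1 \<union> ?D2. (tt p)\<^sup>2)" using D f2 finite_ln_le by (intro sum_mono2) auto
      also have "\<dots> \<le> (\<Sum>p\<in>?D1. (tt p)\<^sup>2) + (\<Sum>p\<in>?D2. (tt p)\<^sup>2)"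
        using f2 finite_ln_le[of "2 ^ i0"] by (subst sum.union_inter[symmetric]) (auto intro: sum_nonneg)
      also have "(\<Sum>p\<in>?D2. (tt p)\<^sup>2) = SS (M * ?u) - SS ?u" using M by (intro SS_diff) simp
      also have "\<dots> \<le> N' * ln M + 2 * B" by (rule SSd[OF u M])
      finally have 1: "(\<Sum>p\<in>?D. (tt p)\<^sup>2) \<le> SS (2 ^ i0) + (N' * ln M + 2 * B)" by (simp add: SS_def)
      have "(\<Sum>p\<in>?D. (xi p)\<^sup>2) \<le> (\<Sum>\<^sub>\<infinity>p\<in>{p. prime p}. (xi p)\<^sup>2)" using fD by (intro finite_sum_le_infsum xs) auto
      with 1 show ?thesis unfolding sum.distrib V1_def by linarith
    qed
  qed (use kp b b1 m a_def in \<open>auto simp: a_def\<close>)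
  moreover have "u0 \<le> 2 ^ i0" using i0 by linarith
  ultimately show ?thesis using Ca unfolding C_def by blast
qed

lemma moment_lower_small_exponent:
  fixes F0 L :: "complex \<Rightarrow> complex"
  assumes kp: "0 < \<kappa>" "\<kappa> < 1" and N: "N' > 0"
    and mert: "\<And>u. u \<ge> u0 \<Longrightarrow> \<bar>SS u - N' * ln u\<bar> \<le> B"
    and xs: "(\<lambda>p. (xi p)\<^sup>2) summable_on {p. prime p}" and t4: "(\<lambda>p. tt p ^ 4) summable_on {p. prime p}"
    and bb: "b1 \<ge> 2"
    and F0c: "continuous_on {s. Re s \<ge> 1 / 2} F0" and F0h: "F0 holomorphic_on {s. Re s > 1 / 2}"
    and F0b: "\<And>s. 1 / 2 \<le> Re s \<Longrightarrow> Re s \<le> b1 \<Longrightarrow> norm (F0 s) \<le> C * (1 + \<bar>Im s\<bar>) ^ M"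
    and LF: "\<And>s. 1 / 2 \<le> Re s \<Longrightarrow> s \<noteq> 1 \<Longrightarrow> L s = F0 s / (s - 1) ^ q"
    and sm: "summable (\<lambda>d. norm (f d) * real d powr (1 - b1))"
    and hs: "\<And>s. Re s = b1 \<Longrightarrow> ((\<lambda>n. f n / of_nat n powr s) has_sum L s) {1..}"
  shows "\<exists>c>0. \<exists>T1. \<forall>T\<ge>T1. \<forall>\<tau>.
    c * ln T powr (\<kappa>\<^sup>2 * N') \<le> gmean \<tau> (sqrt T) (\<lambda>t. norm (L (Complex (1 / 2) t)) powr (2 * \<kappa>))"
proof -
  obtain i0 V V1 a b m where rd: "range_data f xi i0 V (1 / 100) V1 \<kappa> a b m"
    and C6: "6 * (exp (4 * V + CR 1 * (1 / 100)) + exp (16 * V + CR 3 * (1 / 100))) * exp (- real a) \<le> 1" and u0: "u0 \<le> 2 ^ i0"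
    using ex_range_data[OF kp mert xs t4] by blast
  interpret range_data f xi i0 V "1 / 100" V1 \<kappa> a b m by (rule rd)
  have lm: "(\<Sum>r<n. vr r) \<ge> N' * (real n * ln 2) - 2 * B" for n
  proof -
    have le: "(2::real) ^ i0 \<le> 2 ^ (i0 + n)" by (intro power_increasing) auto
    have dj: "disjoint_family_on I {..<n}"
      unfolding disjoint_family_on_def
    proof (intro ballI impI)
      fix r r' :: nat assume ne: "r \<noteq> r'"
      have "I x \<inter> I y = {}" if "x < y" for x y
      proof -
        have "2 ^ (i0 + x + 1) \<le> (2::real) ^ (i0 + y)" using that by (intro power_increasing) auto
        then show ?thesis unfolding I_def by fastforce
      qed
      then show "I r \<inter> I r' = {}" using ne by (metis Int_commute linorder_neqE_nat)
    qed
    have "(\<Sum>r<n. vr r) = (\<Sum>p\<in>(\<Union>r<n. I r). (tt p)\<^sup>2)"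
      unfolding vr_def by (subst sum.UNION_disjoint) (use dj finite_I in \<open>auto simp: disjoint_family_on_def\<close>)
    also have "\<dots> = SS (2 ^ (i0 + n)) - SS (2 ^ i0)" unfolding UN_I by (rule SS_diff[OF le])
    also have "\<dots> \<ge> N' * ln (2 ^ (i0 + n)) - N' * ln (2 ^ i0) - 2 * B"
      using mert[of "2 ^ (i0 + n)"] mert[of "2 ^ i0"] u0 le by linarith
    finally show ?thesis by (simp add: ln_realpow algebra_simps)
  qed
  \<comment> \<open>The loss from the bounded error of the prime sum at the two ends of the union of
    the ranges.\<close>
  define l2 where "l2 = exp (- (\<kappa>\<^sup>2 * (2 * B)))"
  define g where "g = \<kappa>\<^sup>2 * N'"
  have g0: "g > 0" using kp N by (simp add: g_def)
  have LLlow: "l2 * (2 ^ n) powr g \<le> LL n" for n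
  proof -
    have "l2 * (2 ^ n) powr g = exp (\<kappa>\<^sup>2 * (N' * (real n * ln 2) - 2 * B))"
      unfolding l2_def g_def by (simp add: powr_def ln_realpow exp_add[symmetric] algebra_simps)
    also have "\<dots> \<le> LL n" using lm[of n] by (simp add: mult_left_mono)
    finally show ?thesis .
  qed
  have LLinf: "filterlim LL at_top sequentially"
  proof (rule filterlim_at_top_mono[where f = "\<lambda>n. l2 * (2 ^ n) powr g"])
    have "filterlim (\<lambda>x::real. l2 * x powr g) at_top at_top" using g0 unfolding l2_def by real_asymp
    moreover have "filterlim (\<lambda>n. (2::real) ^ n) at_top sequentially" by real_asymp
    ultimately show "filterlim (\<lambda>n. l2 * (2 ^ n) powr g) at_top sequentially" by (rule filterlim_compose)
  qed (use LLlow in auto)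
  have C6': "6 * C6 * exp (- real a) \<le> 1" using C6 by (simp add: C6_def)
  obtain c \<eta> n0 where c: "c > 0" and eta: "\<eta> > 0"
    and main: "\<And>n s \<tau>. n \<ge> n0 \<Longrightarrow> s \<ge> b1 \<Longrightarrow> eta n s \<le> \<eta> \<Longrightarrow> c * LL n \<le> gmean \<tau> s (\<lambda>t. norm (L (Complex (1 / 2) t)) powr (2 * \<kappa>))"
    using L_moment_lower[OF order.refl C6' bb F0c F0h F0b LF sm hs LLinf] by blast
  define K where "K = real (3 * m * (8 * b * a * 2 ^ i0))"
  have K: "K \<ge> 1"
  proof -
    have "1 \<le> 3 * m * (8 * b * a * 2 ^ i0)" using m1 b_ge_1 a1 by (simp add: Suc_le_eq)
    then show ?thesis unfolding K_def by (metis of_nat_1 of_nat_le_iff)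
  qed
  have ZZ: "ZZ n = exp (K * 2 ^ n)" for n by (simp add: ZZ_def KK_def K_def power_add mult_ac)
  have e1: "\<forall>\<^sub>F T::real in at_top. T powr (1 / 8) * exp (- (T powr (3 / 8))\<^sup>2 / 2) \<le> \<eta>"
  proof -
    have "((\<lambda>T::real. T powr (1 / 8) * exp (- (T powr (3 / 8))\<^sup>2 / 2)) \<longlongrightarrow> 0) at_top" by real_asymp
    from order_tendstoD(2)[OF this eta] show ?thesis by eventually_elim simp
  qed
  have e2: "\<forall>\<^sub>F T::real in at_top. 8 * K * 2 ^ n0 \<le> ln T" "\<forall>\<^sub>F T::real in at_top. b1\<^sup>2 \<le> T"
    by real_asymp (rule eventually_ge_at_top)
  from eventually_conj[OF e1 eventually_conj[OF e2]] obtain T1 where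
    T1: "\<And>T. T \<ge> T1 \<Longrightarrow> T powr (1 / 8) * exp (- (T powr (3 / 8))\<^sup>2 / 2) \<le> \<eta> \<and> 8 * K * 2 ^ n0 \<le> ln T \<and> b1\<^sup>2 \<le> T"
    unfolding eventually_at_top_linorder by blast
  have fin: "c * l2 / (16 * K) powr g * ln T powr g \<le> gmean \<tau> (sqrt T) (\<lambda>t. norm (L (Complex (1 / 2) t)) powr (2 * \<kappa>))"
    if T: "T \<ge> max T1 1" for T \<tau>
  proof -
    have T0: "T > 0" using T by simp
    have b1T: "b1 \<le> sqrt T" using T1[of T] T bb by (intro real_le_rsqrt) auto
    have lnT: "8 * K * 2 ^ n0 \<le> ln T" using T1[of T] T by simp
    obtain j where j: "ln T < 8 * K * 2 ^ j"
    proof -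
      obtain j where "ln T < 2 ^ j" using real_arch_pow[of 2 "ln T"] by auto
      moreover have "2 ^ j \<le> 8 * K * (2 :: real) ^ j" using K by simp
      ultimately show ?thesis using that[of j] by linarith
    qed
    \<comment> \<open>The number n = j0 - 1 of ranges is the largest with 8 K 2^n <= ln T. Then ZZ n
      <= T^(1/8), so that sqrt T / ZZ n >= T^(3/8) makes \<open>eta\<close> small, while ln T < 16 K
      2^n keeps LL n of full order.\<close>
    define j0 where "j0 = (LEAST j. ln T < 8 * K * 2 ^ j)"
    have j0: "ln T < 8 * K * 2 ^ j0" unfolding j0_def by (rule LeastI[of _ j]) (rule j)
    have j0n: "j0 > n0"
    proof (rule ccontr)
      assume "\<not> n0 < j0"
      then have "8 * K * 2 ^ j0 \<le> 8 * K * 2 ^ n0" using K by (intro mult_left_mono power_increasing) auto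
      then show False using j0 lnT by linarith
    qed
    then obtain n where n: "j0 = Suc n" "n \<ge> n0" by (cases j0) auto
    have n1: "8 * K * 2 ^ n \<le> ln T" using not_less_Least[of n "\<lambda>j. ln T < 8 * K * 2 ^ j"] n(1) unfolding j0_def by simp
    have Z1: "ZZ n \<le> T powr (1 / 8)" unfolding ZZ powr_def using n1 T0 by simp
    have Z0: "ZZ n > 0" by (rule ZZ_pos)
    have "T powr (3 / 8) * ZZ n \<le> T powr (3 / 8) * T powr (1 / 8)" using Z1 by (intro mult_left_mono) auto
    also have "\<dots> = sqrt T" using T0 by (simp add: powr_add[symmetric] powr_half_sqrt)
    finally have "T powr (3 / 8) \<le> sqrt T / ZZ n" using Z0 by (simp add: pos_le_divide_eq)
    then have "(T powr (3 / 8))\<^sup>2 \<le> (sqrt T / ZZ n)\<^sup>2" by (intro power_mono) auto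
    then have "eta n (sqrt T) \<le> T powr (1 / 8) * exp (- (T powr (3 / 8))\<^sup>2 / 2)"
      unfolding eta_def using Z0 Z1 by (intro mult_mono) auto
    also have "\<dots> \<le> \<eta>" using T1[of T] T by simp
    finally have et: "eta n (sqrt T) \<le> \<eta>" .
    have "ln T / (16 * K) \<le> 2 ^ n" using j0 K n(1) by (simp add: field_simps)
    then have "(ln T / (16 * K)) powr g \<le> (2 ^ n) powr g" using K T g0 by (intro powr_mono2) auto
    then have "ln T powr g / (16 * K) powr g \<le> (2 ^ n) powr g" using K T by (simp add: powr_divide)
    then have "c * (l2 * (ln T powr g / (16 * K) powr g)) \<le> c * (l2 * (2 ^ n) powr g)"
      using c by (intro mult_left_mono) (auto simp: l2_def)
    also have "\<dots> \<le> c * LL n" using c LLlow by (intro mult_left_mono) auto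
    also have "\<dots> \<le> gmean \<tau> (sqrt T) (\<lambda>t. norm (L (Complex (1 / 2) t)) powr (2 * \<kappa>))" by (rule main[OF n(2) b1T et])
    finally show ?thesis by (simp add: mult_ac)
  qed
  have "c * l2 / (16 * K) powr g > 0" using c K by (simp add: l2_def)
  then show ?thesis using fin unfolding g_def by blast
qed

end

subsection \<open>Powers of the series\<close>

text \<open>The double series over pairs (d, e) converges absolutely and is regrouped by n = d * e;
  pairs correspond to (n, d) with d dividing n.\<close>

lemma dirichlet_conv_has_sum:
  assumes a: "(a has_sum s) {1..}" "(\<lambda>n. norm (a n)) summable_on {1..}" and b: "(b has_sum t) {1..}" "(\<lambda>n. norm (b n)) summable_on {1..}"
  shows "(dirichlet_conv a b has_sum (s * t)) {1..}" "(\<lambda>n. norm (dirichlet_conv a b n)) summable_on {1..}"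
proof -
  let ?P = "Sigma {1::nat..} (\<lambda>_. {1::nat..})" and ?S = "Sigma {1::nat..} (\<lambda>n. {d. d dvd n})"
  let ?g = "\<lambda>(d, e). a d * b e" and ?h = "\<lambda>(n, d). a d * b (n div d)"
  have nb: "((\<lambda>e. norm (b e)) has_sum (\<Sum>\<^sub>\<infinity>e\<in>{1..}. norm (b e))) {1..}" using b(2) by (rule has_sum_infsum)
  have na: "((\<lambda>e. norm (a e)) has_sum (\<Sum>\<^sub>\<infinity>e\<in>{1..}. norm (a e))) {1..}" using a(2) by (rule has_sum_infsum)
  have i1: "((\<lambda>e. norm (?g (d, e))) has_sum norm (a d) * (\<Sum>\<^sub>\<infinity>e\<in>{1..}. norm (b e))) {1..}" for d
    using has_sum_cmult_right[OF nb, of "norm (a d)"] by (simp add: norm_mult)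
  have abs: "(\<lambda>x. norm (?g x)) summable_on ?P"
    by (rule summable_on_SigmaI[OF i1]) (use has_sum_imp_summable[OF has_sum_cmult_left[OF na]] in auto)
  have hs: "(?g has_sum (s * t)) ?P"
  proof (rule has_sum_SigmaI)
    show "((\<lambda>e. ?g (d, e)) has_sum a d * t) {1..}" for d using has_sum_cmult_right[OF b(1), of "a d"] by simp
    show "((\<lambda>d. a d * t) has_sum s * t) {1..}" by (rule has_sum_cmult_left[OF a(1)])
    show "?g summable_on ?P" by (rule Infinite_Sum.abs_summable_summable[OF abs])
  qed
  \<comment> \<open>Stated for a transformation \<open>k\<close> of the summand, since it serves for
    the terms and for their norms.\<close>
  have re: "(k ?g has_sum x) ?P \<longleftrightarrow> (k ?h has_sum x) ?S" if "\<And>g x. k g x = k0 (g x)" for k :: "(nat \<times> nat \<Rightarrow> complex) \<Rightarrow> nat \<times> nat \<Rightarrow> 'b::{topological_comm_monoid_add}" and k0 x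
    by (rule has_sum_reindex_bij_witness[where i = "\<lambda>(n, d). (d, n div d)" and j = "\<lambda>(d, e). (d * e, d)"])
      (auto simp: that Suc_le_eq dvd_div_eq_0_iff dest: dvd_pos_nat elim: dvdE intro: gr0I)
  have "(?h has_sum (s * t)) ?S" using hs re[of "\<lambda>g x. g x" "\<lambda>x. x" "s * t"] by simp
  moreover have fin: "((\<lambda>d. ?h (n, d)) has_sum dirichlet_conv a b n) {d. d dvd n}" if "n \<in> {1..}" for n
    using has_sum_finite[of "{d. d dvd n}" "\<lambda>d. ?h (n, d)"] that by (simp add: dirichlet_conv_def)
  ultimately show "(dirichlet_conv a b has_sum (s * t)) {1..}" by (rule has_sum_SigmaD)
  have "((\<lambda>x. norm (?g x)) has_sum (infsum (\<lambda>x. norm (?g x)) ?P)) ?P" by (rule has_sum_infsum[OF abs])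
  then have "((\<lambda>x. norm (?h x)) has_sum (infsum (\<lambda>x. norm (?g x)) ?P)) ?S"
    using re[of "\<lambda>g x. norm (g x)" norm] by simp
  moreover have "((\<lambda>d. norm (?h (n, d))) has_sum (\<Sum>d | d dvd n. norm (a d * b (n div d)))) {d. d dvd n}" if "n \<in> {1..}" for n
    using has_sum_finite[of "{d. d dvd n}" "\<lambda>d. norm (?h (n, d))"] that by simp
  ultimately have "((\<lambda>n. \<Sum>d | d dvd n. norm (a d * b (n div d))) has_sum (infsum (\<lambda>x. norm (?g x)) ?P)) {1..}" by (rule has_sum_SigmaD)
  then have "(\<lambda>n. \<Sum>d | d dvd n. norm (a d * b (n div d))) summable_on {1..}" by (rule has_sum_imp_summable)
  then show "(\<lambda>n. norm (dirichlet_conv a b n)) summable_on {1..}"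
    by (rule Infinite_Sum.summable_on_comparison_test) (auto simp: dirichlet_conv_def intro: norm_sum)
qed

lemma dirichlet_conv_terms:
  "n > 0 \<Longrightarrow> dirichlet_conv F G n / of_nat n powr z = dirichlet_conv (\<lambda>n. F n / of_nat n powr z) (\<lambda>n. G n / of_nat n powr z) n"
  unfolding dirichlet_conv_def sum_divide_distrib
proof (intro sum.cong refl)
  fix d assume "n > 0" "d \<in> {d. d dvd n}"
  then obtain e where "n = d * e" "d > 0" by (auto elim!: dvdE)
  then show "F d * G (n div d) / of_nat n powr z = F d / of_nat d powr z * (G (n div d) / of_nat (n div d) powr z)"
    by (simp add: powr_times_real)
qed

lemma dirichlet_power_has_sum:
  assumes f: "((\<lambda>n. f n / of_nat n powr z) has_sum l) {1..}" "(\<lambda>n. norm (f n / of_nat n powr z)) summable_on {1..}"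
  shows "((\<lambda>n. dirichlet_power f r n / of_nat n powr z) has_sum l ^ r) {1..} \<and> (\<lambda>n. norm (dirichlet_power f r n / of_nat n powr z)) summable_on {1..}"
proof (induction r)
  case 0
  have "((\<lambda>n. dirichlet_power f 0 n / of_nat n powr z) has_sum 1) {1..}"
    using has_sum_finite[of "{1::nat}" "\<lambda>n. dirichlet_power f 0 n / of_nat n powr z"]
    by (subst has_sum_cong_neutral[where T = "{1}" and g = "\<lambda>n. dirichlet_power f 0 n / of_nat n powr z"]) auto
  moreover have "(\<lambda>n. norm (dirichlet_power f 0 n / of_nat n powr z)) summable_on {1..}"
    by (subst summable_on_cong_neutral[where T = "{1}" and g = "\<lambda>n. norm (dirichlet_power f 0 n / of_nat n powr z)"]) auto
  ultimately show ?case by simp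
next
  case (Suc r)
  note c = dirichlet_conv_has_sum[OF f conjunct1[OF Suc] conjunct2[OF Suc]]
  have "((\<lambda>n. dirichlet_power f (Suc r) n / of_nat n powr z) has_sum l ^ Suc r) {1..} \<longleftrightarrow>
      (dirichlet_conv (\<lambda>n. f n / of_nat n powr z) (\<lambda>n. dirichlet_power f r n / of_nat n powr z) has_sum l ^ Suc r) {1..}"
    by (rule has_sum_cong) (simp add: dirichlet_conv_terms)
  moreover have "(\<lambda>n. norm (dirichlet_power f (Suc r) n / of_nat n powr z)) summable_on {1..} \<longleftrightarrow>
      (\<lambda>n. norm (dirichlet_conv (\<lambda>n. f n / of_nat n powr z) (\<lambda>n. dirichlet_power f r n / of_nat n powr z) n)) summable_on {1..}"
    by (rule summable_on_cong) (simp add: dirichlet_conv_terms)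
  ultimately show ?case using c by simp
qed

text \<open>The conditions on the coefficients that the argument needs and that pass to powers of
  the Dirichlet series.\<close>

definition tame :: "(nat \<Rightarrow> complex) \<Rightarrow> bool" where
  "tame F \<longleftrightarrow> multiplicative F \<and> F 1 = 1 \<and> (\<lambda>p. half_norm F p 1 ^ 4) summable_on {p. prime p} \<and>
    (\<exists>xi. (\<forall>p K. prime p \<longrightarrow> (\<Sum>b=2..K. half_norm F p b) \<le> xi p) \<and> (\<lambda>p. (xi p)\<^sup>2) summable_on {p. prime p})"

lemma summable_on_bounded:
  fixes g :: "'a \<Rightarrow> real"
  assumes "g summable_on P" "\<And>p. p \<in> P \<Longrightarrow> g p \<ge> 0"
  shows "\<exists>K. \<forall>p\<in>P. g p \<le> K"
proof -
  have "g p \<le> infsum g P" if "p \<in> P" for p using finite_sum_le_infsum[OF assms(1), of "{p}"] assms(2) that by auto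
  then show ?thesis by blast
qed

lemma half_norm_conv_le:
  assumes "prime p"
  shows "half_norm (dirichlet_conv F G) p a \<le> (\<Sum>b\<le>a. half_norm F p b * half_norm G p (a - b))"
proof -
  have "half_norm (dirichlet_conv F G) p a \<le> (\<Sum>b\<le>a. norm (F (p ^ b)) * norm (G (p ^ (a - b)))) * real p powr (- real a / 2)"
    unfolding half_norm_def dirichlet_conv_prime_power[OF assms]
    by (intro mult_right_mono order_trans[OF norm_sum]) (auto simp: norm_mult)
  also have "\<dots> = (\<Sum>b\<le>a. half_norm F p b * half_norm G p (a - b))"
    unfolding sum_distrib_right half_norm_def
  proof (intro sum.cong refl)
    fix b assume "b \<in> {..a}"
    then have "- real a / 2 = - real b / 2 + - real (a - b) / 2" by (simp add: of_nat_diff field_simps)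
    then have "real p powr (- real a / 2) = real p powr (- real b / 2) * real p powr (- real (a - b) / 2)" by (simp only: powr_add)
    then show "norm (F (p ^ b)) * norm (G (p ^ (a - b))) * real p powr (- real a / 2) =
      norm (F (p ^ b)) * real p powr (- real b / 2) * (norm (G (p ^ (a - b))) * real p powr (- real (a - b) / 2))" by simp
  qed
  finally show ?thesis .
qed

lemma half_norm_zero: "prime p \<Longrightarrow> F 1 = 1 \<Longrightarrow> half_norm F p 0 = 1"
  using prime_gt_0_nat[of p] by (simp add: half_norm_def)

text \<open>The local tail of a convolution contains the product u v of the two first-order terms.
  It is square summable when the fourth powers of u and v are, which is why \<open>tame\<close> asks
  for fourth powers. The other terms contain the tail x or y times a bounded factor.\<close>

lemma tame_conv:
  assumes F: "tame F" and G: "tame G"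
  shows "tame (dirichlet_conv F G)"
proof -
  let ?P = "{p::nat. prime p}"
  obtain x where x: "\<And>p K. prime p \<Longrightarrow> (\<Sum>b=2..K. half_norm F p b) \<le> x p" "(\<lambda>p. (x p)\<^sup>2) summable_on ?P" using F by (auto simp: tame_def)
  obtain y where y: "\<And>p K. prime p \<Longrightarrow> (\<Sum>b=2..K. half_norm G p b) \<le> y p" "(\<lambda>p. (y p)\<^sup>2) summable_on ?P" using G by (auto simp: tame_def)
  define u where "u p = half_norm F p 1" for p
  define v where "v p = half_norm G p 1" for p
  have us: "(\<lambda>p. u p ^ 4) summable_on ?P" and vs: "(\<lambda>p. v p ^ 4) summable_on ?P" using F G by (auto simp: tame_def u_def v_def)
  have nn: "x p \<ge> 0" "y p \<ge> 0" "u p \<ge> 0" "v p \<ge> 0" if "prime p" for p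
    using x(1)[OF that, of 0] y(1)[OF that, of 0] by (auto simp: u_def v_def half_norm_nonneg)
  \<comment> \<open>Terms of a convergent series of powers are bounded.\<close>
  have bd: "\<exists>K. \<forall>p\<in>?P. g p \<le> K" if g: "(\<lambda>p. g p ^ Suc (Suc n)) summable_on ?P" "\<And>p. prime p \<Longrightarrow> g p \<ge> 0" for g :: "nat \<Rightarrow> real" and n
  proof -
    obtain K where K: "\<And>p. p \<in> ?P \<Longrightarrow> g p ^ Suc (Suc n) \<le> K" using summable_on_bounded[OF g(1)] g(2) by auto
    have "g p \<le> 1 + K" if p: "p \<in> ?P" for p
    proof (cases "g p \<le> 1")
      case True
      show ?thesis
      proof -
        have "0 \<le> g p ^ Suc (Suc n)" using g(2) p by (intro zero_le_power) auto
        then show ?thesis using K[OF p] True by linarith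
      qed
    next
      case False
      then have "g p * 1 \<le> g p * g p ^ Suc n" by (intro mult_left_mono one_le_power) auto
      then show ?thesis using K[OF p] by simp
    qed
    then show ?thesis by blast
  qed
  obtain K1 where K1: "\<And>p. prime p \<Longrightarrow> y p \<le> K1" using bd[of y 0] y(2) nn by (auto simp: power2_eq_square)
  obtain K2 where K2: "\<And>p. prime p \<Longrightarrow> u p \<le> K2" using bd[of u 2] us nn by (auto simp: numeral_eq_Suc)
  obtain K3 where K3: "\<And>p. prime p \<Longrightarrow> v p \<le> K3" using bd[of v 2] vs nn by (auto simp: numeral_eq_Suc)
  define z where "z p = x p * (1 + v p + y p) + u p * (v p + y p) + y p" for p
  have zb: "(\<Sum>a=2..K. half_norm (dirichlet_conv F G) p a) \<le> z p" if p: "prime p" for p K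
  proof -
    have F1: "half_norm F p 0 \<le> 1" and G1: "half_norm G p 0 = 1" using F G half_norm_zero[OF p] by (auto simp: tame_def)
    have "(\<Sum>a=2..K. half_norm (dirichlet_conv F G) p a) \<le> (\<Sum>a=2..K. \<Sum>b\<le>a. half_norm F p b * half_norm G p (a - b))"
      by (intro sum_mono half_norm_conv_le p)
    also have "\<dots> \<le> z p"
      unfolding z_def
    proof (rule conv_tail_bound)
      have s1: "(\<Sum>b=1..K. half_norm G p b) \<le> v p + (\<Sum>b=2..K. half_norm G p b)"
      proof (cases "K \<ge> 1")
        case True
        then have "{1..K} = insert 1 {2..K}" by auto
        then show ?thesis by (simp add: v_def)
      qed (use nn[OF p] in auto)
      show y1: "(\<Sum>b=1..K. half_norm G p b) \<le> v p + y p" using s1 y(1)[OF p, of K] by linarith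
      have "{..K} = insert 0 {1..K}" by auto
      then show "(\<Sum>b\<le>K. half_norm G p b) \<le> 1 + v p + y p" using y1 G1 by simp
    qed (use F1 x(1)[OF p] y(1)[OF p] in \<open>auto simp: half_norm_nonneg u_def\<close>)
    finally show ?thesis .
  qed
  have sq3: "(\<alpha> + \<beta> + \<gamma>)\<^sup>2 \<le> 3 * \<alpha>\<^sup>2 + 3 * \<beta>\<^sup>2 + 3 * \<gamma>\<^sup>2" for \<alpha> \<beta> \<gamma> :: real
  proof -
    have "3 * \<alpha>\<^sup>2 + 3 * \<beta>\<^sup>2 + 3 * \<gamma>\<^sup>2 - (\<alpha> + \<beta> + \<gamma>)\<^sup>2 = (\<alpha> - \<beta>)\<^sup>2 + (\<beta> - \<gamma>)\<^sup>2 + (\<alpha> - \<gamma>)\<^sup>2"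
      by (simp add: power2_eq_square algebra_simps)
    moreover have "0 \<le> (\<alpha> - \<beta>)\<^sup>2 + (\<beta> - \<gamma>)\<^sup>2 + (\<alpha> - \<gamma>)\<^sup>2" by simp
    ultimately show ?thesis by linarith
  qed
  have "(\<lambda>p. 3 * (1 + K3 + K1)\<^sup>2 * (x p)\<^sup>2 + 3 * (u p ^ 4 + v p ^ 4) + 3 * (K2 + 1)\<^sup>2 * (y p)\<^sup>2) summable_on ?P"
    by (intro summable_on_add summable_on_cmult_right x y us vs)
  then have zs: "(\<lambda>p. (z p)\<^sup>2) summable_on ?P"
  proof (rule Infinite_Sum.summable_on_comparison_test)
    fix p assume "p \<in> ?P"
    then have p: "prime p" by simp
    note n = nn[OF p]
    have "z p = x p * (1 + v p + y p) + u p * v p + (u p + 1) * y p" by (simp add: z_def algebra_simps)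
    then have "(z p)\<^sup>2 \<le> 3 * (x p * (1 + v p + y p))\<^sup>2 + 3 * (u p * v p)\<^sup>2 + 3 * ((u p + 1) * y p)\<^sup>2" using sq3 by metis
    also have "\<dots> \<le> 3 * (x p * (1 + K3 + K1))\<^sup>2 + 3 * (u p ^ 4 + v p ^ 4) + 3 * ((K2 + 1) * y p)\<^sup>2"
    proof (intro add_mono mult_left_mono power_mono mult_right_mono)
      have "0 \<le> ((u p)\<^sup>2 - (v p)\<^sup>2)\<^sup>2" "0 \<le> (u p * v p)\<^sup>2" by simp_all
      then show "(u p * v p)\<^sup>2 \<le> u p ^ 4 + v p ^ 4" by (simp add: power2_eq_square numeral_eq_Suc algebra_simps)
    qed (use n K1[OF p] K2[OF p] K3[OF p] in auto)
    finally show "(z p)\<^sup>2 \<le> 3 * (1 + K3 + K1)\<^sup>2 * (x p)\<^sup>2 + 3 * (u p ^ 4 + v p ^ 4) + 3 * (K2 + 1)\<^sup>2 * (y p)\<^sup>2"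
      by (simp add: power_mult_distrib mult_ac)
  qed auto
  have "(\<lambda>p. 16 * (u p ^ 4 + v p ^ 4)) summable_on ?P" by (intro summable_on_add summable_on_cmult_right us vs)
  then have ts: "(\<lambda>p. half_norm (dirichlet_conv F G) p 1 ^ 4) summable_on ?P"
  proof (rule Infinite_Sum.summable_on_comparison_test)
    fix p assume "p \<in> ?P"
    then have p: "prime p" by simp
    note n = nn[OF p]
    have "half_norm F p 0 = 1" "half_norm G p 0 = 1" using F G half_norm_zero[OF p] by (auto simp: tame_def)
    then have "half_norm (dirichlet_conv F G) p 1 \<le> u p + v p" using half_norm_conv_le[OF p, of F G 1] by (simp add: u_def v_def)
    also have "\<dots> \<le> 2 * max (u p) (v p)" by simp
    finally have "half_norm (dirichlet_conv F G) p 1 ^ 4 \<le> (2 * max (u p) (v p)) ^ 4" by (intro power_mono half_norm_nonneg)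
    also have "\<dots> \<le> 16 * (u p ^ 4 + v p ^ 4)" by (simp add: max_def power_mult_distrib)
    finally show "half_norm (dirichlet_conv F G) p 1 ^ 4 \<le> 16 * (u p ^ 4 + v p ^ 4)" .
  qed (auto simp: half_norm_nonneg)
  show ?thesis
    unfolding tame_def
  proof (intro conjI exI[of _ z] allI impI zb zs ts)
    show "multiplicative (dirichlet_conv F G)" "dirichlet_conv F G 1 = 1"
      using F G multiplicative_dirichlet_conv dirichlet_conv_at_one[of F G] by (auto simp: tame_def)
  qed
qed

lemma tame_power:
  assumes f: "tame f" shows "tame (dirichlet_power f r)"
proof (induction r)
  case 0
  have "half_norm (dirichlet_power f 0) p b = 0" if "prime p" "b \<ge> 1" for p b
    using that prime_gt_1_nat[of p] by (auto simp: half_norm_def)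
  then have "(\<Sum>b=2..K. half_norm (dirichlet_power f 0) p b) \<le> 0" "half_norm (dirichlet_power f 0) p 1 ^ 4 = 0" if "prime p" for p K
    using that by auto
  then show ?case
    unfolding tame_def
    by (intro conjI exI[of _ "\<lambda>_. 0"]) (auto simp: multiplicative_def intro!: summable_on_0)
next
  case (Suc r)
  then show ?case using tame_conv[OF f Suc] by simp
qed

text \<open>Hence the prime sum of the r-th power is r^2 times the original one.\<close>

lemma dirichlet_power_prime:
  assumes "f 1 = 1" "prime p"
  shows "dirichlet_power f r p = of_nat r * f p"
proof (induction r)
  case (Suc r)
  have "dirichlet_conv f (dirichlet_power f r) p = f 1 * dirichlet_power f r p + f p * dirichlet_power f r 1"
    using dirichlet_conv_prime_power[OF assms(2), of f "dirichlet_power f r" 1] by (simp add: atMost_Suc)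
  then show ?case using Suc assms(1) dirichlet_power_at_1[of f r] by (simp add: algebra_simps)
qed (use assms prime_gt_1_nat[of p] in auto)

lemma moment_lower_gmean:
  fixes f :: "nat \<Rightarrow> complex" and F0 L :: "complex \<Rightarrow> complex"
  assumes f: "tame f" and N: "N > 0" and k: "k > 0"
    and mert: "\<And>u. u \<ge> u0 \<Longrightarrow> \<bar>(\<Sum>p | prime p \<and> ln (real p) \<le> u. (norm (f p))\<^sup>2 / real p) - N * ln u\<bar> \<le> B"
    and F0c: "continuous_on {s. Re s \<ge> 1 / 2} F0" and F0h: "F0 holomorphic_on {s. Re s > 1 / 2}"
    and F0b: "\<And>s. 1 / 2 \<le> Re s \<Longrightarrow> Re s \<le> b1 \<Longrightarrow> norm (F0 s) \<le> C * (1 + \<bar>Im s\<bar>) ^ M"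
    and LF: "\<And>s. 1 / 2 \<le> Re s \<Longrightarrow> s \<noteq> 1 \<Longrightarrow> L s = F0 s / (s - 1) ^ q"
    and b1: "b1 \<ge> 2" and sm: "(\<lambda>n. norm (f n) * real n powr (1 - b1)) summable_on {1..}"
    and hs: "\<And>s. Re s = b1 \<Longrightarrow> ((\<lambda>n. f n / of_nat n powr s) has_sum L s) {1..}"
  shows "\<exists>c>0. \<exists>T1. \<forall>T\<ge>T1. \<forall>\<tau>.
    c * ln T powr (N * k\<^sup>2) \<le> gmean \<tau> (sqrt T) (\<lambda>t. norm (L (Complex (1 / 2) t)) powr (2 * k))"
proof -
  define r where "r = Suc (nat \<lceil>k\<rceil>)"
  have r: "real r > k" "real r > 0" unfolding r_def by linarith+
  define \<kappa> where "\<kappa> = k / real r"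
  have kp: "0 < \<kappa>" "\<kappa> < 1" using r k by (auto simp: \<kappa>_def)
  define F where "F = dirichlet_power f r"
  have tF: "tame F" unfolding F_def by (rule tame_power[OF f])
  then obtain xi where xx: "\<And>p K. prime p \<Longrightarrow> (\<Sum>b=2..K. half_norm F p b) \<le> xi p" "(\<lambda>p. (xi p)\<^sup>2) summable_on {p. prime p}"
    by (auto simp: tame_def)
  interpret prime_data F xi by unfold_locales (use tF xx in \<open>auto simp: tame_def\<close>)
  have tt: "tt p = half_norm F p 1" for p by (simp add: tt_def half_norm_def)
  have SSF: "SS u = (real r)\<^sup>2 * (\<Sum>p | prime p \<and> ln (real p) \<le> u. (norm (f p))\<^sup>2 / real p)" for u
    unfolding SS_def sum_distrib_left
  proof (intro sum.cong refl)
    fix p assume "p \<in> {p. prime p \<and> ln (real p) \<le> u}"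
    then have p: "prime p" "p > 0" by (auto simp: prime_gt_0_nat)
    have "F p = of_nat r * f p" unfolding F_def using f p by (intro dirichlet_power_prime) (auto simp: tame_def)
    then show "(tt p)\<^sup>2 = (real r)\<^sup>2 * ((norm (f p))\<^sup>2 / real p)" using tt_sq[OF p(2)] by (simp add: norm_mult power_mult_distrib)
  qed
  have m': "\<bar>SS u - (real r)\<^sup>2 * N * ln u\<bar> \<le> (real r)\<^sup>2 * B" if "u \<ge> u0" for u
  proof -
    have "SS u - (real r)\<^sup>2 * N * ln u = (real r)\<^sup>2 * ((\<Sum>p | prime p \<and> ln (real p) \<le> u. (norm (f p))\<^sup>2 / real p) - N * ln u)"
      by (simp add: SSF algebra_simps)
    then show ?thesis using mult_left_mono[OF mert[OF that], of "(real r)\<^sup>2"] by (simp add: abs_mult)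
  qed
  have nt: "norm (g n / of_nat n powr s) = norm (g n) * real n powr - Re s" for g :: "nat \<Rightarrow> complex" and n s
  proof -
    have "g n / of_nat n powr s = g n * of_nat n powr - s" by (simp add: powr_minus divide_inverse)
    then show ?thesis by (simp add: norm_mult norm_nat_powr)
  qed
  have fsum: "(\<lambda>n. norm (f n / of_nat n powr s)) summable_on {1..}" if "Re s \<ge> b1 - 1" for s
    by (rule Infinite_Sum.summable_on_comparison_test[OF sm]) (use that in \<open>auto simp: nt intro!: mult_left_mono powr_mono\<close>)
  have "(\<lambda>n. norm (F n / of_nat n powr of_real (b1 - 1))) summable_on {1..}"
  proof -
    have g: "(\<lambda>n. norm (f n / of_nat n powr of_real (b1 - 1))) summable_on {1..}" by (rule fsum) simp
    from dirichlet_power_has_sum[OF has_sum_infsum[OF Infinite_Sum.abs_summable_summable[OF g]] g] show ?thesis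
      unfolding F_def by blast
  qed
  then have "(\<lambda>n. norm (F n) * real n powr (1 - b1)) summable_on {1..}" by (simp add: nt)
  then have "(\<lambda>n. norm (F n) * real n powr (1 - b1)) summable_on UNIV"
    by (subst summable_on_cong_neutral[where S = UNIV and T = "{1..}" and g = "\<lambda>n. norm (F n) * real n powr (1 - b1)"]) (auto simp: not_le)
  then have smF: "summable (\<lambda>n. norm (F n) * real n powr (1 - b1))" by (rule summable_on_imp_summable)
  have hsF: "((\<lambda>n. F n / of_nat n powr s) has_sum L s ^ r) {1..}" if "Re s = b1" for s
    unfolding F_def using dirichlet_power_has_sum[OF hs[OF that] fsum] that by simp
  have "\<exists>c>0. \<exists>T1. \<forall>T\<ge>T1. \<forall>\<tau>. c * ln T powr (\<kappa>\<^sup>2 * ((real r)\<^sup>2 * N))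
    \<le> gmean \<tau> (sqrt T) (\<lambda>t. norm (L (Complex (1 / 2) t) ^ r) powr (2 * \<kappa>))"
  proof (rule moment_lower_small_exponent[OF kp _ m' xx(2) _ b1, where ?F0.0 = "\<lambda>s. F0 s ^ r" and C = "C ^ r" and M = "M * r" and q = "q * r"])
    show "(real r)\<^sup>2 * N > 0" using r N by simp
    show "(\<lambda>p. tt p ^ 4) summable_on {p. prime p}" unfolding tt using tF by (simp add: tame_def)
    show "continuous_on {s. 1 / 2 \<le> Re s} (\<lambda>s. F0 s ^ r)" by (intro continuous_intros F0c)
    show "(\<lambda>s. F0 s ^ r) holomorphic_on {s. 1 / 2 < Re s}" by (intro holomorphic_intros F0h)
    show "norm (F0 s ^ r) \<le> C ^ r * (1 + \<bar>Im s\<bar>) ^ (M * r)" if "1 / 2 \<le> Re s" "Re s \<le> b1" for s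
      using power_mono[OF F0b[OF that], of r] by (simp add: norm_power power_mult power_mult_distrib)
    show "L s ^ r = F0 s ^ r / (s - 1) ^ (q * r)" if "1 / 2 \<le> Re s" "s \<noteq> 1" for s
      using LF[OF that] by (simp add: power_divide power_mult)
  qed (use smF hsF in auto)
  moreover have "\<kappa>\<^sup>2 * ((real r)\<^sup>2 * N) = N * k\<^sup>2" using r by (simp add: \<kappa>_def power_divide)
  moreover have "norm (z ^ r) powr (2 * \<kappa>) = norm z powr (2 * k)" for z :: complex
  proof (cases "z = 0")
    case False
    then have "norm (z ^ r) = norm z powr real r" by (simp add: norm_power powr_realpow)
    then show ?thesis using r by (simp add: powr_powr \<kappa>_def)
  qed (use r in auto)
  ultimately show ?thesis by simp
qed

section \<open>From the hypotheses on f to \<open>tame\<close>\<close>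

lemma sum_primes_subseries:
  fixes g c :: "nat \<Rightarrow> real" and j :: "nat \<Rightarrow> nat"
  assumes "summable c" "\<And>i. c i \<ge> 0" "finite A" "\<And>i. (\<Sum>p\<in>{p \<in> A. j p = i}. g p) \<le> c i"
  shows "sum g A \<le> suminf c"
proof -
  have "sum g A = (\<Sum>i\<in>j ` A. \<Sum>p\<in>{p \<in> A. j p = i}. g p)" using assms(3) by (intro sum.group[symmetric]) auto
  also have "\<dots> \<le> (\<Sum>i\<in>j ` A. c i)" by (intro sum_mono assms)
  also have "\<dots> \<le> suminf c" using assms by (intro sum_le_suminf) auto
  finally show ?thesis .
qed

text \<open>Fourth powers: one factor |f p|^2 / p is bounded by C^2 p^(- 2 \<delta>), the other is
  summed over shells j <= ln p < j + 1 with the prime sum hypothesis. For the tail, the finitely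
  many exponents below \<open>B0\<close> are square summable by hypothesis, and the remaining ones
  are at most a multiple of 1 / p by the pointwise bound.\<close>

lemma tame_of_bounds:
  assumes f: "multiplicative f" "f 1 = 1" and th: "\<theta> < 1 / 2" and bd: "\<And>n. n > 0 \<Longrightarrow> norm (f n) \<le> C * real n powr \<theta>"
    and sq: "(\<lambda>(p, m). (norm (f (p ^ m)))\<^sup>2 / real (p ^ m)) summable_on ({p::nat. prime p} \<times> {m::nat. m \<ge> 2})"
    and mert: "\<And>u. u \<ge> u0 \<Longrightarrow> \<bar>(\<Sum>p | prime p \<and> ln (real p) \<le> u. (norm (f p))\<^sup>2 / real p) - N * ln u\<bar> \<le> B"
  shows "tame f"
proof -
  define \<delta> where "\<delta> = 1 / 2 - \<theta>"
  have dl: "\<delta> > 0" using th by (simp add: \<delta>_def)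
  have C0: "C \<ge> 0" using bd[of 1] f(2) by simp
  have hb: "half_norm f p b \<le> C * (real p powr - \<delta>) ^ b" if p: "prime p" for p b
  proof -
    have p0: "p > 0" using p by (rule prime_gt_0_nat)
    have "half_norm f p b \<le> C * real (p ^ b) powr \<theta> * real p powr (- real b / 2)"
      unfolding half_norm_def using p0 by (intro mult_right_mono bd) auto
    also have "\<dots> = C * (real p powr (real b * \<theta>) * real p powr (- real b / 2))"
      using p0 by (simp add: powr_powr flip: powr_realpow)
    also have "real p powr (real b * \<theta>) * real p powr (- real b / 2) = real p powr (- \<delta> * real b)"
      by (simp add: powr_add[symmetric] \<delta>_def algebra_simps)
    also have "\<dots> = (real p powr - \<delta>) ^ b" using p0 by (simp add: powr_powr flip: powr_realpow)
    finally show ?thesis .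
  qed
  define S where "S u = (\<Sum>p | prime p \<and> ln (real p) \<le> u. (norm (f p))\<^sup>2 / real p)" for u
  define u1 where "u1 = max u0 1"
  define K where "K = \<bar>N\<bar> + \<bar>B\<bar> + S u1"
  have S0: "S u \<ge> 0" for u by (auto simp: S_def intro!: sum_nonneg)
  have K0: "K \<ge> 0" using S0[of u1] by (simp add: K_def)
  have SK: "S u \<le> K * u" if u: "u \<ge> 1" for u
  proof (cases "u \<ge> u1")
    case True
    then have "S u \<le> N * ln u + B" using mert[of u] by (simp add: S_def u1_def)
    also have "\<dots> \<le> \<bar>N\<bar> * u + \<bar>B\<bar> * u"
    proof (intro add_mono)
      have "ln u \<le> u" using ln_le_minus_one[of u] u by simp
      then have "\<bar>N\<bar> * ln u \<le> \<bar>N\<bar> * u" by (intro mult_left_mono) auto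
      moreover have "N * ln u \<le> \<bar>N\<bar> * ln u" using u by (intro mult_right_mono) auto
      ultimately show "N * ln u \<le> \<bar>N\<bar> * u" by linarith
      have "\<bar>B\<bar> * 1 \<le> \<bar>B\<bar> * u" using u by (intro mult_left_mono) auto
      then show "B \<le> \<bar>B\<bar> * u" by linarith
    qed
    also have "\<dots> \<le> K * u" using S0[of u1] u by (simp add: K_def algebra_simps)
    finally show ?thesis .
  next
    case False
    then have "S u \<le> S u1" unfolding S_def by (intro sum_mono2 finite_ln_le) auto
    also have "\<dots> \<le> K * 1" by (simp add: K_def)
    also have "\<dots> \<le> K * u" using K0 u by (intro mult_left_mono) auto
    finally show ?thesis .
  qed
  \<comment> \<open>On shell j the pointwise bound gives exp (- 2 \<delta> j) and the prime sum is
    at most K (j + 1); half of the exponential absorbs the linear growth.\<close>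
  define c where "c j = C\<^sup>2 * (K * (1 + 1 / \<delta>)) * exp (- \<delta>) ^ j" for j :: nat
  have cs: "summable c" unfolding c_def using dl by (intro summable_mult summable_geometric) simp
  have c0: "c j \<ge> 0" for j using K0 dl by (simp add: c_def)
  have h1: "(half_norm f p 1)\<^sup>2 = (norm (f p))\<^sup>2 / real p" if "prime p" for p
    using half_norm_sq[of p f 1] prime_gt_0_nat[OF that] by simp
  have shell: "(\<Sum>p\<in>{p \<in> A. nat \<lfloor>ln (real p)\<rfloor> = j}. half_norm f p 1 ^ 4) \<le> c j" if A: "finite A" "A \<subseteq> {p. prime p}" for A j
  proof -
    have "(\<Sum>p\<in>{p \<in> A. nat \<lfloor>ln (real p)\<rfloor> = j}. half_norm f p 1 ^ 4) \<le> (\<Sum>p\<in>{p \<in> A. nat \<lfloor>ln (real p)\<rfloor> = j}. C\<^sup>2 * (exp (- \<delta> * real j))\<^sup>2 * ((norm (f p))\<^sup>2 / real p))"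
    proof (rule sum_mono)
      fix p assume "p \<in> {p \<in> A. nat \<lfloor>ln (real p)\<rfloor> = j}"
      then have p: "prime p" "nat \<lfloor>ln (real p)\<rfloor> = j" using A by auto
      have p1: "real p \<ge> 1" using prime_ge_1_nat[OF p(1)] by simp
      then have "real j \<le> ln (real p)" using p(2) by (metis ln_ge_zero of_nat_floor)
      then have "real p powr - \<delta> \<le> exp (- \<delta> * real j)" using p1 dl by (simp add: powr_def)
      then have "half_norm f p 1 \<le> C * exp (- \<delta> * real j)" using hb[OF p(1), of 1] C0 by (simp add: order_trans mult_left_mono)
      then have "(half_norm f p 1)\<^sup>2 \<le> (C * exp (- \<delta> * real j))\<^sup>2" by (intro power_mono half_norm_nonneg)
      then have "(half_norm f p 1)\<^sup>2 * (half_norm f p 1)\<^sup>2 \<le> (C * exp (- \<delta> * real j))\<^sup>2 * ((norm (f p))\<^sup>2 / real p)"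
        unfolding h1[OF p(1)] by (intro mult_right_mono) auto
      then show "half_norm f p 1 ^ 4 \<le> C\<^sup>2 * (exp (- \<delta> * real j))\<^sup>2 * ((norm (f p))\<^sup>2 / real p)"
        by (simp only: power_mult_distrib power_add[symmetric]) simp
    qed
    also have "\<dots> = C\<^sup>2 * (exp (- \<delta> * real j))\<^sup>2 * (\<Sum>p\<in>{p \<in> A. nat \<lfloor>ln (real p)\<rfloor> = j}. (norm (f p))\<^sup>2 / real p)"
      by (simp add: sum_distrib_left)
    also have "\<dots> \<le> C\<^sup>2 * (exp (- \<delta> * real j))\<^sup>2 * S (real j + 1)"
      unfolding S_def
    proof (intro mult_left_mono sum_mono2 finite_ln_le subsetI)
      fix p assume "p \<in> {p \<in> A. nat \<lfloor>ln (real p)\<rfloor> = j}"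
      then show "p \<in> {p. prime p \<and> ln (real p) \<le> real j + 1}" using A by (auto, linarith)
    qed auto
    also have "\<dots> \<le> C\<^sup>2 * (exp (- \<delta> * real j))\<^sup>2 * (K * ((1 + 1 / \<delta>) * exp (\<delta> * real j)))"
    proof (intro mult_left_mono)
      have "(real j + 1) \<le> (1 + 1 / \<delta>) * (1 + \<delta> * real j)" using dl by (simp add: field_simps)
      also have "\<dots> \<le> (1 + 1 / \<delta>) * exp (\<delta> * real j)" using dl by (intro mult_left_mono exp_ge_add_one_self) auto
      finally have "K * (real j + 1) \<le> K * ((1 + 1 / \<delta>) * exp (\<delta> * real j))" using K0 by (intro mult_left_mono)
      then show "S (real j + 1) \<le> K * ((1 + 1 / \<delta>) * exp (\<delta> * real j))" using SK[of "real j + 1"] by linarith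
    qed auto
    also have "\<dots> = c j"
    proof -
      have "(exp (- \<delta> * real j))\<^sup>2 * exp (\<delta> * real j) = exp (- \<delta>) ^ j"
        by (simp add: power2_eq_square exp_add[symmetric] exp_of_nat_mult[symmetric] mult.commute)
      then show ?thesis unfolding c_def by (metis (no_types, lifting) mult.assoc mult.left_commute)
    qed
    finally show ?thesis .
  qed
  have t4: "(\<lambda>p. half_norm f p 1 ^ 4) summable_on {p. prime p}"
  proof (rule nonneg_bdd_above_summable_on)
    show "bdd_above (sum (\<lambda>p. half_norm f p 1 ^ 4) ` {F. F \<subseteq> {p. prime p} \<and> finite F})"
    proof (rule bdd_aboveI2)
      fix F :: "nat set" assume "F \<in> {F. F \<subseteq> {p. prime p} \<and> finite F}"
      then have F: "finite F" "F \<subseteq> {p. prime p}" by auto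
      show "(\<Sum>p\<in>F. half_norm f p 1 ^ 4) \<le> suminf c" by (rule sum_primes_subseries[OF cs c0 F(1) shell[OF F]])
    qed
  qed (auto simp: half_norm_nonneg)
  \<comment> \<open>From this exponent on p^(- \<delta> b) is at most 1 / p.\<close>
  define B0 where "B0 = nat \<lceil>1 / \<delta>\<rceil>"
  have B0: "\<delta> * real B0 \<ge> 1"
  proof -
    have "1 / \<delta> \<le> real B0" unfolding B0_def by linarith
    then show ?thesis using dl by (simp add: field_simps)
  qed
  define C' where "C' = C / (1 - 2 powr - \<delta>)"
  have d2: "2 powr - \<delta> < 1" using dl by (simp add: powr_less_one)
  define x where "x p = (\<Sum>b\<in>{2..<B0}. half_norm f p b) + C' / real p" for p
  have xb: "(\<Sum>b=2..K. half_norm f p b) \<le> x p" if p: "prime p" for p K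
  proof -
    have p2: "real p \<ge> 2" using prime_ge_2_nat[OF p] by simp
    define y where "y = real p powr - \<delta>"
    have y: "0 \<le> y" "y \<le> 2 powr - \<delta>" "y < 1"
    proof -
      show "0 \<le> y" by (simp add: y_def)
      show "y \<le> 2 powr - \<delta>" unfolding y_def using p2 dl by (intro powr_mono2') auto
      then show "y < 1" using d2 by simp
    qed
    have "(\<Sum>b=2..K. half_norm f p b) \<le> (\<Sum>b\<in>{2..<B0} \<union> {B0..K}. half_norm f p b)"
      by (intro sum_mono2) (auto simp: half_norm_nonneg)
    also have "\<dots> = (\<Sum>b\<in>{2..<B0}. half_norm f p b) + (\<Sum>b=B0..K. half_norm f p b)"
      by (intro sum.union_disjoint) auto
    also have "(\<Sum>b=B0..K. half_norm f p b) \<le> (\<Sum>b=B0..K. C * y ^ b)" unfolding y_def by (intro sum_mono hb p)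
    also have "\<dots> = C * (\<Sum>b=B0..K. y ^ b)" by (simp add: sum_distrib_left)
    also have "\<dots> \<le> C * (y ^ B0 / (1 - y))"
      using y by (intro mult_left_mono C0) (simp add: sum_gp divide_right_mono)
    also have "\<dots> \<le> C * ((1 / real p) / (1 - 2 powr - \<delta>))"
    proof (intro mult_left_mono C0 frac_le)
      have "y ^ B0 = real p powr (- \<delta> * real B0)" unfolding y_def using p2 by (simp add: powr_powr flip: powr_realpow)
      also have "\<dots> \<le> real p powr - 1" using B0 p2 by (intro powr_mono) auto
      finally show "y ^ B0 \<le> 1 / real p" using p2 by (simp add: powr_minus_divide)
    qed (use y d2 in auto)
    also have "\<dots> = C' / real p" by (simp add: C'_def)
    finally show ?thesis by (simp add: x_def)
  qed
  have hsum: "(\<lambda>p. (half_norm f p b)\<^sup>2) summable_on {p. prime p}" if "b \<ge> 2" for b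
  proof -
    have "(\<lambda>(p, m). (norm (f (p ^ m)))\<^sup>2 / real (p ^ m)) summable_on (\<lambda>p. (p, b)) ` {p. prime p}"
      by (rule summable_on_subset_banach[OF sq]) (use that in auto)
    then have "((\<lambda>(p, m). (norm (f (p ^ m)))\<^sup>2 / real (p ^ m)) \<circ> (\<lambda>p. (p, b))) summable_on {p. prime p}"
      by (subst (asm) summable_on_reindex) (auto simp: inj_on_def)
    then show ?thesis by (rule summable_on_cong[THEN iffD1, rotated]) (auto simp: half_norm_sq prime_gt_0_nat)
  qed
  have sums: "(\<lambda>p. \<Sum>b\<in>D. (half_norm f p b)\<^sup>2) summable_on {p. prime p}" if "finite D" "\<forall>b\<in>D. b \<ge> 2" for D
    using that by (induction D rule: finite_induct) (auto intro: summable_on_add hsum)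
  have inv: "(\<lambda>p. 1 / (real p)\<^sup>2) summable_on {p. prime p}"
  proof (rule summable_on_subset_banach)
    show "(\<lambda>p. 1 / (real p)\<^sup>2) summable_on UNIV"
      using inverse_power_summable[of 2, where 'a = real] by (intro norm_summable_imp_summable_on) (simp add: inverse_eq_divide norm_divide)
  qed simp
  have "(\<lambda>p. 2 * (real (card {2..<B0}) * (\<Sum>b\<in>{2..<B0}. (half_norm f p b)\<^sup>2)) + 2 * C'\<^sup>2 * (1 / (real p)\<^sup>2)) summable_on {p. prime p}"
    by (intro summable_on_add summable_on_cmult_right inv sums) auto
  then have "(\<lambda>p. (x p)\<^sup>2) summable_on {p. prime p}"
  proof (rule Infinite_Sum.summable_on_comparison_test)
    fix p
    have "(\<Sum>b\<in>{2..<B0}. 1 * half_norm f p b)\<^sup>2 \<le> (\<Sum>b\<in>{2..<B0}. 1\<^sup>2) * (\<Sum>b\<in>{2..<B0}. (half_norm f p b)\<^sup>2)"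
      by (rule Cauchy_Schwarz_ineq_sum)
    then have s: "(\<Sum>b\<in>{2..<B0}. half_norm f p b)\<^sup>2 \<le> real (card {2..<B0}) * (\<Sum>b\<in>{2..<B0}. (half_norm f p b)\<^sup>2)" by simp
    have "(\<alpha> + \<beta>)\<^sup>2 \<le> 2 * \<alpha>\<^sup>2 + 2 * \<beta>\<^sup>2" for \<alpha> \<beta> :: real
      using sum_squares_bound[of \<alpha> \<beta>] by (simp add: power2_sum)
    then have "(x p)\<^sup>2 \<le> 2 * (\<Sum>b\<in>{2..<B0}. half_norm f p b)\<^sup>2 + 2 * (C' / real p)\<^sup>2" unfolding x_def .
    with s show "(x p)\<^sup>2 \<le> 2 * (real (card {2..<B0}) * (\<Sum>b\<in>{2..<B0}. (half_norm f p b)\<^sup>2)) + 2 * C'\<^sup>2 * (1 / (real p)\<^sup>2)"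
      by (simp add: power_divide)
  qed auto
  then show ?thesis unfolding tame_def using f t4 xb by blast
qed

text \<open>Multiplying by (s - z0)^q cancels the pole, and F0 takes at z0 the value of the cleared
  Laurent expansion because L z0 itself may be arbitrary.\<close>

lemma meromorphic_clear_pole:
  fixes L :: "complex \<Rightarrow> complex"
  assumes L: "L meromorphic_on A" "L analytic_on A - {z0}" and z0: "z0 \<in> A"
  obtains F0 q where "F0 analytic_on A" "\<And>s. s \<noteq> z0 \<Longrightarrow> L s = F0 s / (s - z0) ^ q"
proof -
  obtain F where F: "fls_conv_radius F > 0" "\<forall>\<^sub>F w in at 0. eval_fls F w = L (z0 + w)"
    using L(1) z0 unfolding meromorphic_on_def has_laurent_expansion_def by blast
  \<comment> \<open>q is 0 if there is no pole; the exponent e is then the order of vanishing, and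
    it is 0 if there is a pole.\<close>
  define q where "q = nat (- fls_subdegree F)"
  define e where "e = nat (fls_subdegree F + int q)"
  define G where "G s = eval_fps (fls_base_factor_to_fps F) (s - z0) * (s - z0) ^ e" for s
  define F0 where "F0 s = (if s = z0 then G z0 else (s - z0) ^ q * L s)" for s
  have "\<forall>\<^sub>F s in at z0. eval_fls F (s - z0) = L s"
    using F(2) by (subst at_to_0) (simp add: eventually_filtermap add.commute)
  then have ev: "\<forall>\<^sub>F s in nhds z0. F0 s = G s"
    unfolding eventually_at_filter
  proof eventually_elim
    case (elim s)
    show ?case
    proof (cases "s = z0")
      case False
      then have "G s = eval_fps (fls_base_factor_to_fps F) (s - z0) * (s - z0) powi (fls_subdegree F + int q)"
        by (simp add: G_def e_def q_def power_int_def)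
      also have "\<dots> = eval_fls F (s - z0) * (s - z0) ^ q" using False by (simp add: eval_fls_def power_int_add)
      finally show ?thesis using elim False by (simp add: F0_def)
    qed (simp add: F0_def)
  qed
  have "eval_fps (fls_base_factor_to_fps F) analytic_on {0}"
    using F(1) by (intro analytic_on_eval_fps) (auto simp: zero_ereal_def fps_conv_radius_fls_regpart)
  then have "(eval_fps (fls_base_factor_to_fps F) \<circ> (\<lambda>s. s - z0)) analytic_on {z0}"
    by (intro analytic_on_compose) (auto intro!: analytic_intros)
  then have "G analytic_on {z0}" unfolding G_def[abs_def] o_def
    by (intro analytic_on_mult analytic_on_power analytic_on_diff analytic_on_ident analytic_on_const)
  then have a1: "F0 analytic_on {z0}" using ev by (subst analytic_at_cong[where g = G]) auto
  have a2: "F0 analytic_on {s}" if s: "s \<in> A" "s \<noteq> z0" for s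
  proof -
    have "L analytic_on {s}" using s by (intro analytic_on_subset[OF L(2)]) auto
    then have "(\<lambda>s. (s - z0) ^ q * L s) analytic_on {s}" by (intro analytic_intros)
    moreover have "\<forall>\<^sub>F x in nhds s. F0 x = (x - z0) ^ q * L x"
      using t1_space_nhds[OF s(2)] by eventually_elim (simp add: F0_def)
    ultimately show ?thesis by (subst analytic_at_cong[where g = "\<lambda>s. (s - z0) ^ q * L s"]) auto
  qed
  have "F0 analytic_on A" using a1 a2 by (subst analytic_on_analytic_at) blast
  moreover have "L s = F0 s / (s - z0) ^ q" if "s \<noteq> z0" for s using that by (simp add: F0_def)
  ultimately show ?thesis using that by blast
qed

lemma strip_polynomial_bound:
  fixes F0 L :: "complex \<Rightarrow> complex"
  assumes F0: "continuous_on {s. Re s \<ge> 1 / 2} F0" and LF: "\<And>s. s \<noteq> 1 \<Longrightarrow> L s = F0 s / (s - 1) ^ q"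
    and gr: "\<And>s. Re s \<ge> 1 / 2 \<Longrightarrow> \<bar>Im s\<bar> \<ge> t0 \<Longrightarrow> norm (L s) \<le> C * \<bar>Im s\<bar> powr A" and b1: "b1 \<ge> 2"
  shows "\<exists>D M. \<forall>s. 1 / 2 \<le> Re s \<longrightarrow> Re s \<le> b1 \<longrightarrow> norm (F0 s) \<le> D * (1 + \<bar>Im s\<bar>) ^ M"
proof -
  define t1 where "t1 = max t0 1"
  have "continuous_on (cbox (Complex (1 / 2) (- t1)) (Complex b1 t1)) F0"
    by (rule continuous_on_subset[OF F0]) (auto simp: in_cbox_complex_iff)
  then have "bounded (F0 ` cbox (Complex (1 / 2) (- t1)) (Complex b1 t1))"
    by (intro compact_imp_bounded compact_continuous_image compact_cbox)
  then obtain K where K: "\<And>s. s \<in> cbox (Complex (1 / 2) (- t1)) (Complex b1 t1) \<Longrightarrow> norm (F0 s) \<le> K"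
    unfolding bounded_iff by blast
  define N where "N = nat \<lceil>A\<rceil>"
  have "norm (F0 s) \<le> (\<bar>K\<bar> + \<bar>C\<bar> * (b1 + 1) ^ q) * (1 + \<bar>Im s\<bar>) ^ (q + N)" if s: "1 / 2 \<le> Re s" "Re s \<le> b1" for s
  proof (cases "\<bar>Im s\<bar> \<le> t1")
    case True
    then have "norm (F0 s) \<le> \<bar>K\<bar>" using K[of s] s by (force simp: in_cbox_complex_iff)
    also have "\<dots> \<le> (\<bar>K\<bar> + \<bar>C\<bar> * (b1 + 1) ^ q) * 1" using b1 by simp
    also have "\<dots> \<le> (\<bar>K\<bar> + \<bar>C\<bar> * (b1 + 1) ^ q) * (1 + \<bar>Im s\<bar>) ^ (q + N)"
      using b1 by (intro mult_left_mono one_le_power) auto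
    finally show ?thesis .
  next
    case False
    then have t: "\<bar>Im s\<bar> \<ge> t0" "\<bar>Im s\<bar> \<ge> 1" by (auto simp: t1_def)
    then have s1: "s \<noteq> 1" by auto
    have "norm (L s) \<le> C * \<bar>Im s\<bar> powr A" by (rule gr[OF s(1) t(1)])
    also have "\<dots> \<le> \<bar>C\<bar> * (1 + \<bar>Im s\<bar>) ^ N"
    proof (intro mult_mono)
      have "A \<le> real N" unfolding N_def by linarith
      then have "\<bar>Im s\<bar> powr A \<le> \<bar>Im s\<bar> powr real N" using t by (intro powr_mono) auto
      also have "\<dots> = \<bar>Im s\<bar> ^ N" using t by (intro powr_realpow) auto
      also have "\<dots> \<le> (1 + \<bar>Im s\<bar>) ^ N" by (intro power_mono) auto
      finally show "\<bar>Im s\<bar> powr A \<le> (1 + \<bar>Im s\<bar>) ^ N" .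
    qed auto
    finally have 1: "norm (L s) \<le> \<bar>C\<bar> * (1 + \<bar>Im s\<bar>) ^ N" .
    have "norm (s - 1) \<le> \<bar>Re s - 1\<bar> + \<bar>Im s\<bar>" using cmod_le[of "s - 1"] by simp
    also have "\<dots> \<le> (b1 + 1) * (1 + \<bar>Im s\<bar>)"
    proof -
      have "\<bar>Re s - 1\<bar> \<le> b1 + 1" using s b1 by linarith
      moreover have "1 * \<bar>Im s\<bar> \<le> (b1 + 1) * \<bar>Im s\<bar>" using b1 by (intro mult_right_mono) auto
      ultimately have "\<bar>Re s - 1\<bar> + 1 * \<bar>Im s\<bar> \<le> (b1 + 1) + (b1 + 1) * \<bar>Im s\<bar>" by (rule add_mono)
      then show ?thesis by (simp only: distrib_left mult_1 mult_1_right)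
    qed
    finally have "norm (s - 1) ^ q \<le> ((b1 + 1) * (1 + \<bar>Im s\<bar>)) ^ q" by (intro power_mono) auto
    with 1 have "norm (L s) * norm (s - 1) ^ q \<le> (\<bar>C\<bar> * (1 + \<bar>Im s\<bar>) ^ N) * ((b1 + 1) * (1 + \<bar>Im s\<bar>)) ^ q"
      by (intro mult_mono) auto
    also have "norm (L s) * norm (s - 1) ^ q = norm (F0 s)" using LF[OF s1] s1 by (simp add: norm_divide norm_power)
    also have "(\<bar>C\<bar> * (1 + \<bar>Im s\<bar>) ^ N) * ((b1 + 1) * (1 + \<bar>Im s\<bar>)) ^ q = (\<bar>C\<bar> * (b1 + 1) ^ q) * (1 + \<bar>Im s\<bar>) ^ (q + N)"
      by (simp add: power_mult_distrib power_add mult_ac)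
    also have "\<dots> \<le> (\<bar>K\<bar> + \<bar>C\<bar> * (b1 + 1) ^ q) * (1 + \<bar>Im s\<bar>) ^ (q + N)" by (intro mult_right_mono) auto
    finally show ?thesis .
  qed
  then show ?thesis by blast
qed

subsection \<open>From Gaussian means to the integral\<close>

lemma power_le_fact_exp:
  assumes "x \<ge> (0::real)" shows "x ^ n \<le> fact n * exp x"
proof -
  have "(\<Sum>k\<in>{n}. inverse (fact k) * x ^ k) \<le> (\<Sum>k. inverse (fact k) * x ^ k)"
    using assms summable_exp[of x] by (intro sum_le_suminf) auto
  then show ?thesis by (simp add: exp_def scaleR_conv_of_real field_simps)
qed

text \<open>For a centre in the middle half of [T, 2 T], points outside satisfy u = |t - \<tau>| >=
  T / 4. Against a Gaussian of twice the deviation the exponent gains 3 u^2 / (8 T): a third of it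
  absorbs the polynomial, the rest is at least T / 64.\<close>

lemma gaussian_tail_le:
  assumes T: "T > 0" and ph: "\<phi> t \<le> D * (1 + \<bar>t\<bar>) ^ M" and D: "D \<ge> 0" and tau: "5 * T / 4 \<le> \<tau>" "\<tau> \<le> 7 * T / 4" and t: "t \<notin> {T..2 * T}"
  shows "normal_density \<tau> (sqrt T) t * \<phi> t \<le> 2 * D * (288 ^ M * fact M * exp (1 / 288)) * exp (- T / 64) * normal_density \<tau> (2 * sqrt T) t"
proof -
  define u where "u = \<bar>t - \<tau>\<bar>"
  have u: "u \<ge> T / 4" using t tau by (auto simp: u_def)
  then have u0: "u \<ge> 0" using T by simp
  define q where "q = 1 / sqrt (2 * pi * T)"
  have q: "q \<ge> 0" using T by (simp add: q_def)
  have u2: "(t - \<tau>)\<^sup>2 = u\<^sup>2" by (simp add: u_def)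
  have n1: "normal_density \<tau> (sqrt T) t = q * exp (- u\<^sup>2 / (2 * T))"
    using T by (simp add: normal_density_def q_def u2)
  have n2: "normal_density \<tau> (2 * sqrt T) t = q / 2 * exp (- u\<^sup>2 / (8 * T))"
  proof -
    have "sqrt (2 * pi * (2 * sqrt T)\<^sup>2) = sqrt (4 * (2 * pi * T))" using T by (simp add: power_mult_distrib)
    also have "\<dots> = 2 * sqrt (2 * pi * T)" by (subst real_sqrt_mult) simp
    finally show ?thesis using T by (simp add: normal_density_def q_def u2 power_mult_distrib)
  qed
  define K where "K = 288 ^ M * fact M * exp (1 / 288 :: real)"
  have Tu: "T * u \<le> 4 * u\<^sup>2" using mult_right_mono[OF u u0] by (simp add: power2_eq_square)
  have T2: "T * T \<le> 16 * u\<^sup>2"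
    using power_mono[OF u, of 2] T by (simp add: power2_eq_square)
  have "\<bar>t\<bar> \<le> 9 * u" using t tau u T unfolding u_def by (auto simp: abs_if split: if_splits)
  \<comment> \<open>288 = 9 * 32, so that (9 u) / 288 = u / 32, which is at most u^2 / (8 T) by T u
    <= 4 u^2.\<close>
  then have "(1 + \<bar>t\<bar>) ^ M \<le> (288 * ((1 + 9 * u) / 288)) ^ M" by (intro power_mono) auto
  also have "\<dots> = 288 ^ M * ((1 + 9 * u) / 288) ^ M" by (simp only: power_mult_distrib)
  also have "\<dots> \<le> 288 ^ M * (fact M * exp ((1 + 9 * u) / 288))" using u0 by (intro mult_left_mono power_le_fact_exp) auto
  also have "\<dots> = K * exp (u / 32)" by (simp add: K_def add_divide_distrib exp_add)
  also have "\<dots> \<le> K * exp (u\<^sup>2 / (8 * T))" using Tu T by (intro mult_left_mono) (auto simp: K_def field_simps)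
  finally have "D * (1 + \<bar>t\<bar>) ^ M \<le> D * (K * exp (u\<^sup>2 / (8 * T)))" using D by (intro mult_left_mono)
  with ph have "\<phi> t \<le> D * (K * exp (u\<^sup>2 / (8 * T)))" by linarith
  then have "normal_density \<tau> (sqrt T) t * \<phi> t \<le> q * exp (- u\<^sup>2 / (2 * T)) * (D * (K * exp (u\<^sup>2 / (8 * T))))"
    unfolding n1 using q by (intro mult_left_mono) auto
  also have "\<dots> = D * K * q * exp (- u\<^sup>2 / (2 * T) + u\<^sup>2 / (8 * T))" by (simp only: exp_add mult_ac)
  also have "- u\<^sup>2 / (2 * T) + u\<^sup>2 / (8 * T) = - u\<^sup>2 / (8 * T) - u\<^sup>2 / (4 * T)" by (simp add: field_simps)
  also have "D * K * q * exp (- u\<^sup>2 / (8 * T) - u\<^sup>2 / (4 * T)) \<le> D * K * q * exp (- u\<^sup>2 / (8 * T) + - T / 64)"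
  proof -
    have "T / 64 \<le> u\<^sup>2 / (4 * T)" using T2 T by (simp add: field_simps)
    then show ?thesis using D q by (intro mult_left_mono mult_nonneg_nonneg) (auto simp: K_def)
  qed
  also have "\<dots> = 2 * D * K * exp (- T / 64) * normal_density \<tau> (2 * sqrt T) t"
    unfolding n2 exp_add by (simp add: mult_ac)
  finally show ?thesis unfolding K_def .
qed

text \<open>Average the lower bound over centres \<tau> in the middle half. The density is symmetric
  in t and \<tau>, so after exchanging the integrals the weight of each t is at most 1. Nonnegative
  integrals with values in \<open>ennreal\<close> make the exchange free of integrability
  conditions.\<close>

lemma integral_lower_of_gmean:
  fixes \<phi> :: "real \<Rightarrow> real"
  assumes ph: "continuous_on UNIV \<phi>" "\<And>t. \<phi> t \<ge> 0" "\<And>t. \<phi> t \<le> D * (1 + \<bar>t\<bar>) ^ M" and g: "g \<ge> 0" and c: "c > 0"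
    and low: "\<And>T \<tau>. T \<ge> T1 \<Longrightarrow> c * ln T powr g \<le> gmean \<tau> (sqrt T) \<phi>"
  shows "\<exists>c>0. \<exists>T0>0. \<forall>T\<ge>T0. integral {T..2 * T} \<phi> \<ge> c * T * ln T powr g"
proof -
  have D0: "D \<ge> 0" using ph(2)[of 0] ph(3)[of 0] by simp
  have [measurable]: "\<phi> \<in> borel_measurable borel" by (rule borel_measurable_continuous_onI[OF ph(1)])
  define W where "W = 2 * D * (288 ^ M * fact M * exp (1 / 288))"
  have W0: "W \<ge> 0" using D0 by (simp add: W_def)
  have "((\<lambda>T::real. W * exp (- T / 64)) \<longlongrightarrow> 0) at_top" by real_asymp
  from order_tendstoD(2)[OF this, of "c / 2"] c have "\<forall>\<^sub>F T::real in at_top. W * exp (- T / 64) < c / 2" by simp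
  then obtain T2 where T2: "\<And>T. T \<ge> T2 \<Longrightarrow> W * exp (- T / 64) < c / 2" unfolding eventually_at_top_linorder by blast
  have main: "c / 4 * T * ln T powr g \<le> integral {T..2 * T} \<phi>" if T: "T \<ge> max (max T1 T2) (exp 1)" for T
  proof -
    have T0: "T > 0" using T exp_gt_zero[of "1::real"] by linarith
    then have sT: "sqrt T > 0" by simp
    have "ln T \<ge> 1" using T T0 by (metis exp_le_cancel_iff exp_ln max.bounded_iff)
    then have lnT: "ln T powr g \<ge> 1" using g by (rule ge_one_powr_ge_zero)
    let ?f = "\<lambda>\<tau> t. indicator {T..2 * T} t * (normal_density \<tau> (sqrt T) t * \<phi> t)"
    define c' where "c' = c / 2 * ln T powr g"
    have c'0: "c' \<ge> 0" using c by (simp add: c'_def)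
    have i1: "integrable lborel (\<lambda>t. normal_density \<tau> (sqrt T) t * \<phi> t)" for \<tau>
      using gint_poly[OF sT ph(1), of D M \<tau>] ph(2,3) by (simp add: gint_def)
    have i2: "integrable lborel (?f \<tau>)" for \<tau> using integrable_mult_indicator[OF _ i1, of "{T..2 * T}" \<tau>] by simp
    have f0: "?f \<tau> t \<ge> 0" for \<tau> t using ph(2) by simp
    have inner: "c' \<le> (\<integral>t. ?f \<tau> t \<partial>lborel)" if tau: "5 * T / 4 \<le> \<tau>" "\<tau> \<le> 7 * T / 4" for \<tau>
    proof -
      have n2: "integrable lborel (\<lambda>t. W * exp (- T / 64) * normal_density \<tau> (2 * sqrt T) t)"
        using sT by (intro integrable_mult_right integrable_normal_density) auto
      have "c * ln T powr g \<le> (\<integral>t. normal_density \<tau> (sqrt T) t * \<phi> t \<partial>lborel)"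
        using low[of T \<tau>] T by (simp add: gmean_def)
      also have "\<dots> \<le> (\<integral>t. ?f \<tau> t + W * exp (- T / 64) * normal_density \<tau> (2 * sqrt T) t \<partial>lborel)"
      proof (rule integral_mono[OF i1 Bochner_Integration.integrable_add[OF i2 n2]])
        fix t
        show "normal_density \<tau> (sqrt T) t * \<phi> t \<le> ?f \<tau> t + W * exp (- T / 64) * normal_density \<tau> (2 * sqrt T) t"
          using gaussian_tail_le[of T \<phi> t D M \<tau>, OF T0 ph(3) D0 tau] W0 unfolding W_def[symmetric]
          by (cases "t \<in> {T..2 * T}") (auto intro!: mult_nonneg_nonneg)
      qed
      also have "\<dots> = (\<integral>t. ?f \<tau> t \<partial>lborel) + W * exp (- T / 64) * 1"
        unfolding Bochner_Integration.integral_add[OF i2 n2] using sT integral_normal_density[of "2 * sqrt T" \<tau>] by simp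
      finally have "c * ln T powr g \<le> (\<integral>t. ?f \<tau> t \<partial>lborel) + W * exp (- T / 64)" by simp
      moreover have "W * exp (- T / 64) \<le> c / 2" using T2[of T] T by simp
      moreover have "c / 2 * 1 \<le> c'" unfolding c'_def using lnT c by (intro mult_left_mono) auto
      moreover have "c * ln T powr g = 2 * c'" by (simp add: c'_def)
      ultimately show ?thesis by linarith
    qed
    \<comment> \<open>T / 2 is the length of the interval of centres.\<close>
    have "ennreal (c' * (T / 2)) = (\<integral>\<^sup>+\<tau>. ennreal c' * indicator {5 * T / 4..7 * T / 4} \<tau> \<partial>lborel)"
      using T0 ennreal_mult[of c' "T / 2"] c'0 by (subst nn_integral_cmult_indicator) auto
    also have "\<dots> \<le> (\<integral>\<^sup>+\<tau>. \<integral>\<^sup>+t. ennreal (?f \<tau> t) \<partial>lborel \<partial>lborel)"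
    proof (rule nn_integral_mono)
      fix \<tau> :: real
      have "(\<integral>\<^sup>+t. ennreal (?f \<tau> t) \<partial>lborel) = ennreal (\<integral>t. ?f \<tau> t \<partial>lborel)"
        by (rule nn_integral_eq_integral[OF i2]) (use f0 in auto)
      then show "ennreal c' * indicator {5 * T / 4..7 * T / 4} \<tau> \<le> (\<integral>\<^sup>+t. ennreal (?f \<tau> t) \<partial>lborel)"
        using inner[of \<tau>] by (auto simp: indicator_def intro: ennreal_leI)
    qed
    also have "\<dots> = (\<integral>\<^sup>+t. \<integral>\<^sup>+\<tau>. ennreal (?f \<tau> t) \<partial>lborel \<partial>lborel)"
      by (rule lborel_pair.Fubini') (unfold normal_density_def case_prod_beta, measurable)
    also have "\<dots> = (\<integral>\<^sup>+t. ennreal (indicator {T..2 * T} t * \<phi> t) \<partial>lborel)"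
    proof (rule nn_integral_cong)
      fix t
      have "ennreal (?f \<tau> t) = ennreal (indicator {T..2 * T} t * \<phi> t) * ennreal (normal_density t (sqrt T) \<tau>)" for \<tau>
        using ph(2) by (subst ennreal_mult[symmetric]) (auto simp: normal_density_def power2_commute mult_ac)
      then have "(\<integral>\<^sup>+\<tau>. ennreal (?f \<tau> t) \<partial>lborel) = ennreal (indicator {T..2 * T} t * \<phi> t) * (\<integral>\<^sup>+\<tau>. ennreal (normal_density t (sqrt T) \<tau>) \<partial>lborel)"
        by (simp add: nn_integral_cmult)
      also have "(\<integral>\<^sup>+\<tau>. ennreal (normal_density t (sqrt T) \<tau>) \<partial>lborel) = 1"
        using sT by (subst nn_integral_eq_integral) auto
      finally show "(\<integral>\<^sup>+\<tau>. ennreal (?f \<tau> t) \<partial>lborel) = ennreal (indicator {T..2 * T} t * \<phi> t)" by simp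
    qed
    also have "\<dots> = ennreal (integral {T..2 * T} \<phi>)"
    proof -
      have si: "set_integrable lborel {T..2 * T} \<phi>"
        by (rule borel_integrable_atLeastAtMost') (rule continuous_on_subset[OF ph(1)], simp)
      have "(\<integral>\<^sup>+t. ennreal (indicator {T..2 * T} t * \<phi> t) \<partial>lborel) = ennreal (\<integral>t. indicator {T..2 * T} t * \<phi> t \<partial>lborel)"
        by (rule nn_integral_eq_integral) (use si ph(2) in \<open>auto simp: set_integrable_def\<close>)
      then show ?thesis using set_borel_integral_eq_integral(2)[OF si] by (simp add: set_lebesgue_integral_def)
    qed
    finally have "c' * (T / 2) \<le> integral {T..2 * T} \<phi>"
      using ph(2) by (subst (asm) ennreal_le_iff) (auto intro!: integral_nonneg integrable_continuous_interval continuous_on_subset[OF ph(1)])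
    then show ?thesis by (simp add: c'_def field_simps)
  qed
  show ?thesis
    by (intro exI[of _ "c / 4"] conjI exI[of _ "max (max T1 T2) (exp 1)"] allI impI main) (use c in \<open>auto simp: less_max_iff_disj\<close>)
qed

text \<open>This serves k = 0: \<open>x powr 0\<close> is 1 for x \<noteq> 0 but 0 at x = 0, so the
  integrand is 1 only away from the zeros of L.\<close>

lemma half_line_zeros_finite:
  fixes F0 L :: "complex \<Rightarrow> complex"
  assumes F0: "F0 analytic_on {s. Re s \<ge> 1 / 2}" and LF: "\<And>s. s \<noteq> 1 \<Longrightarrow> L s = F0 s / (s - 1) ^ q"
    and nz: "L (Complex (1 / 2) t0) \<noteq> 0"
  shows "finite {t \<in> {a..b}. L (Complex (1 / 2) t) = 0}"
proof -
  let ?H = "{s. Re s \<ge> 1 / 2}"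
  obtain U where U: "open U" "?H \<subseteq> U" "F0 holomorphic_on U" using F0 unfolding analytic_on_holomorphic by blast
  \<comment> \<open>The open set of holomorphy may be disconnected; the component containing the
    half-plane is what the identity theorem applies to.\<close>
  define V where "V = connected_component_set U (Complex (1 / 2) 0)"
  have V: "open V" "connected V" "V \<subseteq> U"
    unfolding V_def using U(1) by (auto simp: open_connected_component connected_component_subset)
  have "convex ?H" by (rule convex_halfspace_Re_ge)
  then have HV: "?H \<subseteq> V" unfolding V_def using U(2)
    by (intro connected_component_maximal) (auto intro: convex_connected)
  have Lz: "L (Complex (1 / 2) t) = 0 \<longleftrightarrow> F0 (Complex (1 / 2) t) = 0" for t
    using LF[OF Complex_ne_1, of "1 / 2" t] Complex_ne_1[of "1 / 2" t] by simp
  let ?K = "Complex (1 / 2) ` {a..b}"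
  have inj: "inj_on (Complex (1 / 2)) A" for A by (auto simp: inj_on_def)
  have KV: "compact ?K" "?K \<subseteq> V"
    using HV by (auto intro!: compact_continuous_image continuous_intros simp: Complex_eq)
  have "finite {z \<in> ?K. F0 z = 0}"
  proof (cases "F0 constant_on V")
    case True
    then obtain c where c: "\<And>z. z \<in> V \<Longrightarrow> F0 z = c" unfolding constant_on_def by blast
    have "Complex (1 / 2) t0 \<in> V" by (rule subsetD[OF HV]) simp
    then have "c \<noteq> 0" using c[of "Complex (1 / 2) t0"] nz Lz by metis
    then have "{z \<in> ?K. F0 z = 0} = {}" using c KV(2) by auto
    then show ?thesis by (simp only: finite.emptyI)
  next
    case False
    show ?thesis by (rule holomorphic_compact_finite_zeros[OF _ V(1,2) KV False]) (rule holomorphic_on_subset[OF U(3) V(3)])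
  qed
  moreover have "{z \<in> ?K. F0 z = 0} = Complex (1 / 2) ` {t \<in> {a..b}. L (Complex (1 / 2) t) = 0}" using Lz by auto
  ultimately show ?thesis using finite_image_iff[OF inj] by simp
qed

theorem theorem1:
  fixes f :: "nat \<Rightarrow> complex" and L :: "complex \<Rightarrow> complex" and \<theta> N :: real
  assumes "multiplicative f" and "\<exists>n>0. f n \<noteq> 0"
    and "0 < \<theta>" and "\<theta> < 1/2"
    and "\<And>r::nat. r \<ge> 1 \<Longrightarrow> \<exists>C. \<forall>n>0. norm (dirichlet_root r f n) \<le> C * real n powr \<theta>"
    and "\<And>r::nat. r \<ge> 1 \<Longrightarrow>
           (\<lambda>(p, m). (norm (dirichlet_root r f (p ^ m)))\<^sup>2 / real (p ^ m))
             summable_on ({p::nat. prime p} \<times> {m::nat. m \<ge> 2})"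
    and "N > 0"
    and "(\<lambda>x::real. (\<Sum>p | prime p \<and> real p \<le> x. (norm (f p))\<^sup>2 / real p) - N * ln (ln x))
           \<in> O[at_top](\<lambda>_. 1)"
    and "L_continuation f L"
    and "\<exists>A>0. \<exists>C t\<^sub>0. \<forall>s. Re s \<ge> 1/2 \<longrightarrow> \<bar>Im s\<bar> \<ge> t\<^sub>0 \<longrightarrow> norm (L s) \<le> C * \<bar>Im s\<bar> powr A"
  shows "\<forall>k\<ge>0. \<exists>c>0. \<exists>T\<^sub>0>0. \<forall>T\<ge>T\<^sub>0.
           integral {T..2 * T} (\<lambda>t. norm (L (Complex (1/2) t)) powr (2 * k))
             \<ge> c * T * ln T powr (N * k\<^sup>2)"
proof -
  have f1: "f 1 = 1"
  proof -
    obtain n where n: "n > 0" "f n \<noteq> 0" using assms(2) by blast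
    have "f (1 * n) = f 1 * f n" using assms(1) n(1) unfolding multiplicative_def by (metis coprime_1_left zero_less_one)
    then show ?thesis using n(2) by simp
  qed
  \<comment> \<open>The first root of f is f itself, so the case r = 1 of the hypotheses speaks
    about f.\<close>
  have root: "dirichlet_root 1 f n = f n" if "n > 0" for n
  proof -
    have "\<forall>n>0. dirichlet_power (dirichlet_root 1 f) 1 n = f n"
      using is_dirichlet_root_dirichlet_root[of f 1] f1 by (simp add: is_dirichlet_root_def)
    moreover have "dirichlet_power (dirichlet_root 1 f) 1 n = dirichlet_root 1 f n"
    proof -
      have "dirichlet_power g 1 = dirichlet_conv g conv_one" for g
        unfolding One_nat_def dirichlet_power.simps conv_one_def[abs_def] ..
      then show ?thesis by (simp only: dirichlet_conv_one_right[OF that])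
    qed
    ultimately show ?thesis using that by simp
  qed
  obtain C where C: "\<And>n. n > 0 \<Longrightarrow> norm (f n) \<le> C * real n powr \<theta>"
  proof -
    obtain C where "\<forall>n>0. norm (dirichlet_root 1 f n) \<le> C * real n powr \<theta>" using assms(5)[OF order.refl] by blast
    then have "norm (f n) \<le> C * real n powr \<theta>" if "n > 0" for n using root[OF that] that by metis
    then show ?thesis using that by blast
  qed
  have sq: "(\<lambda>(p, m). (norm (f (p ^ m)))\<^sup>2 / real (p ^ m)) summable_on ({p::nat. prime p} \<times> {m::nat. m \<ge> 2})"
    using assms(6)[of 1] by (rule summable_on_cong[THEN iffD1, rotated]) (auto simp: root[unfolded One_nat_def] prime_gt_0_nat)
  obtain B where B: "\<forall>\<^sub>F x in at_top. norm ((\<Sum>p | prime p \<and> real p \<le> x. (norm (f p))\<^sup>2 / real p) - N * ln (ln x)) \<le> B * norm (1::real)"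
    using assms(8) by (elim landau_o.bigE)
  then obtain x0 where x0: "\<And>x. x \<ge> x0 \<Longrightarrow> \<bar>(\<Sum>p | prime p \<and> real p \<le> x. (norm (f p))\<^sup>2 / real p) - N * ln (ln x)\<bar> \<le> B"
    unfolding eventually_at_top_linorder by auto
  have ln_le: "ln x \<le> u \<longleftrightarrow> x \<le> exp u" if "x > 0" for x u :: real
    using that by (metis exp_le_cancel_iff exp_ln)
  have mert: "\<bar>(\<Sum>p | prime p \<and> ln (real p) \<le> u. (norm (f p))\<^sup>2 / real p) - N * ln u\<bar> \<le> B" if u: "u \<ge> ln (max x0 1)" for u
  proof -
    have "max x0 1 \<le> exp u" using u by (simp add: ln_le)
    then have "x0 \<le> exp u" by simp
    moreover have "{p. prime p \<and> real p \<le> exp u} = {p. prime p \<and> ln (real p) \<le> u}"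
      by (auto simp: ln_le prime_gt_0_nat)
    ultimately show ?thesis using x0[of "exp u"] by simp
  qed
  have tf: "tame f" by (rule tame_of_bounds[OF assms(1) f1 assms(4) C sq mert])
  obtain \<sigma> where hs: "\<And>s. Re s > \<sigma> \<Longrightarrow> ((\<lambda>n. f n / of_nat n powr s) has_sum L s) {1..}"
    and mero: "L meromorphic_on {s. Re s \<ge> 1 / 2}" "L analytic_on {s. Re s \<ge> 1 / 2} - {1}"
    using assms(9) unfolding L_continuation_def by blast
  obtain F0 q where F0: "F0 analytic_on {s. Re s \<ge> 1 / 2}" and LF: "\<And>s. s \<noteq> 1 \<Longrightarrow> L s = F0 s / (s - 1) ^ q"
    by (rule meromorphic_clear_pole[OF mero]) auto
  have F0c: "continuous_on {s. Re s \<ge> 1 / 2} F0" using F0 analytic_imp_holomorphic holomorphic_on_imp_continuous_on by blast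
  have F0h: "F0 holomorphic_on {s. Re s > 1 / 2}"
    by (rule analytic_imp_holomorphic, rule analytic_on_subset[OF F0]) auto
  \<comment> \<open>Beyond \<sigma> the series represents L, and b1 >= 4 makes \<theta> + (1 - b1)
    <= - 2, so the series converges absolutely even one unit to the left of b1.\<close>
  define b1 where "b1 = max (\<sigma> + 1) 4"
  have b1: "b1 \<ge> 2" "b1 \<ge> 4" "b1 > \<sigma>" by (auto simp: b1_def)
  obtain A Cg t0 where gr: "\<And>s. Re s \<ge> 1 / 2 \<Longrightarrow> \<bar>Im s\<bar> \<ge> t0 \<Longrightarrow> norm (L s) \<le> Cg * \<bar>Im s\<bar> powr A"
    using assms(10) by blast
  obtain D M where DM: "\<And>s. 1 / 2 \<le> Re s \<Longrightarrow> Re s \<le> b1 \<Longrightarrow> norm (F0 s) \<le> D * (1 + \<bar>Im s\<bar>) ^ M"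
    using strip_polynomial_bound[OF F0c LF gr b1(1)] by blast
  have C0: "C \<ge> 0" using C[of 1] f1 by simp
  have sm: "(\<lambda>n. norm (f n) * real n powr (1 - b1)) summable_on {1..}"
  proof (rule Infinite_Sum.summable_on_comparison_test)
    have "(\<lambda>n. C * (1 / (real n)\<^sup>2)) summable_on UNIV"
      using inverse_power_summable[of 2, where 'a = real]
      by (intro summable_on_cmult_right norm_summable_imp_summable_on) (simp add: inverse_eq_divide norm_divide)
    then show "(\<lambda>n. C * (1 / (real n)\<^sup>2)) summable_on {1..}" by (rule summable_on_subset_banach) simp
    fix n :: nat assume "n \<in> {1..}"
    then have n: "n > 0" "real n \<ge> 1" by auto
    have "norm (f n) * real n powr (1 - b1) \<le> C * real n powr \<theta> * real n powr (1 - b1)" using C[OF n(1)] by (intro mult_right_mono) auto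
    also have "\<dots> = C * real n powr (\<theta> + (1 - b1))" by (simp add: powr_add)
    also have "\<dots> \<le> C * real n powr - 2" using n assms(4) b1(2) C0 by (intro mult_left_mono powr_mono) auto
    also have "\<dots> = C * (1 / (real n)\<^sup>2)" using n by (simp add: powr_minus powr_numeral inverse_eq_divide)
    finally show "norm (f n) * real n powr (1 - b1) \<le> C * (1 / (real n)\<^sup>2)" .
  qed auto
  have low: "\<exists>c>0. \<exists>T1. \<forall>T\<ge>T1. \<forall>\<tau>.
    c * ln T powr (N * k\<^sup>2) \<le> gmean \<tau> (sqrt T) (\<lambda>t. norm (L (Complex (1 / 2) t)) powr (2 * k))" if "k > 0" for k
    by (rule moment_lower_gmean[OF tf assms(7) that mert F0c F0h DM LF b1(1) sm hs]) (use b1(3) in auto)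
  have ne1: "Complex (1 / 2) t \<noteq> 1" for t by (rule Complex_ne_1) simp
  have Lc: "continuous_on UNIV (\<lambda>t. L (Complex (1 / 2) t))"
  proof -
    have "continuous_on ({s. Re s \<ge> 1 / 2} - {1}) L"
      using mero(2) analytic_imp_holomorphic holomorphic_on_imp_continuous_on by blast
    then show ?thesis
      by (rule continuous_on_compose2) (use ne1 in \<open>auto intro!: continuous_intros simp: Complex_eq\<close>)
  qed
  have D0: "D \<ge> 0" using order_trans[OF norm_ge_zero DM[of "1 / 2"]] b1 by simp
  have Lb: "norm (L (Complex (1 / 2) t)) \<le> D * 2 ^ q * (1 + \<bar>t\<bar>) ^ M" for t
  proof -
    have "1 / 2 \<le> norm (Complex (1 / 2) t - 1)" using abs_Re_le_cmod[of "Complex (1 / 2) t - 1"] by simp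
    then have "(1 / 2) ^ q \<le> norm (Complex (1 / 2) t - 1) ^ q" by (intro power_mono) auto
    then have "norm (F0 (Complex (1 / 2) t)) / norm (Complex (1 / 2) t - 1) ^ q \<le> (D * (1 + \<bar>t\<bar>) ^ M) / (1 / 2) ^ q"
      using DM[of "Complex (1 / 2) t"] b1 D0 by (intro frac_le) auto
    then show ?thesis using LF[OF ne1[of t]] by (simp add: norm_divide norm_power power_divide mult_ac)
  qed
  show ?thesis
  proof (intro allI impI)
    fix k :: real assume "k \<ge> 0"
    then consider "k > 0" | "k = 0" by linarith
    then show "\<exists>c>0. \<exists>T\<^sub>0>0. \<forall>T\<ge>T\<^sub>0. integral {T..2 * T} (\<lambda>t. norm (L (Complex (1/2) t)) powr (2 * k)) \<ge> c * T * ln T powr (N * k\<^sup>2)"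
    proof cases
      case 1
      obtain c T1 where c: "c > 0" "\<And>T \<tau>. T \<ge> T1 \<Longrightarrow> c * ln T powr (N * k\<^sup>2) \<le> gmean \<tau> (sqrt T) (\<lambda>t. norm (L (Complex (1 / 2) t)) powr (2 * k))"
        using low[OF 1] by blast
      show ?thesis
      proof (rule integral_lower_of_gmean[OF _ _ _ _ c])
        show "continuous_on UNIV (\<lambda>t. norm (L (Complex (1 / 2) t)) powr (2 * k))"
          using 1 by (intro continuous_on_powr' continuous_intros Lc) auto
        fix t
        define n where "n = nat \<lceil>2 * k\<rceil>"
        have "norm (L (Complex (1 / 2) t)) powr (2 * k) \<le> (D * 2 ^ q * (1 + \<bar>t\<bar>) ^ M) powr (2 * k)"
          using Lb[of t] 1 by (intro powr_mono2) auto
        also have "\<dots> = (D * 2 ^ q) powr (2 * k) * ((1 + \<bar>t\<bar>) ^ M) powr (2 * k)" using D0 by (simp add: powr_mult)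
        also have "((1 + \<bar>t\<bar>) ^ M) powr (2 * k) \<le> ((1 + \<bar>t\<bar>) ^ M) powr real n"
        proof (rule powr_mono)
          show "2 * k \<le> real n" unfolding n_def by linarith
        qed auto
        also have "\<dots> = (1 + \<bar>t\<bar>) ^ (M * n)" by (subst powr_realpow) (auto simp: power_mult)
        finally show "norm (L (Complex (1 / 2) t)) powr (2 * k) \<le> (D * 2 ^ q) powr (2 * k) * (1 + \<bar>t\<bar>) ^ (M * nat \<lceil>2 * k\<rceil>)"
          unfolding n_def by (simp add: mult_left_mono)
      qed (use assms(7) in auto)
    next
      case 2
      obtain c T1 where c: "c > 0" "\<And>T \<tau>. T \<ge> T1 \<Longrightarrow> c * ln T powr (N * 1\<^sup>2) \<le> gmean \<tau> (sqrt T) (\<lambda>t. norm (L (Complex (1 / 2) t)) powr (2 * 1))"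
        using low[of 1] by auto
      \<comment> \<open>L cannot vanish on the whole critical line, since the moment bound with
        exponent k = 1 is positive.\<close>
      obtain t1 where t1: "L (Complex (1 / 2) t1) \<noteq> 0"
      proof (rule ccontr)
        assume "\<not> thesis"
        then have "\<And>t. L (Complex (1 / 2) t) = 0" using that by blast
        then have "c * ln (max T1 3) powr N \<le> 0" using c(2)[of "max T1 3" 0] by (simp add: gmean_def)
        moreover have "ln (max T1 3) > 0" by (intro ln_gt_zero) auto
        ultimately show False using c(1) by (simp add: mult_le_0_iff)
      qed
      have "integral {T..2 * T} (\<lambda>t. norm (L (Complex (1/2) t)) powr (2 * k)) \<ge> 1 * T * ln T powr (N * k\<^sup>2)" if T: "T \<ge> 3" for T
      proof -
        have "integral {T..2 * T} (\<lambda>t. norm (L (Complex (1/2) t)) powr (2 * k)) = integral {T..2 * T} (\<lambda>t. 1)"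
          by (rule integral_spike[OF negligible_finite[OF half_line_zeros_finite[OF F0 LF t1, of T "2 * T"]]])
            (use 2 in auto)
        also have "\<dots> = T" using T by simp
        finally show ?thesis using 2 T by simp
      qed
      then show ?thesis by (intro exI[of _ 1] conjI exI[of _ 3]) auto
    qed
  qed
qed

end
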